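(* Let $\prec$ be a (strict) partial order on $[n]=\{1,\dots,n\}$, let $\mathfrak g:=\mathfrak g_\prec$ be the associated pattern Lie algebra over $\mathbb Z$, and let $R$ be a finite truncated valuation ring with associated parameters $(d,p,e,f)$ such that $$p>\max\{\alpha(i,j): i\prec j\}+1 .$$ Then $$m_{\mathrm{faithful}}(\mathscr G_R)=\sum_{\ell=0}^{e-1}\ \sum_{(i,j)\in I_{\mathrm{ex}}} f\,p^{f(d-\ell)\alpha(i,j)} .$$
   Context: For a finite group $G$, $m_{\mathrm{faithful}}(G)$ is the smallest integer $n\ge 0$ such that $G$ embeds in $\mathrm{GL}_n(\mathbb C)$ (the trivial group has $m_{\mathrm{faithful}}=0$). The pattern Lie algebra $\mathfrak g_\prec$ is the $\mathbb Z$-Lie subalgebra of $\mathfrak{gl}(n,\mathbb Z)$ spanned by the matrix units $e_{ij}$ with $i\prec j$. For $i\prec j$, $\alpha(i,j):=\#\{k\in[n]: i\prec k\prec j\}$. A pair $(i,j)$ with $i\prec j$ is extreme if $i$ is minimal and $j$ is maximal with respect to $\prec$; $I_{\mathrm{ex}}$ is the set of extreme pairs. The nilpotency class of $\mathfrak g_\prec$ is $\max\{\alpha(i,j):i\prec j\}+1$ (the maximum over the empty set is taken to be $0$). Lazard correspondence: if $\mathfrak f$ is a finite nilpotent $\mathbb Z$-Lie algebra (Lie ring) of cardinality a power of a prime $p$ strictly larger than the nilpotency class of $\mathfrak f$, then $\exp(\mathfrak f)$ denotes the finite $p$-group with underlying set $\mathfrak f$ and multiplication given by the Baker–Campbell–Hausdorff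 formula $x*y=x+y+\frac12[x,y]+\cdots$. Set $\mathfrak g_R:=\mathfrak g\otimes_{\mathbb Z}R$ and $\mathscr G_R:=\exp(\mathfrak g_R)$. A finite truncated valuation ring is a finite commutative local ring $R$ whose maximal ideal $\mathfrak m$ is principal (and nilpotent). Its associated parameters $(d,p,e,f)$ are: $d\ge1$ the smallest positive integer with $\mathfrak m^d=0$; $p=\mathrm{char}(R/\mathfrak m)$; $1\le e\le d$ with $pR=\mathfrak m^e$; and $f\ge1$ with $R/\mathfrak m\cong\mathbb F_{p^f}$. *)

theory Defs
  imports "HOL-Algebra.Algebra" "Jordan_Normal_Form.Matrix"
begin

section \<open>Lie rings\<close>

text \<open>
  A Lie ring is recorded as its additive group, written multiplicatively as everywhere in
  the library's group theory (\<open>\<otimes>\<close> is addition, \<open>\<one>\<close> is zero, \<open>x [^] k\<close> is \<open>k \<cdot> x\<close>),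
  together with a bracket.
\<close>

record 'a lie_ring = "'a monoid" +
  lie_bracket :: "'a \<Rightarrow> 'a \<Rightarrow> 'a"

primrec lower_central :: "('a, 'm) lie_ring_scheme \<Rightarrow> nat \<Rightarrow> 'a set" where
  "lower_central L 0 = carrier L"
| "lower_central L (Suc k) =
     generate L {lie_bracket L x y |x y. x \<in> carrier L \<and> y \<in> lower_central L k}"

definition nilpotency_class :: "('a, 'm) lie_ring_scheme \<Rightarrow> nat" where
  "nilpotency_class L = (LEAST c. lower_central L c = {\<one>\<^bsub>L\<^esub>})"

section \<open>The Lazard correspondence\<close>

text \<open>
  The element \<open>y\<close> with \<open>b y = a x\<close>, for a reduced fraction \<open>q = a / b\<close>.  It is uniquely
  determined if the additive group is finite of order coprime to \<open>b\<close>.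
\<close>

definition rat_scale :: "('a, 'm) lie_ring_scheme \<Rightarrow> rat \<Rightarrow> 'a \<Rightarrow> 'a" where
  "rat_scale L q x =
     (THE y. y \<in> carrier L \<and> y [^]\<^bsub>L\<^esub> snd (quotient_of q) = x [^]\<^bsub>L\<^esub> fst (quotient_of q))"

fun nested_bracket :: "('a, 'm) lie_ring_scheme \<Rightarrow> 'a list \<Rightarrow> 'a" where
  "nested_bracket L [] = \<one>\<^bsub>L\<^esub>"
| "nested_bracket L [x] = x"
| "nested_bracket L (x # y # zs) = lie_bracket L x (nested_bracket L (y # zs))"

text \<open>
  The Baker--Campbell--Hausdorff series in Dynkin's form:
  \[ x * y = \sum_{k \ge 1} \frac{(-1)^{k-1}}{k} \sum_{r_i + s_i > 0}
       \frac{[x^{r_1} y^{s_1} \cdots x^{r_k} y^{s_k}]}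
            {(\sum_i (r_i + s_i)) \prod_i r_i! \, s_i!} \]
  with right-nested brackets.  The tuple \<open>(r\<^sub>i, s\<^sub>i)\<^sub>i\<close> is a nonempty list \<open>ws\<close> of
  pairs.  Only terms of total degree at most the nilpotency class are summed, because all
  others vanish; the coefficients of the former involve no prime larger than the class.
\<close>

definition dynkin_degree :: "(nat \<times> nat) list \<Rightarrow> nat" where
  "dynkin_degree ws = (\<Sum>(r, s)\<leftarrow>ws. r + s)"

definition dynkin_index :: "nat \<Rightarrow> (nat \<times> nat) list set" where
  "dynkin_index c = {ws. ws \<noteq> [] \<and> (0, 0) \<notin> set ws \<and> dynkin_degree ws \<le> c}"

definition dynkin_coeff :: "(nat \<times> nat) list \<Rightarrow> rat" where
  "dynkin_coeff ws =
     (-1) ^ (length ws - 1) /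
     of_nat (length ws * dynkin_degree ws * (\<Prod>(r, s)\<leftarrow>ws. fact r * fact s))"

definition dynkin_word :: "'a \<Rightarrow> 'a \<Rightarrow> (nat \<times> nat) list \<Rightarrow> 'a list" where
  "dynkin_word x y ws = concat (map (\<lambda>(r, s). replicate r x @ replicate s y) ws)"

definition bch :: "('a, 'm) lie_ring_scheme \<Rightarrow> 'a \<Rightarrow> 'a \<Rightarrow> 'a" where
  "bch L x y =
     finprod L (\<lambda>ws. rat_scale L (dynkin_coeff ws) (nested_bracket L (dynkin_word x y ws)))
       (dynkin_index (nilpotency_class L))"

text \<open>
  This is a group if \<open>L\<close> is a nilpotent Lie ring whose order is a power of a prime
  exceeding the nilpotency class.
\<close>

definition lie_exp :: "('a, 'm) lie_ring_scheme \<Rightarrow> 'a monoid" where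
  "lie_exp L = \<lparr>carrier = carrier L, monoid.mult = bch L, one = \<one>\<^bsub>L\<^esub>\<rparr>"

section \<open>Extension of scalars\<close>

text \<open>
  The Lie ring \<open>L \<otimes>\<^sub>\<int> R\<close>.  Its additive group is the free abelian group on the pairs
  \<open>(x, r)\<close> modulo the biadditivity relations, and its bracket is induced by
  \<open>[x \<otimes> r, y \<otimes> s] = [x, y] \<otimes> r s\<close>.
\<close>

definition tensor_free ::
  "('a, 'm) lie_ring_scheme \<Rightarrow> ('r, 'k) ring_scheme \<Rightarrow> ('a \<times> 'r \<Rightarrow>\<^sub>0 int) monoid" where
  "tensor_free L R = free_Abelian_group (carrier L \<times> carrier R)"

definition tensor_relations ::
  "('a, 'm) lie_ring_scheme \<Rightarrow> ('r, 'k) ring_scheme \<Rightarrow> ('a \<times> 'r \<Rightarrow>\<^sub>0 int) set" where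
  "tensor_relations L R = generate (tensor_free L R)
     ({frag_of (x \<otimes>\<^bsub>L\<^esub> y, r) - frag_of (x, r) - frag_of (y, r) |x y r.
         x \<in> carrier L \<and> y \<in> carrier L \<and> r \<in> carrier R} \<union>
      {frag_of (x, r \<oplus>\<^bsub>R\<^esub> s) - frag_of (x, r) - frag_of (x, s) |x r s.
         x \<in> carrier L \<and> r \<in> carrier R \<and> s \<in> carrier R})"

definition free_bracket ::
  "('a, 'm) lie_ring_scheme \<Rightarrow> ('r, 'k) ring_scheme \<Rightarrow>
     ('a \<times> 'r \<Rightarrow>\<^sub>0 int) \<Rightarrow> ('a \<times> 'r \<Rightarrow>\<^sub>0 int) \<Rightarrow> ('a \<times> 'r \<Rightarrow>\<^sub>0 int)" where
  "free_bracket L R u v =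
     frag_extend (\<lambda>(x, r). frag_extend (\<lambda>(y, s).
       frag_of (lie_bracket L x y, r \<otimes>\<^bsub>R\<^esub> s)) v) u"

text \<open>
  For cosets \<open>U\<close> and \<open>V\<close>, all the cosets in the union below coincide.
\<close>

definition lie_tensor ::
  "('a, 'm) lie_ring_scheme \<Rightarrow> ('r, 'k) ring_scheme \<Rightarrow> ('a \<times> 'r \<Rightarrow>\<^sub>0 int) set lie_ring" where
  "lie_tensor L R =
     \<lparr>carrier = carrier (tensor_free L R Mod tensor_relations L R),
      monoid.mult = monoid.mult (tensor_free L R Mod tensor_relations L R),
      one = one (tensor_free L R Mod tensor_relations L R),
      lie_bracket = (\<lambda>U V. \<Union>u\<in>U. \<Union>v\<in>V.
        tensor_relations L R #>\<^bsub>tensor_free L R\<^esub> free_bracket L R u v)\<rparr>"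

section \<open>Pattern Lie algebras\<close>

definition gl_int :: "nat \<Rightarrow> int mat lie_ring" where
  "gl_int n = \<lparr>carrier = carrier_mat n n, monoid.mult = (+), one = 0\<^sub>m n n,
     lie_bracket = (\<lambda>A B. A * B - B * A)\<rparr>"

text \<open>Indices range over \<open>{1..n}\<close>, whereas the library's matrices are indexed from 0.\<close>

definition mat_unit :: "nat \<Rightarrow> nat \<Rightarrow> nat \<Rightarrow> int mat" where
  "mat_unit n i j = mat n n (\<lambda>(a, b). if Suc a = i \<and> Suc b = j then 1 else 0)"

definition pattern_lie :: "nat \<Rightarrow> nat rel \<Rightarrow> int mat lie_ring" where
  "pattern_lie n prec =
     (gl_int n)\<lparr>carrier := generate (gl_int n) {mat_unit n i j |i j. (i, j) \<in> prec}\<rparr>"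

definition strict_order_on_upto :: "nat \<Rightarrow> nat rel \<Rightarrow> bool" where
  "strict_order_on_upto n prec \<longleftrightarrow> prec \<subseteq> {1..n} \<times> {1..n} \<and> irrefl prec \<and> trans prec"

definition alpha :: "nat \<Rightarrow> nat rel \<Rightarrow> nat \<Rightarrow> nat \<Rightarrow> nat" where
  "alpha n prec i j = card {k \<in> {1..n}. (i, k) \<in> prec \<and> (k, j) \<in> prec}"

text \<open>The maximum over the empty set is 0 by convention, hence the inserted 0.\<close>

definition max_alpha :: "nat \<Rightarrow> nat rel \<Rightarrow> nat" where
  "max_alpha n prec = Max (insert 0 {alpha n prec i j |i j. (i, j) \<in> prec})"

definition extreme_pairs :: "nat \<Rightarrow> nat rel \<Rightarrow> (nat \<times> nat) set" where
  "extreme_pairs n prec = {(i, j). (i, j) \<in> prec \<and>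
     \<not> (\<exists>k\<in>{1..n}. (k, i) \<in> prec) \<and> \<not> (\<exists>k\<in>{1..n}. (j, k) \<in> prec)}"

section \<open>Finite truncated valuation rings\<close>

definition max_ideal :: "('a, 'm) ring_scheme \<Rightarrow> 'a set" where
  "max_ideal R = (THE M. maximalideal M R)"

definition ideal_power :: "('a, 'm) ring_scheme \<Rightarrow> 'a set \<Rightarrow> nat \<Rightarrow> 'a set" where
  "ideal_power R I k = I [^]\<^bsub>ideals_set R\<^esub> k"

locale finite_truncated_valuation_ring = cring R for R (structure) +
  assumes finite_carrier: "finite (carrier R)"
    and local_ring: "\<exists>!M. maximalideal M R"
    and principal: "principalideal (max_ideal R) R"
    and nilpotent: "\<exists>k. ideal_power R (max_ideal R) k = {\<zero>}"

text \<open>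
  The characteristic of a ring is the order of 1 in its additive group (0 if infinite), and
  a ring is isomorphic to the field \<open>\<F>\<^sub>q\<close> iff it is a field with \<open>q\<close> elements.
\<close>

definition ring_char :: "('a, 'm) ring_scheme \<Rightarrow> nat" where
  "ring_char R = group.ord (add_monoid R) \<one>\<^bsub>R\<^esub>"

definition tvr_parameters ::
  "('a, 'm) ring_scheme \<Rightarrow> nat \<Rightarrow> nat \<Rightarrow> nat \<Rightarrow> nat \<Rightarrow> bool" where
  "tvr_parameters R d p e f \<longleftrightarrow>
     1 \<le> d \<and> ideal_power R (max_ideal R) d = {\<zero>\<^bsub>R\<^esub>} \<and>
       (\<forall>k. 1 \<le> k \<and> k < d \<longrightarrow> ideal_power R (max_ideal R) k \<noteq> {\<zero>\<^bsub>R\<^esub>}) \<and>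
     p = ring_char (R Quot max_ideal R) \<and>
     1 \<le> e \<and> e \<le> d \<and>
       {[p] \<cdot>\<^bsub>R\<^esub> x |x. x \<in> carrier R} = ideal_power R (max_ideal R) e \<and>
     1 \<le> f \<and> field (R Quot max_ideal R) \<and> card (carrier (R Quot max_ideal R)) = p ^ f"

section \<open>Faithful dimension\<close>

definition GL_complex :: "nat \<Rightarrow> complex mat monoid" where
  "GL_complex n = units_of (ring_mat TYPE(complex) n ())"

text \<open>For finite \<open>G\<close> the set of such \<open>n\<close> is nonempty, so the minimum is attained.\<close>

definition m_faithful :: "('a, 'm) monoid_scheme \<Rightarrow> nat" where
  "m_faithful G = (LEAST n. mon G (GL_complex n) \<noteq> {})"

end

theory Submission
  imports Defs "HOL-Computational_Algebra.Formal_Power_Series" "HOL-Library.Function_Algebras"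
begin

text \<open>
  The Lie ring \<open>\<gg>\<^sub>R\<close> consists of the matrices over \<open>R\<close> supported on the order,
  so the truncated exponential maps \<open>exp(\<gg>\<^sub>R)\<close> into the group of unipotent matrices \<open>1 + a\<close>; that it
  is multiplicative is Dynkin's formula.  The formula comes from the identity of noncommutative series
  \<open>D(e\<^sup>Z) = \<Phi>(ad Z)(D Z) e\<^sup>Z\<close> for the degree derivation \<open>D\<close> and \<open>\<Phi>(t) = (e\<^sup>t - 1) / t\<close>: applied to
  \<open>e\<^sup>Z = e\<^sup>X e\<^sup>Y\<close> it expresses \<open>D Z\<close> through iterated brackets, and \<open>D\<close> multiplies the part of degree
  \<open>k\<close> by \<open>k\<close>.

  For an extreme pair \<open>(i, j)\<close>, let \<open>1 + a\<close> act from the right on the row vectors with \<open>i\<close>-th entry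
  \<open>1\<close> supported on the interval from \<open>i\<close> to \<open>j\<close>, and twist the permutation of the inner coordinates modulo
  \<open>\<mm>\<^bsup>d - l\<^esup>\<close> by a character of the \<open>j\<close>-th coordinate that is trivial on \<open>\<mm>\<^bsup>d - l\<^esup>\<close>.  The
  sum of these monomial representations over \<open>l < e\<close> and \<open>f\<close> characters for each \<open>l\<close> is faithful because
  the characters separate the points of the \<open>p\<close>-torsion \<open>\<mm>\<^bsup>d - e\<^esup>\<close> of \<open>R\<close>.

  Conversely, a faithful representation must contain enough central characters to separate the points of
  the central subgroup of matrices supported on the extreme pairs.  If the restriction of a
  central character \<open>\<chi>\<close> to the entry \<open>(i, j)\<close> has conductor \<open>\<mm>\<^sup>k\<close>, the Heisenberg relations
  between row \<open>i\<close> and column \<open>j\<close> force its weight space to have dimension at least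
  \<open>p\<^bsup>f k \<alpha>(i, j)\<^esup>\<close>.  For each \<open>t\<close>, the characters for which one of these bounds is at least \<open>t\<close> have
  to separate those \<open>p\<close>-torsion central elements on which all the others vanish, which bounds their
  number from below; summing over \<open>t\<close> gives the dimension formula.
\<close>

section \<open>Noncommutative power series\<close>

text \<open>Dynkin's formula has rational coefficients, while the additive group of
  \<open>\<gg>\<^sub>R\<close> is a finite p-group. Hence the formula is proved for free series over
  the rationals, and only the terms of degree at most \<open>h = max_alpha n prec + 1\<close> are
  evaluated in matrices: as \<open>p > h\<close>, their denominators are prime to \<open>p\<close>,
  and longer words vanish because \<open>alpha\<close> grows strictly along products. The constants
  of the formula come from the monomial blocks: the \<open>alpha\<close> inner coordinates of a
  block range over the residue classes modulo the power \<open>d - l\<close> of the maximal ideal,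
  whence its size. The \<open>p\<close>-torsion of \<open>R\<close> has \<open>e\<close> layers of
  order \<open>p ^ f\<close>; a character sees one factor \<open>p\<close>, so each layer costs
  \<open>f\<close> characters. The obstacle in the lower bound is that one central character
  restricts to all extreme entries at once, with a different conductor at each, so that no matching
  of characters with triples of a pair, a level and an index is given beforehand.\<close>

text \<open>A series is the function assigning to each word its coefficient.\<close>

typedef 'x ncs = "UNIV :: ('x list \<Rightarrow> rat) set" morphisms wcoeff Ncs ..

lemma wcoeff_Ncs [simp]: "wcoeff (Ncs f) = f"
  by (simp add: Ncs_inverse)

lemma ncs_eqI: "(\<And>w. wcoeff u w = wcoeff v w) \<Longrightarrow> u = v"
  by (metis wcoeff_inject ext)

instantiation ncs :: (type) ring_1
begin

definition "0 = Ncs (\<lambda>_. 0)"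
definition "1 = Ncs (\<lambda>w. if w = [] then 1 else 0)"
definition "u + v = Ncs (\<lambda>w. wcoeff u w + wcoeff v w)"
definition "u - v = Ncs (\<lambda>w. wcoeff u w - wcoeff v w)"
definition "- u = Ncs (\<lambda>w. - wcoeff u w)"
definition "u * v = Ncs (\<lambda>w. \<Sum>i=0..length w. wcoeff u (take i w) * wcoeff v (drop i w))"

instance
proof
  fix a b c :: "'a ncs"
  show "a * b * c = a * (b * c)"
  proof (rule ncs_eqI)
    fix w :: "'a list"
    let ?n = "length w"
    \<comment> \<open>The word is cut into three consecutive pieces of lengths \<open>i\<close>,
      \<open>d\<close> and \<open>r\<close>. Measuring the last one from the end turns both sides
      into the double sums of the associativity lemma for ordinary power series.\<close>
    let ?f = "\<lambda>i d r. wcoeff a (take i w) * wcoeff b (take d (drop i w)) * wcoeff c (drop (?n - r) w)"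
    have "wcoeff (a * b * c) w = (\<Sum>j=0..?n. \<Sum>i=0..j. ?f i (j - i) (?n - j))"
    proof -
      have "wcoeff (a * b) (take j w) =
          (\<Sum>i=0..j. wcoeff a (take i w) * wcoeff b (take (j - i) (drop i w)))" if "j \<le> ?n" for j
        unfolding times_ncs_def wcoeff_Ncs using that
        by (intro sum.cong) (auto simp: drop_take min_def)
      then have "(\<Sum>j=0..?n. wcoeff (a * b) (take j w) * wcoeff c (drop j w)) =
          (\<Sum>j=0..?n. \<Sum>i=0..j. ?f i (j - i) (?n - j))"
        by (intro sum.cong) (auto simp: sum_distrib_right)
      then show ?thesis
        by (subst times_ncs_def) simp
    qed
    also have "\<dots> = (\<Sum>j=0..?n. \<Sum>i=0..?n - j. ?f j i (?n - j - i))"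
      by (rule fps_mult_assoc_lemma)
    also have "\<dots> = wcoeff (a * (b * c)) w"
    proof -
      have "wcoeff (b * c) (drop j w) =
          (\<Sum>i=0..?n - j. wcoeff b (take i (drop j w)) * wcoeff c (drop (j + i) w))" if "j \<le> ?n" for j
        unfolding times_ncs_def wcoeff_Ncs using that
        by (intro sum.cong) (auto simp: add.commute)
      then have "(\<Sum>j=0..?n. wcoeff a (take j w) * wcoeff (b * c) (drop j w)) =
          (\<Sum>j=0..?n. \<Sum>i=0..?n - j. ?f j i (?n - j - i))"
        by (intro sum.cong) (auto simp: sum_distrib_left mult.assoc intro!: sum.cong)
      then show ?thesis
        by (subst times_ncs_def) simp
    qed
    finally show "wcoeff (a * b * c) w = wcoeff (a * (b * c)) w" .
  qed
  have *: "(\<Sum>i=0..length w. (if take i w = [] then 1 else 0) * wcoeff a (drop i w)) = wcoeff a w" for w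
  proof -
    have "(\<Sum>i=0..length w. (if take i w = [] then 1 else 0) * wcoeff a (drop i w))
      = (\<Sum>i=0..length w. if i = 0 then wcoeff a w else 0)"
      by (intro sum.cong) auto
    then show ?thesis by simp
  qed
  show "1 * a = a"
    by (rule ncs_eqI) (simp only: times_ncs_def one_ncs_def wcoeff_Ncs *)
  have *: "(\<Sum>i=0..length w. wcoeff a (take i w) * (if drop i w = [] then 1 else 0)) = wcoeff a w" for w
  proof -
    have "(\<Sum>i=0..length w. wcoeff a (take i w) * (if drop i w = [] then 1 else 0))
      = (\<Sum>i=0..length w. if i = length w then wcoeff a w else 0)"
      by (intro sum.cong) auto
    then show ?thesis by simp
  qed
  show "a * 1 = a"
    by (rule ncs_eqI) (simp only: times_ncs_def one_ncs_def wcoeff_Ncs *)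
  show "(0::'a ncs) \<noteq> 1"
    by (auto simp: zero_ncs_def one_ncs_def Ncs_inject fun_eq_iff)
  show "(a + b) * c = a * c + b * c"
    by (simp add: times_ncs_def plus_ncs_def distrib_right sum.distrib)
  show "a * (b + c) = a * b + a * c"
    by (simp add: times_ncs_def plus_ncs_def distrib_left sum.distrib)
  show "a + b + c = a + (b + c)" "a + b = b + a"
    by (simp_all add: plus_ncs_def ac_simps)
  show "0 + a = a" "- a + a = 0" "a - b = a + - b"
    by (simp_all add: plus_ncs_def minus_ncs_def uminus_ncs_def zero_ncs_def wcoeff_inverse)
qed

end

lemma wcoeff_simps [simp]:
  "wcoeff 0 w = 0" "wcoeff (u + v) w = wcoeff u w + wcoeff v w"
  "wcoeff (u - v) w = wcoeff u w - wcoeff v w" "wcoeff (- u) w = - wcoeff u w"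
  by (auto simp: plus_ncs_def minus_ncs_def uminus_ncs_def zero_ncs_def)

lemma wcoeff_one: "wcoeff 1 w = (if w = [] then 1 else 0)"
  by (simp add: one_ncs_def)

lemma wcoeff_mult:
  "wcoeff (u * v) w = (\<Sum>i\<le>length w. wcoeff u (take i w) * wcoeff v (drop i w))"
  by (simp add: times_ncs_def atLeast0AtMost)

lemma wcoeff_sum [simp]: "wcoeff (sum f A) w = (\<Sum>x\<in>A. wcoeff (f x) w)"
  by (induction A rule: infinite_finite_induct) auto

definition smul :: "rat \<Rightarrow> 'x ncs \<Rightarrow> 'x ncs" where
  "smul c u = Ncs (\<lambda>w. c * wcoeff u w)"

lemma wcoeff_smul [simp]: "wcoeff (smul c u) w = c * wcoeff u w"
  by (simp add: smul_def)

lemma smul_mult_left: "smul c u * v = smul c (u * v)"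
  by (rule ncs_eqI) (simp add: wcoeff_mult sum_distrib_left mult.assoc)

lemma smul_mult_right: "u * smul c v = smul c (u * v)"
  by (rule ncs_eqI) (simp add: wcoeff_mult sum_distrib_left mult.left_commute)

lemma smul_simps: "smul c (u + v) = smul c u + smul c v" "smul c (u - v) = smul c u - smul c v"
  "smul c (smul c' u) = smul (c * c') u" "smul 1 u = u" "smul 0 u = 0" "smul c 0 = 0"
  "smul (c + c') u = smul c u + smul c' u"
  by (auto intro!: ncs_eqI simp: algebra_simps)

lemma smul_of_nat: "of_nat k * u = smul (of_nat k) u"
  by (induction k) (auto simp: smul_simps algebra_simps)

section \<open>Order of vanishing, and power series in operators that raise it\<close>

definition vanish :: "nat \<Rightarrow> 'x ncs \<Rightarrow> bool" where
  "vanish N u \<longleftrightarrow> (\<forall>w. length w < N \<longrightarrow> wcoeff u w = 0)"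

lemma vanish_mono: "vanish N u \<Longrightarrow> M \<le> N \<Longrightarrow> vanish M u"
  by (auto simp: vanish_def)

lemma vanish_0 [simp]: "vanish 0 u"
  by (auto simp: vanish_def)

lemma vanish_mult:
  assumes "vanish M u" "vanish N v"
  shows "vanish (M + N) (u * v)"
  unfolding vanish_def
proof (intro allI impI)
  fix w :: "'a list" assume w: "length w < M + N"
  have "wcoeff u (take i w) * wcoeff v (drop i w) = 0" if "i \<le> length w" for i
  proof (cases "i < M")
    case True
    then have "wcoeff u (take i w) = 0" using assms(1) that by (auto simp: vanish_def)
    then show ?thesis by simp
  next
    case False
    then have "wcoeff v (drop i w) = 0" using assms(2) that w by (auto simp: vanish_def)
    then show ?thesis by simp
  qed
  then show "wcoeff (u * v) w = 0" unfolding wcoeff_mult by (intro sum.neutral) auto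
qed

text \<open>Such an operator is topologically nilpotent: on a word \<open>w\<close> only its powers
  up to \<open>length w\<close> have a nonzero coefficient. Hence every formal power series can be
  applied to it by finite sums, without a notion of convergence.\<close>

definition raising :: "('x ncs \<Rightarrow> 'x ncs) \<Rightarrow> bool" where
  "raising T \<longleftrightarrow> (\<forall>u v. T (u + v) = T u + T v) \<and> (\<forall>c u. T (smul c u) = smul c (T u)) \<and>
     (\<forall>u N. vanish N u \<longrightarrow> vanish (Suc N) (T u))"

definition op_series :: "rat fps \<Rightarrow> ('x ncs \<Rightarrow> 'x ncs) \<Rightarrow> 'x ncs \<Rightarrow> 'x ncs" where
  "op_series F T u = Ncs (\<lambda>w. \<Sum>k\<le>length w. fps_nth F k * wcoeff ((T ^^ k) u) w)"

context
  fixes T :: "'x ncs \<Rightarrow> 'x ncs"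
  assumes T: "raising T"
begin

lemma raising_funpow_add: "(T ^^ k) (u + v) = (T ^^ k) u + (T ^^ k) v"
  using T by (induction k) (auto simp: raising_def)

lemma raising_funpow_smul: "(T ^^ k) (smul c u) = smul c ((T ^^ k) u)"
  using T by (induction k) (auto simp: raising_def)

lemma raising_funpow_0: "(T ^^ k) 0 = 0"
  using raising_funpow_smul[of k 0 0] by (simp add: smul_simps)

lemma raising_funpow_sum: "(T ^^ k) (sum f A) = (\<Sum>x\<in>A. (T ^^ k) (f x))"
  by (induction A rule: infinite_finite_induct) (auto simp: raising_funpow_add raising_funpow_0)

lemma raising_funpow_diff: "(T ^^ k) (u - v) = (T ^^ k) u - (T ^^ k) v"
  using raising_funpow_add[of k "u - v" v] by simp

lemma raising_funpow_vanish: "vanish N u \<Longrightarrow> vanish (N + k) ((T ^^ k) u)"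
  using T by (induction k) (auto simp: raising_def)

lemma raising_funpow_zero: "length w < k \<Longrightarrow> wcoeff ((T ^^ k) u) w = 0"
  using raising_funpow_vanish[of 0 u k] by (auto simp: vanish_def)

lemma op_series_trunc:
  assumes "length w \<le> N"
  shows "wcoeff (op_series F T u) w = (\<Sum>k\<le>N. fps_nth F k * wcoeff ((T ^^ k) u) w)"
  unfolding op_series_def wcoeff_Ncs
  by (rule sum.mono_neutral_left) (use assms in \<open>auto simp: raising_funpow_zero\<close>)

lemma op_series_trunc_vanish:
  "vanish (Suc N) (op_series F T u - (\<Sum>k\<le>N. smul (fps_nth F k) ((T ^^ k) u)))"
  by (auto simp: vanish_def op_series_trunc)

text \<open>At a word of length \<open>N\<close> the inner series can be replaced by its partial sum
  up to \<open>N\<close>, because powers of \<open>T\<close> keep the remainder beyond that degree.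
  Of the resulting square of index pairs only the triangle \<open>j + k \<le> N\<close> survives,
  and this is the Cauchy product.\<close>

lemma op_series_mult: "op_series (F * G) T u = op_series F T (op_series G T u)"
proof (rule ncs_eqI)
  fix w :: "'x list"
  define N where "N = length w"
  define a where "a m = wcoeff ((T ^^ m) u) w" for m
  have a0: "a m = 0" if "m > N" for m
    using that by (simp add: a_def N_def raising_funpow_zero)
  have 1: "wcoeff ((T ^^ j) (op_series G T u)) w = (\<Sum>k\<le>N. fps_nth G k * a (j + k))" for j
  proof -
    let ?S = "\<Sum>k\<le>N. smul (fps_nth G k) ((T ^^ k) u)"
    have "vanish (Suc N + j) ((T ^^ j) (op_series G T u) - (T ^^ j) ?S)"
      using raising_funpow_vanish[OF op_series_trunc_vanish] by (simp add: raising_funpow_diff)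
    then have "wcoeff ((T ^^ j) (op_series G T u)) w = wcoeff ((T ^^ j) ?S) w"
      by (auto simp: vanish_def N_def)
    then show ?thesis
      by (simp add: raising_funpow_sum raising_funpow_smul a_def funpow_add)
  qed
  have "wcoeff (op_series F T (op_series G T u)) w =
      (\<Sum>(j, k)\<in>{..N} \<times> {..N}. fps_nth F j * fps_nth G k * a (j + k))"
    unfolding op_series_def[of F] wcoeff_Ncs N_def[symmetric] 1 sum_distrib_left sum.cartesian_product
    by (simp add: mult.assoc)
  also have "\<dots> = (\<Sum>(j, k)\<in>{(j, k). j + k \<le> N}. fps_nth F j * fps_nth G k * a (j + k))"
    by (rule sum.mono_neutral_right) (auto, use a0 not_le in blast)
  also have "\<dots> = (\<Sum>k\<le>N. \<Sum>i\<le>k. fps_nth F i * fps_nth G (k - i) * a k)"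
    by (subst sum.triangle_reindex_eq) auto
  also have "\<dots> = wcoeff (op_series (F * G) T u) w"
    by (simp add: op_series_def N_def[symmetric] a_def[symmetric] fps_mult_nth sum_distrib_right
        atLeast0AtMost)
  finally show "wcoeff (op_series (F * G) T u) w = wcoeff (op_series F T (op_series G T u)) w"
    by simp
qed

lemma op_series_one: "op_series 1 T u = u"
  by (rule ncs_eqI) (simp add: op_series_def if_distrib[of "\<lambda>x. x * _"] cong: if_cong)

lemma op_series_X: "op_series fps_X T u = T u"
proof (rule ncs_eqI)
  fix w
  show "wcoeff (op_series fps_X T u) w = wcoeff (T u) w"
    using raising_funpow_zero[of w 1 u]
    by (cases w) (auto simp: op_series_def fps_X_def if_distrib[of "\<lambda>x. x * _"] cong: if_cong)
qed

lemma op_series_add: "op_series (F + G) T u = op_series F T u + op_series G T u"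
  by (rule ncs_eqI) (simp add: op_series_def algebra_simps sum.distrib)

lemma op_series_diff: "op_series (F - G) T u = op_series F T u - op_series G T u"
  by (rule ncs_eqI) (simp add: op_series_def algebra_simps sum_subtractf)

lemma op_series_raising:
  assumes "fps_nth G 0 = 0"
  shows "raising (op_series G T)"
  unfolding raising_def
proof (intro conjI allI impI)
  fix u N assume u: "vanish N (u :: 'x ncs)"
  show "vanish (Suc N) (op_series G T u)"
    unfolding vanish_def op_series_def wcoeff_Ncs
  proof (intro allI impI sum.neutral ballI)
    fix w :: "'x list" and k assume "length w < Suc N"
    show "fps_nth G k * wcoeff ((T ^^ k) u) w = 0"
    proof (cases k)
      case (Suc k')
      then have "wcoeff ((T ^^ k) u) w = 0" using raising_funpow_vanish[OF u, of k] \<open>length w < Suc N\<close>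
        by (auto simp: vanish_def)
      then show ?thesis by simp
    qed (use assms in simp)
  qed
qed (auto intro!: ncs_eqI simp: op_series_def raising_funpow_add raising_funpow_smul algebra_simps
      sum.distrib sum_distrib_left)

lemma op_series_funpow: "((op_series G T) ^^ k) u = op_series (G ^ k) T u"
  by (induction k) (auto simp: op_series_one op_series_mult)

text \<open>\<open>G ^ k\<close> starts in degree \<open>k\<close> or later, which makes the double
  sum triangular.\<close>

lemma op_series_compose:
  assumes "fps_nth G 0 = 0"
  shows "op_series (fps_compose F G) T u = op_series F (op_series G T) u"
proof (rule ncs_eqI)
  fix w :: "'x list"
  define N where "N = length w"
  define a where "a m = wcoeff ((T ^^ m) u) w" for m
  have "wcoeff (op_series F (op_series G T) u) w
      = (\<Sum>k\<le>N. \<Sum>m\<le>N. fps_nth F k * fps_nth (G ^ k) m * a m)"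
    by (simp add: op_series_def[of F] op_series_funpow op_series_def[of "G ^ _" T]
        N_def[symmetric] a_def[symmetric] sum_distrib_left mult.assoc)
  also have "\<dots> = (\<Sum>m\<le>N. \<Sum>k\<le>N. fps_nth F k * fps_nth (G ^ k) m * a m)"
    by (rule sum.swap)
  also have "\<dots> = (\<Sum>m\<le>N. \<Sum>k\<le>m. fps_nth F k * fps_nth (G ^ k) m * a m)"
    by (intro sum.cong refl sum.mono_neutral_right)
      (use assms in \<open>auto simp: startsby_zero_power_prefix\<close>)
  also have "\<dots> = wcoeff (op_series (fps_compose F G) T u) w"
    by (simp add: op_series_def N_def[symmetric] a_def[symmetric] fps_compose_nth sum_distrib_right
        atLeast0AtMost)
  finally show "wcoeff (op_series (fps_compose F G) T u) w = wcoeff (op_series F (op_series G T) u) w"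
    by simp
qed

end

section \<open>Exponentials, inner derivations and the degree derivation\<close>

definition letter :: "'x \<Rightarrow> 'x ncs" where
  "letter a = Ncs (\<lambda>w. if w = [a] then 1 else 0)"

definition ad :: "'x ncs \<Rightarrow> 'x ncs \<Rightarrow> 'x ncs" where
  "ad u v = u * v - v * u"

text \<open>Writing the exponential as a series in left multiplication by \<open>u\<close>, applied
  to \<open>1\<close>, brings it under the calculus of \<open>op_series\<close>; the logarithm will
  be treated in the same way.\<close>

definition ncexp :: "'x ncs \<Rightarrow> 'x ncs" where
  "ncexp u = op_series (fps_exp 1) ((*) u) 1"

lemma raising_mult: "vanish 1 u \<Longrightarrow> raising ((*) u)"
  using vanish_mult[of 1 u] by (auto simp: raising_def smul_mult_right distrib_left)

lemma raising_ad:
  assumes "vanish 1 u"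
  shows "raising (ad u)"
  unfolding raising_def
proof (intro conjI allI impI)
  fix v N assume v: "vanish N (v :: 'a ncs)"
  show "vanish (Suc N) (ad u v)"
    using vanish_mult[OF assms v] vanish_mult[OF v assms] by (auto simp: ad_def vanish_def)
qed (auto simp: ad_def algebra_simps smul_mult_left smul_mult_right smul_simps)

lemma funpow_mult: "(((*) u) ^^ k) v = u ^ k * (v :: 'x ncs)"
  by (induction k) (auto simp: mult.assoc)

text \<open>Left multiplication by \<open>u\<close> commutes with right multiplication by
  \<open>v\<close>, so the series may be applied to \<open>1\<close> first.\<close>

lemma op_series_mult_right:
  assumes u: "vanish 1 u"
  shows "op_series F ((*) u) v = op_series F ((*) u) 1 * v"
proof (rule ncs_eqI)
  fix w :: "'a list"
  let ?N = "length w"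
  have "wcoeff (op_series F ((*) u) 1 * v) w
      = (\<Sum>i\<le>?N. (\<Sum>k\<le>?N. fps_nth F k * wcoeff (u ^ k) (take i w)) * wcoeff v (drop i w))"
    unfolding wcoeff_mult
    by (intro sum.cong refl) (simp add: op_series_trunc[OF raising_mult[OF u], of _ ?N] funpow_mult)
  also have "\<dots> = (\<Sum>k\<le>?N. fps_nth F k * wcoeff (u ^ k * v) w)"
    unfolding wcoeff_mult sum_distrib_left sum_distrib_right
    by (subst sum.swap) (simp add: mult.assoc)
  finally show "wcoeff (op_series F ((*) u) v) w = wcoeff (op_series F ((*) u) 1 * v) w"
    by (simp add: op_series_def funpow_mult)
qed

text \<open>The Cauchy product arranged by total degree, which is the form in which the binomial
  expansions \<open>power_commute_ad\<close> and \<open>euler_power\<close> can be compared with it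
  term by term.\<close>

lemma op_series_mult_op_series:
  assumes S: "raising S" and u: "vanish 1 u"
  shows "wcoeff (op_series F S x * op_series G ((*) u) 1) w =
    (\<Sum>k\<le>length w. \<Sum>m\<le>k. fps_nth F m * fps_nth G (k - m) * wcoeff ((S ^^ m) x * u ^ (k - m)) w)"
proof -
  let ?N = "length w"
  let ?t = "\<lambda>m j. fps_nth F m * fps_nth G j * wcoeff ((S ^^ m) x * u ^ j) w"
  have "wcoeff (op_series F S x * op_series G ((*) u) 1) w
    = (\<Sum>i\<le>?N. \<Sum>m\<le>?N. \<Sum>j\<le>?N. fps_nth F m * fps_nth G j *
        (wcoeff ((S ^^ m) x) (take i w) * wcoeff (u ^ j) (drop i w)))"
  proof -
    have t1: "wcoeff (op_series F S x) (take i w) =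
        (\<Sum>m\<le>?N. fps_nth F m * wcoeff ((S ^^ m) x) (take i w))" for i
      by (rule op_series_trunc[OF S]) simp
    have t2: "wcoeff (op_series G ((*) u) 1) (drop i w) =
        (\<Sum>j\<le>?N. fps_nth G j * wcoeff (u ^ j) (drop i w))" for i
      using op_series_trunc[OF raising_mult[OF u], of "drop i w" ?N G 1] by (simp add: funpow_mult)
    show ?thesis unfolding wcoeff_mult t1 t2 sum_product by (simp add: ac_simps)
  qed
  also have "\<dots> = (\<Sum>m\<le>?N. \<Sum>j\<le>?N. ?t m j)"
    unfolding wcoeff_mult sum_distrib_left
    by (rule trans[OF sum.swap], rule sum.cong[OF refl], rule sum.swap)
  also have "\<dots> = (\<Sum>(m, j)\<in>{..?N} \<times> {..?N}. ?t m j)"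
    by (simp add: sum.cartesian_product)
  also have "\<dots> = (\<Sum>(m, j)\<in>{(m, j). m + j \<le> ?N}. ?t m j)"
  proof (rule sum.mono_neutral_right)
    show "\<forall>i\<in>{..?N} \<times> {..?N} - {(m, j). m + j \<le> ?N}. (case i of (m, j) \<Rightarrow> ?t m j) = 0"
    proof (intro ballI)
      fix i assume "i \<in> {..?N} \<times> {..?N} - {(m, j). m + j \<le> ?N}"
      then obtain m j where i: "i = (m, j)" and "\<not> m + j \<le> ?N" by auto
      note this(2)
      moreover have "vanish (0 + m) ((S ^^ m) x)"
        by (rule raising_funpow_vanish[OF S]) simp
      moreover have "vanish (0 + j) (u ^ j)"
        using raising_funpow_vanish[OF raising_mult[OF u], of 0 1 j] by (simp add: funpow_mult)
      ultimately have "wcoeff ((S ^^ m) x * u ^ j) w = 0"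
        using vanish_mult[of m "(S ^^ m) x" j "u ^ j"] by (auto simp: vanish_def)
      then show "(case i of (m, j) \<Rightarrow> ?t m j) = 0" by (simp add: i)
    qed
  qed auto
  also have "\<dots> = (\<Sum>k\<le>?N. \<Sum>m\<le>k. ?t m (k - m))"
    by (rule sum.triangle_reindex_eq)
  finally show ?thesis .
qed

lemma sum_choose_Suc:
  fixes f :: "nat \<Rightarrow> 'a :: ring_1"
  shows "(\<Sum>m\<le>Suc k. of_nat (Suc k choose m) * f m) =
    (\<Sum>m\<le>k. of_nat (k choose m) * f m) + (\<Sum>m\<le>k. of_nat (k choose m) * f (Suc m))"
proof -
  have "(\<Sum>m\<le>Suc k. of_nat (Suc k choose m) * f m) =
      f 0 + (\<Sum>m\<le>k. of_nat (k choose Suc m) * f (Suc m)) + (\<Sum>m\<le>k. of_nat (k choose m) * f (Suc m))"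
    by (simp only: sum.atMost_Suc_shift binomial_Suc_Suc) (simp add: algebra_simps sum.distrib)
  also have "f 0 + (\<Sum>m\<le>k. of_nat (k choose Suc m) * f (Suc m)) =
      (\<Sum>m\<le>Suc k. of_nat (k choose m) * f m)"
    by (simp only: sum.atMost_Suc_shift) simp
  finally show ?thesis by (simp add: binomial_eq_0)
qed

lemma mult_ad_funpow: "u * (ad u ^^ m) v = (ad u ^^ Suc m) v + (ad u ^^ m) v * u"
  by (simp add: ad_def)

lemma of_nat_ncs_commute: "(u :: 'x ncs) * (of_nat k * v) = of_nat k * (u * v)"
  by (simp add: smul_of_nat smul_mult_right)

text \<open>Left multiplication by \<open>u\<close> is the sum of \<open>ad u\<close> and right
  multiplication by \<open>u\<close>, and these two operators commute; this is their binomial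
  theorem.\<close>

lemma power_commute_ad:
  "u ^ k * v = (\<Sum>m\<le>k. of_nat (k choose m) * ((ad u ^^ m) v * u ^ (k - m)))"
proof (induction k)
  case (Suc k)
  have *: "u * ((ad u ^^ m) v * u ^ (k - m)) =
      (ad u ^^ m) v * u ^ (Suc k - m) + (ad u ^^ Suc m) v * u ^ (Suc k - Suc m)" if "m \<le> k" for m
    unfolding mult.assoc[symmetric] mult_ad_funpow using that
    by (simp add: Suc_diff_le distrib_right mult.assoc del: funpow.simps)
  have "u ^ Suc k * v = u * (u ^ k * v)" by (simp add: mult.assoc)
  also have "\<dots> = (\<Sum>m\<le>k. of_nat (k choose m) * (u * ((ad u ^^ m) v * u ^ (k - m))))"
    unfolding Suc sum_distrib_left by (simp add: of_nat_ncs_commute)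
  also have "\<dots> = (\<Sum>m\<le>k. of_nat (k choose m) * ((ad u ^^ m) v * u ^ (Suc k - m)))
      + (\<Sum>m\<le>k. of_nat (k choose m) * ((ad u ^^ Suc m) v * u ^ (Suc k - Suc m)))"
    unfolding sum.distrib[symmetric] distrib_left[symmetric]
    by (intro sum.cong refl) (simp only: * atMost_iff)
  also have "\<dots> = (\<Sum>m\<le>Suc k. of_nat (Suc k choose m) * ((ad u ^^ m) v * u ^ (Suc k - m)))"
    by (rule sum_choose_Suc[symmetric])
  finally show ?case .
qed simp

lemma ncexp_mult:
  assumes "vanish 1 u"
  shows "wcoeff (ncexp u * v) w = (\<Sum>k\<le>length w. wcoeff (u ^ k * v) w / fact k)"
  unfolding ncexp_def op_series_mult_right[OF assms, of "fps_exp 1" v, symmetric]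
  by (simp add: op_series_def funpow_mult)

text \<open>Hadamard's identity, conjugation by \<open>e^u\<close> being \<open>e^(ad u)\<close>, in
  a form without inverses. Dividing the binomial expansion of \<open>u^k v\<close> by
  \<open>k!\<close> splits the coefficient into \<open>1 / m!\<close> and
  \<open>1 / (k - m)!\<close>.\<close>

lemma ncexp_commute:
  assumes u: "vanish 1 u"
  shows "ncexp u * v = op_series (fps_exp 1) (ad u) v * ncexp u"
proof (rule ncs_eqI)
  fix w :: "'a list"
  have 1: "wcoeff (u ^ k * v) w / fact k =
      (\<Sum>m\<le>k. wcoeff ((ad u ^^ m) v * u ^ (k - m)) w / (fact m * fact (k - m)))" for k
    unfolding power_commute_ad[of u k v] wcoeff_sum sum_divide_distrib smul_of_nat
    by (intro sum.cong refl) (simp add: binomial_fact)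
  show "wcoeff (ncexp u * v) w = wcoeff (op_series (fps_exp 1) (ad u) v * ncexp u) w"
    unfolding ncexp_mult[OF u] 1
    unfolding ncexp_def op_series_mult_op_series[OF raising_ad[OF u] u] by simp
qed

definition euler :: "'x ncs \<Rightarrow> 'x ncs" where
  "euler u = Ncs (\<lambda>w. of_nat (length w) * wcoeff u w)"

lemma wcoeff_euler [simp]: "wcoeff (euler u) w = of_nat (length w) * wcoeff u w"
  by (simp add: euler_def)

lemma euler_mult: "euler (u * v) = euler u * v + u * euler v"
proof (rule ncs_eqI)
  fix w :: "'a list"
  have "of_nat (length w) * (wcoeff u (take i w) * wcoeff v (drop i w)) =
      of_nat (length (take i w)) * wcoeff u (take i w) * wcoeff v (drop i w)
      + wcoeff u (take i w) * (of_nat (length (drop i w)) * wcoeff v (drop i w))"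
    if "i \<le> length w" for i
  proof -
    have "of_nat (length w) = (of_nat (length (take i w)) + of_nat (length (drop i w)) :: rat)"
      using that by (simp flip: of_nat_add)
    then show ?thesis by (simp only: distrib_left distrib_right mult.assoc mult.left_commute)
  qed
  then show "wcoeff (euler (u * v)) w = wcoeff (euler u * v + u * euler v) w"
    by (simp only: wcoeff_simps wcoeff_mult wcoeff_euler sum_distrib_left sum.distrib[symmetric])
      (auto intro!: sum.cong)
qed

lemma euler_one [simp]: "euler 1 = 0"
  by (rule ncs_eqI) (simp add: wcoeff_one)

text \<open>By the product rule, \<open>D(u^(k+1))\<close> is the sum of all
  \<open>u^i (D u) u^(k-i)\<close>. Moving the left powers across by \<open>power_commute_ad\<close>
  would give sums of binomial coefficients along a diagonal (hockey-stick identity); the induction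
  replaces this by Pascal's rule.\<close>

lemma euler_power:
  "euler (u ^ Suc k) = (\<Sum>m\<le>k. of_nat (Suc k choose Suc m) * ((ad u ^^ m) (euler u) * u ^ (k - m)))"
proof (induction k)
  case (Suc k)
  define g where "g m = (ad u ^^ m) (euler u) * u ^ (Suc k - m)" for m
  have *: "u * ((ad u ^^ m) (euler u) * u ^ (k - m)) = g m + g (Suc m)" if "m \<le> k" for m
    unfolding mult.assoc[symmetric] mult_ad_funpow g_def using that
    by (simp add: Suc_diff_le distrib_right mult.assoc del: funpow.simps)
  have "euler (u ^ Suc (Suc k)) = g 0 + u * euler (u ^ Suc k)"
    by (subst power_Suc, subst euler_mult) (simp add: g_def)
  also have "\<dots> = g 0 + (\<Sum>m\<le>k. of_nat (Suc k choose Suc m) * (u * ((ad u ^^ m) (euler u) * u ^ (k - m))))"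
    unfolding Suc sum_distrib_left by (simp only: of_nat_ncs_commute)
  also have "\<dots> = g 0 + (\<Sum>m\<le>k. of_nat (Suc k choose Suc m) * (g m + g (Suc m)))"
    by (intro arg_cong2[of _ _ _ _ "(+)"] sum.cong refl) (simp only: * atMost_iff)
  also have "\<dots> = (g 0 + (\<Sum>m\<le>k. of_nat (Suc k choose Suc m) * g (Suc m)))
      + (\<Sum>m\<le>k. of_nat (Suc k choose Suc m) * g m)"
    by (simp add: distrib_left sum.distrib)
  also have "g 0 + (\<Sum>m\<le>k. of_nat (Suc k choose Suc m) * g (Suc m)) =
      (\<Sum>m\<le>Suc k. of_nat (Suc k choose m) * g m)"
    by (simp only: sum.atMost_Suc_shift) simp
  also have "(\<Sum>m\<le>k. of_nat (Suc k choose Suc m) * g m) = (\<Sum>m\<le>Suc k. of_nat (Suc k choose Suc m) * g m)"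
    by (simp add: binomial_eq_0)
  also have "(\<Sum>m\<le>Suc k. of_nat (Suc k choose m) * g m) + (\<Sum>m\<le>Suc k. of_nat (Suc k choose Suc m) * g m)
      = (\<Sum>m\<le>Suc k. of_nat (Suc (Suc k) choose Suc m) * g m)"
    unfolding sum.distrib[symmetric] by (simp only: binomial_Suc_Suc of_nat_add distrib_right)
  finally show ?case by (simp only: g_def)
qed simp

text \<open>The series of \<open>(exp t - 1) / t\<close>; likewise \<open>ln_quot\<close> below is that of \<open>ln (1 + t) / t\<close>.\<close>

definition expm1_quot :: "rat fps" where
  "expm1_quot = Abs_fps (\<lambda>m. 1 / fact (Suc m))"

text \<open>The coefficient \<open>(k+1 choose m+1) / (k+1)!\<close> equals
  \<open>1 / ((m+1)! (k-m)!)\<close>, which is a coefficient of \<open>expm1_quot\<close> times one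
  of the exponential series.\<close>

lemma euler_ncexp:
  assumes u: "vanish 1 u"
  shows "euler (ncexp u) = op_series expm1_quot (ad u) (euler u) * ncexp u"
proof (rule ncs_eqI)
  fix w :: "'a list"
  let ?N = "length w"
  have 1: "wcoeff (euler (u ^ Suc k)) w / fact (Suc k) =
      (\<Sum>m\<le>k. fps_nth expm1_quot m * fps_nth (fps_exp 1) (k - m) * wcoeff ((ad u ^^ m) (euler u) * u ^ (k - m)) w)" for k
    unfolding euler_power[of u k] wcoeff_sum sum_divide_distrib smul_of_nat
    by (intro sum.cong refl) (simp add: binomial_fact expm1_quot_def del: fact_Suc binomial_Suc_Suc)
  \<comment> \<open>The cut-off is \<open>Suc ?N\<close> so that the index again runs up to
    \<open>?N\<close> after the zero summand \<open>k = 0\<close> has been split off.\<close>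
  have "wcoeff (euler (ncexp u)) w = (\<Sum>k\<le>Suc ?N. wcoeff (euler (u ^ k)) w / fact k)"
    unfolding ncexp_def wcoeff_euler
    by (subst op_series_trunc[OF raising_mult[OF u], of _ "Suc ?N"])
      (auto simp: funpow_mult sum_distrib_left distrib_left)
  also have "\<dots> = (\<Sum>k\<le>?N. wcoeff (euler (u ^ Suc k)) w / fact (Suc k))"
    by (subst sum.atMost_Suc_shift) (simp del: fact_Suc power_Suc wcoeff_euler)
  also have "\<dots> = wcoeff (op_series expm1_quot (ad u) (euler u) * ncexp u) w"
    unfolding ncexp_def op_series_mult_op_series[OF raising_ad[OF u] u] 1 ..
  finally show "wcoeff (euler (ncexp u)) w = wcoeff (op_series expm1_quot (ad u) (euler u) * ncexp u) w" .
qed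

text \<open>In the coefficient of \<open>(u - v) g\<close> at \<open>w\<close>, all proper prefixes
  contribute zero by induction, which leaves the constant term 1 of \<open>g\<close>. This takes the
  place of multiplying by inverse exponentials.\<close>

lemma mult_right_cancel_unipotent:
  assumes "wcoeff g [] = 1" "u * g = v * g"
  shows "u = v"
proof -
  have z: "(u - v) * g = 0" using assms by (simp add: left_diff_distrib)
  have "wcoeff (u - v) w = 0" for w
  proof (induction w rule: length_induct)
    case (1 w)
    have "0 = wcoeff ((u - v) * g) w" using z by simp
    also have "\<dots> = (\<Sum>i\<le>length w. if i = length w then wcoeff (u - v) w else 0)"
      unfolding wcoeff_mult
    proof (intro sum.cong refl)
      fix i assume "i \<in> {..length w}"
      then show "wcoeff (u - v) (take i w) * wcoeff g (drop i w) =
          (if i = length w then wcoeff (u - v) w else 0)"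
        using 1[rule_format, of "take i w"] assms(1) by auto
    qed
    finally show ?case by simp
  qed
  then show ?thesis by (intro ncs_eqI) (metis eq_iff_diff_eq_0 wcoeff_simps(3))
qed

lemma ncexp_nil: "wcoeff (ncexp u) [] = 1"
  by (simp add: ncexp_def op_series_def wcoeff_one)

lemma wcoeff_letter: "wcoeff (letter a) w = (if w = [a] then 1 else 0)"
  by (simp add: letter_def)

lemma vanish_letter: "vanish 1 (letter a)"
  by (auto simp: vanish_def letter_def)

lemma euler_letter: "euler (letter a) = letter a"
  by (rule ncs_eqI) (simp add: wcoeff_letter)

lemma funpow_ad_self: "(ad u ^^ Suc m) u = 0"
  by (induction m) (auto simp: ad_def)

definition ln_quot :: "rat fps" where
  "ln_quot = Abs_fps (\<lambda>k. (-1) ^ k / of_nat (Suc k))"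

lemma fps_exp_ln: "fps_compose (fps_exp 1) (fps_ln 1) = 1 + (fps_X :: rat fps)"
proof -
  have "fps_compose (fps_exp 1 - 1) (fps_inv (fps_exp 1 - 1)) = (fps_X :: rat fps)"
    by (rule fps_inv_right) simp_all
  then have "fps_compose (fps_exp 1 - 1) (fps_ln 1) = (fps_X :: rat fps)"
    by (simp add: fps_ln_fps_exp_inv)
  then show ?thesis by (simp add: fps_compose_sub_distrib algebra_simps)
qed

lemma fps_X_ln_quot: "fps_X * ln_quot = fps_ln 1"
  by (rule fps_ext) (auto simp: ln_quot_def fps_ln_nth fps_X_mult_nth)

lemma fps_X_expm1_quot: "fps_X * expm1_quot = fps_exp 1 - 1"
  by (rule fps_ext) (auto simp: expm1_quot_def fps_X_mult_nth gr0_conv_Suc)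

text \<open>With \<open>H = e^t - 1\<close>, the series \<open>ln (1 + H) / H\<close> is
  \<open>t / H\<close>, the reciprocal of \<open>expm1_quot\<close>. So an equation in which
  \<open>expm1_quot\<close> is applied to \<open>ad Z\<close> is solved by a series in
  \<open>e^(ad Z) - 1\<close>, an operator that is known from the factors of
  \<open>e^Z\<close>.\<close>

lemma ln_quot_expm1_quot: "fps_compose ln_quot (fps_exp 1 - 1) * expm1_quot = 1"
proof -
  define H :: "rat fps" where "H = fps_exp 1 - 1"
  have H0: "fps_nth H 0 = 0" by (simp add: H_def)
  have "fps_compose (fps_inv H) H = fps_X" by (rule fps_inv) (simp_all add: H_def)
  then have "fps_X = fps_compose (fps_X * ln_quot) H"
    by (simp add: fps_X_ln_quot fps_ln_fps_exp_inv H_def)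
  also have "\<dots> = fps_X * (fps_compose ln_quot H * expm1_quot)"
    by (simp add: fps_compose_mult_distrib[OF H0] fps_X_expm1_quot[symmetric] H0 H_def[symmetric])
      (simp add: H_def fps_X_expm1_quot[symmetric] ac_simps)
  finally show ?thesis unfolding H_def by (metis fps_X_neq_zero mult.right_neutral mult_left_cancel)
qed

section \<open>Dynkin's formula\<close>

text \<open>The series as a Lie ring record, so that the same \<open>nested_bracket\<close> that
  occurs in the group law can be formed from letters.\<close>

definition ncs_lie :: "'x ncs lie_ring" where
  "ncs_lie = \<lparr>carrier = UNIV, monoid.mult = (+), one = 0, lie_bracket = ad\<rparr>"

text \<open>Homogeneity is what allows the degree derivation to be undone: in the coefficient of
  \<open>w\<close> only brackets of exactly \<open>length w\<close> letters occur, so the factor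
  \<open>length w\<close> cancels the Dynkin degree.\<close>

lemma nested_bracket_homogeneous:
  "(\<And>u. u \<in> set us \<Longrightarrow> \<exists>a. u = letter a) \<Longrightarrow>
    wcoeff (nested_bracket ncs_lie us) w \<noteq> 0 \<Longrightarrow> length w = length us"
proof (induction us arbitrary: w rule: induct_list012)
  case 1
  then show ?case by (simp add: ncs_lie_def)
next
  case (2 x)
  then show ?case by (auto simp: wcoeff_letter split: if_splits)
next
  case (3 x y zs)
  let ?v = "nested_bracket ncs_lie (y # zs)"
  obtain a where a: "x = letter a" using 3(3) by auto
  have *: "length w = Suc (length (y # zs))" if "wcoeff (x * ?v) w \<noteq> 0 \<or> wcoeff (?v * x) w \<noteq> 0"
    using that
  proof
    assume "wcoeff (x * ?v) w \<noteq> 0"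
    then obtain i where i: "i \<le> length w" "wcoeff x (take i w) \<noteq> 0" "wcoeff ?v (drop i w) \<noteq> 0"
      unfolding wcoeff_mult by (metis (no_types, lifting) atMost_iff mult_eq_0_iff sum.neutral)
    then have "take i w = [a]" by (auto simp: a wcoeff_letter split: if_splits)
    then have "i = 1" using i(1) by (metis length_Cons length_take list.size(3) min.absorb2 One_nat_def)
    then show ?thesis using 3(2)[of "drop i w"] 3(3) i by auto
  next
    assume "wcoeff (?v * x) w \<noteq> 0"
    then obtain i where i: "i \<le> length w" "wcoeff ?v (take i w) \<noteq> 0" "wcoeff x (drop i w) \<noteq> 0"
      unfolding wcoeff_mult by (metis (no_types, lifting) atMost_iff mult_eq_0_iff sum.neutral)
    then have "drop i w = [a]" by (auto simp: a wcoeff_letter split: if_splits)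
    then have "length w - i = 1" by (metis length_Cons length_drop list.size(3) One_nat_def)
    then show ?thesis using 3(2)[of "take i w"] 3(3) i by auto
  qed
  have "wcoeff (x * ?v) w \<noteq> 0 \<or> wcoeff (?v * x) w \<noteq> 0"
    using 3(4) by (auto simp: ncs_lie_def ad_def)
  then show ?case using * by simp
qed

lemma nested_bracket_append:
  "ys \<noteq> [] \<Longrightarrow> nested_bracket ncs_lie (xs @ ys) = foldr ad xs (nested_bracket ncs_lie ys)"
proof (induction xs)
  case (Cons x xs)
  then obtain z zs where "xs @ ys = z # zs" by (cases "xs @ ys") auto
  then show ?case using Cons by (simp add: ncs_lie_def)
qed simp

lemma foldr_smul:
  "vanish 1 x \<Longrightarrow> vanish 1 y \<Longrightarrow> set us \<subseteq> {x, y} \<Longrightarrow> foldr ad us (smul c v) = smul c (foldr ad us v)"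
  by (induction us) (auto simp: ad_def smul_mult_left smul_mult_right smul_simps)

definition pair_coeff :: "nat \<times> nat \<Rightarrow> rat" where
  "pair_coeff = (\<lambda>(r, s). 1 / (fact r * fact s))"

definition pair_word :: "'a \<Rightarrow> 'a \<Rightarrow> nat \<times> nat \<Rightarrow> 'a list" where
  "pair_word x y = (\<lambda>(r, s). replicate r x @ replicate s y)"

lemma dynkin_word_alt: "dynkin_word x y ws = concat (map (pair_word x y) ws)"
  by (simp add: dynkin_word_def pair_word_def)

lemma length_dynkin_word: "length (dynkin_word x y ws) = dynkin_degree ws"
  by (induction ws) (auto simp: dynkin_word_def dynkin_degree_def)

lemma set_dynkin_word: "set (dynkin_word x y ws) \<subseteq> {x, y}"
  by (induction ws) (simp_all add: dynkin_word_def set_replicate_conv_if split_def)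

lemma dynkin_coeff_alt:
  "dynkin_coeff ws = (-1) ^ (length ws - 1) / (of_nat (length ws) * of_nat (dynkin_degree ws)) *
     prod_list (map pair_coeff ws)"
proof -
  have "of_nat (\<Prod>(r, s)\<leftarrow>ws. fact r * fact s) * prod_list (map pair_coeff ws) = (1 :: rat)"
    by (induction ws) (auto simp: pair_coeff_def field_simps)
  then have "prod_list (map pair_coeff ws) = 1 / of_nat (\<Prod>(r, s)\<leftarrow>ws. fact r * fact s)"
    by (metis mult_zero_left zero_neq_one eq_divide_imp mult.commute)
  then show ?thesis by (simp add: dynkin_coeff_def)
qed

lemma finite_dynkin_index [simp]: "finite (dynkin_index c)"
proof (rule finite_subset)
  show "dynkin_index c \<subseteq> {ws. set ws \<subseteq> {..c} \<times> {..c} \<and> length ws \<le> c}"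
  proof clarify
    fix ws assume ws: "ws \<in> dynkin_index c"
    have 1: "r + s \<le> dynkin_degree ws" if "(r, s) \<in> set ws" for r s ws
      using that by (induction ws) (auto simp: dynkin_degree_def)
    have 2: "length ws \<le> dynkin_degree ws" if "(0, 0) \<notin> set ws" for ws
      using that by (induction ws) (auto simp: dynkin_degree_def Suc_le_eq)
    show "set ws \<subseteq> {..c} \<times> {..c} \<and> length ws \<le> c"
      using ws 1[of _ _ ws] 2[of ws] by (fastforce simp: dynkin_index_def)
  qed
  show "finite {ws. set ws \<subseteq> {..c} \<times> {..c} \<and> length ws \<le> c}"
    by (rule finite_lists_length_le) simp
qed

section \<open>The logarithm of a product of two exponentials\<close>

context
  fixes a b :: 'x
begin

definition nclog :: "'x ncs" where
  "nclog = op_series (fps_ln 1) ((*) (ncexp (letter a) * ncexp (letter b) - 1)) 1"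

text \<open>This is \<open>e^(ad Z) - 1\<close> for \<open>Z = nclog\<close>, see
  \<open>bch_op_alt\<close>, written without \<open>Z\<close>, so that its powers expand into words
  in the inner derivations of the two letters.\<close>

definition bch_op :: "'x ncs \<Rightarrow> 'x ncs" where
  "bch_op v = op_series (fps_exp 1) (ad (letter a)) (op_series (fps_exp 1) (ad (letter b)) v) - v"

text \<open>The logarithmic derivative \<open>D(G) G^(-1)\<close> of \<open>G = e^a e^b\<close>: the
  first factor contributes \<open>a\<close>, the second contributes \<open>b\<close> conjugated by
  \<open>e^a\<close>.\<close>

definition bch_start :: "'x ncs" where
  "bch_start = (letter a) + op_series (fps_exp 1) (ad (letter a)) (letter b)"

lemma vanish_ncexp_prod: "vanish 1 (ncexp (letter a) * ncexp (letter b) - 1)"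
  by (simp add: vanish_def wcoeff_mult ncexp_nil wcoeff_one)

lemma vanish_nclog: "vanish 1 nclog"
  using op_series_raising[OF raising_mult[OF vanish_ncexp_prod], of "fps_ln 1"]
  by (simp add: raising_def nclog_def)

lemma ncexp_nclog: "ncexp nclog = ncexp (letter a) * ncexp (letter b)"
proof -
  let ?W = "ncexp (letter a) * ncexp (letter b) - 1"
  note W = vanish_ncexp_prod
  have "(*) nclog = op_series (fps_ln 1) ((*) ?W)"
    by (rule ext) (simp add: nclog_def op_series_mult_right[OF W, symmetric])
  then have "ncexp nclog = op_series (fps_exp 1) (op_series (fps_ln 1) ((*) ?W)) 1"
    by (simp only: ncexp_def[of nclog])
  also have "\<dots> = op_series (fps_compose (fps_exp 1) (fps_ln 1)) ((*) ?W) 1"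
    by (rule op_series_compose[OF raising_mult[OF W], symmetric]) simp
  also have "\<dots> = 1 + ?W"
    by (simp add: fps_exp_ln op_series_add[OF raising_mult[OF W]] op_series_one[OF raising_mult[OF W]]
        op_series_X[OF raising_mult[OF W]])
  finally show ?thesis by simp
qed

lemma ncexp_prod_nil: "wcoeff (ncexp (letter a) * ncexp (letter b)) [] = 1"
  by (simp add: wcoeff_mult ncexp_nil)

text \<open>Both sides are the conjugate of \<open>v\<close> by \<open>e^Z = e^a e^b\<close>,
  computed once in a single step and once factor by factor; the common right factor is then
  cancelled.\<close>

lemma exp_ad_nclog:
  "op_series (fps_exp 1) (ad nclog) v = op_series (fps_exp 1) (ad (letter a)) (op_series (fps_exp 1) (ad (letter b)) v)"
  (is "?l = ?r")
proof (rule mult_right_cancel_unipotent[OF ncexp_prod_nil])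
  let ?G = "ncexp (letter a) * ncexp (letter b)"
  have "op_series (fps_exp 1) (ad nclog) v * ?G = ncexp (letter a) * (ncexp (letter b) * v)"
    using ncexp_commute[OF vanish_nclog, of v] by (simp add: ncexp_nclog mult.assoc)
  also have "\<dots> = ncexp (letter a) * op_series (fps_exp 1) (ad (letter b)) v * ncexp (letter b)"
    by (simp add: ncexp_commute[OF vanish_letter, of b v] mult.assoc)
  also have "\<dots> = op_series (fps_exp 1) (ad (letter a)) (op_series (fps_exp 1) (ad (letter b)) v) * ?G"
    unfolding ncexp_commute[OF vanish_letter, of a "op_series _ _ v"] by (simp add: mult.assoc)
  finally show "op_series (fps_exp 1) (ad nclog) v * ?G =
    op_series (fps_exp 1) (ad (letter a)) (op_series (fps_exp 1) (ad (letter b)) v) * ?G" .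
qed

lemma bch_op_alt: "bch_op = op_series (fps_exp 1 - 1) (ad nclog)"
  using raising_ad[OF vanish_nclog]
  by (intro ext) (simp add: bch_op_def exp_ad_nclog[symmetric] op_series_diff op_series_one)

lemma raising_bch_op: "raising bch_op"
  unfolding bch_op_alt by (rule op_series_raising[OF raising_ad[OF vanish_nclog]]) simp

lemma euler_nclog: "euler nclog = op_series ln_quot bch_op bch_start"
proof -
  note rX = raising_ad[OF vanish_letter[of a]] and rY = raising_ad[OF vanish_letter[of b]]
  note rZ = raising_ad[OF vanish_nclog]
  let ?G = "ncexp (letter a) * ncexp (letter b)"
  note G1 = ncexp_prod_nil
  \<comment> \<open>A letter is homogeneous of degree 1 and commutes with itself, so only the
    constant term of \<open>expm1_quot\<close> acts on it.\<close>
  have eu: "euler (ncexp (letter c)) = letter c * ncexp (letter c)" for c :: 'x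
  proof -
    have "op_series expm1_quot (ad (letter c)) (letter c) = letter c"
    proof (rule ncs_eqI)
      fix w
      have "fps_nth expm1_quot k * wcoeff ((ad (letter c) ^^ k) (letter c)) w =
          (if k = 0 then wcoeff (letter c) w else 0)" for k
        by (cases k) (simp_all add: funpow_ad_self expm1_quot_def del: funpow.simps(2))
      then show "wcoeff (op_series expm1_quot (ad (letter c)) (letter c)) w = wcoeff (letter c) w"
        by (simp add: op_series_def)
    qed
    then show ?thesis by (simp add: euler_ncexp[OF vanish_letter] euler_letter)
  qed
  have start: "op_series expm1_quot (ad nclog) (euler nclog) = bch_start"
  proof (rule mult_right_cancel_unipotent[OF G1])
    have "op_series expm1_quot (ad nclog) (euler nclog) * ?G = euler ?G"
      using euler_ncexp[OF vanish_nclog] by (simp add: ncexp_nclog)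
    also have "\<dots> = (letter a) * ?G + ncexp (letter a) * (letter b) * ncexp (letter b)"
      by (simp add: euler_mult eu mult.assoc)
    also have "\<dots> = bch_start * ?G"
      by (simp add: ncexp_commute[OF vanish_letter, of a] bch_start_def distrib_right mult.assoc)
    finally show "op_series expm1_quot (ad nclog) (euler nclog) * ?G = bch_start * ?G" .
  qed
  have "euler nclog = op_series (fps_compose ln_quot (fps_exp 1 - 1) * expm1_quot) (ad nclog) (euler nclog)"
    by (simp add: ln_quot_expm1_quot op_series_one[OF rZ])
  also have "\<dots> = op_series ln_quot (op_series (fps_exp 1 - 1) (ad nclog)) bch_start"
    by (simp add: op_series_mult[OF rZ] op_series_compose[OF rZ] start)
  finally show ?thesis by (simp add: bch_op_alt)
qed

context
  fixes h :: nat
begin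

text \<open>The omitted pair \<open>(0, 0)\<close> is the identity summand that
  \<open>bch_op\<close> subtracts. Exponents above \<open>h\<close> cannot reach words of length at
  most \<open>h\<close>.\<close>

definition bch_pairs :: "(nat \<times> nat) set" where
  "bch_pairs = {..h} \<times> {..h} - {(0, 0)}"

definition pair_op :: "nat \<times> nat \<Rightarrow> 'x ncs \<Rightarrow> 'x ncs" where
  "pair_op rs v = smul (pair_coeff rs) (foldr ad (pair_word (letter a) (letter b) rs) v)"

definition pair_start :: "nat \<times> nat \<Rightarrow> 'x ncs" where
  "pair_start rs = smul (pair_coeff rs) (nested_bracket ncs_lie (pair_word (letter a) (letter b) rs))"

lemma finite_bch_pairs [simp]: "finite bch_pairs"
  by (simp add: bch_pairs_def)

lemma op_series_exp_exp_trunc: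
  assumes "length w \<le> h"
  shows "wcoeff (op_series (fps_exp 1) (ad (letter a)) (op_series (fps_exp 1) (ad (letter b)) v)) w =
    (\<Sum>rs\<in>{..h} \<times> {..h}. wcoeff (pair_op rs v) w)"
proof -
  note rX = raising_ad[OF vanish_letter[of a]] and rY = raising_ad[OF vanish_letter[of b]]
  let ?S = "\<Sum>k\<le>h. smul (fps_nth (fps_exp 1) k) ((ad (letter b) ^^ k) v)"
  have "wcoeff ((ad (letter a) ^^ r) (op_series (fps_exp 1) (ad (letter b)) v)) w = wcoeff ((ad (letter a) ^^ r) ?S) w" for r
  proof -
    have "vanish (Suc h + r) ((ad (letter a) ^^ r) (op_series (fps_exp 1) (ad (letter b)) v) - (ad (letter a) ^^ r) ?S)"
      using raising_funpow_vanish[OF rX op_series_trunc_vanish[OF rY, of h "fps_exp 1" v], of r] by (simp add: raising_funpow_diff[OF rX])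
    then show ?thesis using assms by (auto simp: vanish_def)
  qed
  then have "wcoeff (op_series (fps_exp 1) (ad (letter a)) (op_series (fps_exp 1) (ad (letter b)) v)) w =
      (\<Sum>r\<le>h. \<Sum>s\<le>h. wcoeff (pair_op (r, s) v) w)"
    unfolding op_series_trunc[OF rX assms]
    by (simp add: raising_funpow_sum[OF rX] raising_funpow_smul[OF rX] pair_op_def pair_coeff_def
        pair_word_def sum_distrib_left)
  then show ?thesis by (simp add: sum.cartesian_product)
qed

lemma bch_op_trunc: "vanish (Suc h) (bch_op v - (\<Sum>rs\<in>bch_pairs. pair_op rs v))"
proof -
  have "{..h} \<times> {..h} = insert (0, 0) bch_pairs" "(0, 0) \<notin> bch_pairs"
    by (auto simp: bch_pairs_def)
  moreover have "pair_op (0, 0) v = v"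
    by (simp add: pair_op_def pair_coeff_def pair_word_def smul_simps)
  ultimately show ?thesis
    by (auto simp: vanish_def bch_op_def op_series_exp_exp_trunc)
qed

lemma pair_op_add: "pair_op rs (u + v) = pair_op rs u + pair_op rs v"
proof -
  have "foldr ad us (u + v) = foldr ad us u + foldr ad us v" for us :: "'x ncs list"
    by (induction us) (auto simp: ad_def algebra_simps)
  then show ?thesis by (simp add: pair_op_def smul_simps)
qed

lemma pair_op_sum: "pair_op rs (sum f A) = (\<Sum>x\<in>A. pair_op rs (f x))"
proof -
  have "pair_op rs 0 = 0" using pair_op_add[of rs 0 0] by simp
  then show ?thesis by (induction A rule: infinite_finite_induct) (auto simp: pair_op_add)
qed

lemma bch_op_funpow_trunc:
  "vanish (Suc h) ((bch_op ^^ k) v - (\<Sum>l | set l \<subseteq> bch_pairs \<and> length l = k. foldr pair_op l v))"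
proof (induction k)
  case 0
  have "{l. set l \<subseteq> bch_pairs \<and> l = []} = {[]}" by auto
  then show ?case by (simp add: vanish_def)
next
  case (Suc k)
  let ?L = "\<lambda>k. {l. set l \<subseteq> bch_pairs \<and> length l = k}"
  let ?S = "\<lambda>k. \<Sum>l\<in>?L k. foldr pair_op l v"
  have "vanish (Suc (Suc h)) (bch_op ((bch_op ^^ k) v - ?S k))"
    using Suc raising_bch_op unfolding raising_def by blast
  then have "vanish (Suc h) (bch_op ((bch_op ^^ k) v - ?S k))" by (rule vanish_mono) simp
  then have 1: "vanish (Suc h) (bch_op ((bch_op ^^ k) v) - bch_op (?S k))"
    using raising_funpow_diff[OF raising_bch_op, of 1] by simp
  have "(\<Sum>rs\<in>bch_pairs. pair_op rs (?S k)) = (\<Sum>rs\<in>bch_pairs. \<Sum>l\<in>?L k. foldr pair_op (rs # l) v)"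
    by (simp add: pair_op_sum)
  also have "\<dots> = (\<Sum>(l, rs)\<in>?L k \<times> bch_pairs. foldr pair_op (rs # l) v)"
    by (subst sum.swap) (simp add: sum.cartesian_product)
  also have "\<dots> = ?S (Suc k)"
    unfolding lists_length_Suc_eq
    by (subst sum.reindex) (auto simp: inj_on_def intro!: sum.cong)
  finally have "vanish (Suc h) (bch_op (?S k) - ?S (Suc k))"
    using bch_op_trunc[of "?S k"] by simp
  with 1 show ?case by (auto simp: vanish_def)
qed

text \<open>A nested bracket whose two innermost letters agree is zero. Among all pairs only
  \<open>(1, 0)\<close> and \<open>(r, 1)\<close> therefore contribute, and they yield
  \<open>a\<close> and the terms \<open>(ad a)^r b / r!\<close>.\<close>

lemma bch_start_trunc: "vanish (Suc h) (bch_start - (\<Sum>rs\<in>bch_pairs. pair_start rs))"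
proof -
  note rX = raising_ad[OF vanish_letter[of a]]
  have nb: "pair_start (r, s) = (if s = 0 then (if r = 1 then (letter a) else 0)
      else if s = 1 then smul (1 / fact r) ((ad (letter a) ^^ r) (letter b)) else 0)" for r s
  proof (cases s)
    case 0
    show ?thesis
    proof (cases r)
      case (Suc r')
      have "nested_bracket ncs_lie (replicate r' (letter a) @ [(letter a)]) = (ad (letter a) ^^ r') (letter a)"
        by (subst nested_bracket_append) simp_all
      then have "nested_bracket ncs_lie (replicate r (letter a)) = (ad (letter a) ^^ r') (letter a)"
        by (simp add: Suc replicate_append_same del: replicate.simps) (metis replicate_Suc replicate_append_same)
      then show ?thesis using 0 Suc funpow_ad_self[of "r' - 1" "letter a"]
        by (cases r') (auto simp: pair_start_def pair_word_def pair_coeff_def smul_simps)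
    qed (simp add: 0 pair_start_def pair_word_def pair_coeff_def smul_simps ncs_lie_def)
  next
    case (Suc s')
    have "nested_bracket ncs_lie ((replicate r (letter a) @ replicate s' (letter b)) @ [(letter b)]) = (ad (letter a) ^^ r) ((ad (letter b) ^^ s') (letter b))"
      by (subst nested_bracket_append) simp_all
    then have "nested_bracket ncs_lie (replicate r (letter a) @ replicate s (letter b)) = (ad (letter a) ^^ r) ((ad (letter b) ^^ s') (letter b))"
      by (simp add: Suc replicate_append_same del: replicate.simps) (metis replicate_Suc replicate_append_same)
    then show ?thesis using Suc funpow_ad_self[of "s' - 1" "letter b"]
      by (cases s') (auto simp: pair_start_def pair_word_def pair_coeff_def smul_simps raising_funpow_0[OF rX])
  qed
  show ?thesis unfolding vanish_def
  proof (intro allI impI)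
    fix w :: "'x list" assume w: "length w < Suc h"
    have p0: "pair_start (0, 0) = 0" by (simp add: nb)
    have ins: "{..h} \<times> {..h} = insert (0, 0) bch_pairs" "(0, 0) \<notin> bch_pairs"
      by (auto simp: bch_pairs_def)
    have "(\<Sum>rs\<in>bch_pairs. wcoeff (pair_start rs) w) = (\<Sum>rs\<in>{..h} \<times> {..h}. wcoeff (pair_start rs) w)"
      using ins p0 by simp
    also have "\<dots> = (\<Sum>r\<le>h. \<Sum>s\<le>h. wcoeff (pair_start (r, s)) w)"
      by (simp add: sum.cartesian_product)
    also have "\<dots> = (\<Sum>r\<le>h. \<Sum>s\<le>h. (if s = 0 then (if r = 1 then wcoeff (letter a) w else 0) else 0) +
        (if s = 1 then wcoeff ((ad (letter a) ^^ r) (letter b)) w / fact r else 0))"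
      by (intro sum.cong refl) (auto simp: nb)
    also have "\<dots> = (\<Sum>r\<le>h. (if r = 1 then wcoeff (letter a) w else 0) +
        (if 1 \<le> h then wcoeff ((ad (letter a) ^^ r) (letter b)) w / fact r else 0))"
      by (intro sum.cong refl) (simp add: sum.distrib)
    also have "\<dots> = wcoeff bch_start w"
    proof (cases "1 \<le> h")
      case True
      then show ?thesis using w
        by (simp add: sum.distrib bch_start_def op_series_trunc[OF rX, of w h])
    next
      case False
      then have "w = []" using w by (cases w) auto
      then show ?thesis using False
        by (simp add: bch_start_def op_series_def wcoeff_letter)
    qed
    finally show "wcoeff (bch_start - (\<Sum>rs\<in>bch_pairs. pair_start rs)) w = 0" by simp
  qed
qed

text \<open>The operators of \<open>l\<close> wrap their letters around the bracket of the last pair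
  while the factorials multiply, so \<open>l @ [rs]\<close> becomes a single Dynkin word. The pair
  \<open>rs\<close> is nonzero because it supplies the innermost letter.\<close>

lemma foldr_pair_op_start:
  assumes "rs \<noteq> (0, 0)"
  shows "foldr pair_op l (pair_start rs) =
    smul (prod_list (map pair_coeff (l @ [rs]))) (nested_bracket ncs_lie (dynkin_word (letter a) (letter b) (l @ [rs])))"
proof (induction l)
  case Nil
  then show ?case by (simp add: pair_start_def dynkin_word_alt)
next
  case (Cons x l)
  have ne: "dynkin_word (letter a) (letter b) (l @ [rs]) \<noteq> []"
    using assms by (cases rs) (auto simp: dynkin_word_def)
  have "set (pair_word (letter a) (letter b) x) \<subseteq> {(letter a), (letter b)}" by (auto simp: pair_word_def split: prod.splits)
  moreover have "dynkin_word (letter a) (letter b) ((x # l) @ [rs]) =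
      pair_word (letter a) (letter b) x @ dynkin_word (letter a) (letter b) (l @ [rs])"
    by (simp add: dynkin_word_alt)
  ultimately show ?case unfolding foldr.simps comp_def Cons
    by (simp add: pair_op_def foldr_smul[OF vanish_letter[of a] vanish_letter[of b]] smul_simps
        nested_bracket_append[OF ne])
qed

text \<open>The coefficient \<open>(-1)^k / (k + 1)\<close> of \<open>ln_quot\<close> goes with the
  lists of \<open>k + 1\<close> pairs, \<open>k\<close> for the powers of \<open>bch_op\<close> and
  one for \<open>bch_start\<close>. Undoing the degree derivation divides by
  \<open>length w\<close>, which is the remaining denominator in Dynkin's coefficient.\<close>

lemma wcoeff_nclog:
  assumes w: "length w \<le> h"
  shows "wcoeff nclog w =
    (\<Sum>ws\<in>dynkin_index h. dynkin_coeff ws * wcoeff (nested_bracket ncs_lie (dynkin_word (letter a) (letter b) ws)) w)"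
\<comment> \<open>The degree derivation loses the constant term, so the empty word is treated
  apart.\<close>
proof (cases "w = []")
  case True
  have "dynkin_coeff ws * wcoeff (nested_bracket ncs_lie (dynkin_word (letter a) (letter b) ws)) w = 0"
    if "ws \<in> dynkin_index h" for ws
  proof (rule ccontr)
    assume *: "\<not> ?thesis"
    then have "length w = length (dynkin_word (letter a) (letter b) ws)"
      by (intro nested_bracket_homogeneous) (use set_dynkin_word[of "letter a" "letter b" ws] in auto)
    then have "dynkin_degree ws = 0" by (simp add: True length_dynkin_word)
    then show False using * by (simp add: dynkin_coeff_def)
  qed
  moreover have "wcoeff nclog w = 0" using vanish_nclog True by (simp add: vanish_def)
  ultimately show ?thesis by (metis (no_types, lifting) sum.neutral)
next
  case False
  let ?L = "\<lambda>k. {l. set l \<subseteq> bch_pairs \<and> length l = k}"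
  let ?nb = "\<lambda>ws. wcoeff (nested_bracket ncs_lie (dynkin_word (letter a) (letter b) ws)) w"
  define t where "t ws = (-1) ^ (length ws - 1) / of_nat (length ws) * prod_list (map pair_coeff ws) * ?nb ws" for ws
  have nb0: "?nb ws = 0" if "dynkin_degree ws \<noteq> length w" for ws
  proof (rule ccontr)
    assume "?nb ws \<noteq> 0"
    then have "length w = length (dynkin_word (letter a) (letter b) ws)"
      by (intro nested_bracket_homogeneous) (use set_dynkin_word[of "letter a" "letter b" ws] in auto)
    with that show False by (simp add: length_dynkin_word)
  qed
  have start: "wcoeff (foldr pair_op l bch_start) w = (\<Sum>rs\<in>bch_pairs. wcoeff (foldr pair_op l (pair_start rs)) w)" for l
  proof -
    have add: "foldr pair_op l (u + v) = foldr pair_op l u + foldr pair_op l v" for u v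
      by (induction l) (auto simp: pair_op_add)
    have z: "foldr pair_op l 0 = 0" using add[of 0 0] by simp
    have s: "foldr pair_op l (sum f A) = (\<Sum>x\<in>A. foldr pair_op l (f x))" for f and A :: "(nat \<times> nat) set"
      by (induction A rule: infinite_finite_induct) (auto simp: add z)
    have adv: "vanish N (ad (letter c) u)" if "vanish N u" for N u and c :: 'x
    proof -
      have "vanish (Suc N) (ad (letter c) u)"
        using raising_ad[OF vanish_letter[of c]] that unfolding raising_def by blast
      then show ?thesis by (rule vanish_mono) simp
    qed
    have "vanish N (foldr ad us u)" if "vanish N u" "set us \<subseteq> {(letter a), (letter b)}" for N u us
      using that by (induction us) (auto simp: adv)
    moreover have "set (pair_word (letter a) (letter b) rs) \<subseteq> {letter a, letter b}" for rs
      by (cases rs) (auto simp: pair_word_def)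
    ultimately have "vanish N (pair_op rs u)" if "vanish N u" for N u rs
      using that by (simp add: pair_op_def vanish_def)
    then have v: "vanish N (foldr pair_op l u)" if "vanish N u" for N u
      using that by (induction l) auto
    have "foldr pair_op l bch_start =
      foldr pair_op l (bch_start - (\<Sum>rs\<in>bch_pairs. pair_start rs)) + (\<Sum>rs\<in>bch_pairs. foldr pair_op l (pair_start rs))"
      unfolding s[symmetric] add[symmetric] by simp
    with v[OF bch_start_trunc] w show ?thesis by (simp add: vanish_def)
  qed
  have "of_nat (length w) * wcoeff nclog w = wcoeff (euler nclog) w" by simp
  also have "\<dots> = (\<Sum>k\<le>h. fps_nth ln_quot k * wcoeff ((bch_op ^^ k) bch_start) w)"
    unfolding euler_nclog by (rule op_series_trunc[OF raising_bch_op w])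
  also have "\<dots> = (\<Sum>k\<le>h. \<Sum>ws\<in>?L (Suc k). t ws)"
  proof (intro sum.cong refl)
    fix k
    have "wcoeff ((bch_op ^^ k) bch_start) w = (\<Sum>l\<in>?L k. wcoeff (foldr pair_op l bch_start) w)"
      using bch_op_funpow_trunc[of k bch_start] w by (auto simp: vanish_def)
    also have "\<dots> = (\<Sum>(l, rs)\<in>?L k \<times> bch_pairs. prod_list (map pair_coeff (l @ [rs])) * ?nb (l @ [rs]))"
      unfolding start sum.cartesian_product
    proof (intro sum.cong refl, clarify)
      fix l r s assume "(r, s) \<in> bch_pairs"
      then have "(r, s) \<noteq> (0, 0)" by (auto simp: bch_pairs_def)
      from foldr_pair_op_start[OF this, of l]
      show "wcoeff (foldr pair_op l (pair_start (r, s))) w =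
        prod_list (map pair_coeff (l @ [(r, s)])) * ?nb (l @ [(r, s)])" by simp
    qed
    also have "\<dots> = (\<Sum>ws\<in>?L (Suc k). prod_list (map pair_coeff ws) * ?nb ws)"
    proof (rule sum.reindex_bij_betw[of "\<lambda>(l, rs). l @ [rs]", symmetric, THEN sym, THEN trans[rotated]])
      show "bij_betw (\<lambda>(l, rs). l @ [rs]) (?L k \<times> bch_pairs) (?L (Suc k))"
        unfolding bij_betw_def
      proof
        show "(\<lambda>(l, rs). l @ [rs]) ` (?L k \<times> bch_pairs) = ?L (Suc k)"
        proof (intro equalityI subsetI)
          fix ws assume ws: "ws \<in> ?L (Suc k)"
          then have "ws \<noteq> []" by auto
          then have e: "ws = (\<lambda>(l, rs). l @ [rs]) (butlast ws, last ws)" by simp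
          have "(butlast ws, last ws) \<in> ?L k \<times> bch_pairs"
            using ws \<open>ws \<noteq> []\<close> in_set_butlastD[of _ ws] by auto
          then show "ws \<in> (\<lambda>(l, rs). l @ [rs]) ` (?L k \<times> bch_pairs)"
            by (subst e) (rule imageI)
        qed auto
      qed (auto simp: inj_on_def)
    qed (simp add: case_prod_unfold)
    finally show "fps_nth ln_quot k * wcoeff ((bch_op ^^ k) bch_start) w = (\<Sum>ws\<in>?L (Suc k). t ws)"
      by (simp add: sum_distrib_left ln_quot_def t_def mult.assoc)
  qed
  also have "\<dots> = (\<Sum>ws\<in>(\<Union>k\<in>{..h}. ?L (Suc k)). t ws)"
    by (subst sum.UNION_disjoint) (auto simp: finite_lists_length_eq)
  \<comment> \<open>Both index sets contain all lists of degree \<open>length w\<close> without the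
    pair \<open>(0, 0)\<close>, and every list of another degree contributes zero.\<close>
  also have "\<dots> = (\<Sum>ws\<in>dynkin_index h. t ws)"
  proof (rule sum.mono_neutral_cong[OF _ _ _ _ refl])
    show "finite (\<Union>k\<in>{..h}. ?L (Suc k))" by (auto simp: finite_lists_length_eq)
    have t0: "t ws = 0" if "dynkin_degree ws \<noteq> length w" for ws
      using nb0[OF that] by (simp add: t_def)
    have 1: "r \<le> dynkin_degree ws \<and> s \<le> dynkin_degree ws" if "(r, s) \<in> set ws" for r s ws
      using that by (induction ws) (auto simp: dynkin_degree_def)
    have 2: "length ws \<le> dynkin_degree ws" if "(0, 0) \<notin> set ws" for ws
      using that by (induction ws) (auto simp: dynkin_degree_def Suc_le_eq)
    show "t ws = 0" if "ws \<in> dynkin_index h - (\<Union>k\<in>{..h}. ?L (Suc k))" for ws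
    proof (rule t0, rule notI)
      assume d: "dynkin_degree ws = length w"
      have "length ws \<le> h" "ws \<noteq> []" "(0, 0) \<notin> set ws"
        using that 2[of ws] by (auto simp: dynkin_index_def)
      moreover have "set ws \<subseteq> bch_pairs"
      proof (rule subsetI)
        fix rs assume rs: "rs \<in> set ws"
        obtain r s where e: "rs = (r, s)" by (cases rs)
        have "rs \<noteq> (0, 0)" using rs \<open>(0, 0) \<notin> set ws\<close> by metis
        moreover have "r \<le> h" "s \<le> h" using 1[of r s ws] rs e d w by simp_all
        ultimately show "rs \<in> bch_pairs" by (simp add: e bch_pairs_def)
      qed
      ultimately have "ws \<in> ?L (Suc (length ws - 1))" "length ws - 1 \<in> {..h}" by auto
      then show False using that by blast
    qed
    show "t ws = 0" if "ws \<in> (\<Union>k\<in>{..h}. ?L (Suc k)) - dynkin_index h" for ws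
    proof (rule t0, rule notI)
      assume d: "dynkin_degree ws = length w"
      have "ws \<noteq> []" "(0, 0) \<notin> set ws" using that by (auto simp: bch_pairs_def)
      then show False using that d w by (auto simp: dynkin_index_def)
    qed
  qed auto
  also have "\<dots> = of_nat (length w) * (\<Sum>ws\<in>dynkin_index h. dynkin_coeff ws * ?nb ws)"
    unfolding sum_distrib_left
  proof (intro sum.cong refl)
    fix ws
    show "t ws = of_nat (length w) * (dynkin_coeff ws * ?nb ws)"
    proof (cases "dynkin_degree ws = length w")
      case True
      then show ?thesis using False by (simp add: t_def dynkin_coeff_alt field_simps)
    qed (simp add: nb0 t_def)
  qed
  finally show ?thesis using False by simp
qed

end

end

section \<open>Truncated exponentials in torsion rings\<close>

definition p_integral :: "int \<Rightarrow> rat \<Rightarrow> bool" where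
  "p_integral p q \<longleftrightarrow> \<not> p dvd snd (quotient_of q)"

text \<open>
  The integer by which a \<open>p\<close>-integral rational acts on a group of exponent dividing \<open>m\<close>; it is unspecified
  for other rationals.
\<close>

definition residue :: "int \<Rightarrow> rat \<Rightarrow> int" where
  "residue m q = (SOME k. m dvd k * snd (quotient_of q) - fst (quotient_of q))"

lemma p_integralE:
  assumes "p_integral p q"
  obtains a b where "q = of_int a / of_int b" "\<not> p dvd b" "b \<noteq> 0"
proof -
  obtain a b where ab: "quotient_of q = (a, b)" by (cases "quotient_of q")
  then have "\<not> p dvd b" using assms by (simp add: p_integral_def)
  then show thesis
    using that[of a b] quotient_of_div[OF ab] quotient_of_denom_pos[OF ab] by auto
qed

text \<open>The definitions refer to the reduced fraction, but sums and products of fractions do not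
  come reduced; this mediates between the two.\<close>

lemma quotient_of_cross:
  assumes "quotient_of q = (a', b')" "q = of_int a / of_int b" "b \<noteq> 0"
  shows "a * b' = a' * b" "b' dvd b"
proof -
  have "q = of_int a' / of_int b'" "b' > 0"
    using quotient_of_div[OF assms(1)] quotient_of_denom_pos[OF assms(1)] by auto
  then have "(of_int (a * b') :: rat) = of_int (a' * b)"
    using assms(2,3) by (simp add: field_simps)
  then show e: "a * b' = a' * b" by (simp only: of_int_eq_iff)
  have "coprime b' a'" using quotient_of_coprime[OF assms(1)] by (simp add: coprime_commute)
  moreover have "b' dvd a' * b" by (metis e dvd_triv_right)
  ultimately show "b' dvd b" using coprime_dvd_mult_right_iff by blast
qed

lemma p_integralI:
  assumes "q = of_int a / of_int b" "\<not> p dvd b"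
  shows "p_integral p q"
proof -
  obtain a' b' where ab: "quotient_of q = (a', b')" by (cases "quotient_of q")
  have "b \<noteq> 0" using assms(2) by auto
  from quotient_of_cross(2)[OF ab assms(1) this] assms(2) show ?thesis
    by (auto simp: p_integral_def ab intro: dvd_trans)
qed

locale prime_power_modulus =
  fixes p m :: int and D :: nat
  assumes prime_p: "Factorial_Ring.prime p" and m_def: "m = p ^ D"
begin

lemma coprime_m: "\<not> p dvd b \<Longrightarrow> coprime b m"
  using prime_imp_coprime[OF prime_p, of b] by (simp add: m_def coprime_commute)

text \<open>The reduced denominator is invertible modulo \<open>m\<close> and can be cancelled. So
  \<open>residue\<close> solves the congruence for every way of writing the rational with a
  denominator prime to \<open>p\<close>.\<close>

lemma residue_char:
  assumes "q = of_int a / of_int b" "\<not> p dvd b"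
  shows "m dvd residue m q * b - a"
proof -
  obtain a' b' where ab: "quotient_of q = (a', b')" by (cases "quotient_of q")
  have b0: "b \<noteq> 0" using assms(2) by auto
  note cross = quotient_of_cross[OF ab assms(1) b0]
  have b': "\<not> p dvd b'" using cross(2) assms(2) by (auto intro: dvd_trans)
  have "\<exists>k. m dvd k * b' - a'"
  proof -
    obtain u v where "u * b' + v * m = 1"
      using coprime_m[OF b'] bezout_int[of b' m] by auto
    then have "a' * (u * b' + v * m) = a'" by simp
    then have "(a' * u) * b' - a' = m * (- (a' * v))" by (simp add: algebra_simps)
    then show ?thesis by (metis dvd_triv_left)
  qed
  then have "m dvd residue m q * b' - a'"
    unfolding residue_def ab fst_conv snd_conv by (rule someI_ex)
  then have "m dvd (residue m q * b' - a') * b" by simp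
  also have "(residue m q * b' - a') * b = b' * (residue m q * b - a)"
    using cross(1) by (simp add: algebra_simps)
  finally show ?thesis using coprime_m[OF b'] by (simp add: coprime_commute coprime_dvd_mult_right_iff)
qed

lemma p_integral_mult: "p_integral p q \<Longrightarrow> p_integral p r \<Longrightarrow> p_integral p (q * r)"
proof (elim p_integralE)
  fix a b c d
  assume *: "q = of_int a / of_int b" "\<not> p dvd b" "b \<noteq> 0" "r = of_int c / of_int d" "\<not> p dvd d" "d \<noteq> 0"
  show ?thesis
    by (rule p_integralI[of _ "a * c" "b * d"]) (use * prime_p in \<open>auto simp: prime_dvd_mult_iff\<close>)
qed

lemma p_integral_add: "p_integral p q \<Longrightarrow> p_integral p r \<Longrightarrow> p_integral p (q + r)"
proof (elim p_integralE)
  fix a b c d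
  assume *: "q = of_int a / of_int b" "\<not> p dvd b" "b \<noteq> 0" "r = of_int c / of_int d" "\<not> p dvd d" "d \<noteq> 0"
  show ?thesis
    by (rule p_integralI[of _ "a * d + c * b" "b * d"])
      (use * prime_p in \<open>auto simp: prime_dvd_mult_iff field_simps\<close>)
qed

lemma p_integral_of_int [simp]: "p_integral p (of_int k)"
  by (rule p_integralI[of _ k 1]) (use prime_p not_prime_unit in auto)

lemma p_integral_0 [simp]: "p_integral p 0" and p_integral_1 [simp]: "p_integral p 1"
  using p_integral_of_int[of 0] p_integral_of_int[of 1] by simp_all

lemma p_integral_sum: "(\<And>x. x \<in> S \<Longrightarrow> p_integral p (f x)) \<Longrightarrow> p_integral p (sum f S)"
  by (induction S rule: infinite_finite_induct) (auto intro: p_integral_add)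

lemma residue_mult:
  assumes "p_integral p q" "p_integral p r"
  shows "m dvd residue m (q * r) - residue m q * residue m r"
proof -
  obtain a b where 1: "q = of_int a / of_int b" "\<not> p dvd b" "b \<noteq> 0" using assms(1) by (rule p_integralE)
  obtain c d where 2: "r = of_int c / of_int d" "\<not> p dvd d" "d \<noteq> 0" using assms(2) by (rule p_integralE)
  have bd: "\<not> p dvd b * d" using 1 2 prime_p by (simp add: prime_dvd_mult_iff)
  have "m dvd residue m (q * r) * (b * d) - a * c"
    by (rule residue_char[OF _ bd]) (simp add: 1 2)
  moreover have "m dvd residue m q * b - a" "m dvd residue m r * d - c"
    using residue_char 1 2 by blast+
  ultimately have "m dvd (residue m (q * r) * (b * d) - a * c) - (residue m q * b - a) * (residue m r * d)
     - a * (residue m r * d - c)" by (meson dvd_diff dvd_mult dvd_mult2)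
  also have "\<dots> = (b * d) * (residue m (q * r) - residue m q * residue m r)" by (simp add: algebra_simps)
  finally show ?thesis using coprime_m[OF bd] by (simp add: coprime_commute coprime_dvd_mult_right_iff)
qed

lemma residue_add:
  assumes "p_integral p q" "p_integral p r"
  shows "m dvd residue m (q + r) - (residue m q + residue m r)"
proof -
  obtain a b where 1: "q = of_int a / of_int b" "\<not> p dvd b" "b \<noteq> 0" using assms(1) by (rule p_integralE)
  obtain c d where 2: "r = of_int c / of_int d" "\<not> p dvd d" "d \<noteq> 0" using assms(2) by (rule p_integralE)
  have bd: "\<not> p dvd b * d" using 1 2 prime_p by (simp add: prime_dvd_mult_iff)
  have "m dvd residue m (q + r) * (b * d) - (a * d + c * b)"
    by (rule residue_char[OF _ bd]) (simp add: 1 2 field_simps)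
  moreover have "m dvd residue m q * b - a" "m dvd residue m r * d - c"
    using residue_char 1 2 by blast+
  ultimately have "m dvd (residue m (q + r) * (b * d) - (a * d + c * b)) - (residue m q * b - a) * d
     - (residue m r * d - c) * b" by (meson dvd_diff dvd_mult dvd_mult2)
  also have "\<dots> = (b * d) * (residue m (q + r) - (residue m q + residue m r))" by (simp add: algebra_simps)
  finally show ?thesis using coprime_m[OF bd] by (simp add: coprime_commute coprime_dvd_mult_right_iff)
qed

lemma residue_of_int: "m dvd residue m (of_int k) - k"
  using residue_char[of "of_int k" k 1] prime_p not_prime_unit by auto

lemma p_integral_inverse_fact:
  assumes "int k < p"
  shows "p_integral p (1 / fact k)"
proof (rule p_integralI[of _ 1 "fact k"])
  show "\<not> p dvd fact k"
    using assms
  proof (induction k)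
    case 0
    then show ?case using prime_p not_prime_unit by auto
  next
    case (Suc k)
    then have "\<not> p dvd int (Suc k)" by (auto dest: zdvd_imp_le)
    then show ?case using Suc prime_p
      by (simp add: prime_dvd_mult_iff del: of_nat_Suc)
  qed
qed simp

text \<open>The length of the list, its degree and the arguments of the factorials are at most
  \<open>c\<close>, hence below \<open>p\<close>, so no factor of the denominator is divisible by
  \<open>p\<close>.\<close>

lemma p_integral_dynkin_coeff:
  assumes "ws \<in> dynkin_index c" "int c < p"
  shows "p_integral p (dynkin_coeff ws)"
proof -
  have deg: "dynkin_degree ws \<le> c" and ne: "ws \<noteq> []" and z: "(0, 0) \<notin> set ws"
    using assms(1) by (auto simp: dynkin_index_def)
  have len: "length ws \<le> dynkin_degree ws" if "(0, 0) \<notin> set ws" for ws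
    using that by (induction ws) (auto simp: dynkin_degree_def Suc_le_eq)
  have pc: "p_integral p (prod_list (map pair_coeff ws))" if "dynkin_degree ws \<le> c" for ws
    using that
  proof (induction ws)
    case (Cons x ws)
    obtain r s where x: "x = (r, s)" by (cases x)
    have "p_integral p (1 / fact r)" "p_integral p (1 / fact s)"
      using Cons(2) assms(2) by (auto intro!: p_integral_inverse_fact simp: x dynkin_degree_def)
    then have "p_integral p (pair_coeff x)"
      using p_integral_mult[of "1 / fact r" "1 / fact s"] by (simp add: x pair_coeff_def)
    then show ?case using Cons by (auto intro!: p_integral_mult simp: dynkin_degree_def split: prod.splits)
  qed simp
  have inv: "p_integral p (1 / of_nat k)" if "0 < k" "k \<le> c" for k
    by (rule p_integralI[of _ 1 "int k"]) (use that assms(2) in \<open>auto dest: zdvd_imp_le\<close>)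
  have "p_integral p (of_int ((-1) ^ (length ws - 1)) * (1 / of_nat (length ws)) *
      (1 / of_nat (dynkin_degree ws)) * prod_list (map pair_coeff ws))"
    using len[OF z] deg length_greater_0_conv[of ws] ne
    by (intro p_integral_mult p_integral_of_int inv pc) linarith+
  then show ?thesis by (simp add: dynkin_coeff_alt)
qed

end

section \<open>Evaluation of noncommutative series at a nilpotent pair\<close>

definition commutator_lie :: "('a, 'm) ring_scheme \<Rightarrow> 'a lie_ring" where
  "commutator_lie A = \<lparr>carrier = carrier A, monoid.mult = add A, one = \<zero>\<^bsub>A\<^esub>,
     lie_bracket = (\<lambda>x y. x \<otimes>\<^bsub>A\<^esub> y \<ominus>\<^bsub>A\<^esub> y \<otimes>\<^bsub>A\<^esub> x)\<rparr>"

text \<open>The left quotient by a letter (Brzozowski derivative): \<open>u\<close> is its constant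
  term plus the sum of \<open>letter c * der c u\<close> over the letters \<open>c\<close>. The
  evaluation below is a Horner scheme along this decomposition.\<close>

definition der :: "'x \<Rightarrow> 'x ncs \<Rightarrow> 'x ncs" where
  "der c u = Ncs (\<lambda>w. wcoeff u (c # w))"

lemma wcoeff_der [simp]: "wcoeff (der c u) w = wcoeff u (c # w)"
  by (simp add: der_def)

lemma der_mult: "der c (u * v) = der c u * v + smul (wcoeff u []) (der c v)"
  by (rule ncs_eqI) (simp add: wcoeff_mult sum.atMost_Suc_shift del: sum.atMost_Suc)

lemma der_simps: "der c (u + v) = der c u + der c v" "der c (smul q u) = smul q (der c u)"
  "der c 0 = 0" "der c 1 = 0"
  by (auto intro!: ncs_eqI simp: wcoeff_one)

locale torsion_ring = ring A + prime_power_modulus p m D for A (structure) and p m D +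
  assumes torsion: "x \<in> carrier A \<Longrightarrow> [m] \<cdot> x = \<zero>"
begin

definition act :: "rat \<Rightarrow> 'a \<Rightarrow> 'a" where
  "act q x = [residue m q] \<cdot> x"

lemma int_pow_cong:
  assumes "m dvd k - l" "x \<in> carrier A"
  shows "[k] \<cdot> x = [l] \<cdot> x"
proof -
  obtain j where "k - l = m * j" using assms(1) by (elim dvdE)
  then have k: "k = m * j + l" by simp
  have "[k] \<cdot> x = [j] \<cdot> ([m] \<cdot> x) \<oplus> [l] \<cdot> x"
    unfolding k using assms(2) by (simp add: add.int_pow_mult add.int_pow_pow)
  then show ?thesis using assms(2) torsion by (simp add: add.int_pow_one)
qed

lemma act_closed [simp]: "x \<in> carrier A \<Longrightarrow> act q x \<in> carrier A"
  by (simp add: act_def)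

lemma act_add:
  assumes "p_integral p q" "p_integral p r" "x \<in> carrier A"
  shows "act (q + r) x = act q x \<oplus> act r x"
  using int_pow_cong[OF residue_add[OF assms(1,2)] assms(3)] assms(3)
  by (simp add: act_def add.int_pow_mult)

lemma act_mult:
  assumes "p_integral p q" "p_integral p r" "x \<in> carrier A"
  shows "act (q * r) x = act q (act r x)"
  using int_pow_cong[OF residue_mult[OF assms(1,2)] assms(3)] assms(3)
  by (simp add: act_def add.int_pow_pow mult.commute)

lemma act_of_int: "x \<in> carrier A \<Longrightarrow> act (of_int k) x = [k] \<cdot> x"
  unfolding act_def by (rule int_pow_cong[OF residue_of_int])

lemma act_0: "x \<in> carrier A \<Longrightarrow> act 0 x = \<zero>" and act_1: "x \<in> carrier A \<Longrightarrow> act 1 x = x"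
  and act_minus_1: "x \<in> carrier A \<Longrightarrow> act (-1) x = \<ominus> x"
  using act_of_int[of x 0] act_of_int[of x 1] act_of_int[of x "-1"]
  by (simp_all add: add.int_pow_neg) (simp add: add_pow_def)

lemma act_distrib: "x \<in> carrier A \<Longrightarrow> y \<in> carrier A \<Longrightarrow> act q (x \<oplus> y) = act q x \<oplus> act q y"
  by (simp add: act_def add.int_pow_distrib)

lemma act_zero [simp]: "act q \<zero> = \<zero>"
  by (simp add: act_def add.int_pow_one)

lemma mult_act: "x \<in> carrier A \<Longrightarrow> y \<in> carrier A \<Longrightarrow> x \<otimes> act q y = act q (x \<otimes> y)"
  by (simp add: act_def add_pow_rdistr_int)

lemma act_mult_left: "x \<in> carrier A \<Longrightarrow> y \<in> carrier A \<Longrightarrow> act q x \<otimes> y = act q (x \<otimes> y)"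
  by (simp add: act_def add_pow_ldistr_int)

definition rexp :: "nat \<Rightarrow> 'a \<Rightarrow> 'a" where
  "rexp h z = (\<Oplus>k\<in>{..h}. act (1 / fact k) (z [^] k))"

end

text \<open>The chain \<open>I\<close> expresses nilpotency: a word of length \<open>k\<close> in
  \<open>x\<close> and \<open>y\<close> lies in \<open>I k\<close>, so words longer than
  \<open>h\<close> vanish. It starts with the whole ring because the ring has a unit, and the
  conditions are one-sided because the Horner scheme multiplies by \<open>x\<close> and
  \<open>y\<close> from the left.\<close>

locale nilpotent_pair = torsion_ring +
  fixes x y :: 'a and I :: "nat \<Rightarrow> 'a set" and h :: nat
  assumes x [simp]: "x \<in> carrier A" and y [simp]: "y \<in> carrier A"
    and I_sub: "additive_subgroup (I k) A"
    and I_0: "I 0 = carrier A"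
    and I_x: "z \<in> I k \<Longrightarrow> x \<otimes> z \<in> I (Suc k)" and I_y: "z \<in> I k \<Longrightarrow> y \<otimes> z \<in> I (Suc k)"
    and I_Suc: "I (Suc k) \<subseteq> I k"
    and I_h: "I (Suc h) = {\<zero>}" and h: "int h < p"
begin

text \<open>Evaluation of the terms of degree less than \<open>k\<close> at \<open>(x, y)\<close>; the letters are \<open>True\<close> and \<open>False\<close>.\<close>

fun ev :: "nat \<Rightarrow> bool ncs \<Rightarrow> 'a" where
  "ev 0 u = \<zero>"
| "ev (Suc k) u = act (wcoeff u []) \<one> \<oplus> (x \<otimes> ev k (der True u) \<oplus> y \<otimes> ev k (der False u))"

definition integral :: "nat \<Rightarrow> bool ncs \<Rightarrow> bool" where
  "integral k u \<longleftrightarrow> (\<forall>w. length w < k \<longrightarrow> p_integral p (wcoeff u w))"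

lemma minus_eqI:
  "s = g \<oplus> t \<Longrightarrow> g \<in> carrier A \<Longrightarrow> t \<in> carrier A \<Longrightarrow> s \<ominus> t = g"
  by (simp add: minus_eq a_assoc r_neg)

lemma I_closed: "z \<in> I k \<Longrightarrow> z \<in> carrier A"
  using additive_subgroup.a_subset[OF I_sub] by auto

lemma I_add: "z \<in> I k \<Longrightarrow> z' \<in> I k \<Longrightarrow> z \<oplus> z' \<in> I k"
  by (rule additive_subgroup.a_closed[OF I_sub])

lemma I_zero [simp]: "\<zero> \<in> I k"
  by (rule additive_subgroup.zero_closed[OF I_sub])

lemma I_act: "z \<in> I k \<Longrightarrow> act q z \<in> I k"
  unfolding act_def add_pow_def
  by (rule group.subgroup_int_pow_closed[OF a_group additive_subgroup.a_subgroup[OF I_sub]])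

lemma ev_closed [simp]: "ev k u \<in> carrier A"
  by (induction k arbitrary: u) auto

lemma ev_cong: "(\<And>w. length w < k \<Longrightarrow> wcoeff u w = wcoeff v w) \<Longrightarrow> ev k u = ev k v"
proof (induction k arbitrary: u v)
  case (Suc k)
  have "ev k (der c u) = ev k (der c v)" for c
    by (rule Suc.IH) (simp add: Suc.prems)
  then show ?case using Suc.prems[of "[]"] by simp
qed simp

lemma integral_der: "integral (Suc k) u \<Longrightarrow> integral k (der c u)"
  by (simp add: integral_def)

lemma integral_Suc: "integral (Suc k) u \<Longrightarrow> integral k u"
  by (simp add: integral_def)

lemma integral_add: "integral k u \<Longrightarrow> integral k v \<Longrightarrow> integral k (u + v)"
  by (simp add: integral_def p_integral_add)

lemma integral_smul: "p_integral p q \<Longrightarrow> integral k u \<Longrightarrow> integral k (smul q u)"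
  by (simp add: integral_def p_integral_mult)

lemma integral_mult: "integral k u \<Longrightarrow> integral k v \<Longrightarrow> integral k (u * v)"
  unfolding integral_def wcoeff_mult by (auto intro!: p_integral_sum p_integral_mult)

lemma integral_0 [simp]: "integral k 0" and integral_1 [simp]: "integral k 1"
  by (auto simp: integral_def wcoeff_one)

lemma integral_power: "integral k u \<Longrightarrow> integral k (u ^ j)"
  by (induction j) (auto intro: integral_mult)

lemma integral_letter: "integral k (letter c)"
  by (auto simp: integral_def wcoeff_letter)

lemma integral_uminus: "integral k u \<Longrightarrow> integral k (- u)"
  using integral_smul[OF p_integral_of_int[of "-1"], of k u]
  by (simp add: smul_def uminus_ncs_def)

lemma integral_ad: "integral k u \<Longrightarrow> integral k v \<Longrightarrow> integral k (ad u v)"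
  using integral_add[OF _ integral_uminus] integral_mult by (simp add: ad_def)

lemma integral_sum: "(\<And>i. i \<in> S \<Longrightarrow> integral k (f i)) \<Longrightarrow> integral k (sum f S)"
  by (induction S rule: infinite_finite_induct) (auto intro: integral_add)

lemma integral_nested_bracket:
  "integral k (nested_bracket ncs_lie (map (\<lambda>c. letter c) cs))"
  by (induction cs rule: induct_list012) (auto simp: ncs_lie_def integral_letter integral_ad)

lemma ev_zero [simp]: "ev k 0 = \<zero>"
  by (induction k) (auto simp: der_simps act_0)

lemma ev_add: "integral k u \<Longrightarrow> integral k v \<Longrightarrow> ev k (u + v) = ev k u \<oplus> ev k v"
proof (induction k arbitrary: u v)
  case (Suc k)
  have "p_integral p (wcoeff u [])" "p_integral p (wcoeff v [])"
    using Suc.prems by (auto simp: integral_def)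
  then show ?case using Suc.IH[OF integral_der integral_der, OF Suc.prems]
    by (simp add: der_simps act_add r_distr a_ac)
qed simp

lemma ev_smul: "p_integral p q \<Longrightarrow> integral k u \<Longrightarrow> ev k (smul q u) = act q (ev k u)"
proof (induction k arbitrary: u)
  case (Suc k)
  have "p_integral p (wcoeff u [])" using Suc.prems by (auto simp: integral_def)
  then show ?case using Suc.IH[OF Suc.prems(1) integral_der, OF Suc.prems(2)] Suc.prems(1)
    by (simp add: der_simps act_mult act_distrib mult_act)
qed simp

lemma ev_sum:
  assumes "finite S" "\<And>i. i \<in> S \<Longrightarrow> integral k (f i)"
  shows "ev k (sum f S) = (\<Oplus>i\<in>S. ev k (f i))"
  using assms by (induction S) (auto simp: ev_add integral_sum finsum_insert)

lemma ev_left_I: "z \<in> I j \<Longrightarrow> ev k u \<otimes> z \<in> I j"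
proof (induction k arbitrary: u)
  case 0
  then show ?case using I_closed by simp
next
  case (Suc k)
  have zc: "z \<in> carrier A" using Suc.prems by (rule I_closed)
  have "x \<otimes> (ev k (der True u) \<otimes> z) \<in> I j" "y \<otimes> (ev k (der False u) \<otimes> z) \<in> I j"
    using Suc I_x I_y I_Suc by blast+
  then show ?case using zc I_act[OF Suc.prems]
    by (simp add: l_distr act_mult_left m_assoc I_add)
qed

lemma ev_Suc_diff: "ev (Suc k) u \<ominus> ev k u \<in> I k"
proof (induction k arbitrary: u)
  case 0
  then show ?case using I_0 by (simp del: ev.simps(2))
next
  case (Suc k)
  let ?d = "\<lambda>c. ev (Suc k) (der c u) \<ominus> ev k (der c u)"
  have "x \<otimes> ?d True \<oplus> y \<otimes> ?d False \<in> I (Suc k)"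
    by (intro I_add I_x I_y Suc)
  moreover have "ev (Suc (Suc k)) u \<ominus> ev (Suc k) u = x \<otimes> ?d True \<oplus> y \<otimes> ?d False"
    by (simp only: ev.simps(2)[of "Suc k" u] ev.simps(2)[of k u])
      (simp add: minus_eq r_distr r_minus minus_add a_ac r_neg1 r_neg2 del: ev.simps)
  ultimately show ?case by simp
qed

text \<open>The product of the truncated values contains, besides the words of length below
  \<open>k\<close>, only longer ones, and these lie in \<open>I k\<close>. For
  \<open>k = h + 1\<close> this subgroup is zero, so that evaluation becomes multiplicative.\<close>

lemma ev_mult_mod:
  "integral k u \<Longrightarrow> integral k v \<Longrightarrow> ev k (u * v) \<ominus> ev k u \<otimes> ev k v \<in> I k"
proof (induction k arbitrary: u)
  case 0
  then show ?case using I_0 by simp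
next
  case (Suc k)
  let ?u = "\<lambda>c. der c u" and ?v = "\<lambda>c. der c v"
  let ?r = "wcoeff u []"
  have r: "p_integral p ?r" using Suc.prems(1) by (auto simp: integral_def)
  define e where "e c = ev k (?u c * v) \<ominus> ev k (?u c) \<otimes> ev k v" for c
  define f where "f = ev k v \<ominus> ev (Suc k) v"
  have e: "e c \<in> I k" for c
    unfolding e_def by (rule Suc.IH) (use Suc.prems in \<open>auto intro: integral_der integral_Suc\<close>)
  have f: "f \<in> I k"
  proof -
    have "f = \<ominus> (ev (Suc k) v \<ominus> ev k v)"
      unfolding f_def by (simp add: minus_eq minus_add a_comm del: ev.simps)
    then show ?thesis using ev_Suc_diff[of k v] additive_subgroup.a_inv_closed[OF I_sub] by simp
  qed
  have [simp]: "e c \<in> carrier A" "f \<in> carrier A" for c using e f I_closed by auto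
  have E: "ev k (?u c * v) = e c \<oplus> ev k (?u c) \<otimes> f \<oplus> ev k (?u c) \<otimes> ev (Suc k) v" for c
    by (simp add: e_def f_def minus_eq r_distr r_minus a_assoc l_neg del: ev.simps)
  \<comment> \<open>\<open>g c\<close> collects the error from the induction hypothesis and the one
    from replacing \<open>ev k v\<close> by \<open>ev (Suc k) v\<close>. Multiplication by
    \<open>x\<close> or \<open>y\<close> then lifts it from \<open>I k\<close> to
    \<open>I (Suc k)\<close>.\<close>
  define g where "g c = e c \<oplus> ev k (?u c) \<otimes> f" for c
  have g: "g c \<in> I k" for c unfolding g_def by (intro I_add e ev_left_I f)
  have [simp]: "g c \<in> carrier A" for c using g I_closed by auto
  have D: "ev k (der c (u * v)) = g c \<oplus> ev k (?u c) \<otimes> ev (Suc k) v \<oplus> act ?r (ev k (?v c))" for c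
  proof -
    have "integral k (?u c * v)" "integral k (smul ?r (?v c))"
      using Suc.prems r by (auto intro!: integral_mult integral_smul intro: integral_der integral_Suc)
    then show ?thesis
      unfolding der_mult using r Suc.prems(2)
      by (simp add: ev_add ev_smul integral_der E g_def del: ev.simps)
  qed
  have "ev (Suc k) u \<otimes> ev (Suc k) v =
      act ?r (ev (Suc k) v) \<oplus> (x \<otimes> (ev k (?u True) \<otimes> ev (Suc k) v) \<oplus> y \<otimes> (ev k (?u False) \<otimes> ev (Suc k) v))"
    by (simp only: ev.simps(2)[of k u]) (simp add: l_distr act_mult_left m_assoc del: ev.simps)
  moreover have "act ?r (ev (Suc k) v) = act (wcoeff (u * v) []) \<one> \<oplus>
      (x \<otimes> act ?r (ev k (?v True)) \<oplus> y \<otimes> act ?r (ev k (?v False)))"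
  proof -
    have "p_integral p (wcoeff v [])" using Suc.prems(2) by (auto simp: integral_def)
    then show ?thesis using r by (simp add: act_distrib mult_act wcoeff_mult act_mult)
  qed
  ultimately have "ev (Suc k) (u * v) \<ominus> ev (Suc k) u \<otimes> ev (Suc k) v = x \<otimes> g True \<oplus> y \<otimes> g False"
    by (simp only: ev.simps(2)[of k "u * v"] D)
      (rule minus_eqI, simp_all add: r_distr a_ac del: ev.simps)
  then show ?case using I_x[OF g] I_y[OF g] I_add by simp
qed

abbreviation "evh \<equiv> ev (Suc h)"

lemma ev_mult: "integral (Suc h) u \<Longrightarrow> integral (Suc h) v \<Longrightarrow> evh (u * v) = evh u \<otimes> evh v"
  using ev_mult_mod[of "Suc h" u v] I_h by (simp del: ev.simps)

lemma ev_one: "evh 1 = \<one>"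
  by (simp add: der_simps wcoeff_one act_1)

lemma ev_power: "integral (Suc h) u \<Longrightarrow> evh (u ^ k) = evh u [^] k"
proof (induction k)
  case (Suc k)
  have "evh (u ^ k * u) = evh (u ^ k) \<otimes> evh u"
    by (rule ev_mult) (use Suc.prems in \<open>auto intro: integral_power\<close>)
  then show ?case using Suc by (simp add: power_commutes del: ev.simps)
qed (simp add: ev_one del: ev.simps)

text \<open>For \<open>h = 0\<close> only constant terms are evaluated and letters are sent to zero;
  this is still right because \<open>I 1\<close> is zero then, which forces \<open>x\<close> and
  \<open>y\<close> to vanish.\<close>

lemma ev_letter: "evh (letter c) = (if c then x else y)"
proof (cases h)
  case 0
  have "x \<otimes> \<one> \<in> I 1" "y \<otimes> \<one> \<in> I 1" using I_x[of \<one> 0] I_y[of \<one> 0] I_0 by auto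
  then have "x = \<zero>" "y = \<zero>" using I_h 0 by auto
  moreover have "evh (letter c) = \<zero>" using 0 by (simp add: wcoeff_letter act_0)
  ultimately show ?thesis by simp
next
  case (Suc k)
  have "der c' (letter c) = (if c' = c then 1 else 0)" for c'
    by (rule ncs_eqI) (simp add: wcoeff_letter wcoeff_one)
  then show ?thesis using Suc by (cases c) (simp_all add: wcoeff_letter act_0 act_1 der_simps wcoeff_one)
qed

lemma ev_ncexp:
  assumes u: "vanish 1 u" and i: "integral (Suc h) u"
  shows "evh (ncexp u) = rexp h (evh u)" "integral (Suc h) (ncexp u)"
proof -
  let ?s = "\<Sum>k\<le>h. smul (1 / fact k) (u ^ k)"
  have pf: "p_integral p (1 / fact k)" if "k \<le> h" for k
    using that h by (intro p_integral_inverse_fact) auto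
  have eq: "wcoeff (ncexp u) w = wcoeff ?s w" if "length w < Suc h" for w
    using that by (simp add: ncexp_def op_series_trunc[OF raising_mult[OF u], of w h] funpow_mult)
  then have "evh (ncexp u) = evh ?s" by (intro ev_cong) auto
  also have "\<dots> = (\<Oplus>k\<in>{..h}. evh (smul (1 / fact k) (u ^ k)))"
    by (rule ev_sum) (auto intro!: integral_smul integral_power pf i)
  also have "\<dots> = rexp h (evh u)"
    unfolding rexp_def
    by (intro finsum_cong' refl) (auto simp: ev_smul pf integral_power i ev_power simp del: ev.simps)
  finally show "evh (ncexp u) = rexp h (evh u)" .
  have "integral (Suc h) ?s" by (auto intro!: integral_sum integral_smul integral_power pf i)
  then show "integral (Suc h) (ncexp u)" using eq by (simp add: integral_def)
qed

lemma ev_nested_bracket: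
  "evh (nested_bracket ncs_lie (map (\<lambda>c. letter c) cs)) =
    nested_bracket (commutator_lie A) (map (\<lambda>c. if c then x else y) cs)"
proof (induction cs rule: induct_list012)
  case (3 c d cs)
  let ?v = "nested_bracket ncs_lie (map (\<lambda>c. letter c) (d # cs))"
  have i: "integral (Suc h) (letter c)" "integral (Suc h) ?v"
    using integral_letter integral_nested_bracket by blast+
  have "evh (letter c * ?v - ?v * letter c) = evh (letter c * ?v + smul (-1) (?v * letter c))"
    by (rule ev_cong) simp
  also have "\<dots> = evh (letter c) \<otimes> evh ?v \<ominus> evh ?v \<otimes> evh (letter c)"
    using i p_integral_of_int[of "-1"]
    by (simp add: ev_add ev_smul integral_mult integral_smul ev_mult act_minus_1 minus_eq del: ev.simps)
  finally have "evh (letter c * ?v - ?v * letter c) = evh (letter c) \<otimes> evh ?v \<ominus> evh ?v \<otimes> evh (letter c)" .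
  moreover have "nested_bracket ncs_lie (map (\<lambda>c. letter c) (c # d # cs)) = letter c * ?v - ?v * letter c"
    by (simp add: ncs_lie_def ad_def)
  ultimately show ?case using 3(2)
    by (simp only: ev_letter) (simp add: commutator_lie_def del: ev.simps)
qed (auto simp: ncs_lie_def commutator_lie_def ev_letter simp del: ev.simps)

lemma dynkin_word_map: "dynkin_word (f a) (f b) ws = map f (dynkin_word a b ws)"
  by (induction ws) (auto simp: dynkin_word_def)

text \<open>Up to degree \<open>h\<close> the logarithm \<open>Z\<close> agrees with Dynkin's sum,
  so its coefficients there are \<open>p\<close>-integral and it can be evaluated. Evaluation
  commutes with products and exponentials and carries \<open>e^Z = e^X e^Y\<close> into the
  ring.\<close>

theorem rexp_dynkin:
  "rexp h (\<Oplus>ws\<in>dynkin_index h. act (dynkin_coeff ws)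
      (nested_bracket (commutator_lie A) (dynkin_word x y ws))) = rexp h x \<otimes> rexp h y"
proof -
  let ?nb = "\<lambda>ws. nested_bracket ncs_lie (dynkin_word (letter True) (letter False) ws)"
  let ?s = "\<Sum>ws\<in>dynkin_index h. smul (dynkin_coeff ws) (?nb ws)"
  let ?z = "nclog True False"
  have pd: "p_integral p (dynkin_coeff ws)" if "ws \<in> dynkin_index h" for ws
    by (rule p_integral_dynkin_coeff[OF that h])
  have inb: "integral k (?nb ws)" for k ws
    unfolding dynkin_word_map by (rule integral_nested_bracket)
  have eq: "wcoeff ?z w = wcoeff ?s w" if "length w < Suc h" for w
    using that wcoeff_nclog[of w h True False] by simp
  have "integral (Suc h) ?s" by (auto intro!: integral_sum integral_smul pd inb)
  then have iZ: "integral (Suc h) ?z" using eq by (simp add: integral_def)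
  have "evh ?z = evh ?s" using eq by (intro ev_cong) auto
  also have "\<dots> = (\<Oplus>ws\<in>dynkin_index h. evh (smul (dynkin_coeff ws) (?nb ws)))"
    by (rule ev_sum) (auto intro!: integral_smul pd inb)
  also have "\<dots> = (\<Oplus>ws\<in>dynkin_index h. act (dynkin_coeff ws)
      (nested_bracket (commutator_lie A) (dynkin_word x y ws)))"
  proof (intro finsum_cong' refl)
    have nb: "evh (?nb ws) = nested_bracket (commutator_lie A) (dynkin_word x y ws)" for ws
      unfolding dynkin_word_map ev_nested_bracket
      using dynkin_word_map[of "\<lambda>c. if c then x else y" True False ws] by simp
    show "(\<lambda>ws. act (dynkin_coeff ws) (nested_bracket (commutator_lie A) (dynkin_word x y ws))) \<in> dynkin_index h \<rightarrow> carrier A"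
      unfolding nb[symmetric] by (auto simp del: ev.simps)
    show "evh (smul (dynkin_coeff ws) (?nb ws)) = act (dynkin_coeff ws) (nested_bracket (commutator_lie A) (dynkin_word x y ws))"
      if "ws \<in> dynkin_index h" for ws
      using that by (simp add: ev_smul pd inb nb del: ev.simps)
  qed
  finally have "rexp h (\<Oplus>ws\<in>dynkin_index h. act (dynkin_coeff ws)
      (nested_bracket (commutator_lie A) (dynkin_word x y ws))) = evh (ncexp ?z)"
    using ev_ncexp(1)[OF vanish_nclog iZ] by simp
  also have "\<dots> = evh (ncexp (letter True)) \<otimes> evh (ncexp (letter False))"
    unfolding ncexp_nclog
    by (intro ev_mult ev_ncexp(2) vanish_letter integral_letter)
  also have "\<dots> = rexp h x \<otimes> rexp h y"
    by (simp add: ev_ncexp(1)[OF vanish_letter integral_letter] ev_letter del: ev.simps)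
  finally show ?thesis .
qed

end

lemma (in abelian_monoid) finsum_swap:
  assumes "finite S" "finite T" "\<And>i j. i \<in> S \<Longrightarrow> j \<in> T \<Longrightarrow> f i j \<in> carrier G"
  shows "(\<Oplus>i\<in>S. \<Oplus>j\<in>T. f i j) = (\<Oplus>j\<in>T. \<Oplus>i\<in>S. f i j)"
  using assms(1,3)
proof (induction S)
  case (insert s S)
  have "(\<Oplus>i\<in>insert s S. \<Oplus>j\<in>T. f i j) = (\<Oplus>j\<in>T. f s j) \<oplus> (\<Oplus>j\<in>T. \<Oplus>i\<in>S. f i j)"
    using insert by (subst finsum_insert) auto
  also have "\<dots> = (\<Oplus>j\<in>T. f s j \<oplus> (\<Oplus>i\<in>S. f i j))"
    using insert by (intro finsum_addf[symmetric]) auto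
  also have "\<dots> = (\<Oplus>j\<in>T. \<Oplus>i\<in>insert s S. f i j)"
    using insert by (intro finsum_cong') auto
  finally show ?case .
qed simp

section \<open>Incidence rings\<close>

text \<open>Matrices are functions on all pairs of naturals, forced to be zero off the reflexive
  order: equality of matrices is then equality of functions, and the diagonal positions provide the
  unit.\<close>

definition incidence_ring ::
  "('r, 'k) ring_scheme \<Rightarrow> nat \<Rightarrow> nat rel \<Rightarrow> (nat \<Rightarrow> nat \<Rightarrow> 'r) ring" where
  "incidence_ring R n prec = \<lparr>carrier = {M. (\<forall>i j. M i j \<in> carrier R) \<and>
      (\<forall>i j. (i, j) \<notin> prec \<union> Id_on {1..n} \<longrightarrow> M i j = \<zero>\<^bsub>R\<^esub>)},
    monoid.mult = (\<lambda>M N i j. \<Oplus>\<^bsub>R\<^esub>k\<in>{1..n}. M i k \<otimes>\<^bsub>R\<^esub> N k j),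
    one = (\<lambda>i j. if i = j \<and> i \<in> {1..n} then \<one>\<^bsub>R\<^esub> else \<zero>\<^bsub>R\<^esub>),
    ring.zero = (\<lambda>i j. \<zero>\<^bsub>R\<^esub>), ring.add = (\<lambda>M N i j. M i j \<oplus>\<^bsub>R\<^esub> N i j)\<rparr>"

lemma (in cring) finsum_delta:
  assumes "finite S" "\<And>i. i \<in> S \<Longrightarrow> f i \<in> carrier R" "\<And>i. i \<in> S \<Longrightarrow> i \<noteq> k \<Longrightarrow> f i = \<zero>"
  shows "finsum R f S = (if k \<in> S then f k else \<zero>)"
proof (cases "k \<in> S")
  case True
  have "finsum R f S = (\<Oplus>i\<in>S. if k = i then f i else \<zero>)"
    using assms by (intro finsum_cong') auto
  also have "\<dots> = f k" using assms True by (intro finsum_singleton) auto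
  finally show ?thesis using True by simp
next
  case False
  have "finsum R f S = (\<Oplus>i\<in>S. \<zero>)" using assms False by (intro finsum_cong') auto
  then show ?thesis using False by simp
qed

locale incidence = cring R for R (structure) + fixes n :: nat and prec :: "nat rel"
  assumes order: "strict_order_on_upto n prec"
begin

abbreviation "U \<equiv> incidence_ring R n prec"

lemma prec_trans: "(i, j) \<in> prec \<Longrightarrow> (j, k) \<in> prec \<Longrightarrow> (i, k) \<in> prec"
  using order by (auto simp: strict_order_on_upto_def dest: transD)

lemma prec_irrefl: "(i, i) \<notin> prec"
  using order by (auto simp: strict_order_on_upto_def irrefl_def)

lemma prec_range: "(i, j) \<in> prec \<Longrightarrow> i \<in> {1..n} \<and> j \<in> {1..n}"
  using order by (auto simp: strict_order_on_upto_def)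

lemma finite_prec: "finite prec"
  using order by (auto simp: strict_order_on_upto_def intro: finite_subset)

abbreviation "preceq \<equiv> prec \<union> Id_on {1..n}"

lemma preceq_trans: "(i, j) \<in> preceq \<Longrightarrow> (j, k) \<in> preceq \<Longrightarrow> (i, k) \<in> preceq"
  using prec_trans by blast

lemma U_entry: "M \<in> carrier U \<Longrightarrow> M i j \<in> carrier R"
  by (simp add: incidence_ring_def)

lemma U_zero_entry: "M \<in> carrier U \<Longrightarrow> (i, j) \<notin> preceq \<Longrightarrow> M i j = \<zero>"
  by (auto simp: incidence_ring_def)

lemma U_carrierI:
  "(\<And>i j. M i j \<in> carrier R) \<Longrightarrow> (\<And>i j. (i, j) \<notin> preceq \<Longrightarrow> M i j = \<zero>) \<Longrightarrow> M \<in> carrier U"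
  by (auto simp: incidence_ring_def)

lemma U_mult: "M \<otimes>\<^bsub>U\<^esub> N = (\<lambda>i j. \<Oplus>k\<in>{1..n}. M i k \<otimes> N k j)"
  and U_add: "M \<oplus>\<^bsub>U\<^esub> N = (\<lambda>i j. M i j \<oplus> N i j)"
  and U_one: "\<one>\<^bsub>U\<^esub> = (\<lambda>i j. if i = j \<and> i \<in> {1..n} then \<one> else \<zero>)"
  and U_zero: "\<zero>\<^bsub>U\<^esub> = (\<lambda>i j. \<zero>)"
  by (simp_all add: incidence_ring_def)

declare U_entry [simp]

lemma U_mult_closed: "M \<in> carrier U \<Longrightarrow> N \<in> carrier U \<Longrightarrow> M \<otimes>\<^bsub>U\<^esub> N \<in> carrier U"
proof (rule U_carrierI)
  assume *: "M \<in> carrier U" "N \<in> carrier U"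
  show "(M \<otimes>\<^bsub>U\<^esub> N) i j \<in> carrier R" for i j using * by (auto simp: U_mult)
  fix i j assume ij: "(i, j) \<notin> preceq"
  have "M i k \<otimes> N k j = \<zero>" for k
  proof -
    have "M i k = \<zero> \<or> N k j = \<zero>"
      using U_zero_entry[OF *(1)] U_zero_entry[OF *(2)] preceq_trans ij by blast
    then show ?thesis using * by auto
  qed
  then show "(M \<otimes>\<^bsub>U\<^esub> N) i j = \<zero>" by (simp add: U_mult)
qed

lemma U_uminus_closed:
  assumes "M \<in> carrier U"
  shows "(\<lambda>i j. \<ominus> M i j) \<in> carrier U"
proof (rule U_carrierI)
  show "\<ominus> M i j = \<zero>" if "(i, j) \<notin> preceq" for i j
    using U_zero_entry[OF assms that] by simp
qed (use assms in simp)

lemma U_add_closed: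
  assumes "M \<in> carrier U" "N \<in> carrier U"
  shows "M \<oplus>\<^bsub>U\<^esub> N \<in> carrier U"
proof (rule U_carrierI)
  show "(M \<oplus>\<^bsub>U\<^esub> N) i j = \<zero>" if "(i, j) \<notin> preceq" for i j
    using U_zero_entry[OF assms(1) that] U_zero_entry[OF assms(2) that] by (simp add: U_add)
qed (use assms in \<open>simp add: U_add\<close>)

lemma U_ring: "ring U"
proof (rule ringI)
  show "abelian_group U"
  proof (rule abelian_groupI)
    fix M assume M: "M \<in> carrier U"
    show "\<exists>N\<in>carrier U. N \<oplus>\<^bsub>U\<^esub> M = \<zero>\<^bsub>U\<^esub>"
      by (rule bexI[of _ "\<lambda>i j. \<ominus> M i j"])
        (use M U_uminus_closed[OF M] in \<open>auto simp: U_add U_zero l_neg\<close>)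
    show "M \<oplus>\<^bsub>U\<^esub> N \<in> carrier U" if "N \<in> carrier U" for N using M that by (rule U_add_closed)
  qed (auto simp: U_add U_zero a_ac intro!: U_carrierI)
  show "monoid U"
  proof (rule monoidI)
    fix M N P assume *: "M \<in> carrier U" "N \<in> carrier U" "P \<in> carrier U"
    show "M \<otimes>\<^bsub>U\<^esub> N \<in> carrier U" using * by (simp add: U_mult_closed)
    show "M \<otimes>\<^bsub>U\<^esub> N \<otimes>\<^bsub>U\<^esub> P = M \<otimes>\<^bsub>U\<^esub> (N \<otimes>\<^bsub>U\<^esub> P)"
    proof (intro ext)
      fix i j
      have "(M \<otimes>\<^bsub>U\<^esub> N \<otimes>\<^bsub>U\<^esub> P) i j = (\<Oplus>k\<in>{1..n}. \<Oplus>l\<in>{1..n}. M i l \<otimes> N l k \<otimes> P k j)"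
        unfolding U_mult using * by (intro finsum_cong' refl) (auto simp: finsum_ldistr)
      also have "\<dots> = (\<Oplus>l\<in>{1..n}. \<Oplus>k\<in>{1..n}. M i l \<otimes> N l k \<otimes> P k j)"
        using * by (intro finsum_swap) auto
      also have "\<dots> = (M \<otimes>\<^bsub>U\<^esub> (N \<otimes>\<^bsub>U\<^esub> P)) i j"
        unfolding U_mult using * by (intro finsum_cong' refl) (auto simp: finsum_rdistr m_assoc)
      finally show "(M \<otimes>\<^bsub>U\<^esub> N \<otimes>\<^bsub>U\<^esub> P) i j = (M \<otimes>\<^bsub>U\<^esub> (N \<otimes>\<^bsub>U\<^esub> P)) i j" .
    qed
  next
    fix M assume M: "M \<in> carrier U"
    have *: "(i, j) \<in> preceq \<Longrightarrow> i \<in> {1..n} \<and> j \<in> {1..n}" for i j using prec_range by auto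
    show "\<one>\<^bsub>U\<^esub> \<otimes>\<^bsub>U\<^esub> M = M"
    proof (intro ext)
      fix i j
      have "(\<one>\<^bsub>U\<^esub> \<otimes>\<^bsub>U\<^esub> M) i j = (if i \<in> {1..n} then M i j else \<zero>)"
        unfolding U_mult U_one using M by (subst finsum_delta[where k = i]) auto
      then show "(\<one>\<^bsub>U\<^esub> \<otimes>\<^bsub>U\<^esub> M) i j = M i j" using U_zero_entry[OF M] * by metis
    qed
    show "M \<otimes>\<^bsub>U\<^esub> \<one>\<^bsub>U\<^esub> = M"
    proof (intro ext)
      fix i j
      have "(M \<otimes>\<^bsub>U\<^esub> \<one>\<^bsub>U\<^esub>) i j = (if j \<in> {1..n} then M i j else \<zero>)"
        unfolding U_mult U_one using M by (subst finsum_delta[where k = j]) auto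
      then show "(M \<otimes>\<^bsub>U\<^esub> \<one>\<^bsub>U\<^esub>) i j = M i j" using U_zero_entry[OF M] * by metis
    qed
  next
    show "\<one>\<^bsub>U\<^esub> \<in> carrier U"
      by (rule U_carrierI) (auto simp: U_one Id_on_def)
  qed
  fix M N P assume *: "M \<in> carrier U" "N \<in> carrier U" "P \<in> carrier U"
  show "(M \<oplus>\<^bsub>U\<^esub> N) \<otimes>\<^bsub>U\<^esub> P = M \<otimes>\<^bsub>U\<^esub> P \<oplus>\<^bsub>U\<^esub> N \<otimes>\<^bsub>U\<^esub> P"
    unfolding U_mult U_add using *
    by (intro ext, subst finsum_addf[symmetric]) (auto simp: l_distr)
  show "P \<otimes>\<^bsub>U\<^esub> (M \<oplus>\<^bsub>U\<^esub> N) = P \<otimes>\<^bsub>U\<^esub> M \<oplus>\<^bsub>U\<^esub> P \<otimes>\<^bsub>U\<^esub> N"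
    unfolding U_mult U_add using *
    by (intro ext, subst finsum_addf[symmetric]) (auto simp: r_distr)
qed

sublocale U: ring U
  by (rule U_ring)

lemma U_uminus: "M \<in> carrier U \<Longrightarrow> \<ominus>\<^bsub>U\<^esub> M = (\<lambda>i j. \<ominus> M i j)"
proof (rule U.minus_equality)
  assume M: "M \<in> carrier U"
  show "(\<lambda>i j. \<ominus> M i j) \<oplus>\<^bsub>U\<^esub> M = \<zero>\<^bsub>U\<^esub>" using M by (simp add: U_add U_zero l_neg)
  show "(\<lambda>i j. \<ominus> M i j) \<in> carrier U" using M by (rule U_uminus_closed)
qed

lemma U_minus: "M \<in> carrier U \<Longrightarrow> N \<in> carrier U \<Longrightarrow> M \<ominus>\<^bsub>U\<^esub> N = (\<lambda>i j. M i j \<ominus> N i j)"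
  by (simp add: U.minus_eq U_uminus U_add minus_eq)

lemma U_int_pow: "M \<in> carrier U \<Longrightarrow> add_pow U (k :: int) M i j = [k] \<cdot> M i j"
proof -
  assume M: "M \<in> carrier U"
  have "(\<lambda>M. M i j) \<in> hom (add_monoid U) (add_monoid R)"
    by (auto simp: hom_def U_add)
  from hom_int_pow[OF this _ U.a_group a_group] M show ?thesis by (simp add: add_pow_def)
qed

lemma U_finsum:
  "(\<And>x. x \<in> S \<Longrightarrow> f x \<in> carrier U) \<Longrightarrow> finsum U f S i j = (\<Oplus>x\<in>S. f x i j)"
proof (induction S rule: infinite_finite_induct)
  case (insert x S)
  then show ?case by (subst U.finsum_insert; (subst finsum_insert)?) (auto simp: U_add)
qed (auto simp: U_zero finsum_infinite U.finsum_infinite)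

section \<open>Strictly supported matrices, their filtration and the unipotent group\<close>

definition pat :: "(nat \<Rightarrow> nat \<Rightarrow> 'a) set" where
  "pat = {M \<in> carrier U. \<forall>i j. (i, j) \<notin> prec \<longrightarrow> M i j = \<zero>}"

text \<open>Depth is measured by \<open>alpha\<close>, the number of points strictly between two
  indices, instead of by lengths of chains. This is the quantity in which the bound on
  \<open>p\<close> is expressed.\<close>

definition J :: "nat \<Rightarrow> (nat \<Rightarrow> nat \<Rightarrow> 'a) set" where
  "J m = {M \<in> pat. \<forall>i j. (i, j) \<in> prec \<longrightarrow> alpha n prec i j < m \<longrightarrow> M i j = \<zero>}"

text \<open>The point \<open>k\<close> lies between \<open>i\<close> and \<open>j\<close> but
  neither between \<open>k\<close> and \<open>j\<close> nor between \<open>i\<close> and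
  \<open>k\<close>, and by transitivity both smaller intervals are contained in the larger
  one.\<close>

lemma alpha_mono:
  assumes "(i, k) \<in> prec" "(k, j) \<in> prec"
  shows "alpha n prec k j < alpha n prec i j" "alpha n prec i k < alpha n prec i j"
proof -
  let ?S = "\<lambda>i j. {k \<in> {1..n}. (i, k) \<in> prec \<and> (k, j) \<in> prec}"
  have "k \<in> ?S i j" "k \<notin> ?S k j" "k \<notin> ?S i k"
    using assms prec_irrefl prec_range[OF assms(1)] by auto
  moreover have "?S k j \<subseteq> ?S i j" "?S i k \<subseteq> ?S i j"
    using assms prec_trans by blast+
  ultimately have "?S k j \<subset> ?S i j" "?S i k \<subset> ?S i j" by blast+
  then show "alpha n prec k j < alpha n prec i j" "alpha n prec i k < alpha n prec i j"
    unfolding alpha_def by (auto intro!: psubset_card_mono)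
qed

lemma alpha_le_max: "(i, j) \<in> prec \<Longrightarrow> alpha n prec i j \<le> max_alpha n prec"
proof -
  assume "(i, j) \<in> prec"
  moreover have "{alpha n prec i j |i j. (i, j) \<in> prec} = (\<lambda>(i, j). alpha n prec i j) ` prec" by auto
  ultimately show ?thesis unfolding max_alpha_def using finite_prec by (intro Max_ge) auto
qed

lemma pat_U: "M \<in> pat \<Longrightarrow> M \<in> carrier U"
  by (simp add: pat_def)

lemma pat_zero: "M \<in> pat \<Longrightarrow> (i, j) \<notin> prec \<Longrightarrow> M i j = \<zero>"
  unfolding pat_def by blast

lemma patI: "(\<And>i j. M i j \<in> carrier R) \<Longrightarrow> (\<And>i j. (i, j) \<notin> prec \<Longrightarrow> M i j = \<zero>) \<Longrightarrow> M \<in> pat"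
  unfolding pat_def using U_carrierI[of M] by blast

declare pat_U [simp]

lemma JI: "M \<in> pat \<Longrightarrow> (\<And>i j. (i, j) \<in> prec \<Longrightarrow> alpha n prec i j < m \<Longrightarrow> M i j = \<zero>) \<Longrightarrow> M \<in> J m"
  unfolding J_def by blast

lemma J_0: "J 0 = pat" and J_pat: "M \<in> J m \<Longrightarrow> M \<in> pat" and J_Suc: "J (Suc m) \<subseteq> J m"
  and J_zero: "M \<in> J m \<Longrightarrow> (i, j) \<in> prec \<Longrightarrow> alpha n prec i j < m \<Longrightarrow> M i j = \<zero>"
  by (auto simp: J_def)

lemma J_U [simp]: "M \<in> J m \<Longrightarrow> M \<in> carrier U"
  using J_pat pat_U by blast

lemma J_top: "max_alpha n prec < m \<Longrightarrow> J m = {\<zero>\<^bsub>U\<^esub>}"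
proof -
  assume m: "max_alpha n prec < m"
  have "M = \<zero>\<^bsub>U\<^esub>" if "M \<in> J m" for M
  proof (intro ext)
    fix i j
    show "M i j = \<zero>\<^bsub>U\<^esub> i j"
      using J_zero[OF that, of i j] pat_zero[OF J_pat[OF that], of i j] alpha_le_max[of i j] m
      by (cases "(i, j) \<in> prec") (auto simp: U_zero)
  qed
  moreover have "\<zero>\<^bsub>U\<^esub> \<in> J m" by (auto simp: U_zero intro!: patI JI)
  ultimately show ?thesis by blast
qed

lemma J_subgroup: "additive_subgroup (J m) U"
proof (rule additive_subgroup.intro, rule U.add.subgroupI)
  have "\<zero>\<^bsub>U\<^esub> \<in> J m" by (auto simp: U_zero intro!: patI JI)
  then show "J m \<noteq> {}" by blast
  fix M assume M: "M \<in> J m"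
  then show "\<ominus>\<^bsub>U\<^esub> M \<in> J m"
    using J_pat[OF M] by (auto simp: U_uminus J_zero[OF M] pat_zero intro!: patI JI)
  fix N assume N: "N \<in> J m"
  then show "M \<oplus>\<^bsub>U\<^esub> N \<in> J m"
    using M J_pat[OF M] J_pat[OF N]
    by (auto simp: U_add J_zero[OF M] J_zero[OF N] pat_zero intro!: patI JI)
qed auto

lemma J_add: "M \<in> J m \<Longrightarrow> N \<in> J m \<Longrightarrow> M \<oplus>\<^bsub>U\<^esub> N \<in> J m"
  by (rule additive_subgroup.a_closed[OF J_subgroup])

lemma J_uminus: "M \<in> J m \<Longrightarrow> \<ominus>\<^bsub>U\<^esub> M \<in> J m"
  by (rule additive_subgroup.a_inv_closed[OF J_subgroup])

lemma J_minus: "M \<in> J m \<Longrightarrow> N \<in> J m \<Longrightarrow> M \<ominus>\<^bsub>U\<^esub> N \<in> J m"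
  by (simp add: U.minus_eq J_add J_uminus)

lemma pat_mult_U: "x \<in> pat \<Longrightarrow> z \<in> carrier U \<Longrightarrow> x \<otimes>\<^bsub>U\<^esub> z \<in> pat"
proof (rule patI)
  assume *: "x \<in> pat" "z \<in> carrier U"
  show "(x \<otimes>\<^bsub>U\<^esub> z) i j \<in> carrier R" for i j using * by (auto simp: U_mult)
  fix i j assume ij: "(i, j) \<notin> prec"
  have "x i k \<otimes> z k j = \<zero>" for k
  proof -
    have "x i k = \<zero> \<or> z k j = \<zero>"
      using U_zero_entry[OF *(2)] pat_zero[OF *(1)] prec_trans ij by blast
    then show ?thesis using * by auto
  qed
  then show "(x \<otimes>\<^bsub>U\<^esub> z) i j = \<zero>" by (simp add: U_mult)
qed

lemma J_mult:
  assumes "x \<in> pat" "z \<in> J m"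
  shows "x \<otimes>\<^bsub>U\<^esub> z \<in> J (Suc m)" "z \<otimes>\<^bsub>U\<^esub> x \<in> J (Suc m)"
proof -
  have z: "z \<in> pat" using assms(2) by (rule J_pat)
  have aux: "(M \<otimes>\<^bsub>U\<^esub> N) i j = \<zero>"
    if "M \<in> pat" "N \<in> pat" "(M \<in> J m \<or> N \<in> J m)" "(i, j) \<in> prec" "alpha n prec i j < Suc m" for M N i j
  proof -
    have "M i k \<otimes> N k j = \<zero>" for k
    proof (cases "(i, k) \<in> prec \<and> (k, j) \<in> prec")
      case True
      then have "alpha n prec k j < m" "alpha n prec i k < m"
        using alpha_mono[of i k j] that(5) by auto
      then have "M i k = \<zero> \<or> N k j = \<zero>" using that(3) True J_zero by blast
      then show ?thesis using that(1,2) by auto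
    next
      case False
      then have "M i k = \<zero> \<or> N k j = \<zero>" using pat_zero[OF that(1)] pat_zero[OF that(2)] by blast
      then show ?thesis using that(1,2) by auto
    qed
    then show ?thesis by (simp add: U_mult)
  qed
  have "x \<otimes>\<^bsub>U\<^esub> z \<in> pat" "z \<otimes>\<^bsub>U\<^esub> x \<in> pat" using z assms(1) by (simp_all add: pat_mult_U)
  then show "x \<otimes>\<^bsub>U\<^esub> z \<in> J (Suc m)" "z \<otimes>\<^bsub>U\<^esub> x \<in> J (Suc m)"
    using aux[of x z] aux[of z x] assms z by (auto intro!: JI)
qed

definition unipotent :: "(nat \<Rightarrow> nat \<Rightarrow> 'a) set" where
  "unipotent = {g \<in> carrier U. g \<ominus>\<^bsub>U\<^esub> \<one>\<^bsub>U\<^esub> \<in> pat}"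

lemma unipotentI: "a \<in> pat \<Longrightarrow> \<one>\<^bsub>U\<^esub> \<oplus>\<^bsub>U\<^esub> a \<in> unipotent"
  by (simp add: unipotent_def U.minus_eq U.a_assoc U.a_comm[of "\<one>\<^bsub>U\<^esub>"] U.r_neg)

lemma unipotentE:
  assumes "g \<in> unipotent"
  obtains a where "a \<in> pat" "g = \<one>\<^bsub>U\<^esub> \<oplus>\<^bsub>U\<^esub> a"
proof
  show "g \<ominus>\<^bsub>U\<^esub> \<one>\<^bsub>U\<^esub> \<in> pat" using assms by (simp add: unipotent_def)
  show "g = \<one>\<^bsub>U\<^esub> \<oplus>\<^bsub>U\<^esub> (g \<ominus>\<^bsub>U\<^esub> \<one>\<^bsub>U\<^esub>)"
    using assms by (simp add: unipotent_def U.minus_eq U.a_ac U.r_neg)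
qed

lemma unipotent_U [simp]: "g \<in> unipotent \<Longrightarrow> g \<in> carrier U"
  by (simp add: unipotent_def)

lemma pat_add: "a \<in> pat \<Longrightarrow> b \<in> pat \<Longrightarrow> a \<oplus>\<^bsub>U\<^esub> b \<in> pat"
  using J_add[of a 0 b] by (simp add: J_0)

lemma unipotent_mult: "g \<in> unipotent \<Longrightarrow> g' \<in> unipotent \<Longrightarrow> g \<otimes>\<^bsub>U\<^esub> g' \<in> unipotent"
proof (elim unipotentE)
  fix a b assume *: "a \<in> pat" "g = \<one>\<^bsub>U\<^esub> \<oplus>\<^bsub>U\<^esub> a" "b \<in> pat" "g' = \<one>\<^bsub>U\<^esub> \<oplus>\<^bsub>U\<^esub> b"
  have "g \<otimes>\<^bsub>U\<^esub> g' = \<one>\<^bsub>U\<^esub> \<oplus>\<^bsub>U\<^esub> (a \<oplus>\<^bsub>U\<^esub> b \<oplus>\<^bsub>U\<^esub> a \<otimes>\<^bsub>U\<^esub> b)"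
    using * by (simp add: U.l_distr U.r_distr U.a_ac)
  then show ?thesis using * by (simp only:) (intro unipotentI pat_add pat_mult_U; simp)
qed

lemma unipotent_diag: "g \<in> unipotent \<Longrightarrow> i \<in> {1..n} \<Longrightarrow> g i i = \<one>"
  by (elim unipotentE) (auto simp: U_one U_add pat_zero prec_irrefl)

text \<open>Successive approximation: if \<open>g g' = 1 + e\<close>, then replacing
  \<open>g'\<close> by \<open>g' (1 - e)\<close> changes the error to \<open>- e^2\<close>, at least
  one step deeper in the filtration.\<close>

lemma unipotent_right_inverse:
  assumes "g \<in> unipotent"
  shows "\<exists>g'\<in>unipotent. g \<otimes>\<^bsub>U\<^esub> g' = \<one>\<^bsub>U\<^esub>"
proof -
  have "\<exists>g'\<in>unipotent. \<exists>e\<in>J k. g \<otimes>\<^bsub>U\<^esub> g' = \<one>\<^bsub>U\<^esub> \<oplus>\<^bsub>U\<^esub> e" for k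
  proof (induction k)
    case 0
    obtain a where a: "a \<in> pat" "g = \<one>\<^bsub>U\<^esub> \<oplus>\<^bsub>U\<^esub> a" using assms by (rule unipotentE)
    have "\<zero>\<^bsub>U\<^esub> \<in> pat" by (auto simp: U_zero intro!: patI)
    then have "\<one>\<^bsub>U\<^esub> \<in> unipotent" using unipotentI[of "\<zero>\<^bsub>U\<^esub>"] by simp
    moreover have "g \<otimes>\<^bsub>U\<^esub> \<one>\<^bsub>U\<^esub> = \<one>\<^bsub>U\<^esub> \<oplus>\<^bsub>U\<^esub> a" using a by simp
    ultimately show ?case using a(1) J_0 by blast
  next
    case (Suc k)
    then obtain g' e where g': "g' \<in> unipotent" "e \<in> J k" "g \<otimes>\<^bsub>U\<^esub> g' = \<one>\<^bsub>U\<^esub> \<oplus>\<^bsub>U\<^esub> e" by blast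
    let ?e = "\<ominus>\<^bsub>U\<^esub> (e \<otimes>\<^bsub>U\<^esub> e)"
    have e: "e \<in> pat" using g'(2) by (rule J_pat)
    have "\<ominus>\<^bsub>U\<^esub> e \<in> pat" using J_uminus[OF g'(2)] J_pat by blast
    then have u: "g' \<otimes>\<^bsub>U\<^esub> (\<one>\<^bsub>U\<^esub> \<oplus>\<^bsub>U\<^esub> \<ominus>\<^bsub>U\<^esub> e) \<in> unipotent"
      by (intro unipotent_mult g' unipotentI)
    have "g \<otimes>\<^bsub>U\<^esub> (g' \<otimes>\<^bsub>U\<^esub> (\<one>\<^bsub>U\<^esub> \<oplus>\<^bsub>U\<^esub> \<ominus>\<^bsub>U\<^esub> e)) = (\<one>\<^bsub>U\<^esub> \<oplus>\<^bsub>U\<^esub> e) \<otimes>\<^bsub>U\<^esub> (\<one>\<^bsub>U\<^esub> \<oplus>\<^bsub>U\<^esub> \<ominus>\<^bsub>U\<^esub> e)"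
      using assms g' e by (simp add: U.m_assoc[symmetric])
    also have "\<dots> = \<one>\<^bsub>U\<^esub> \<oplus>\<^bsub>U\<^esub> ?e"
      using e by (simp add: U.l_distr U.r_distr U.r_minus U.minus_add U.a_assoc U.r_neg2)
    finally show ?case using u J_uminus[OF J_mult(1)[OF e g'(2)]] by blast
  qed
  from this[of "Suc (max_alpha n prec)"] J_top[of "Suc (max_alpha n prec)"] show ?thesis
    by (auto simp del: One_nat_def)
qed

end

section \<open>The truncated exponential on strictly supported matrices\<close>

locale pattern_group = incidence R n prec + prime_power_modulus p m D
  for R (structure) and n prec p m D +
  assumes torsion_R: "r \<in> carrier R \<Longrightarrow> [m] \<cdot> r = \<zero>"
    and large_p: "int (Suc (max_alpha n prec)) < p"
begin

sublocale T: torsion_ring U p m D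
proof
  fix M assume M: "M \<in> carrier U"
  then show "add_pow U m M = \<zero>\<^bsub>U\<^esub>"
    by (intro ext) (simp add: U_int_pow torsion_R U_zero)
qed

abbreviation "h \<equiv> Suc (max_alpha n prec)"

abbreviation "E \<equiv> T.rexp h"

text \<open>The filtration \<open>J\<close> delayed by one step, with the whole ring in front of it,
  since the unit is not strictly supported. Stage \<open>h + 1\<close> is \<open>J h\<close>, which
  is zero.\<close>

definition filt :: "nat \<Rightarrow> (nat \<Rightarrow> nat \<Rightarrow> 'a) set" where
  "filt k = (case k of 0 \<Rightarrow> carrier U | Suc j \<Rightarrow> J j)"

lemma nilpotent_pair:
  assumes "x \<in> pat" "y \<in> pat"
  shows "nilpotent_pair U p m D x y filt h"
proof (intro nilpotent_pair.intro nilpotent_pair_axioms.intro)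
  show "torsion_ring U p m D" by (rule T.torsion_ring_axioms)
  have *: "z \<in> filt k \<Longrightarrow> x \<otimes>\<^bsub>U\<^esub> z \<in> filt (Suc k)" if "x \<in> pat" for x z k
    using that by (auto simp: filt_def J_0 J_mult pat_mult_U split: nat.splits)
  show "z \<in> filt k \<Longrightarrow> x \<otimes>\<^bsub>U\<^esub> z \<in> filt (Suc k)" "z \<in> filt k \<Longrightarrow> y \<otimes>\<^bsub>U\<^esub> z \<in> filt (Suc k)" for z k
    using * assms by blast+
  show "additive_subgroup (filt k) U" for k
    using U.add.subgroup_self J_subgroup by (auto simp: filt_def intro: additive_subgroup.intro split: nat.splits)
  show "filt (Suc h) = {\<zero>\<^bsub>U\<^esub>}" using J_top by (simp add: filt_def)
  show "filt (Suc k) \<subseteq> filt k" for k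
    using J_Suc by (auto simp: filt_def split: nat.splits)
qed (use assms large_p in \<open>auto simp: filt_def\<close>)

lemma E_dynkin:
  assumes "x \<in> pat" "y \<in> pat"
  shows "E (\<Oplus>\<^bsub>U\<^esub>ws\<in>dynkin_index h. T.act (dynkin_coeff ws)
      (nested_bracket (commutator_lie U) (dynkin_word x y ws))) = E x \<otimes>\<^bsub>U\<^esub> E y"
  by (rule nilpotent_pair.rexp_dynkin[OF nilpotent_pair[OF assms]])

definition E_tail :: "(nat \<Rightarrow> nat \<Rightarrow> 'a) \<Rightarrow> nat \<Rightarrow> nat \<Rightarrow> 'a" where
  "E_tail z = (\<Oplus>\<^bsub>U\<^esub>k\<in>{2..h}. T.act (1 / fact k) (z [^]\<^bsub>U\<^esub> k))"

lemma E_alt: "z \<in> carrier U \<Longrightarrow> E z = \<one>\<^bsub>U\<^esub> \<oplus>\<^bsub>U\<^esub> (z \<oplus>\<^bsub>U\<^esub> E_tail z)"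
proof -
  assume z: "z \<in> carrier U"
  have "{..h} = insert 0 (insert 1 {2..h})" by auto
  then show ?thesis
    unfolding T.rexp_def E_tail_def using z
    by (simp add: U.finsum_insert T.act_1 del: One_nat_def)
qed

lemma J_act: "z \<in> J k \<Longrightarrow> T.act q z \<in> J k"
  unfolding T.act_def add_pow_def
  by (rule group.subgroup_int_pow_closed[OF U.a_group additive_subgroup.a_subgroup[OF J_subgroup]])

lemma J_finsum: "(\<And>k. k \<in> S \<Longrightarrow> f k \<in> J i) \<Longrightarrow> finsum U f S \<in> J i"
proof (induction S rule: infinite_finite_induct)
  case (insert x S)
  have "f k \<in> carrier U" if "k \<in> insert x S" for k
    using insert.prems[OF that] by (rule J_U)
  then show ?case using insert by (subst U.finsum_insert) (auto intro: J_add)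
qed (use additive_subgroup.zero_closed[OF J_subgroup] in \<open>auto simp: U.finsum_infinite\<close>)

text \<open>From degree two on, each summand of the telescoped difference of powers contains
  \<open>x - y\<close> together with a further factor from \<open>pat\<close>, and this factor
  raises the depth.\<close>

lemma J_pow_diff:
  assumes "x \<in> pat" "y \<in> pat" "x \<ominus>\<^bsub>U\<^esub> y \<in> J k"
  shows "x [^]\<^bsub>U\<^esub> Suc (Suc j) \<ominus>\<^bsub>U\<^esub> y [^]\<^bsub>U\<^esub> Suc (Suc j) \<in> J (Suc k)"
proof -
  have pow: "y [^]\<^bsub>U\<^esub> Suc j \<in> pat" for j
    using assms(2) by (induction j) (auto simp: pat_mult_U)
  have step: "x [^]\<^bsub>U\<^esub> Suc (Suc j) \<ominus>\<^bsub>U\<^esub> y [^]\<^bsub>U\<^esub> Suc (Suc j) =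
      (x [^]\<^bsub>U\<^esub> Suc j \<ominus>\<^bsub>U\<^esub> y [^]\<^bsub>U\<^esub> Suc j) \<otimes>\<^bsub>U\<^esub> x \<oplus>\<^bsub>U\<^esub> y [^]\<^bsub>U\<^esub> Suc j \<otimes>\<^bsub>U\<^esub> (x \<ominus>\<^bsub>U\<^esub> y)" for j
    using assms(1,2)
    by (simp add: U.minus_eq U.l_distr U.r_distr U.l_minus U.r_minus U.a_assoc U.r_neg1 del: U.nat_pow_Suc)
  have "x [^]\<^bsub>U\<^esub> Suc j \<ominus>\<^bsub>U\<^esub> y [^]\<^bsub>U\<^esub> Suc j \<in> J k" for j
  proof (induction j)
    case 0
    then show ?case using assms by simp
  next
    case (Suc j)
    then show ?case
      unfolding step using assms J_mult pow J_Suc by (intro J_add) blast+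
  qed
  then show ?thesis unfolding step using assms pow by (intro J_add J_mult)
qed

text \<open>If the exponentials agree, then \<open>x - y\<close> equals a difference of tails of
  degree at least two, which lies one step deeper than \<open>x - y\<close> is known to lie. By
  induction it lies in every stage, hence in the zero stage.\<close>

lemma E_inj:
  assumes "x \<in> pat" "y \<in> pat" "E x = E y"
  shows "x = y"
proof -
  have [simp]: "x \<in> carrier U" "y \<in> carrier U" using assms by auto
  have tc: "E_tail z \<in> carrier U" if "z \<in> carrier U" for z
    using that by (auto simp: E_tail_def)
  have eq: "x \<ominus>\<^bsub>U\<^esub> y = E_tail y \<ominus>\<^bsub>U\<^esub> E_tail x"
  proof -
    have "x \<oplus>\<^bsub>U\<^esub> E_tail x = y \<oplus>\<^bsub>U\<^esub> E_tail y"
      using assms(3) by (simp add: E_alt tc U.add.l_cancel)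
    then have "x = y \<oplus>\<^bsub>U\<^esub> E_tail y \<ominus>\<^bsub>U\<^esub> E_tail x"
      using tc by (metis U.minus_eq U.a_assoc U.r_neg U.r_zero U.a_inv_closed \<open>x \<in> carrier U\<close>)
    then have "x \<ominus>\<^bsub>U\<^esub> y = (y \<oplus>\<^bsub>U\<^esub> E_tail y \<ominus>\<^bsub>U\<^esub> E_tail x) \<ominus>\<^bsub>U\<^esub> y" by simp
    then show ?thesis using tc
      by (simp add: U.minus_eq U.a_assoc U.a_comm[of "\<ominus>\<^bsub>U\<^esub> E_tail x" "\<ominus>\<^bsub>U\<^esub> y"]
          U.a_lcomm[of "E_tail y" "\<ominus>\<^bsub>U\<^esub> y"] U.r_neg2)
  qed
  have "x \<ominus>\<^bsub>U\<^esub> y \<in> J k" for k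
  proof (induction k)
    case 0
    then show ?case using J_minus[of x 0 y] assms by (simp add: J_0)
  next
    case (Suc k)
    have d: "y \<ominus>\<^bsub>U\<^esub> x \<in> J k"
    proof -
      have "y \<ominus>\<^bsub>U\<^esub> x = \<ominus>\<^bsub>U\<^esub> (x \<ominus>\<^bsub>U\<^esub> y)" by (simp add: U.minus_eq U.minus_add U.a_comm)
      then show ?thesis using J_uminus[OF Suc] by simp
    qed
    have "E_tail y \<ominus>\<^bsub>U\<^esub> E_tail x = (\<Oplus>\<^bsub>U\<^esub>k\<in>{2..h}. T.act (1 / fact k) (y [^]\<^bsub>U\<^esub> k \<ominus>\<^bsub>U\<^esub> x [^]\<^bsub>U\<^esub> k))"
    proof -
      have s: "finsum U (\<lambda>k. f k \<ominus>\<^bsub>U\<^esub> g k) S = finsum U f S \<ominus>\<^bsub>U\<^esub> finsum U g S"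
        if "finite S" "f \<in> S \<rightarrow> carrier U" "g \<in> S \<rightarrow> carrier U" for f g and S :: "nat set"
        using that by (induction S)
          (auto simp: U.finsum_insert U.minus_eq U.minus_add U.a_ac Pi_def U.finsum_closed)
      have a: "T.act q (u \<ominus>\<^bsub>U\<^esub> v) = T.act q u \<ominus>\<^bsub>U\<^esub> T.act q v" if "u \<in> carrier U" "v \<in> carrier U" for q u v
        using that unfolding T.act_def
        by (simp add: U.minus_eq U.add.int_pow_distrib U.add.int_pow_inv)
      show ?thesis unfolding E_tail_def by (subst s[symmetric]) (auto simp: a)
    qed
    also have "\<dots> \<in> J (Suc k)"
    proof (rule J_finsum, rule J_act)
      fix l assume "l \<in> {2..h}"
      then obtain j where "l = Suc (Suc j)" by (metis Suc_le_D atLeastAtMost_iff numeral_2_eq_2 Suc_le_mono)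
      then show "y [^]\<^bsub>U\<^esub> l \<ominus>\<^bsub>U\<^esub> x [^]\<^bsub>U\<^esub> l \<in> J (Suc k)"
        using J_pow_diff[OF assms(2,1) d] by simp
    qed
    finally show ?case using eq by simp
  qed
  from this[of h] J_top[of h] have "x \<ominus>\<^bsub>U\<^esub> y = \<zero>\<^bsub>U\<^esub>" by simp
  then show ?thesis by (simp add: U.r_right_minus_eq)
qed

text \<open>This covers rows, columns and central matrices, the elements with which the lower bound
  computes.\<close>

lemma E_square_zero:
  assumes "z \<in> pat" "z \<otimes>\<^bsub>U\<^esub> z = \<zero>\<^bsub>U\<^esub>"
  shows "E z = \<one>\<^bsub>U\<^esub> \<oplus>\<^bsub>U\<^esub> z"
proof -
  have "z [^]\<^bsub>U\<^esub> Suc (Suc j) = \<zero>\<^bsub>U\<^esub>" for j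
    using assms by (induction j) auto
  then have "z [^]\<^bsub>U\<^esub> k = \<zero>\<^bsub>U\<^esub>" if "k \<in> {2..h}" for k
    using that by (metis Suc_le_D atLeastAtMost_iff numeral_2_eq_2 Suc_le_mono)
  then have "E_tail z = (\<Oplus>\<^bsub>U\<^esub>k\<in>{2..h}. \<zero>\<^bsub>U\<^esub>)"
    unfolding E_tail_def by (intro U.finsum_cong') auto
  then show ?thesis using assms by (simp add: E_alt)
qed

lemma E_unipotent:
  assumes z: "z \<in> pat"
  shows "E z \<in> unipotent"
proof -
  have pow: "z [^]\<^bsub>U\<^esub> Suc j \<in> pat" for j
    using z by (induction j) (auto simp: pat_mult_U)
  have "E_tail z \<in> J 0"
    unfolding E_tail_def
  proof (rule J_finsum, rule J_act)
    fix k assume "k \<in> {2..h}"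
    then show "z [^]\<^bsub>U\<^esub> k \<in> J 0" using pow[of "k - 1"] by (simp add: J_0)
  qed
  then show ?thesis using z by (simp add: E_alt J_0 unipotentI pat_add)
qed

end

section \<open>The Lie ring as a ring of matrices\<close>

lemma gl_int_simps [simp]:
  "carrier (gl_int n) = carrier_mat n n" "A \<otimes>\<^bsub>gl_int n\<^esub> B = A + B" "\<one>\<^bsub>gl_int n\<^esub> = 0\<^sub>m n n"
  "lie_bracket (gl_int n) A B = A * B - B * A"
  by (simp_all add: gl_int_def)

lemma group_gl_int: "group (gl_int n)"
proof (rule groupI)
  fix A assume "A \<in> carrier (gl_int n)"
  then show "\<exists>B\<in>carrier (gl_int n). B \<otimes>\<^bsub>gl_int n\<^esub> A = \<one>\<^bsub>gl_int n\<^esub>"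
    by (intro bexI[of _ "- A"]) auto
qed (auto simp: assoc_add_mat)

lemma inv_gl_int: "A \<in> carrier_mat n n \<Longrightarrow> inv\<^bsub>gl_int n\<^esub> A = - A"
  by (rule group.inv_equality[OF group_gl_int]) auto

lemma (in abelian_group) int_pow_sum:
  fixes f :: "'i \<Rightarrow> int"
  assumes "x \<in> carrier G"
  shows "add_pow G (sum f S) x = (\<Oplus>i\<in>S. add_pow G (f i) x)"
proof (induction S rule: infinite_finite_induct)
  case (insert i S)
  then show ?case using assms by (simp add: add.int_pow_mult finsum_insert)
qed (use assms in \<open>auto simp: add_pow_def finsum_infinite\<close>)

context incidence
begin

abbreviation "\<gg> \<equiv> pattern_lie n prec"
abbreviation "L \<equiv> lie_tensor \<gg> R"
abbreviation "F \<equiv> tensor_free \<gg> R"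
abbreviation "K \<equiv> tensor_relations \<gg> R"

definition supported :: "int mat \<Rightarrow> bool" where
  "supported A \<longleftrightarrow> A \<in> carrier_mat n n \<and> (\<forall>a<n. \<forall>b<n. (Suc a, Suc b) \<notin> prec \<longrightarrow> A $$ (a, b) = 0)"

lemma pattern_lie_simps [simp]:
  "A \<otimes>\<^bsub>\<gg>\<^esub> B = A + B" "\<one>\<^bsub>\<gg>\<^esub> = 0\<^sub>m n n" "lie_bracket \<gg> A B = A * B - B * A"
  by (simp_all add: pattern_lie_def gl_int_def)

lemma pattern_carrier:
  "carrier \<gg> = generate (gl_int n) {mat_unit n i j |i j. (i, j) \<in> prec}"
  by (simp add: pattern_lie_def)

lemma mat_unit_carrier [simp]: "mat_unit n i j \<in> carrier_mat n n"
  by (simp add: mat_unit_def)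

lemma supported_add: "supported A \<Longrightarrow> supported B \<Longrightarrow> supported (A + B)"
  by (auto simp: supported_def)

lemma supported_uminus: "supported A \<Longrightarrow> supported (- A)"
  by (auto simp: supported_def)

lemma supported_carrier: "supported A \<Longrightarrow> A \<in> carrier_mat n n"
  by (simp add: supported_def)

lemma supported_zero: "supported (0\<^sub>m n n)"
  by (auto simp: supported_def)

lemma supported_mult:
  assumes A: "supported A" and B: "supported B"
  shows "supported (A * B)"
  unfolding supported_def
proof (intro conjI allI impI)
  show "A * B \<in> carrier_mat n n" using A B by (auto simp: supported_def)
  fix a b assume ab: "a < n" "b < n" "(Suc a, Suc b) \<notin> prec"
  have "A $$ (a, k) * B $$ (k, b) = 0" if "k < n" for k
  proof -
    have "(Suc a, Suc k) \<notin> prec \<or> (Suc k, Suc b) \<notin> prec" using ab prec_trans by blast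
    then have "A $$ (a, k) = 0 \<or> B $$ (k, b) = 0"
      using A B ab that unfolding supported_def by blast
    then show ?thesis by auto
  qed
  then have "(\<Sum>k = 0..<n. A $$ (a, k) * B $$ (k, b)) = 0" by (intro sum.neutral) auto
  moreover have "A \<in> carrier_mat n n" "B \<in> carrier_mat n n" using A B by (simp_all add: supported_def)
  ultimately show "(A * B) $$ (a, b) = 0"
    using ab by (simp add: scalar_prod_def)
qed

lemma supported_mat_unit: "(i, j) \<in> prec \<Longrightarrow> supported (mat_unit n i j)"
  by (auto simp: supported_def mat_unit_def)

lemma pattern_supported: "A \<in> carrier \<gg> \<Longrightarrow> supported A"
  unfolding pattern_carrier
proof (induction rule: generate.induct)
  case (inv h)
  then show ?case by (auto simp: inv_gl_int supported_mat_unit supported_uminus)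
qed (auto simp: supported_add supported_zero supported_mat_unit)

lemma subgroup_pattern: "subgroup (carrier \<gg>) (gl_int n)"
  unfolding pattern_carrier by (rule group.generate_is_subgroup[OF group_gl_int]) auto

text \<open>The positions at which the matrix may be nonzero are cleared one at a time by
  subtracting an integer multiple of a matrix unit.\<close>

lemma supported_pattern:
  assumes "supported A"
  shows "A \<in> carrier \<gg>"
proof -
  have smult: "k \<cdot>\<^sub>m mat_unit n i j \<in> carrier \<gg>" if "(i, j) \<in> prec" for k i j
  proof -
    have u: "mat_unit n i j \<in> carrier \<gg>"
      using that unfolding pattern_carrier by (auto intro: generate.incl)
    have nat: "int c \<cdot>\<^sub>m mat_unit n i j \<in> carrier \<gg>" for c
    proof (induction c)
      case 0
      have "0 \<cdot>\<^sub>m mat_unit n i j = 0\<^sub>m n n" by (intro eq_matI) (auto simp: mat_unit_def)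
      then show ?case using subgroup.one_closed[OF subgroup_pattern] by simp
    next
      case (Suc c)
      have "int (Suc c) \<cdot>\<^sub>m mat_unit n i j = int c \<cdot>\<^sub>m mat_unit n i j + mat_unit n i j"
        by (intro eq_matI) (auto simp: mat_unit_def algebra_simps)
      then show ?case using subgroup.m_closed[OF subgroup_pattern Suc u] by simp
    qed
    show ?thesis
    proof (cases "k \<ge> 0")
      case True
      then show ?thesis using nat[of "nat k"] by simp
    next
      case False
      have "k \<cdot>\<^sub>m mat_unit n i j = - (int (nat (- k)) \<cdot>\<^sub>m mat_unit n i j)"
        using False by (intro eq_matI) (auto simp: mat_unit_def)
      then show ?thesis
        using subgroup.m_inv_closed[OF subgroup_pattern nat[of "nat (- k)"]]
        by (simp add: inv_gl_int)
    qed
  qed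
  have "A \<in> carrier \<gg>"
    if "A \<in> carrier_mat n n" "finite P" "P \<subseteq> prec" "\<And>a b. a < n \<Longrightarrow> b < n \<Longrightarrow> (Suc a, Suc b) \<notin> P \<Longrightarrow> A $$ (a, b) = 0"
    for A P
    using that(2,1,3,4)
  proof (induction P arbitrary: A)
    case empty
    then have "A = 0\<^sub>m n n" by (intro eq_matI) auto
    then show ?case using subgroup.one_closed[OF subgroup_pattern] by simp
  next
    case (insert x P)
    obtain i j where x: "x = (i, j)" by (cases x)
    let ?c = "A $$ (i - 1, j - 1)"
    let ?B = "A - ?c \<cdot>\<^sub>m mat_unit n i j"
    have ij: "(i, j) \<in> prec" "i \<in> {1..n}" "j \<in> {1..n}" using insert.prems x prec_range[of i j] by auto
    have "?B \<in> carrier \<gg>"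
    proof (rule insert.IH)
      fix a b assume ab: "a < n" "b < n" "(Suc a, Suc b) \<notin> P"
      show "?B $$ (a, b) = 0"
      proof (cases "(Suc a, Suc b) = x")
        case True
        then show ?thesis using ab insert.prems by (auto simp: x mat_unit_def)
      next
        case False
        then show ?thesis using ab insert.prems(3)[of a b] insert.prems(1)
          by (auto simp: x mat_unit_def)
      qed
    next
      show "?B \<in> carrier_mat n n" by (intro minus_carrier_mat smult_carrier_mat) simp
    qed (use insert.prems in auto)
    moreover have "A = ?B + ?c \<cdot>\<^sub>m mat_unit n i j"
      using insert.prems(1) by (intro eq_matI) (auto simp: mat_unit_def)
    ultimately show ?case
      using subgroup.m_closed[OF subgroup_pattern _ smult[OF ij(1), of ?c]] by (metis gl_int_simps(2))
  qed
  from this[of A prec] assms finite_prec show ?thesis by (auto simp: supported_def)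
qed

lemma carrier_pattern_iff: "A \<in> carrier \<gg> \<longleftrightarrow> supported A"
  using supported_pattern pattern_supported by blast

section \<open>The tensor product with the scalars as matrices over the scalars\<close>

definition entry :: "int mat \<Rightarrow> nat \<Rightarrow> nat \<Rightarrow> int" where
  "entry A i j = (if (i, j) \<in> prec then A $$ (i - 1, j - 1) else 0)"

lemma entry_add: "supported A \<Longrightarrow> supported B \<Longrightarrow> entry (A + B) i j = entry A i j + entry B i j"
  using prec_range[of i j] by (auto simp: entry_def supported_def)

lemma entry_uminus: "supported A \<Longrightarrow> entry (- A) i j = - entry A i j"
  using prec_range[of i j] by (auto simp: entry_def supported_def)

lemma entry_zero [simp]: "entry (0\<^sub>m n n) i j = 0"
  using prec_range[of i j] by (auto simp: entry_def)

lemma entry_mat_unit: "(k, l) \<in> prec \<Longrightarrow> entry (mat_unit n k l) i j = (if i = k \<and> j = l then 1 else 0)"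
  using prec_range[of i j] prec_range[of k l] by (auto simp: entry_def mat_unit_def)

lemma entry_mult:
  assumes A: "supported A" and B: "supported B"
  shows "entry (A * B) i j = (\<Sum>k\<in>{1..n}. entry A i k * entry B k j)"
proof (cases "(i, j) \<in> prec")
  case True
  then have ij: "i \<in> {1..n}" "j \<in> {1..n}" using prec_range by auto
  have e: "entry C (Suc a) (Suc b) = C $$ (a, b)" if "supported C" "a < n" "b < n" for C a b
    using that by (auto simp: entry_def supported_def)
  have "entry (A * B) i j = (\<Sum>k<n. A $$ (i - 1, k) * B $$ (k, j - 1))"
    using True ij A B by (auto simp: entry_def supported_def scalar_prod_def atLeast0LessThan)
  also have "\<dots> = (\<Sum>k<n. entry A i (Suc k) * entry B (Suc k) j)"
    using e[OF A, of "i - 1"] e[OF B, of _ "j - 1"] ij by (intro sum.cong) auto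
  also have "\<dots> = (\<Sum>k\<in>{1..n}. entry A i k * entry B k j)"
    by (simp add: sum.atLeast1_atMost_eq)
  finally show ?thesis .
next
  case False
  have "entry A i k * entry B k j = 0" for k
    using False prec_trans[of i k j] by (auto simp: entry_def)
  then have "(\<Sum>k\<in>{1..n}. entry A i k * entry B k j) = 0" by (intro sum.neutral) simp
  then show ?thesis using False by (simp add: entry_def[of "A * B"])
qed

definition toU :: "int mat \<Rightarrow> 'a \<Rightarrow> nat \<Rightarrow> nat \<Rightarrow> 'a" where
  "toU A r = (\<lambda>i j. [entry A i j] \<cdot> r)"

lemma int_pow_0': "add_pow R (0 :: int) x = \<zero>"
  by (simp add: add_pow_def)

lemma toU_pat: "r \<in> carrier R \<Longrightarrow> toU A r \<in> pat"
  by (rule patI) (auto simp: toU_def entry_def int_pow_0')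

lemma toU_add_left:
  "supported A \<Longrightarrow> supported B \<Longrightarrow> r \<in> carrier R \<Longrightarrow> toU (A + B) r = toU A r \<oplus>\<^bsub>U\<^esub> toU B r"
  by (simp add: toU_def U_add entry_add add.int_pow_mult)

lemma toU_add_right: "r \<in> carrier R \<Longrightarrow> s \<in> carrier R \<Longrightarrow> toU A (r \<oplus> s) = toU A r \<oplus>\<^bsub>U\<^esub> toU A s"
  by (simp add: toU_def U_add add.int_pow_distrib)

lemma toU_mult:
  assumes "supported A" "supported B" and [simp]: "r \<in> carrier R" "s \<in> carrier R"
  shows "toU (A * B) (r \<otimes> s) = toU A r \<otimes>\<^bsub>U\<^esub> toU B s"
proof (intro ext)
  fix i j
  have "toU (A * B) (r \<otimes> s) i j = (\<Oplus>k\<in>{1..n}. add_pow R (entry A i k * entry B k j) (r \<otimes> s))"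
    unfolding toU_def entry_mult[OF assms(1,2)] by (rule int_pow_sum) simp
  also have "\<dots> = (toU A r \<otimes>\<^bsub>U\<^esub> toU B s) i j"
    unfolding toU_def U_mult
    by (intro finsum_cong' refl)
      (simp_all add: add_pow_ldistr_int add_pow_rdistr_int add.int_pow_pow mult.commute)
  finally show "toU (A * B) (r \<otimes> s) i j = (toU A r \<otimes>\<^bsub>U\<^esub> toU B s) i j" .
qed

lemma toU_uminus: "supported A \<Longrightarrow> r \<in> carrier R \<Longrightarrow> toU (- A) r = \<ominus>\<^bsub>U\<^esub> toU A r"
  by (simp add: toU_pat U_uminus) (simp add: toU_def entry_uminus add.int_pow_neg)

lemma toU_zero: "toU (0\<^sub>m n n) r = \<zero>\<^bsub>U\<^esub>"
  by (simp add: toU_def U_zero int_pow_0')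

lemma comm_group_U: "comm_group (add_monoid U)"
  by (rule U.a_comm_group)

text \<open>The universal property of the free abelian group yields only existence, so the additive
  extension of the map that sends the pair \<open>(A, r)\<close> to \<open>toU A r\<close> is fixed
  by choice.\<close>

definition free_mat :: "(int mat \<times> 'a \<Rightarrow>\<^sub>0 int) \<Rightarrow> nat \<Rightarrow> nat \<Rightarrow> 'a" where
  "free_mat = (SOME f. f \<in> hom F (add_monoid U) \<and> (\<forall>x\<in>carrier \<gg> \<times> carrier R. f (frag_of x) = toU (fst x) (snd x)))"

lemma free_mat: "free_mat \<in> hom F (add_monoid U)"
  "A \<in> carrier \<gg> \<Longrightarrow> r \<in> carrier R \<Longrightarrow> free_mat (frag_of (A, r)) = toU A r"
proof -
  have "(\<lambda>x. toU (fst x) (snd x)) ` (carrier \<gg> \<times> carrier R) \<subseteq> carrier (add_monoid U)"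
    using toU_pat by auto
  then obtain f where "f \<in> hom F (add_monoid U)"
    "\<And>x. x \<in> carrier \<gg> \<times> carrier R \<Longrightarrow> f (frag_of x) = toU (fst x) (snd x)"
    unfolding tensor_free_def by (rule comm_group.free_Abelian_group_universal[OF comm_group_U]) blast
  then have "\<exists>f. f \<in> hom F (add_monoid U) \<and> (\<forall>x\<in>carrier \<gg> \<times> carrier R. f (frag_of x) = toU (fst x) (snd x))"
    by blast
  from someI_ex[OF this] show "free_mat \<in> hom F (add_monoid U)"
    "A \<in> carrier \<gg> \<Longrightarrow> r \<in> carrier R \<Longrightarrow> free_mat (frag_of (A, r)) = toU A r"
    unfolding free_mat_def[symmetric] by auto
qed

lemma F_simps [simp]: "u \<otimes>\<^bsub>F\<^esub> v = u + v" "\<one>\<^bsub>F\<^esub> = 0"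
  by (simp_all add: tensor_free_def)

lemma F_carrier: "u \<in> carrier F \<longleftrightarrow> Poly_Mapping.keys u \<subseteq> carrier \<gg> \<times> carrier R"
  by (simp add: tensor_free_def)

lemma F_group: "group F" and F_comm_group: "comm_group F"
  by (simp_all add: tensor_free_def abelian_free_Abelian_group)

lemma F_inv: "u \<in> carrier F \<Longrightarrow> inv\<^bsub>F\<^esub> u = - u"
  by (simp add: tensor_free_def)

lemma F_add: "u \<in> carrier F \<Longrightarrow> v \<in> carrier F \<Longrightarrow> u + v \<in> carrier F"
  using group.is_monoid[OF F_group, THEN monoid.m_closed, of u v] by simp

lemma F_uminus: "u \<in> carrier F \<Longrightarrow> - u \<in> carrier F"
  using group.inv_closed[OF F_group, of u] by (simp add: F_inv)

lemma F_diff: "u \<in> carrier F \<Longrightarrow> v \<in> carrier F \<Longrightarrow> u - v \<in> carrier F"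
  using F_add[OF _ F_uminus, of u v] by simp

lemma F_zero [simp]: "0 \<in> carrier F"
  by (simp add: F_carrier)

lemma F_frag [simp]: "A \<in> carrier \<gg> \<Longrightarrow> r \<in> carrier R \<Longrightarrow> frag_of (A, r) \<in> carrier F"
  by (simp add: F_carrier)

lemma F_induct [consumes 1, case_names zero diff frag]:
  assumes "u \<in> carrier F" "P 0"
    "\<And>u v. u \<in> carrier F \<Longrightarrow> v \<in> carrier F \<Longrightarrow> P u \<Longrightarrow> P v \<Longrightarrow> P (u - v)"
    "\<And>A r. A \<in> carrier \<gg> \<Longrightarrow> r \<in> carrier R \<Longrightarrow> P (frag_of (A, r))"
  shows "P u"
  using assms(1) unfolding F_carrier
  by (rule free_Abelian_group_induct) (use assms(2-) in \<open>auto simp: F_carrier\<close>)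

lemma free_mat_closed [simp]: "u \<in> carrier F \<Longrightarrow> free_mat u \<in> carrier U"
  using free_mat(1) by (auto simp: hom_def)

lemma free_mat_add: "u \<in> carrier F \<Longrightarrow> v \<in> carrier F \<Longrightarrow> free_mat (u + v) = free_mat u \<oplus>\<^bsub>U\<^esub> free_mat v"
  using hom_mult[OF free_mat(1), of u v] by simp

lemma free_mat_zero [simp]: "free_mat 0 = \<zero>\<^bsub>U\<^esub>"
  using hom_one[OF free_mat(1) F_group U.a_group] by simp

lemma free_mat_diff: "u \<in> carrier F \<Longrightarrow> v \<in> carrier F \<Longrightarrow> free_mat (u - v) = free_mat u \<ominus>\<^bsub>U\<^esub> free_mat v"
proof -
  assume *: "u \<in> carrier F" "v \<in> carrier F"
  have "free_mat u = free_mat (u - v) \<oplus>\<^bsub>U\<^esub> free_mat v" using free_mat_add[OF F_diff[OF *] *(2)] by simp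
  then show ?thesis using * F_diff[OF *] by (simp add: U.minus_eq U.a_assoc U.r_neg)
qed

lemma free_mat_pat: "u \<in> carrier F \<Longrightarrow> free_mat u \<in> pat"
proof (induction rule: F_induct)
  case zero
  then show ?case by (auto simp: U_zero intro!: patI)
next
  case (diff u v)
  then show ?case using J_minus[of "free_mat u" 0 "free_mat v"] by (simp add: free_mat_diff J_0)
qed (simp add: free_mat(2) toU_pat)

lemma K_generators:
  "{frag_of (x \<otimes>\<^bsub>\<gg>\<^esub> y, r) - frag_of (x, r) - frag_of (y, r) |x y r.
         x \<in> carrier \<gg> \<and> y \<in> carrier \<gg> \<and> r \<in> carrier R} \<union>
      {frag_of (x, r \<oplus>\<^bsub>R\<^esub> s) - frag_of (x, r) - frag_of (x, s) |x r s.
         x \<in> carrier \<gg> \<and> r \<in> carrier R \<and> s \<in> carrier R} \<subseteq> carrier F"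
  by (auto intro!: F_diff F_frag simp: carrier_pattern_iff supported_add)

lemma K_subgroup: "subgroup K F"
  unfolding tensor_relations_def by (rule group.generate_is_subgroup[OF F_group K_generators])

lemma K_F: "u \<in> K \<Longrightarrow> u \<in> carrier F"
  using subgroup.subset[OF K_subgroup] by blast

lemma K_add: "u \<in> K \<Longrightarrow> v \<in> K \<Longrightarrow> u + v \<in> K"
  using subgroup.m_closed[OF K_subgroup] by simp

lemma K_zero [simp]: "0 \<in> K"
  using subgroup.one_closed[OF K_subgroup] by simp

lemma K_uminus: "u \<in> K \<Longrightarrow> - u \<in> K"
  using subgroup.m_inv_closed[OF K_subgroup] F_inv[OF K_F] by fastforce

lemma K_diff: "u \<in> K \<Longrightarrow> v \<in> K \<Longrightarrow> u - v \<in> K"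
  using K_add[OF _ K_uminus, of u v] by simp

lemma K_sum: "(\<And>i. i \<in> S \<Longrightarrow> f i \<in> K) \<Longrightarrow> sum f S \<in> K"
  by (induction S rule: infinite_finite_induct) (auto intro: K_add)

lemma K_left:
  "A \<in> carrier \<gg> \<Longrightarrow> B \<in> carrier \<gg> \<Longrightarrow> r \<in> carrier R \<Longrightarrow>
    frag_of (A + B, r) - frag_of (A, r) - frag_of (B, r) \<in> K"
  unfolding tensor_relations_def by (rule generate.incl) auto

lemma K_right:
  "A \<in> carrier \<gg> \<Longrightarrow> r \<in> carrier R \<Longrightarrow> s \<in> carrier R \<Longrightarrow>
    frag_of (A, r \<oplus> s) - frag_of (A, r) - frag_of (A, s) \<in> K"
  unfolding tensor_relations_def by (rule generate.incl) auto

lemma free_mat_K: "u \<in> K \<Longrightarrow> free_mat u = \<zero>\<^bsub>U\<^esub>"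
proof -
  let ?G = "{frag_of (x \<otimes>\<^bsub>\<gg>\<^esub> y, r) - frag_of (x, r) - frag_of (y, r) |x y r.
         x \<in> carrier \<gg> \<and> y \<in> carrier \<gg> \<and> r \<in> carrier R} \<union>
      {frag_of (x, r \<oplus>\<^bsub>R\<^esub> s) - frag_of (x, r) - frag_of (x, s) |x r s.
         x \<in> carrier \<gg> \<and> r \<in> carrier R \<and> s \<in> carrier R}"
  have z: "a \<oplus>\<^bsub>U\<^esub> b \<ominus>\<^bsub>U\<^esub> a \<ominus>\<^bsub>U\<^esub> b = \<zero>\<^bsub>U\<^esub>" if "a \<in> carrier U" "b \<in> carrier U" for a b
  proof -
    have "a \<oplus>\<^bsub>U\<^esub> b \<ominus>\<^bsub>U\<^esub> a \<ominus>\<^bsub>U\<^esub> b = (a \<oplus>\<^bsub>U\<^esub> \<ominus>\<^bsub>U\<^esub> a) \<oplus>\<^bsub>U\<^esub> (b \<oplus>\<^bsub>U\<^esub> \<ominus>\<^bsub>U\<^esub> b)"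
      using that by (simp add: U.minus_eq U.a_ac)
    then show ?thesis using that by (simp add: U.r_neg)
  qed
  have G: "free_mat g = \<zero>\<^bsub>U\<^esub>" if "g \<in> ?G" for g
    using that
  proof
    assume "g \<in> {frag_of (x \<otimes>\<^bsub>\<gg>\<^esub> y, r) - frag_of (x, r) - frag_of (y, r) |x y r.
         x \<in> carrier \<gg> \<and> y \<in> carrier \<gg> \<and> r \<in> carrier R}"
    then obtain A B r where g: "g = frag_of (A + B, r) - frag_of (A, r) - frag_of (B, r)"
      and *: "A \<in> carrier \<gg>" "B \<in> carrier \<gg>" "r \<in> carrier R" by auto
    have "A + B \<in> carrier \<gg>" using * by (simp add: carrier_pattern_iff supported_add)
    then have "free_mat g = toU (A + B) r \<ominus>\<^bsub>U\<^esub> toU A r \<ominus>\<^bsub>U\<^esub> toU B r"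
      unfolding g using * by (simp add: free_mat_diff F_diff free_mat(2))
    then show ?thesis using * by (simp add: toU_add_left carrier_pattern_iff z toU_pat)
  next
    assume "g \<in> {frag_of (x, r \<oplus>\<^bsub>R\<^esub> s) - frag_of (x, r) - frag_of (x, s) |x r s.
         x \<in> carrier \<gg> \<and> r \<in> carrier R \<and> s \<in> carrier R}"
    then obtain A r s where g: "g = frag_of (A, r \<oplus> s) - frag_of (A, r) - frag_of (A, s)"
      and *: "A \<in> carrier \<gg>" "r \<in> carrier R" "s \<in> carrier R" by auto
    have "free_mat g = toU A (r \<oplus> s) \<ominus>\<^bsub>U\<^esub> toU A r \<ominus>\<^bsub>U\<^esub> toU A s"
      unfolding g using * by (simp add: free_mat_diff F_diff free_mat(2))
    then show ?thesis using * by (simp add: toU_add_right z toU_pat)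
  qed
  assume "u \<in> K"
  then show ?thesis
    unfolding tensor_relations_def
  proof (induction rule: generate.induct)
    case (inv g)
    then have gF: "g \<in> carrier F" using K_generators by blast
    have "free_mat (0 - g) = \<zero>\<^bsub>U\<^esub> \<ominus>\<^bsub>U\<^esub> free_mat g" using free_mat_diff[OF F_zero gF] by simp
    then show ?case using G[OF inv] by (simp add: F_inv[OF gF] U.minus_eq)
  next
    case (eng g g')
    then have "g \<in> carrier F" "g' \<in> carrier F"
      using K_F unfolding tensor_relations_def by blast+
    then show ?case using eng by (simp add: free_mat_add)
  qed (use G in simp_all)
qed

text \<open>The section of \<open>free_mat\<close> that shows its kernel to be the tensor relations.\<close>

definition sect :: "(nat \<Rightarrow> nat \<Rightarrow> 'a) \<Rightarrow> (int mat \<times> 'a \<Rightarrow>\<^sub>0 int)" where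
  "sect a = (\<Sum>(i, j)\<in>prec. frag_of (mat_unit n i j, a i j))"

lemma unit_pattern: "(i, j) \<in> prec \<Longrightarrow> mat_unit n i j \<in> carrier \<gg>"
  by (simp add: carrier_pattern_iff supported_mat_unit)

lemma F_sum: "(\<And>i. i \<in> S \<Longrightarrow> f i \<in> carrier F) \<Longrightarrow> sum f S \<in> carrier F"
  by (induction S rule: infinite_finite_induct) (auto intro: F_add)

lemma sect_F: "a \<in> carrier U \<Longrightarrow> sect a \<in> carrier F"
  unfolding sect_def by (rule F_sum) (auto intro!: F_frag unit_pattern)

lemma sect_add: "a \<in> carrier U \<Longrightarrow> b \<in> carrier U \<Longrightarrow> sect (a \<oplus>\<^bsub>U\<^esub> b) - sect a - sect b \<in> K"
  unfolding sect_def sum_subtractf[symmetric]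
  by (rule K_sum) (auto simp: U_add intro!: K_right unit_pattern)

lemma frag_zero_right: "A \<in> carrier \<gg> \<Longrightarrow> frag_of (A, \<zero>) \<in> K"
  using K_uminus[OF K_right[of A \<zero> \<zero>]] by simp

lemma zero_pattern: "0\<^sub>m n n \<in> carrier \<gg>"
  by (simp add: carrier_pattern_iff supported_zero)

lemma frag_zero_left: "r \<in> carrier R \<Longrightarrow> frag_of (0\<^sub>m n n, r) \<in> K"
  using K_uminus[OF K_left[of "0\<^sub>m n n" "0\<^sub>m n n" r]] zero_pattern by simp

lemma sect_zero: "sect \<zero>\<^bsub>U\<^esub> \<in> K"
  unfolding sect_def by (rule K_sum) (auto simp: U_zero intro!: frag_zero_right unit_pattern)

lemma sect_diff:
  assumes "a \<in> carrier U" "b \<in> carrier U"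
  shows "sect (a \<ominus>\<^bsub>U\<^esub> b) - (sect a - sect b) \<in> K"
proof -
  have "sect ((a \<ominus>\<^bsub>U\<^esub> b) \<oplus>\<^bsub>U\<^esub> b) - sect (a \<ominus>\<^bsub>U\<^esub> b) - sect b \<in> K"
    by (rule sect_add) (use assms in auto)
  moreover have "(a \<ominus>\<^bsub>U\<^esub> b) \<oplus>\<^bsub>U\<^esub> b = a" using assms by (simp add: U.minus_eq U.a_assoc U.l_neg)
  ultimately have "- (sect a - sect (a \<ominus>\<^bsub>U\<^esub> b) - sect b) \<in> K" using K_uminus by metis
  then show ?thesis by (simp add: algebra_simps)
qed

text \<open>\<open>sect\<close> writes a summand for every pair of the order. All except the one at
  \<open>(k, l)\<close> have scalar zero here, and symbols with scalar zero are relations.\<close>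

lemma frag_sect_unit:
  assumes kl: "(k, l) \<in> prec" and r: "r \<in> carrier R"
  shows "frag_of (mat_unit n k l, r) - sect (toU (mat_unit n k l) r) \<in> K"
proof -
  define h where h: "h = mat_unit n k l"
  have "frag_of (h, r) - sect (toU h r) = - (\<Sum>(i, j)\<in>prec - {(k, l)}. frag_of (mat_unit n i j, \<zero>))"
  proof -
    have "sect (toU h r) = frag_of (mat_unit n k l, toU h r k l) +
        (\<Sum>(i, j)\<in>prec - {(k, l)}. frag_of (mat_unit n i j, toU h r i j))"
      unfolding sect_def by (subst sum.remove[OF finite_prec kl]) simp
    moreover have "toU h r k l = r" using kl r by (simp add: toU_def h entry_mat_unit)
    moreover have "(\<Sum>(i, j)\<in>prec - {(k, l)}. frag_of (mat_unit n i j, toU h r i j)) =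
        (\<Sum>(i, j)\<in>prec - {(k, l)}. frag_of (mat_unit n i j, \<zero>))"
    proof (intro sum.cong refl)
      fix x assume x: "x \<in> prec - {(k, l)}"
      obtain i j where ij: "x = (i, j)" by (cases x)
      have "toU h r i j = \<zero>" using x ij kl by (auto simp: toU_def h entry_mat_unit int_pow_0')
      then show "(case x of (i, j) \<Rightarrow> frag_of (mat_unit n i j, toU h r i j)) =
          (case x of (i, j) \<Rightarrow> frag_of (mat_unit n i j, \<zero>))" by (simp add: ij)
    qed
    ultimately show ?thesis by (simp add: h)
  qed
  also have "\<dots> \<in> K"
    by (intro K_uminus K_sum) (auto intro!: frag_zero_right unit_pattern)
  finally show ?thesis by (simp add: h)
qed

text \<open>Both terms are additive in \<open>A\<close> modulo the relations, so following the
  generation of the pattern Lie algebra reduces the claim to matrix units.\<close>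

lemma frag_sect:
  assumes "A \<in> carrier \<gg>"
  shows "r \<in> carrier R \<Longrightarrow> frag_of (A, r) - sect (toU A r) \<in> K"
  using assms unfolding pattern_carrier
proof (induction arbitrary: r rule: generate.induct)
  case one
  then show ?case using K_diff[OF frag_zero_left sect_zero] by (simp add: toU_zero)
next
  case (incl h)
  then obtain k l where h: "h = mat_unit n k l" and kl: "(k, l) \<in> prec" by auto
  show ?case unfolding h using kl incl(2) by (rule frag_sect_unit)
next
  case (inv h)
  then obtain k l where h: "h = mat_unit n k l" and kl: "(k, l) \<in> prec" by auto
  have s: "supported h" using kl by (simp add: h supported_mat_unit)
  then have c: "h \<in> carrier \<gg>" "- h \<in> carrier \<gg>" by (simp_all add: carrier_pattern_iff supported_uminus)
  have unit: "frag_of (h, r) - sect (toU h r) \<in> K"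
    unfolding h using kl inv(2) by (rule frag_sect_unit)
  have "h + - h = 0\<^sub>m n n" using supported_carrier[OF s] by (intro eq_matI) auto
  then have 1: "frag_of (0\<^sub>m n n, r) - frag_of (h, r) - frag_of (- h, r) \<in> K"
    using K_left[OF c inv(2)] by simp
  have 2: "sect (\<zero>\<^bsub>U\<^esub> \<ominus>\<^bsub>U\<^esub> toU h r) - (sect \<zero>\<^bsub>U\<^esub> - sect (toU h r)) \<in> K"
    using inv(2) by (intro sect_diff) (auto simp: toU_pat)
  have "frag_of (- h, r) - sect (toU (- h) r) =
      frag_of (0\<^sub>m n n, r) - (frag_of (0\<^sub>m n n, r) - frag_of (h, r) - frag_of (- h, r)) -
      (frag_of (h, r) - sect (toU h r)) -
      (sect (\<zero>\<^bsub>U\<^esub> \<ominus>\<^bsub>U\<^esub> toU h r) - (sect \<zero>\<^bsub>U\<^esub> - sect (toU h r))) - sect \<zero>\<^bsub>U\<^esub>"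
    using s inv(2) by (simp add: toU_uminus U.minus_eq toU_pat)
  also have "\<dots> \<in> K"
    by (rule K_diff[OF K_diff[OF K_diff[OF K_diff[OF frag_zero_left[OF inv(2)] 1] unit] 2] sect_zero])
  finally show ?case using supported_carrier[OF s] by (simp add: inv_gl_int)
next
  case (eng h1 h2)
  then have c: "h1 \<in> carrier \<gg>" "h2 \<in> carrier \<gg>" unfolding pattern_carrier by auto
  then have s: "supported h1" "supported h2" by (simp_all add: carrier_pattern_iff)
  have "frag_of (h1 + h2, r) - sect (toU (h1 + h2) r) =
      (frag_of (h1 + h2, r) - frag_of (h1, r) - frag_of (h2, r)) +
      (frag_of (h1, r) - sect (toU h1 r)) + (frag_of (h2, r) - sect (toU h2 r)) -
      (sect (toU h1 r \<oplus>\<^bsub>U\<^esub> toU h2 r) - sect (toU h1 r) - sect (toU h2 r))"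
    using s eng by (simp add: toU_add_left)
  also have "\<dots> \<in> K"
    by (rule K_diff[OF K_add[OF K_add[OF K_left eng.IH(1)] eng.IH(2)] sect_add])
      (use eng.prems c in \<open>auto simp: toU_pat\<close>)
  finally show ?case by simp
qed

lemma free_mat_sect: "u \<in> carrier F \<Longrightarrow> u - sect (free_mat u) \<in> K"
proof (induction rule: F_induct)
  case zero
  then show ?case using K_uminus[OF sect_zero] by simp
next
  case (diff u v)
  have "u - v - sect (free_mat (u - v)) =
      (u - sect (free_mat u)) - (v - sect (free_mat v)) - (sect (free_mat u \<ominus>\<^bsub>U\<^esub> free_mat v) - (sect (free_mat u) - sect (free_mat v)))"
    using diff by (simp add: free_mat_diff)
  also have "\<dots> \<in> K"
    by (rule K_diff[OF K_diff[OF diff(3,4)] sect_diff]) (use diff in auto)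
  finally show ?case .
qed (simp add: free_mat(2) frag_sect)

lemma free_mat_eq_zero_iff: "u \<in> carrier F \<Longrightarrow> free_mat u = \<zero>\<^bsub>U\<^esub> \<longleftrightarrow> u \<in> K"
  using free_mat_sect[of u] K_add[OF _ sect_zero, of "u - sect \<zero>\<^bsub>U\<^esub>"] free_mat_K by auto

lemma free_mat_sect_id:
  assumes "a \<in> pat"
  shows "free_mat (sect a) = a"
proof -
  have "free_mat (sum f S) = finsum U (\<lambda>x. free_mat (f x)) S" if "finite S" "\<And>x. x \<in> S \<Longrightarrow> f x \<in> carrier F"
    for f and S :: "(nat \<times> nat) set"
    using that by (induction S) (auto simp: free_mat_add F_sum)
  then have "free_mat (sect a) = (\<Oplus>\<^bsub>U\<^esub>x\<in>prec. free_mat (frag_of (mat_unit n (fst x) (snd x), a (fst x) (snd x))))"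
    unfolding sect_def case_prod_beta using finite_prec assms by (simp add: unit_pattern)
  also have "\<dots> = (\<Oplus>\<^bsub>U\<^esub>x\<in>prec. toU (mat_unit n (fst x) (snd x)) (a (fst x) (snd x)))"
    using assms by (intro U.finsum_cong') (auto simp: free_mat(2) unit_pattern toU_pat)
  also have "\<dots> = a"
  proof (intro ext)
    fix i j
    have "(\<Oplus>\<^bsub>U\<^esub>x\<in>prec. toU (mat_unit n (fst x) (snd x)) (a (fst x) (snd x))) i j =
      (\<Oplus>x\<in>prec. toU (mat_unit n (fst x) (snd x)) (a (fst x) (snd x)) i j)"
      using assms by (intro U_finsum) (auto simp: toU_pat)
    also have "\<dots> = (if (i, j) \<in> prec then toU (mat_unit n i j) (a i j) i j else \<zero>)"
      using assms finite_prec
      by (subst finsum_delta[where k = "(i, j)"]) (auto simp: toU_def entry_mat_unit int_pow_0')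
    also have "\<dots> = a i j"
      using assms pat_zero[OF assms, of i j] by (auto simp: toU_def entry_mat_unit)
    finally show "(\<Oplus>\<^bsub>U\<^esub>x\<in>prec. toU (mat_unit n (fst x) (snd x)) (a (fst x) (snd x))) i j = a i j" .
  qed
  finally show ?thesis .
qed

lemma K_normal: "K \<lhd> F"
  using comm_group.subgroup_imp_normal[OF F_comm_group K_subgroup] .

lemma free_bracket_diff_left: "free_bracket \<gg> R (u - u') v = free_bracket \<gg> R u v - free_bracket \<gg> R u' v"
  by (simp add: free_bracket_def frag_extend_diff)

lemma free_bracket_diff_right:
  "free_bracket \<gg> R (frag_of (A, r)) (v - v') = free_bracket \<gg> R (frag_of (A, r)) v - free_bracket \<gg> R (frag_of (A, r)) v'"
  by (simp add: free_bracket_def frag_extend_diff)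

lemma free_bracket_frag:
  "free_bracket \<gg> R (frag_of (A, r)) (frag_of (B, s)) = frag_of (A * B - B * A, r \<otimes> s)"
  by (simp add: free_bracket_def)

lemma free_bracket_zero: "free_bracket \<gg> R 0 v = 0" "free_bracket \<gg> R (frag_of (A, r)) 0 = 0"
  by (simp_all add: free_bracket_def)

lemma bracket_pattern: "A \<in> carrier \<gg> \<Longrightarrow> B \<in> carrier \<gg> \<Longrightarrow> A * B - B * A \<in> carrier \<gg>"
  and bracket_alt: "A \<in> carrier \<gg> \<Longrightarrow> B \<in> carrier \<gg> \<Longrightarrow> A * B - B * A = A * B + - (B * A)"
proof -
  assume *: "A \<in> carrier \<gg>" "B \<in> carrier \<gg>"
  then have s: "supported (A * B)" "supported (B * A)"
    by (simp_all add: carrier_pattern_iff supported_mult)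
  show e: "A * B - B * A = A * B + - (B * A)"
    using s supported_carrier by (intro eq_matI) auto
  show "A * B - B * A \<in> carrier \<gg>"
    unfolding e by (simp add: carrier_pattern_iff s supported_add supported_uminus)
qed

text \<open>Both sides are biadditive, which leaves pairs \<open>(A, r)\<close> and
  \<open>(B, s)\<close>. There the commutativity of the scalars enters, because the single scalar
  \<open>r s\<close> also has to serve for the product taken in the opposite order.\<close>

lemma free_mat_free_bracket:
  assumes "u \<in> carrier F" "v \<in> carrier F"
  shows "free_bracket \<gg> R u v \<in> carrier F \<and>
    free_mat (free_bracket \<gg> R u v) = free_mat u \<otimes>\<^bsub>U\<^esub> free_mat v \<ominus>\<^bsub>U\<^esub> free_mat v \<otimes>\<^bsub>U\<^esub> free_mat u"
  using assms
proof (induction rule: F_induct)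
  case zero
  then show ?case by (simp add: free_bracket_zero U.minus_eq)
next
  case (diff u u')
  then show ?case
    by (simp add: free_bracket_diff_left F_diff free_mat_diff)
      (simp add: U.minus_eq U.l_distr U.r_distr U.l_minus U.r_minus U.minus_add U.a_ac)
next
  case (frag A r)
  show ?case using frag(3)
  proof (induction rule: F_induct)
    case zero
    then show ?case using frag by (simp add: free_bracket_zero U.minus_eq)
  next
    case (diff v v')
    then show ?case using frag
      by (simp add: free_bracket_diff_right F_diff free_mat_diff)
        (simp add: U.minus_eq U.l_distr U.r_distr U.l_minus U.r_minus U.minus_add U.a_ac)
  next
    case (frag B s)
    have AB: "supported (A * B)" "supported (B * A)" "supported A" "supported B"
      using \<open>A \<in> carrier \<gg>\<close> \<open>B \<in> carrier \<gg>\<close> by (simp_all add: carrier_pattern_iff supported_mult)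
    have "toU (A * B - B * A) (r \<otimes> s) = toU (A * B) (r \<otimes> s) \<oplus>\<^bsub>U\<^esub> toU (- (B * A)) (r \<otimes> s)"
      using AB \<open>r \<in> carrier R\<close> \<open>s \<in> carrier R\<close> \<open>A \<in> carrier \<gg>\<close> \<open>B \<in> carrier \<gg>\<close>
      by (simp add: bracket_alt toU_add_left supported_uminus)
    also have "\<dots> = toU A r \<otimes>\<^bsub>U\<^esub> toU B s \<ominus>\<^bsub>U\<^esub> toU B s \<otimes>\<^bsub>U\<^esub> toU A r"
    proof -
      have "toU (B * A) (r \<otimes> s) = toU B s \<otimes>\<^bsub>U\<^esub> toU A r"
        using toU_mult[OF AB(4,3), of s r] m_comm[of r s] \<open>r \<in> carrier R\<close> \<open>s \<in> carrier R\<close> by simp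
      then show ?thesis
        using AB \<open>r \<in> carrier R\<close> \<open>s \<in> carrier R\<close>
        by (simp add: toU_uminus U.minus_eq toU_mult)
    qed
    finally show ?case
      using \<open>r \<in> carrier R\<close> \<open>s \<in> carrier R\<close> \<open>A \<in> carrier \<gg>\<close> \<open>B \<in> carrier \<gg>\<close>
      by (simp add: free_bracket_frag bracket_pattern free_mat(2))
  qed
qed

text \<open>The value at an arbitrary representative; by \<open>free_mat_coset\<close> the choice
  does not matter.\<close>

definition tensor_mat :: "(int mat \<times> 'a \<Rightarrow>\<^sub>0 int) set \<Rightarrow> nat \<Rightarrow> nat \<Rightarrow> 'a" where
  "tensor_mat C = free_mat (SOME u. u \<in> C)"

abbreviation coset :: "(int mat \<times> 'a \<Rightarrow>\<^sub>0 int) \<Rightarrow> (int mat \<times> 'a \<Rightarrow>\<^sub>0 int) set" where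
  "coset u \<equiv> K #>\<^bsub>F\<^esub> u"

lemma mem_coset: "u \<in> carrier F \<Longrightarrow> v \<in> coset u \<longleftrightarrow> v - u \<in> K"
proof -
  assume "u \<in> carrier F"
  have "v \<in> coset u \<longleftrightarrow> (\<exists>k\<in>K. v = k + u)" by (auto simp: r_coset_def)
  then show ?thesis by (metis add_diff_cancel diff_add_cancel)
qed

lemma coset_F: "u \<in> carrier F \<Longrightarrow> v \<in> coset u \<Longrightarrow> v \<in> carrier F"
  using mem_coset[of u v] F_add[OF K_F, of "v - u" u] by simp

lemma free_mat_coset: "u \<in> carrier F \<Longrightarrow> v \<in> coset u \<Longrightarrow> free_mat v = free_mat u"
  using free_mat_add[of "v - u" u] mem_coset[of u v] free_mat_K[of "v - u"] K_F[of "v - u"] by simp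

lemma tensor_mat_coset: "u \<in> carrier F \<Longrightarrow> tensor_mat (coset u) = free_mat u"
  unfolding tensor_mat_def using mem_coset[of u u] by (intro free_mat_coset) (auto intro: someI)

lemma L_carrier: "carrier L = coset ` carrier F"
  by (simp add: lie_tensor_def carrier_FactGroup)

lemma coset_eq_iff: "u \<in> carrier F \<Longrightarrow> v \<in> carrier F \<Longrightarrow> coset u = coset v \<longleftrightarrow> free_mat u = free_mat v"
proof
  assume *: "u \<in> carrier F" "v \<in> carrier F" "free_mat u = free_mat v"
  have "free_mat (u - v) = \<zero>\<^bsub>U\<^esub>" using * by (simp add: free_mat_diff U.minus_eq U.r_neg)
  then have "u - v \<in> K" using free_mat_eq_zero_iff[of "u - v"] * by (simp add: F_diff)
  then show "coset u = coset v"
    using group.repr_independence[OF F_group _ *(2) K_subgroup, of u] mem_coset[OF *(2)] by blast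
qed (metis tensor_mat_coset)

lemma L_mult: "u \<in> carrier F \<Longrightarrow> v \<in> carrier F \<Longrightarrow> coset u \<otimes>\<^bsub>L\<^esub> coset v = coset (u + v)"
  using normal.rcos_sum[OF K_normal, of u v] by (simp add: lie_tensor_def)

lemma L_one: "\<one>\<^bsub>L\<^esub> = coset 0"
proof -
  have "coset 0 = K" using mem_coset[of 0] by auto
  then show ?thesis by (simp add: lie_tensor_def)
qed

lemma L_bracket:
  assumes "u \<in> carrier F" "v \<in> carrier F"
  shows "lie_bracket L (coset u) (coset v) = coset (free_bracket \<gg> R u v)"
proof -
  have eq: "coset (free_bracket \<gg> R u' v') = coset (free_bracket \<gg> R u v)"
    if "u' \<in> coset u" "v' \<in> coset v" for u' v'
  proof -
    have "u' \<in> carrier F" "v' \<in> carrier F" using that assms coset_F by blast+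
    then show ?thesis
      using free_mat_free_bracket[of u' v'] free_mat_free_bracket[OF assms] assms
        free_mat_coset[OF assms(1) that(1)] free_mat_coset[OF assms(2) that(2)] by (simp add: coset_eq_iff)
  qed
  have ne: "coset u \<noteq> {}" "coset v \<noteq> {}" using assms mem_coset[of u u] mem_coset[of v v] by auto
  have "lie_bracket L (coset u) (coset v) =
      (\<Union>u'\<in>coset u. \<Union>v'\<in>coset v. coset (free_bracket \<gg> R u' v'))"
    by (simp add: lie_tensor_def)
  also have "\<dots> = (\<Union>u'\<in>coset u. \<Union>v'\<in>coset v. coset (free_bracket \<gg> R u v))"
    by (intro SUP_cong refl eq)
  also have "\<dots> = coset (free_bracket \<gg> R u v)" using ne by simp
  finally show ?thesis .
qed

lemma L_cases:
  assumes "x \<in> carrier L"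
  obtains u where "u \<in> carrier F" "x = coset u"
  using assms unfolding L_carrier by blast

lemma tensor_mat_bij: "bij_betw tensor_mat (carrier L) pat"
  unfolding bij_betw_def
proof
  show "inj_on tensor_mat (carrier L)"
  proof (rule inj_onI)
    fix x y assume "x \<in> carrier L" "y \<in> carrier L" "tensor_mat x = tensor_mat y"
    moreover obtain u v where "u \<in> carrier F" "x = coset u" "v \<in> carrier F" "y = coset v"
      using calculation(1,2) by (meson L_cases)
    ultimately show "x = y" by (simp only: tensor_mat_coset coset_eq_iff)
  qed
  have "a \<in> tensor_mat ` carrier L" if "a \<in> pat" for a
  proof -
    have "sect a \<in> carrier F" using that by (simp add: sect_F)
    then have "tensor_mat (coset (sect a)) = a" "coset (sect a) \<in> carrier L"
      using free_mat_sect_id[OF that] by (simp_all add: tensor_mat_coset L_carrier)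
    then show ?thesis by (metis imageI)
  qed
  moreover have "tensor_mat C \<in> pat" if C: "C \<in> carrier L" for C
  proof -
    obtain u where u: "u \<in> carrier F" "C = coset u" by (rule L_cases[OF C])
    show ?thesis unfolding u(2) tensor_mat_coset[OF u(1)] by (rule free_mat_pat[OF u(1)])
  qed
  ultimately show "tensor_mat ` carrier L = pat" by blast
qed

lemma coset_L: "u \<in> carrier F \<Longrightarrow> coset u \<in> carrier L"
  by (simp add: L_carrier)

lemma tensor_mat_mult:
  assumes "x \<in> carrier L" "y \<in> carrier L"
  shows "x \<otimes>\<^bsub>L\<^esub> y \<in> carrier L" "tensor_mat (x \<otimes>\<^bsub>L\<^esub> y) = tensor_mat x \<oplus>\<^bsub>U\<^esub> tensor_mat y"
proof -
  obtain u v where *: "u \<in> carrier F" "x = coset u" "v \<in> carrier F" "y = coset v"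
    using assms by (meson L_cases)
  have uv: "u + v \<in> carrier F" using * by (simp add: F_add)
  show "x \<otimes>\<^bsub>L\<^esub> y \<in> carrier L"
    unfolding *(2,4) L_mult[OF *(1,3)] by (rule coset_L[OF uv])
  show "tensor_mat (x \<otimes>\<^bsub>L\<^esub> y) = tensor_mat x \<oplus>\<^bsub>U\<^esub> tensor_mat y"
    unfolding *(2,4) L_mult[OF *(1,3)] tensor_mat_coset[OF uv] tensor_mat_coset[OF *(1)] tensor_mat_coset[OF *(3)]
    by (rule free_mat_add[OF *(1,3)])
qed

lemma tensor_mat_one: "\<one>\<^bsub>L\<^esub> \<in> carrier L" "tensor_mat \<one>\<^bsub>L\<^esub> = \<zero>\<^bsub>U\<^esub>"
  unfolding L_one tensor_mat_coset[OF F_zero] by (rule coset_L[OF F_zero], rule free_mat_zero)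

lemma tensor_mat_bracket:
  assumes "x \<in> carrier L" "y \<in> carrier L"
  shows "lie_bracket L x y \<in> carrier L"
    "tensor_mat (lie_bracket L x y) = tensor_mat x \<otimes>\<^bsub>U\<^esub> tensor_mat y \<ominus>\<^bsub>U\<^esub> tensor_mat y \<otimes>\<^bsub>U\<^esub> tensor_mat x"
proof -
  obtain u v where *: "u \<in> carrier F" "x = coset u" "v \<in> carrier F" "y = coset v"
    using assms by (meson L_cases)
  note fb = free_mat_free_bracket[OF *(1,3)]
  show "lie_bracket L x y \<in> carrier L"
    unfolding *(2,4) L_bracket[OF *(1,3)] using fb by (intro coset_L) simp
  show "tensor_mat (lie_bracket L x y) = tensor_mat x \<otimes>\<^bsub>U\<^esub> tensor_mat y \<ominus>\<^bsub>U\<^esub> tensor_mat y \<otimes>\<^bsub>U\<^esub> tensor_mat x"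
    unfolding *(2,4) L_bracket[OF *(1,3)] tensor_mat_coset[OF conjunct1[OF fb]] tensor_mat_coset[OF *(1)] tensor_mat_coset[OF *(3)]
    by (rule conjunct2[OF fb])
qed

end

section \<open>The Lazard group inside the unipotent matrices\<close>

context pattern_group
begin

lemma tensor_mat_pat: "x \<in> carrier L \<Longrightarrow> tensor_mat x \<in> pat"
  using tensor_mat_bij by (auto simp: bij_betw_def)

lemma tensor_mat_U: "x \<in> carrier L \<Longrightarrow> tensor_mat x \<in> carrier U"
  using tensor_mat_pat by simp

lemma tensor_mat_inj: "x \<in> carrier L \<Longrightarrow> y \<in> carrier L \<Longrightarrow> tensor_mat x = tensor_mat y \<Longrightarrow> x = y"
  using tensor_mat_bij by (auto simp: bij_betw_def inj_on_def)

lemma tensor_mat_surj: "a \<in> pat \<Longrightarrow> \<exists>x\<in>carrier L. tensor_mat x = a"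
  using tensor_mat_bij by (metis bij_betw_def image_iff)

lemma L_comm_group: "comm_group L"
proof (rule comm_groupI)
  fix x y z assume *: "x \<in> carrier L" "y \<in> carrier L" "z \<in> carrier L"
  show "x \<otimes>\<^bsub>L\<^esub> y \<otimes>\<^bsub>L\<^esub> z = x \<otimes>\<^bsub>L\<^esub> (y \<otimes>\<^bsub>L\<^esub> z)"
    by (rule tensor_mat_inj) (use * in \<open>simp_all add: tensor_mat_mult tensor_mat_U U.a_assoc\<close>)
  show "x \<otimes>\<^bsub>L\<^esub> y = y \<otimes>\<^bsub>L\<^esub> x"
    by (rule tensor_mat_inj) (use * in \<open>simp_all add: tensor_mat_mult tensor_mat_U U.a_comm\<close>)
next
  fix x assume *: "x \<in> carrier L"
  show "\<one>\<^bsub>L\<^esub> \<otimes>\<^bsub>L\<^esub> x = x"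
    by (rule tensor_mat_inj) (use * in \<open>simp_all add: tensor_mat_mult tensor_mat_one tensor_mat_U\<close>)
  have "\<ominus>\<^bsub>U\<^esub> tensor_mat x \<in> pat" using J_uminus[of "tensor_mat x" 0] tensor_mat_pat[OF *] by (simp add: J_0)
  then obtain y where y: "y \<in> carrier L" "tensor_mat y = \<ominus>\<^bsub>U\<^esub> tensor_mat x" using tensor_mat_surj by blast
  have "y \<otimes>\<^bsub>L\<^esub> x = \<one>\<^bsub>L\<^esub>"
    by (rule tensor_mat_inj) (use * y in \<open>simp_all add: tensor_mat_mult tensor_mat_one tensor_mat_U U.l_neg\<close>)
  then show "\<exists>y\<in>carrier L. y \<otimes>\<^bsub>L\<^esub> x = \<one>\<^bsub>L\<^esub>" using y by blast
qed (simp_all add: tensor_mat_mult tensor_mat_one)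

sublocale LG: comm_group L
  by (rule L_comm_group)

lemma tensor_mat_hom: "tensor_mat \<in> hom L (add_monoid U)"
  by (auto simp: hom_def tensor_mat_mult tensor_mat_U)

lemma tensor_mat_int_pow: "x \<in> carrier L \<Longrightarrow> tensor_mat (x [^]\<^bsub>L\<^esub> (k :: int)) = add_pow U k (tensor_mat x)"
  using hom_int_pow[OF tensor_mat_hom _ LG.is_group U.a_group] by (simp add: add_pow_def)

lemma tensor_mat_inv: "x \<in> carrier L \<Longrightarrow> tensor_mat (inv\<^bsub>L\<^esub> x) = \<ominus>\<^bsub>U\<^esub> tensor_mat x"
  using group_hom.hom_inv[of L "add_monoid U" tensor_mat x] tensor_mat_hom LG.is_group U.a_group
  by (simp add: group_hom_def group_hom_axioms_def a_inv_def)

lemma tensor_mat_finprod: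
  "finite S \<Longrightarrow> (\<And>i. i \<in> S \<Longrightarrow> f i \<in> carrier L) \<Longrightarrow>
    finprod L f S \<in> carrier L \<and> tensor_mat (finprod L f S) = (\<Oplus>\<^bsub>U\<^esub>i\<in>S. tensor_mat (f i))"
  by (induction S rule: finite_induct) (auto simp: tensor_mat_one tensor_mat_mult tensor_mat_U)

text \<open>The denominator is invertible modulo the exponent \<open>m\<close>: the residue of the
  fraction gives a solution of the equation that defines \<open>rat_scale\<close>, and a Bezout
  coefficient of the denominator shows that there is no other.\<close>

lemma tensor_mat_rat_scale:
  assumes q: "p_integral p q" and x: "x \<in> carrier L"
  shows "rat_scale L q x \<in> carrier L" "tensor_mat (rat_scale L q x) = T.act q (tensor_mat x)"
proof -
  obtain a b where ab: "quotient_of q = (a, b)" by (cases "quotient_of q")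
  have b: "\<not> p dvd b" using q by (simp add: p_integral_def ab)
  have "q = of_int a / of_int b" using quotient_of_div[OF ab] .
  from residue_char[OF this b] have r: "m dvd residue m q * b - a" .
  let ?y = "x [^]\<^bsub>L\<^esub> residue m q"
  have "rat_scale L q x = ?y"
    unfolding rat_scale_def ab fst_conv snd_conv
  proof (rule the_equality)
    have "?y [^]\<^bsub>L\<^esub> b = x [^]\<^bsub>L\<^esub> a"
    proof (rule tensor_mat_inj)
      show "tensor_mat (?y [^]\<^bsub>L\<^esub> b) = tensor_mat (x [^]\<^bsub>L\<^esub> a)"
        using x T.int_pow_cong[OF r tensor_mat_U[OF x]]
        by (simp add: tensor_mat_int_pow U.add.int_pow_pow tensor_mat_U mult.commute)
    qed (use x in auto)
    then show "?y \<in> carrier L \<and> ?y [^]\<^bsub>L\<^esub> b = x [^]\<^bsub>L\<^esub> a" using x by simp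
  next
    fix y assume y: "y \<in> carrier L \<and> y [^]\<^bsub>L\<^esub> b = x [^]\<^bsub>L\<^esub> a"
    obtain u v where uv: "u * b + v * m = 1"
      using coprime_m[OF b] bezout_int[of b m] by auto
    have "y = (y [^]\<^bsub>L\<^esub> b) [^]\<^bsub>L\<^esub> u" if "y \<in> carrier L" for y
    proof (rule tensor_mat_inj)
      have "m dvd 1 - b * u" by (metis add_diff_cancel_left' dvd_triv_right mult.commute uv)
      from T.int_pow_cong[OF this tensor_mat_U[OF that]] show "tensor_mat y = tensor_mat ((y [^]\<^bsub>L\<^esub> b) [^]\<^bsub>L\<^esub> u)"
        using that by (simp add: tensor_mat_int_pow U.add.int_pow_pow tensor_mat_U mult.commute)
    qed (use that in auto)
    moreover have "?y [^]\<^bsub>L\<^esub> b = x [^]\<^bsub>L\<^esub> a"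
    proof (rule tensor_mat_inj)
      show "tensor_mat (?y [^]\<^bsub>L\<^esub> b) = tensor_mat (x [^]\<^bsub>L\<^esub> a)"
        using x T.int_pow_cong[OF r tensor_mat_U[OF x]]
        by (simp add: tensor_mat_int_pow U.add.int_pow_pow tensor_mat_U mult.commute)
    qed (use x in auto)
    ultimately show "y = ?y" using y x LG.int_pow_closed by metis
  qed
  then show "rat_scale L q x \<in> carrier L" "tensor_mat (rat_scale L q x) = T.act q (tensor_mat x)"
    using x by (simp_all add: tensor_mat_int_pow T.act_def)
qed

lemma tensor_mat_nested_bracket:
  "set ws \<subseteq> carrier L \<Longrightarrow> nested_bracket L ws \<in> carrier L \<and>
    tensor_mat (nested_bracket L ws) = nested_bracket (commutator_lie U) (map tensor_mat ws)"
  by (induction ws rule: induct_list012)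
    (auto simp: tensor_mat_one tensor_mat_bracket commutator_lie_def)

text \<open>A bracket with an element of depth \<open>k\<close> has depth at least
  \<open>k + 1\<close>. As \<open>J h\<close> is zero, this bounds the nilpotency class by
  \<open>h\<close>.\<close>

lemma tensor_mat_lower_central: "lower_central L k \<subseteq> carrier L \<and> tensor_mat ` lower_central L k \<subseteq> J k"
proof (induction k)
  case 0
  then show ?case using tensor_mat_pat by (auto simp: J_0)
next
  case (Suc k)
  let ?G = "{lie_bracket L x y |x y. x \<in> carrier L \<and> y \<in> lower_central L k}"
  have G: "g \<in> carrier L \<and> tensor_mat g \<in> J (Suc k)" if g: "g \<in> ?G" for g
  proof -
    obtain x y where xy: "g = lie_bracket L x y" "x \<in> carrier L" "y \<in> lower_central L k" using g by blast
    then have "y \<in> carrier L" "tensor_mat y \<in> J k" using Suc by auto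
    then show ?thesis using xy(2) J_mult[OF tensor_mat_pat[OF xy(2)]] unfolding xy(1)
      by (simp add: tensor_mat_bracket J_minus)
  qed
  have "z \<in> carrier L \<and> tensor_mat z \<in> J (Suc k)" if "z \<in> generate L ?G" for z
    using that
  proof (induction rule: generate.induct)
    case one
    then show ?case using additive_subgroup.zero_closed[OF J_subgroup] by (simp add: tensor_mat_one)
  next
    case (incl g)
    then show ?case by (rule G)
  next
    case (inv g)
    then show ?case using G[OF inv] by (simp add: tensor_mat_inv J_uminus)
  next
    case (eng g g')
    then show ?case by (simp add: tensor_mat_mult J_add)
  qed
  then show ?case by auto
qed

definition "cl = nilpotency_class L"

lemma lower_central_one: "lower_central L h = {\<one>\<^bsub>L\<^esub>}"
proof -
  have "z = \<one>\<^bsub>L\<^esub>" if z: "z \<in> lower_central L h" for z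
  proof (rule tensor_mat_inj)
    have "z \<in> carrier L" "tensor_mat z \<in> J h" using z tensor_mat_lower_central by blast+
    then show "z \<in> carrier L" "tensor_mat z = tensor_mat \<one>\<^bsub>L\<^esub>" using J_top[of h] by (simp_all add: tensor_mat_one)
  qed simp
  moreover have "\<one>\<^bsub>L\<^esub> \<in> lower_central L h" by (simp add: generate.one)
  ultimately show ?thesis by blast
qed

lemma cl_le: "cl \<le> h"
  unfolding cl_def nilpotency_class_def using lower_central_one by (rule Least_le)

lemma lower_central_cl: "lower_central L cl = {\<one>\<^bsub>L\<^esub>}"
  unfolding cl_def nilpotency_class_def using lower_central_one by (rule LeastI)

lemma lower_central_above: "lower_central L (cl + j) = {\<one>\<^bsub>L\<^esub>}"
proof (induction j)
  case (Suc j)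
  have b: "lie_bracket L x \<one>\<^bsub>L\<^esub> = \<one>\<^bsub>L\<^esub>" if "x \<in> carrier L" for x
    by (rule tensor_mat_inj) (use that in \<open>simp_all add: tensor_mat_bracket tensor_mat_one tensor_mat_U U.minus_eq\<close>)
  have "z = \<one>\<^bsub>L\<^esub>" if "z \<in> lower_central L (Suc (cl + j))" for z
    using that unfolding lower_central.simps
  proof (induction rule: generate.induct)
    case (incl g)
    then obtain x where "x \<in> carrier L" "g = lie_bracket L x \<one>\<^bsub>L\<^esub>" using Suc by auto
    then show ?case using b by simp
  next
    case (inv g)
    then obtain x where "x \<in> carrier L" "g = lie_bracket L x \<one>\<^bsub>L\<^esub>" using Suc by auto
    then show ?case using b by simp
  qed simp_all
  moreover have "\<one>\<^bsub>L\<^esub> \<in> lower_central L (Suc (cl + j))" by (simp add: generate.one)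
  ultimately have "lower_central L (Suc (cl + j)) = {\<one>\<^bsub>L\<^esub>}" by blast
  then show ?case by simp
qed (simp add: lower_central_cl)

lemma nested_bracket_lower_central:
  "set (x # ws) \<subseteq> carrier L \<Longrightarrow> nested_bracket L (x # ws) \<in> lower_central L (length ws)"
proof (induction ws arbitrary: x)
  case (Cons y ws)
  then show ?case by (auto intro!: generate.incl)
qed simp

lemma nested_bracket_large:
  assumes "set ws \<subseteq> carrier L" "cl < length ws"
  shows "nested_bracket L ws = \<one>\<^bsub>L\<^esub>"
proof -
  obtain x xs where ws: "ws = x # xs" using assms(2) by (cases ws) auto
  have "nested_bracket L ws \<in> lower_central L (cl + (length xs - cl))"
    using nested_bracket_lower_central[of x xs] assms by (simp add: ws)
  then show ?thesis by (simp add: lower_central_above)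
qed

text \<open>\<open>bch\<close> sums up to the class \<open>cl\<close>, which can be smaller than
  \<open>h\<close> (for example for the empty order), whereas the exponential works with
  \<open>h\<close>. The terms in between are brackets of more than \<open>cl\<close> elements and
  vanish.\<close>

lemma tensor_mat_bch:
  assumes x: "x \<in> carrier L" and y: "y \<in> carrier L"
  shows "bch L x y \<in> carrier L" "tensor_mat (bch L x y) = (\<Oplus>\<^bsub>U\<^esub>ws\<in>dynkin_index h. T.act (dynkin_coeff ws)
      (nested_bracket (commutator_lie U) (dynkin_word (tensor_mat x) (tensor_mat y) ws)))"
proof -
  let ?t = "\<lambda>ws. rat_scale L (dynkin_coeff ws) (nested_bracket L (dynkin_word x y ws))"
  let ?u = "\<lambda>ws. T.act (dynkin_coeff ws) (nested_bracket (commutator_lie U) (dynkin_word (tensor_mat x) (tensor_mat y) ws))"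
  have w: "set (dynkin_word x y ws) \<subseteq> carrier L" for ws
    using set_dynkin_word[of x y ws] x y by auto
  have sub: "dynkin_index cl \<subseteq> dynkin_index h" using cl_le by (auto simp: dynkin_index_def)
  have pc: "p_integral p (dynkin_coeff ws)" if "ws \<in> dynkin_index h" for ws
    by (rule p_integral_dynkin_coeff[OF that large_p])
  have map: "map tensor_mat (dynkin_word x y ws) = dynkin_word (tensor_mat x) (tensor_mat y) ws" for ws
    by (induction ws) (auto simp: dynkin_word_def)
  have nb: "nested_bracket L (dynkin_word x y ws) \<in> carrier L"
    "tensor_mat (nested_bracket L (dynkin_word x y ws)) = nested_bracket (commutator_lie U) (dynkin_word (tensor_mat x) (tensor_mat y) ws)" for ws
    using tensor_mat_nested_bracket[OF w[of ws]] by (simp_all add: map)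
  have t: "?t ws \<in> carrier L" "tensor_mat (?t ws) = ?u ws" if "ws \<in> dynkin_index h" for ws
    using tensor_mat_rat_scale[OF pc[OF that] nb(1)[of ws]] by (simp_all add: nb(2))
  have fp: "finprod L ?t (dynkin_index cl) \<in> carrier L \<and>
      tensor_mat (finprod L ?t (dynkin_index cl)) = (\<Oplus>\<^bsub>U\<^esub>ws\<in>dynkin_index cl. tensor_mat (?t ws))"
    by (rule tensor_mat_finprod) (use t(1) sub in auto)
  have bch: "bch L x y = finprod L ?t (dynkin_index cl)" by (simp add: bch_def cl_def)
  then show "bch L x y \<in> carrier L" using fp by simp
  have uc: "?u ws \<in> carrier U" if "ws \<in> dynkin_index h" for ws
    using t(2)[OF that] tensor_mat_U[OF t(1)[OF that]] by simp
  have "tensor_mat (bch L x y) = (\<Oplus>\<^bsub>U\<^esub>ws\<in>dynkin_index cl. ?u ws)"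
    unfolding bch conjunct2[OF fp] using t(2) uc sub by (intro U.finsum_cong') auto
  also have "\<dots> = (\<Oplus>\<^bsub>U\<^esub>ws\<in>dynkin_index h. ?u ws)"
  proof (rule U.add.finprod_mono_neutral_cong_left[OF finite_dynkin_index sub])
    fix ws assume ws: "ws \<in> dynkin_index h - dynkin_index cl"
    then have "cl < length (dynkin_word x y ws)"
      by (auto simp: dynkin_index_def length_dynkin_word)
    then have "nested_bracket L (dynkin_word x y ws) = \<one>\<^bsub>L\<^esub>"
      by (rule nested_bracket_large[OF w])
    then have "nested_bracket (commutator_lie U) (dynkin_word (tensor_mat x) (tensor_mat y) ws) = \<zero>\<^bsub>U\<^esub>"
      using nb(2)[of ws] tensor_mat_one(2) by metis
    then show "?u ws = \<zero>\<^bsub>U\<^esub>" by simp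
  qed (use uc in auto)
  finally show "tensor_mat (bch L x y) = (\<Oplus>\<^bsub>U\<^esub>ws\<in>dynkin_index h. ?u ws)" .
qed

definition group_elem :: "(int mat \<times> 'a \<Rightarrow>\<^sub>0 int) set \<Rightarrow> nat \<Rightarrow> nat \<Rightarrow> 'a" where
  "group_elem x = E (tensor_mat x)"

lemma group_elem_unipotent: "x \<in> carrier L \<Longrightarrow> group_elem x \<in> unipotent"
  by (simp add: group_elem_def E_unipotent tensor_mat_pat)

lemma group_elem_inj: "x \<in> carrier L \<Longrightarrow> y \<in> carrier L \<Longrightarrow> group_elem x = group_elem y \<Longrightarrow> x = y"
  unfolding group_elem_def using E_inj[OF tensor_mat_pat tensor_mat_pat] tensor_mat_inj by blast

lemma group_elem_bch: "x \<in> carrier L \<Longrightarrow> y \<in> carrier L \<Longrightarrow> group_elem (bch L x y) = group_elem x \<otimes>\<^bsub>U\<^esub> group_elem y"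
  unfolding group_elem_def by (simp add: tensor_mat_bch E_dynkin tensor_mat_pat)

lemma group_elem_square_zero:
  assumes "z \<in> pat" "z \<otimes>\<^bsub>U\<^esub> z = \<zero>\<^bsub>U\<^esub>"
  shows "\<exists>x\<in>carrier L. group_elem x = \<one>\<^bsub>U\<^esub> \<oplus>\<^bsub>U\<^esub> z"
  using tensor_mat_surj[OF assms(1)] E_square_zero[OF assms] by (auto simp: group_elem_def)

end

section \<open>Truncated valuation rings and their characters\<close>

text \<open>A counting form of the homomorphism theorem for a mere function whose fibres are the
  classes modulo \<open>N\<close>. It serves for multiplication by the uniformizer, for characters
  and for coset representatives alike; the bijection comes from a chosen section of
  \<open>\<phi>\<close>.\<close>

lemma (in abelian_group) card_fibres:
  assumes H: "additive_subgroup H G" and fin: "finite H" and N: "N \<subseteq> H"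
    and \<phi>: "\<And>a b. a \<in> H \<Longrightarrow> b \<in> H \<Longrightarrow> \<phi> a = \<phi> b \<longleftrightarrow> a \<ominus> b \<in> N"
  shows "card H = card N * card (\<phi> ` H)"
proof -
  have Hc: "a \<in> carrier G" if "a \<in> H" for a
    using additive_subgroup.a_subset[OF H] that by blast
  have minus: "a \<ominus> b \<in> H" if "a \<in> H" "b \<in> H" for a b
    using that additive_subgroup.a_closed[OF H] additive_subgroup.a_inv_closed[OF H] by (simp add: minus_eq)
  define s where "s y = (SOME a. a \<in> H \<and> \<phi> a = y)" for y
  have s: "s y \<in> H" "\<phi> (s y) = y" if "y \<in> \<phi> ` H" for y
  proof -
    have "\<exists>a. a \<in> H \<and> \<phi> a = y" using that by blast
    from someI_ex[OF this] show "s y \<in> H" "\<phi> (s y) = y" by (auto simp: s_def)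
  qed
  have "bij_betw (\<lambda>(c, y). c \<oplus> s y) (N \<times> \<phi> ` H) H"
  proof (rule bij_betw_byWitness[where f' = "\<lambda>a. (a \<ominus> s (\<phi> a), \<phi> a)"])
    have phi_add: "\<phi> (c \<oplus> s y) = y" if "c \<in> N" "y \<in> \<phi> ` H" for c y
    proof -
      have *: "c \<in> H" "s y \<in> H" using that N s by auto
      have "c \<oplus> s y \<ominus> s y = c" using * Hc by (simp add: minus_eq a_assoc r_neg)
      then have "\<phi> (c \<oplus> s y) = \<phi> (s y)"
        using \<phi>[of "c \<oplus> s y" "s y"] * that additive_subgroup.a_closed[OF H] by simp
      then show ?thesis using s that by simp
    qed
    show "\<forall>x\<in>N \<times> \<phi> ` H. (\<lambda>a. (a \<ominus> s (\<phi> a), \<phi> a)) ((\<lambda>(c, y). c \<oplus> s y) x) = x"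
    proof
      fix x assume "x \<in> N \<times> \<phi> ` H"
      then obtain c y where x: "x = (c, y)" "c \<in> N" "y \<in> \<phi> ` H" by blast
      then have "c \<in> carrier G" "s y \<in> carrier G" using N s Hc by blast+
      then show "(\<lambda>a. (a \<ominus> s (\<phi> a), \<phi> a)) ((\<lambda>(c, y). c \<oplus> s y) x) = x"
        using x phi_add[of c y] by (simp add: minus_eq a_assoc r_neg)
    qed
    show "\<forall>a\<in>H. (\<lambda>(c, y). c \<oplus> s y) ((\<lambda>a. (a \<ominus> s (\<phi> a), \<phi> a)) a) = a"
      using s Hc by (auto simp: minus_eq a_assoc l_neg)
    show "(\<lambda>(c, y). c \<oplus> s y) ` (N \<times> \<phi> ` H) \<subseteq> H"
      using N s additive_subgroup.a_closed[OF H] by auto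
    show "(\<lambda>a. (a \<ominus> s (\<phi> a), \<phi> a)) ` H \<subseteq> N \<times> \<phi> ` H"
    proof (rule image_subsetI)
      fix a assume a: "a \<in> H"
      then have "a \<ominus> s (\<phi> a) \<in> N" using \<phi>[of a "s (\<phi> a)"] s[of "\<phi> a"] by simp
      then show "(a \<ominus> s (\<phi> a), \<phi> a) \<in> N \<times> \<phi> ` H" using a by simp
    qed
  qed
  then have "card H = card (N \<times> \<phi> ` H)" by (simp add: bij_betw_same_card)
  then show ?thesis by (simp add: card_cartesian_product)
qed

section \<open>The powers of the maximal ideal\<close>

locale tvr = finite_truncated_valuation_ring R for R (structure) +
  fixes d p e f :: nat
  assumes params: "tvr_parameters R d p e f" and p_gt_1: "p > 1"
begin

lemma maximal: "maximalideal (max_ideal R) R"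
  unfolding max_ideal_def using local_ring by (rule theI')

definition "unif = (SOME x. x \<in> carrier R \<and> max_ideal R = PIdl x)"

lemma unif: "unif \<in> carrier R" "max_ideal R = PIdl unif"
proof -
  have "\<exists>x. x \<in> carrier R \<and> max_ideal R = PIdl x"
    using principalideal.generate[OF principal] cgenideal_eq_genideal by metis
  from someI_ex[OF this] show "unif \<in> carrier R" "max_ideal R = PIdl unif"
    by (auto simp: unif_def)
qed

definition mi :: "nat \<Rightarrow> 'a set" where
  "mi k = PIdl (unif [^] k)"

lemma mi_iff: "x \<in> mi k \<longleftrightarrow> (\<exists>y\<in>carrier R. x = y \<otimes> unif [^] k)"
  by (auto simp: mi_def cgenideal_def)

lemma miI: "y \<in> carrier R \<Longrightarrow> y \<otimes> unif [^] k \<in> mi k"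
  unfolding mi_iff by blast

lemma pow_closed [simp]: "unif [^] (k :: nat) \<in> carrier R"
  using unif by simp

lemma ideal_mi: "ideal (mi k) R"
  unfolding mi_def by (rule cgenideal_ideal) simp

lemma sub_mi: "additive_subgroup (mi k) R"
  using ideal_mi by (rule ideal.axioms)

lemma mi_carrier: "x \<in> mi k \<Longrightarrow> x \<in> carrier R"
  using additive_subgroup.a_subset[OF sub_mi] by blast

lemma ideal_power_mi: "ideal_power R (max_ideal R) k = mi k"
proof (induction k)
  case 0
  have "mi 0 = carrier R" by (auto simp: mi_iff)
  then show ?case by (simp add: ideal_power_def ideals_set_def)
next
  case (Suc k)
  have "ideal_power R (max_ideal R) (Suc k) = ideal_prod R (mi k) (PIdl unif)"
    using Suc unif(2) by (simp add: ideal_power_def ideals_set_def)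
  also have "\<dots> = mi (Suc k)"
  proof (intro equalityI subsetI)
    fix x assume "x \<in> ideal_prod R (mi k) (PIdl unif)"
    then show "x \<in> mi (Suc k)"
    proof (induction rule: ideal_prod.induct)
      case (prod a b)
      then obtain y z where yz: "y \<in> carrier R" "a = y \<otimes> unif [^] k" "z \<in> carrier R" "b = z \<otimes> unif"
        by (auto simp: mi_iff cgenideal_def)
      then have "a \<otimes> b = (y \<otimes> z) \<otimes> unif [^] Suc k" using unif(1) by (simp add: m_ac)
      then show ?case using miI[of "y \<otimes> z" "Suc k"] yz by simp
    next
      case (sum a b)
      then show ?case using additive_subgroup.a_closed[OF sub_mi] by blast
    qed
  next
    fix x assume "x \<in> mi (Suc k)"
    then obtain y where y: "y \<in> carrier R" "x = y \<otimes> unif [^] Suc k" unfolding mi_iff by blast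
    then have "x = (y \<otimes> unif [^] k) \<otimes> unif" using unif(1) by (simp add: m_assoc)
    then show "x \<in> ideal_prod R (mi k) (PIdl unif)"
      using ideal_prod.prod[OF miI[OF y(1)] cgenideal_self[OF unif(1)]] by simp
  qed
  finally show ?case .
qed

lemma mi_0: "mi 0 = carrier R"
  by (auto simp: mi_iff)

lemma mi_1: "mi 1 = max_ideal R"
  using unif by (simp add: mi_def)

lemma d_pos: "1 \<le> d" and mi_d: "mi d = {\<zero>}" and mi_lt_d: "1 \<le> k \<Longrightarrow> k < d \<Longrightarrow> mi k \<noteq> {\<zero>}"
  and p_char: "p = ring_char (R Quot max_ideal R)" and e_pos: "1 \<le> e" and e_le: "e \<le> d"
  and p_mult: "{[p] \<cdot> x |x. x \<in> carrier R} = mi e" and f_pos: "1 \<le> f"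
  and quot_field: "field (R Quot max_ideal R)"
  and card_quot: "card (carrier (R Quot max_ideal R)) = p ^ f"
  using params unfolding tvr_parameters_def ideal_power_mi by blast+

lemma pow_d: "unif [^] d = \<zero>"
proof -
  have "\<one> \<otimes> unif [^] d \<in> mi d" unfolding mi_iff by blast
  then show ?thesis using mi_d by simp
qed

lemma one_notin_max: "\<one> \<notin> max_ideal R"
  using maximalideal.I_notcarr[OF maximal] ideal.one_imp_carrier[OF maximalideal.axioms(1)[OF maximal]] by auto

lemma pow_nonzero: "k < d \<Longrightarrow> unif [^] k \<noteq> \<zero>"
proof
  assume k: "k < d" "unif [^] k = \<zero>"
  then have z: "x = \<zero>" if "x \<in> mi k" for x using that mi_iff[of x k] by auto
  have "\<zero> \<in> mi k" by (rule additive_subgroup.zero_closed[OF sub_mi])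
  with z have "mi k = {\<zero>}" by blast
  then have "k = 0" using mi_lt_d[of k] k(1) by linarith
  then have "\<one> = \<zero>" using k(2) by simp
  moreover have "\<zero> \<in> max_ideal R"
    using additive_subgroup.zero_closed[OF sub_mi[of 1]] by (simp add: mi_1[symmetric])
  ultimately show False using one_notin_max by simp
qed

lemma mi_antimono: "j \<le> k \<Longrightarrow> mi k \<subseteq> mi j"
proof
  fix x assume "j \<le> k" "x \<in> mi k"
  then obtain y where y: "y \<in> carrier R" "x = y \<otimes> unif [^] k" by (auto simp: mi_iff)
  have "unif [^] k = unif [^] (k - j) \<otimes> unif [^] j"
    using nat_pow_mult[of unif "k - j" j] unif(1) \<open>j \<le> k\<close> by simp
  then have "x = (y \<otimes> unif [^] (k - j)) \<otimes> unif [^] j" using y by (simp add: m_assoc)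
  then show "x \<in> mi j" using miI[of "y \<otimes> unif [^] (k - j)" j] y(1) by simp
qed

lemma one_minus_nilpotent:
  assumes "a \<in> carrier R"
  shows "\<exists>z\<in>carrier R. (\<one> \<ominus> a) \<otimes> z = \<one> \<ominus> a [^] (k :: nat)"
proof (induction k)
  case 0
  have "(\<one> \<ominus> a) \<otimes> \<zero> = \<one> \<ominus> a [^] (0 :: nat)" using assms by (simp add: minus_eq r_neg)
  then show ?case by blast
next
  case (Suc k)
  then obtain z where z: "z \<in> carrier R" "(\<one> \<ominus> a) \<otimes> z = \<one> \<ominus> a [^] k" by blast
  have "(\<one> \<ominus> a) \<otimes> (z \<oplus> a [^] k) = (\<one> \<ominus> a [^] k) \<oplus> (\<one> \<ominus> a) \<otimes> a [^] k"
    using z assms by (simp add: r_distr)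
  also have "\<dots> = \<one> \<ominus> a [^] Suc k"
    using assms by (simp add: minus_eq l_distr l_minus m_comm[of a] a_ac r_neg1 r_neg2)
  finally show ?case using z assms by blast
qed

text \<open>Maximality gives \<open>1 = a + r x\<close> with \<open>a\<close> in the maximal ideal.
  Since \<open>a\<close> is nilpotent, \<open>r x = 1 - a\<close> is inverted by a geometric
  sum.\<close>

lemma unit_if:
  assumes x: "x \<in> carrier R" "x \<notin> max_ideal R"
  shows "\<exists>y\<in>carrier R. x \<otimes> y = \<one>"
proof -
  let ?m = "max_ideal R" and ?J = "set_add R (max_ideal R) (PIdl x)"
  have idm: "ideal ?m R" using maximal by (rule maximalideal.axioms)
  have idx: "ideal (PIdl x) R" using x by (simp add: cgenideal_ideal)
  have J: "ideal ?J R" by (rule add_ideals[OF idm idx])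
  have mJ: "?m \<subseteq> ?J"
  proof
    fix a assume a: "a \<in> ?m"
    then have "a \<in> carrier R" using idm ideal.Icarr by metis
    moreover have "\<zero> \<in> PIdl x" using additive_subgroup.zero_closed idx ideal.axioms(1) by blast
    moreover have "a = a \<oplus> \<zero>" using calculation by simp
    ultimately show "a \<in> ?J" using a unfolding set_add_def' by blast
  qed
  have xJ: "x \<in> ?J"
  proof -
    have "\<zero> \<in> ?m" using additive_subgroup.zero_closed idm ideal.axioms(1) by blast
    moreover have "x \<in> PIdl x" using x by (simp add: cgenideal_self)
    moreover have "x = \<zero> \<oplus> x" using x by simp
    ultimately show ?thesis unfolding set_add_def' by blast
  qed
  have "?J = carrier R"
    using maximalideal.I_maximal[OF maximal J mJ] xJ x ideal.Icarr[OF J] by blast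
  then have "\<one> \<in> ?J" by simp
  then obtain a b where ab: "a \<in> ?m" "b \<in> PIdl x" "\<one> = a \<oplus> b" by (auto simp: set_add_def')
  then obtain r where r: "r \<in> carrier R" "b = r \<otimes> x" by (auto simp: cgenideal_def)
  have a: "a \<in> carrier R" using ab idm ideal.Icarr by metis
  obtain c where c: "c \<in> carrier R" "a = c \<otimes> unif" using ab unif by (auto simp: cgenideal_def)
  have "a [^] d = c [^] d \<otimes> unif [^] d" using c unif by (simp add: nat_pow_distrib)
  then have "a [^] d = \<zero>" using c pow_d by simp
  moreover obtain z where z: "z \<in> carrier R" "(\<one> \<ominus> a) \<otimes> z = \<one> \<ominus> a [^] d"
    using one_minus_nilpotent[OF a] by blast
  ultimately have "(\<one> \<ominus> a) \<otimes> z = \<one>" by (simp add: minus_eq)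
  moreover have "\<one> \<ominus> a = x \<otimes> r"
    using ab a r x by (simp add: minus_eq m_comm a_ac r_neg1 r_neg2)
  ultimately have "x \<otimes> (r \<otimes> z) = \<one>" using x r z by (simp add: m_assoc)
  then show ?thesis using r z by blast
qed

text \<open>\<open>j\<close> is the largest exponent for which \<open>x\<close> lies in
  \<open>mi j\<close>. The cofactor is outside the maximal ideal, as otherwise one more power of the
  uniformizer could be split off, and is therefore a unit.\<close>

lemma decompose:
  assumes "x \<in> carrier R" "x \<noteq> \<zero>"
  shows "\<exists>j<d. \<exists>u\<in>carrier R. \<exists>v\<in>carrier R. u \<otimes> v = \<one> \<and> x = u \<otimes> unif [^] j"
proof -
  define j where "j = (GREATEST j. x \<in> mi j)"
  have bd: "\<forall>k. x \<in> mi k \<longrightarrow> k \<le> d"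
  proof (intro allI impI)
    fix k assume "x \<in> mi k"
    then show "k \<le> d" using mi_antimono[of d k] assms mi_d by (cases "k \<le> d") auto
  qed
  have "x \<in> mi 0" using assms by (simp add: mi_0)
  then have xj: "x \<in> mi j" and mx: "\<And>k. x \<in> mi k \<Longrightarrow> k \<le> j"
    unfolding j_def using bd GreatestI_nat[of "\<lambda>j. x \<in> mi j" 0 d] Greatest_le_nat[of "\<lambda>j. x \<in> mi j" _ d] by blast+
  have "j < d" using bd xj mi_d assms by (metis le_neq_implies_less singletonD)
  obtain u where u: "u \<in> carrier R" "x = u \<otimes> unif [^] j" using xj by (auto simp: mi_iff)
  have "u \<notin> max_ideal R"
  proof
    assume "u \<in> max_ideal R"
    then obtain c where c: "c \<in> carrier R" "u = c \<otimes> unif" using unif by (auto simp: cgenideal_def)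
    then have "x = c \<otimes> unif [^] Suc j" using u unif by (simp add: m_assoc m_comm)
    then have "x \<in> mi (Suc j)" using miI[OF c(1), of "Suc j"] by simp
    then show False using mx[of "Suc j"] by simp
  qed
  then obtain v where "v \<in> carrier R" "u \<otimes> v = \<one>" using unit_if[OF u(1)] by blast
  then show ?thesis using \<open>j < d\<close> u by blast
qed

lemma ann_pow:
  assumes "k \<le> d"
  shows "{x \<in> carrier R. x \<otimes> unif [^] k = \<zero>} = mi (d - k)"
proof (intro equalityI subsetI)
  fix x assume "x \<in> mi (d - k)"
  then obtain y where y: "y \<in> carrier R" "x = y \<otimes> unif [^] (d - k)" by (auto simp: mi_iff)
  have "unif [^] (d - k) \<otimes> unif [^] k = \<zero>"
    using nat_pow_mult[of unif "d - k" k] unif(1) assms pow_d by simp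
  then show "x \<in> {x \<in> carrier R. x \<otimes> unif [^] k = \<zero>}" using y by (simp add: m_assoc)
next
  fix x assume x: "x \<in> {x \<in> carrier R. x \<otimes> unif [^] k = \<zero>}"
  show "x \<in> mi (d - k)"
  proof (cases "x = \<zero>")
    case True
    then show ?thesis using additive_subgroup.zero_closed[OF sub_mi] by simp
  next
    case False
    obtain u v j where *: "j < d" "u \<in> carrier R" "v \<in> carrier R" "u \<otimes> v = \<one>" "x = u \<otimes> unif [^] j"
      using decompose[OF _ False] x by (elim CollectE conjE) blast
    have "unif [^] (j + k) = (u \<otimes> v) \<otimes> (unif [^] j \<otimes> unif [^] k)"
      using nat_pow_mult[of unif j k] unif(1) * by simp
    also have "\<dots> = v \<otimes> (x \<otimes> unif [^] k)"
      unfolding *(5) using *(2,3) by (simp add: m_ac)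
    also have "\<dots> = \<zero>" using x * by simp
    finally have "\<not> j + k < d" using pow_nonzero by blast
    then have "x \<in> mi j \<and> d - k \<le> j" using miI[OF *(2), of j] *(5) by simp
    then show ?thesis using mi_antimono by blast
  qed
qed

lemma finite_mi [simp]: "finite (mi k)"
  using finite_carrier mi_carrier by (meson finite_subset subsetI)

text \<open>Multiplication by the uniformizer maps \<open>mi k\<close> onto
  \<open>mi (Suc k)\<close>, and its kernel is \<open>mi (d - 1)\<close>.\<close>

lemma card_mi_Suc:
  assumes "k < d"
  shows "card (mi k) = card (mi (d - 1)) * card (mi (Suc k))"
proof -
  have "card (mi k) = card (mi (d - 1)) * card ((\<lambda>x. x \<otimes> unif) ` mi k)"
  proof (rule card_fibres[OF sub_mi finite_mi])
    show "mi (d - 1) \<subseteq> mi k" using assms by (intro mi_antimono) simp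
    fix a b assume ab: "a \<in> mi k" "b \<in> mi k"
    then have c: "a \<in> carrier R" "b \<in> carrier R" using mi_carrier by auto
    have "a \<otimes> unif = b \<otimes> unif \<longleftrightarrow> (a \<ominus> b) \<otimes> unif = \<zero>"
      using c unif(1) by (simp add: minus_eq l_distr l_minus) (metis minus_eq m_closed r_right_minus_eq)
    also have "\<dots> \<longleftrightarrow> a \<ominus> b \<in> mi (d - 1)"
      using ann_pow[of 1] d_pos c unif(1) by auto
    finally show "a \<otimes> unif = b \<otimes> unif \<longleftrightarrow> a \<ominus> b \<in> mi (d - 1)" .
  qed
  moreover have "(\<lambda>x. x \<otimes> unif) ` mi k = mi (Suc k)"
  proof (intro equalityI subsetI)
    fix x assume "x \<in> (\<lambda>x. x \<otimes> unif) ` mi k"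
    then obtain y where y: "y \<in> carrier R" "x = y \<otimes> unif [^] k \<otimes> unif" by (auto simp: mi_iff)
    then have "x = y \<otimes> unif [^] Suc k" using unif(1) by (simp add: m_assoc)
    then show "x \<in> mi (Suc k)" using miI[OF y(1), of "Suc k"] by simp
  next
    fix x assume "x \<in> mi (Suc k)"
    then obtain y where y: "y \<in> carrier R" "x = y \<otimes> unif [^] Suc k" unfolding mi_iff by blast
    then have "x = (y \<otimes> unif [^] k) \<otimes> unif" using unif(1) by (simp add: m_assoc)
    moreover have "y \<otimes> unif [^] k \<in> mi k" using y(1) by (rule miI)
    ultimately show "x \<in> (\<lambda>x. x \<otimes> unif) ` mi k" by blast
  qed
  ultimately show ?thesis by simp
qed

text \<open>The order of the ring is counted twice: as kernel times image of multiplication by the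
  uniformizer, and by Lagrange as maximal ideal times residue field. Both products contain the order
  of the maximal ideal.\<close>

lemma card_socle: "card (mi (d - 1)) = p ^ f"
proof -
  have "card (carrier R) = card (mi (d - 1)) * card (mi 1)"
    using card_mi_Suc[of 0] d_pos by (simp add: mi_0)
  moreover have "card (carrier R) = card (mi 1) * card (carrier (R Quot max_ideal R))"
    using a_lagrange[OF finite_carrier sub_mi[of 1]] unfolding mi_1
    by (simp add: FactRing_def order_def mult.commute)
  moreover have "card (mi 1) > 0"
    using additive_subgroup.zero_closed[OF sub_mi[of 1]] by (auto simp: card_gt_0_iff)
  ultimately have "card (mi 1) * card (mi (d - 1)) = card (mi 1) * p ^ f"
    by (metis card_quot mult.commute)
  then show ?thesis using \<open>card (mi 1) > 0\<close> by (metis mult_left_cancel less_numeral_extra(3))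
qed

lemma card_mi: "k \<le> d \<Longrightarrow> card (mi k) = p ^ (f * (d - k))"
proof (induction k rule: inc_induct)
  case base
  then show ?case by (simp add: mi_d)
next
  case (step k)
  have "d - k = Suc (d - Suc k)" using step by simp
  then show ?case using step card_mi_Suc[of k] card_socle by (simp add: power_add)
qed

lemma card_carrier: "card (carrier R) = p ^ (f * d)"
  using card_mi[of 0] by (simp add: mi_0)

text \<open>The characteristic of a field cannot split into proper factors. The values 0 and 1 of
  \<open>ring_char\<close> are excluded by \<open>p_gt_1\<close>, which the bound on
  \<open>p\<close> in the theorem supplies.\<close>

lemma prime_p: "Factorial_Ring.prime p"
proof -
  interpret Q: field "R Quot max_ideal R" by (rule quot_field)
  have dvd: "p dvd k \<longleftrightarrow> [k] \<cdot>\<^bsub>R Quot max_ideal R\<^esub> \<one>\<^bsub>R Quot max_ideal R\<^esub> = \<zero>\<^bsub>R Quot max_ideal R\<^esub>" for k :: nat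
    using group.pow_eq_id[OF Q.a_group, of "\<one>\<^bsub>R Quot max_ideal R\<^esub>" k]
    by (simp add: p_char ring_char_def add_pow_def)
  have "p dvd a \<or> p dvd b" if "p dvd a * b" for a b
  proof -
    let ?o = "\<lambda>k :: nat. add_pow (R Quot max_ideal R) k \<one>\<^bsub>R Quot max_ideal R\<^esub>"
    have "?o a \<otimes>\<^bsub>R Quot max_ideal R\<^esub> ?o b = ?o (a * b)"
      by (simp add: Q.add_pow_ldistr Q.add.nat_pow_pow mult.commute)
    then have "?o a \<otimes>\<^bsub>R Quot max_ideal R\<^esub> ?o b = \<zero>\<^bsub>R Quot max_ideal R\<^esub>" using that dvd by simp
    then show ?thesis using Q.integral[of "?o a" "?o b"] dvd by auto
  qed
  moreover have "p \<noteq> 0" "\<not> is_unit p" using p_gt_1 by simp_all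
  ultimately have "prime_elem p" unfolding prime_elem_def by blast
  then show ?thesis unfolding normalization_semidom_class.prime_def by simp
qed

lemma torsion: "r \<in> carrier R \<Longrightarrow> add_pow R (p ^ (f * d)) r = \<zero>"
  using group.pow_order_eq_1[OF a_group, of r] by (simp add: order_def card_carrier add_pow_def)

text \<open>Since \<open>p R\<close> is the \<open>e\<close>-th power of the maximal ideal,
  \<open>p\<close> and \<open>unif [^] e\<close> are multiples of each other and have the same
  annihilator.\<close>

lemma p_torsion: "{x \<in> carrier R. [p] \<cdot> x = \<zero>} = mi (d - e)"
proof -
  have "[p] \<cdot> x = \<zero> \<longleftrightarrow> x \<otimes> unif [^] e = \<zero>" if x: "x \<in> carrier R" for x
  proof
    assume *: "[p] \<cdot> x = \<zero>"
    have "unif [^] e \<in> mi e" using mi_iff[of _ e] by (metis l_one one_closed pow_closed)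
    then obtain y where y: "y \<in> carrier R" "unif [^] e = [p] \<cdot> y" using p_mult by blast
    have "x \<otimes> unif [^] e = ([p] \<cdot> x) \<otimes> y"
      using x y by (simp add: add_pow_ldistr add_pow_rdistr)
    then show "x \<otimes> unif [^] e = \<zero>" using * y by simp
  next
    assume *: "x \<otimes> unif [^] e = \<zero>"
    have "[p] \<cdot> \<one> \<in> mi e" using p_mult by blast
    then obtain y where y: "y \<in> carrier R" "[p] \<cdot> \<one> = y \<otimes> unif [^] e" by (auto simp: mi_iff)
    have "[p] \<cdot> x = x \<otimes> ([p] \<cdot> \<one>)" using x by (simp add: add_pow_rdistr)
    also have "\<dots> = y \<otimes> (x \<otimes> unif [^] e)" using x y by (simp add: m_ac)
    finally show "[p] \<cdot> x = \<zero>" using * y by simp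
  qed
  then show ?thesis using ann_pow[OF e_le] by auto
qed

text \<open>By \<open>decompose\<close> a nonzero ideal contains a power of the uniformizer with
  each of its nonzero elements, and the smallest such power generates it.\<close>

lemma ideal_eq_mi:
  assumes I: "ideal I R"
  obtains k where "k \<le> d" "I = mi k"
proof (cases "I = {\<zero>}")
  case True
  then show thesis using that[of d] mi_d by simp
next
  case False
  have z: "\<zero> \<in> I" using additive_subgroup.zero_closed I ideal.axioms(1) by blast
  define P where "P j \<longleftrightarrow> unif [^] j \<in> I" for j :: nat
  have key: "\<exists>j<d. P j \<and> x \<in> mi j" if x: "x \<in> I" "x \<noteq> \<zero>" for x
  proof -
    obtain u v j where *: "j < d" "u \<in> carrier R" "v \<in> carrier R" "u \<otimes> v = \<one>" "x = u \<otimes> unif [^] j"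
      using decompose[of x] x ideal.Icarr[OF I] by blast
    have "v \<otimes> x = unif [^] j" unfolding *(5) using * by (simp add: m_assoc[symmetric] m_comm[of v u])
    then have "P j" using ideal.I_l_closed[OF I x(1) *(3)] by (simp add: P_def)
    moreover have "x \<in> mi j" unfolding *(5) using *(2) by (rule miI)
    ultimately show ?thesis using *(1) by blast
  qed
  define k where "k = (LEAST j. P j)"
  obtain x where "x \<in> I" "x \<noteq> \<zero>" using False z by blast
  then obtain j where j: "j < d" "P j" using key by blast
  have k: "P k" "k \<le> j" unfolding k_def using j by (auto intro: LeastI Least_le)
  have "I = mi k"
  proof (intro equalityI subsetI)
    fix x assume "x \<in> I"
    show "x \<in> mi k"
    proof (cases "x = \<zero>")
      case True
      then show ?thesis using additive_subgroup.zero_closed[OF sub_mi] by simp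
    next
      case False
      then obtain i where "P i" "x \<in> mi i" using key \<open>x \<in> I\<close> by blast
      moreover have "k \<le> i" unfolding k_def using \<open>P i\<close> by (rule Least_le)
      ultimately show ?thesis using mi_antimono by blast
    qed
  next
    fix x assume "x \<in> mi k"
    then show "x \<in> I" using k(1) ideal.I_l_closed[OF I] by (auto simp: mi_iff P_def)
  qed
  then show thesis using that[of k] k j by simp
qed

end

section \<open>Weight vectors\<close>

lemma sum_roots_of_unity_power:
  fixes m k :: nat
  assumes "0 < k" "k < m"
  shows "(\<Sum>j<m. cis (2 * pi / of_nat m) ^ (j * k)) = 0"
proof -
  let ?w = "cis (2 * pi / of_nat m)"
  have w: "?w ^ i = cis (2 * pi * of_nat i / of_nat m)" for i
    by (simp add: DeMoivre mult.commute)
  have ne: "?w ^ k \<noteq> 1"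
  proof
    assume "?w ^ k = 1"
    then have "cis (2 * pi * of_nat k / of_nat m) = cis (2 * pi * of_nat 0 / of_nat m)" by (simp add: w)
    moreover have "inj_on (\<lambda>k. cis (2 * pi * real k / real m)) {..<m}"
      using bij_betw_roots_unity[of m] assms by (auto simp: bij_betw_def)
    ultimately have "k = 0" using assms by (intro inj_onD[of "\<lambda>k. cis (2 * pi * real k / real m)" "{..<m}"]) auto
    then show False using assms by simp
  qed
  have "?w ^ m = 1" using assms by (simp add: w)
  then have "(?w ^ k) ^ m = 1" by (metis mult.commute power_mult power_one)
  then show ?thesis
    using geometric_sum[OF ne, of m] by (simp add: power_mult[symmetric] mult.commute)
qed

section \<open>Simultaneous eigenvectors of commuting operators of finite order\<close>

locale complex_space = vector_space scale
  for scale :: "complex \<Rightarrow> 'v :: ab_group_add \<Rightarrow> 'v"  (infixr "*\<^sub>V" 75)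
begin

definition lin :: "('v \<Rightarrow> 'v) \<Rightarrow> bool" where
  "lin T \<longleftrightarrow> (\<forall>u v. T (u + v) = T u + T v) \<and> (\<forall>c v. T (c *\<^sub>V v) = c *\<^sub>V T v)"

lemma lin_add: "lin T \<Longrightarrow> T (u + v) = T u + T v" and lin_scale: "lin T \<Longrightarrow> T (c *\<^sub>V v) = c *\<^sub>V T v"
  by (auto simp: lin_def)

lemma lin_0: "lin T \<Longrightarrow> T 0 = 0"
  using lin_scale[of T 0 0] by simp

lemma lin_diff: "lin T \<Longrightarrow> T (u - v) = T u - T v"
  using lin_add[of T "u - v" v] by simp

lemma lin_sum: "lin T \<Longrightarrow> T (sum f A) = (\<Sum>x\<in>A. T (f x))"
  by (induction A rule: infinite_finite_induct) (auto simp: lin_0 lin_add)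

lemma lin_funpow: "lin T \<Longrightarrow> lin (T ^^ k)"
  by (induction k) (auto simp: lin_def)

text \<open>Discrete Fourier transform of the orbit of \<open>w\<close>: each \<open>u j\<close> is
  an eigenvector or zero, and together they add up to \<open>m\<close> times \<open>w\<close>, so at
  least one of them is nonzero.\<close>

lemma eigenvector_finite_order:
  assumes T: "lin T" and P: "subspace P" and stable: "\<And>v. v \<in> P \<Longrightarrow> T v \<in> P"
    and w: "w \<in> P" "w \<noteq> 0" and m: "0 < m" and ord: "(T ^^ m) w = w"
  shows "\<exists>u\<in>P. u \<noteq> 0 \<and> (\<exists>c. T u = c *\<^sub>V u)"
proof -
  let ?w = "cis (2 * pi / of_nat m)"
  have wm: "?w ^ m = 1" using m by (simp add: DeMoivre)
  define u where "u j = (\<Sum>k<m. ?w ^ (j * k) *\<^sub>V (T ^^ k) w)" for j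
  have pow: "(T ^^ k) w \<in> P" for k by (induction k) (auto simp: w stable)
  have uP: "u j \<in> P" for j
    unfolding u_def by (intro subspace_sum subspace_scale P pow)
  have eig: "T (u j) = inverse (?w ^ j) *\<^sub>V u j" for j
  proof -
    have "?w ^ j *\<^sub>V T (u j) = (\<Sum>k<m. ?w ^ (j * Suc k) *\<^sub>V (T ^^ Suc k) w)"
      by (simp add: u_def lin_sum[OF T] lin_scale[OF T] scale_sum_right power_add)
    also have "\<dots> = (\<Sum>k<Suc m. ?w ^ (j * k) *\<^sub>V (T ^^ k) w) - w"
      by (subst sum.lessThan_Suc_shift) simp
    also have "\<dots> = u j"
      using ord wm by (simp add: u_def power_mult[of _ m j] mult.commute[of j m])
    finally have "?w ^ j *\<^sub>V T (u j) = u j" .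
    then have "inverse (?w ^ j) *\<^sub>V u j = (inverse (?w ^ j) * ?w ^ j) *\<^sub>V T (u j)" by (metis scale_scale)
    then show ?thesis by simp
  qed
  have "(\<Sum>j<m. u j) = (\<Sum>k<m. \<Sum>j<m. ?w ^ (j * k) *\<^sub>V (T ^^ k) w)"
    unfolding u_def by (rule sum.swap)
  also have "\<dots> = (\<Sum>k<m. (if k = 0 then of_nat m else 0) *\<^sub>V (T ^^ k) w)"
    by (intro sum.cong refl) (auto simp: scale_sum_left[symmetric] sum_roots_of_unity_power)
  also have "\<dots> = (\<Sum>k<m. if k = 0 then of_nat m *\<^sub>V w else 0)"
    by (intro sum.cong refl) auto
  also have "\<dots> = of_nat m *\<^sub>V w"
    using m by simp
  finally have "(\<Sum>j<m. u j) \<noteq> 0" using w m by simp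
  then obtain j where "u j \<noteq> 0" by (metis sum.neutral)
  then show ?thesis using uP eig by blast
qed

text \<open>A simultaneous eigenspace of the operators treated so far is stable under the next one,
  which commutes with them, and so contains an eigenvector of it.\<close>

lemma common_eigenvector:
  assumes fin: "finite Y" and T: "\<And>z. z \<in> Y \<Longrightarrow> lin (T z)" and P: "subspace P"
    and stable: "\<And>z v. z \<in> Y \<Longrightarrow> v \<in> P \<Longrightarrow> T z v \<in> P"
    and comm: "\<And>z z' v. z \<in> Y \<Longrightarrow> z' \<in> Y \<Longrightarrow> v \<in> P \<Longrightarrow> T z (T z' v) = T z' (T z v)"
    and m: "0 < m" and ord: "\<And>z v. z \<in> Y \<Longrightarrow> v \<in> P \<Longrightarrow> (T z ^^ m) v = v"
    and w: "w \<in> P" "w \<noteq> 0"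
  shows "\<exists>u\<in>P. u \<noteq> 0 \<and> (\<exists>c. \<forall>z\<in>Y. T z u = c z *\<^sub>V u)"
  using fin T stable comm ord
proof (induction Y)
  case empty
  then show ?case using w by auto
next
  case (insert y Y)
  have "\<exists>u\<in>P. u \<noteq> 0 \<and> (\<exists>c. \<forall>z\<in>Y. T z u = c z *\<^sub>V u)"
    by (rule insert.IH) (use insert.prems in blast)+
  then obtain u c where u: "u \<in> P" "u \<noteq> 0" "\<forall>z\<in>Y. T z u = c z *\<^sub>V u" by blast
  let ?Q = "{v \<in> P. \<forall>z\<in>Y. T z v = c z *\<^sub>V v}"
  have "\<exists>u\<in>?Q. u \<noteq> 0 \<and> (\<exists>a. T y u = a *\<^sub>V u)"
  proof (rule eigenvector_finite_order[where w = u and m = m])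
    show "subspace ?Q"
      using P insert.prems(1) unfolding subspace_def
      by (auto simp: lin_0 lin_add lin_scale scale_right_distrib mult.commute)
    show "T y v \<in> ?Q" if v: "v \<in> ?Q" for v
    proof -
      have "T z (T y v) = c z *\<^sub>V T y v" if z: "z \<in> Y" for z
      proof -
        have "T z (T y v) = T y (T z v)" using insert.prems(3)[of z y v] z v by simp
        also have "\<dots> = c z *\<^sub>V T y v" using v z insert.prems(1)[of y] by (simp add: lin_scale)
        finally show ?thesis .
      qed
      then show ?thesis using insert.prems(2)[of y v] v by simp
    qed
  qed (use u insert.prems m in auto)
  then obtain v a where v: "v \<in> ?Q" "v \<noteq> 0" "T y v = a *\<^sub>V v" by blast
  then have "\<forall>z\<in>insert y Y. T z v = (c(y := a)) z *\<^sub>V v" using insert.hyps by auto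
  then show ?case using v by blast
qed

text \<open>The search takes place in the kernel of the sum of the powers of \<open>T x\<close>
  below \<open>m\<close>. This kernel contains the nonzero vector \<open>T x v - v\<close>, whereas
  on an eigenvector of eigenvalue 1 the sum would be multiplication by \<open>m\<close>.\<close>

lemma common_eigenvector_nontrivial:
  assumes fin: "finite Y" and T: "\<And>z. z \<in> Y \<Longrightarrow> lin (T z)" and P: "subspace P"
    and stable: "\<And>z v. z \<in> Y \<Longrightarrow> v \<in> P \<Longrightarrow> T z v \<in> P"
    and comm: "\<And>z z' v. z \<in> Y \<Longrightarrow> z' \<in> Y \<Longrightarrow> v \<in> P \<Longrightarrow> T z (T z' v) = T z' (T z v)"
    and m: "0 < m" and ord: "\<And>z v. z \<in> Y \<Longrightarrow> v \<in> P \<Longrightarrow> (T z ^^ m) v = v"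
    and x: "x \<in> Y" and v: "v \<in> P" "T x v \<noteq> v"
  shows "\<exists>u\<in>P. u \<noteq> 0 \<and> (\<exists>c. (\<forall>z\<in>Y. T z u = c z *\<^sub>V u) \<and> c x \<noteq> 1)"
proof -
  let ?N = "\<lambda>u. \<Sum>k<m. (T x ^^ k) u"
  let ?Q = "{u \<in> P. ?N u = 0}"
  note lx = lin_funpow[OF T[OF x]]
  have pc: "(T x ^^ k) (T z u) = T z ((T x ^^ k) u)" if "z \<in> Y" "u \<in> P" for z u k
  proof (induction k)
    case (Suc k)
    have "(T x ^^ k) u \<in> P" by (induction k) (auto simp: that stable x)
    then show ?case using Suc comm[OF x that(1)] by simp
  qed simp
  have "\<exists>u\<in>?Q. u \<noteq> 0 \<and> (\<exists>c. \<forall>z\<in>Y. T z u = c z *\<^sub>V u)"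
  proof (rule common_eigenvector[where w = "T x v - v" and m = m])
    show "subspace ?Q"
      using P unfolding subspace_def
      by (auto simp: lin_0[OF lx] lin_add[OF lx] lin_scale[OF lx] sum.distrib scale_sum_right[symmetric])
    show "T z u \<in> ?Q" if "z \<in> Y" "u \<in> ?Q" for z u
      using that stable by (auto simp: pc lin_sum[OF T[OF that(1)], symmetric] lin_0[OF T[OF that(1)]])
    show "T x v - v \<in> ?Q"
    proof -
      have "?N (T x v - v) = (\<Sum>k<m. (T x ^^ Suc k) v - (T x ^^ k) v)"
        by (intro sum.cong refl) (simp add: lin_diff[OF lx] funpow_swap1)
      also have "\<dots> = (T x ^^ m) v - v"
        by (subst sum_lessThan_telescope) simp
      finally show ?thesis using ord[OF x v(1)] subspace_diff[OF P stable[OF x v(1)] v(1)] by simp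
    qed
  qed (use fin T comm m ord v in auto)
  then obtain u c where u: "u \<in> ?Q" "u \<noteq> 0" "\<forall>z\<in>Y. T z u = c z *\<^sub>V u" by blast
  have "c x \<noteq> 1"
  proof
    assume "c x = 1"
    then have "T x u = u" using u x by simp
    then have "(T x ^^ k) u = u" for k by (induction k) auto
    then have "?N u = of_nat m *\<^sub>V u" by (simp add: sum_constant_scale)
    then show False using u m by simp
  qed
  then show ?thesis using u by blast
qed

text \<open>Applying \<open>T z\<close> minus the scalar \<open>wt s z\<close> to the relation
  removes the term of \<open>s\<close>; choosing \<open>z\<close> so that it distinguishes
  \<open>s\<close> from a given \<open>j\<close> keeps the term of \<open>j\<close> for the
  induction hypothesis.\<close>

lemma weight_vectors_independent:
  assumes "finite S" and T: "\<And>z. z \<in> Y \<Longrightarrow> lin (T z)"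
    and u: "\<And>i z. i \<in> S \<Longrightarrow> z \<in> Y \<Longrightarrow> T z (u i) = wt i z *\<^sub>V u i"
    and dist: "\<And>i j. i \<in> S \<Longrightarrow> j \<in> S \<Longrightarrow> i \<noteq> j \<Longrightarrow> \<exists>z\<in>Y. wt i z \<noteq> wt j z"
    and sum: "(\<Sum>i\<in>S. u i) = 0" and i: "i \<in> S"
  shows "u i = 0"
  using assms(1) u dist sum i
proof (induction S arbitrary: u i)
  case (insert s S)
  have *: "u j = 0" if j: "j \<in> S" for j
  proof -
    obtain z where z: "z \<in> Y" "wt j z \<noteq> wt s z"
      using insert.prems(2)[of j s] insert.hyps j by auto
    have "(\<Sum>i\<in>S. (wt i z - wt s z) *\<^sub>V u i) = T z (\<Sum>i\<in>insert s S. u i) - wt s z *\<^sub>V (\<Sum>i\<in>insert s S. u i)"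
      using insert.hyps insert.prems(1)[OF _ z(1)]
      by (simp add: lin_sum[OF T[OF z(1)]] lin_add[OF T[OF z(1)]] scale_sum_right scale_right_distrib
          scale_left_diff_distrib sum_subtractf)
    also have "\<dots> = 0" using insert.prems(3) by (simp add: lin_0[OF T[OF z(1)]])
    finally have "(wt j z - wt s z) *\<^sub>V u j = 0"
      using insert.prems(1,2) j
      by (intro insert.IH[where u = "\<lambda>i. (wt i z - wt s z) *\<^sub>V u i"]) (auto simp: lin_scale[OF T] mult.commute)
    then show ?thesis using z by simp
  qed
  then have "(\<Sum>i\<in>S. u i) = 0" by simp
  then have "u s = 0" using insert.prems(3) insert.hyps by simp
  then show ?case using * insert.prems(4) by blast
qed simp

lemma card_independent_family:
  assumes "finite I" and B: "finite B" and span: "\<And>i. i \<in> I \<Longrightarrow> v i \<in> span B"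
    and indep: "\<And>c i. (\<Sum>i\<in>I. c i *\<^sub>V v i) = 0 \<Longrightarrow> i \<in> I \<Longrightarrow> c i = 0"
  shows "card I \<le> card B"
proof -
  have inj: "inj_on v I"
  proof (rule inj_onI, rule ccontr)
    fix i j assume ij: "i \<in> I" "j \<in> I" "v i = v j" "i \<noteq> j"
    let ?c = "\<lambda>k. if k = i then 1 else if k = j then - 1 else (0 :: complex)"
    have "(\<Sum>k\<in>I. ?c k *\<^sub>V v k) = (\<Sum>k\<in>{i, j}. ?c k *\<^sub>V v k)"
      by (rule sum.mono_neutral_right) (use assms(1) ij in auto)
    also have "\<dots> = 0" using ij by simp
    finally have "?c i = 0" by (rule indep) (rule ij)
    then show False by simp
  qed
  have "independent (v ` I)"
  proof (rule independent_if_scalars_zero)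
    fix g x assume g: "(\<Sum>x\<in>v ` I. g x *\<^sub>V x) = 0" "x \<in> v ` I"
    then have "(\<Sum>i\<in>I. g (v i) *\<^sub>V v i) = 0" by (simp add: sum.reindex[OF inj])
    then show "g x = 0" using indep[of "\<lambda>i. g (v i)"] g(2) by blast
  qed (use assms(1) in simp)
  then have "card (v ` I) \<le> card B"
    using independent_span_bound[OF B] span by blast
  then show ?thesis using inj by (simp add: card_image)
qed

end

text \<open>Vectors are functions, so that a single type serves all dimensions and the vector space
  locale is interpreted only once. The space of dimension \<open>N\<close> is later cut out as a
  subspace.\<close>

definition fscale :: "complex \<Rightarrow> ('i \<Rightarrow> complex) \<Rightarrow> 'i \<Rightarrow> complex" where
  "fscale c f = (\<lambda>i. c * f i)"

interpretation fs: complex_space "fscale :: complex \<Rightarrow> ('i \<Rightarrow> complex) \<Rightarrow> 'i \<Rightarrow> complex"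
  by unfold_locales (auto simp: fscale_def fun_eq_iff algebra_simps)

lemma sum_fun_apply: "(sum f A) x = (\<Sum>i\<in>A. f i (x :: 'i) :: complex)"
  by (induction A rule: infinite_finite_induct) auto

lemma card_independent_functions:
  fixes v :: "'j \<Rightarrow> nat \<Rightarrow> complex"
  assumes "finite I" and supp: "\<And>i k. i \<in> I \<Longrightarrow> N \<le> k \<Longrightarrow> v i k = 0"
    and indep: "\<And>c i. (\<Sum>i\<in>I. fscale (c i) (v i)) = 0 \<Longrightarrow> i \<in> I \<Longrightarrow> c i = 0"
  shows "card I \<le> N"
proof -
  define b :: "nat \<Rightarrow> nat \<Rightarrow> complex" where "b k = (\<lambda>l. if l = k then 1 else 0)" for k
  have "card I \<le> card (b ` {..<N})"
  proof (rule fs.card_independent_family[OF assms(1)])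
    fix i assume i: "i \<in> I"
    have "v i = (\<Sum>k<N. fscale (v i k) (b k))"
    proof
      fix l
      have "(\<Sum>k<N. fscale (v i k) (b k)) l = (\<Sum>k<N. if l = k then v i l else 0)"
        unfolding sum_fun_apply fscale_def b_def by (intro sum.cong) auto
      also have "\<dots> = v i l" using supp[OF i, of l] by (simp add: not_less)
      finally show "v i l = (\<Sum>k<N. fscale (v i k) (b k)) l" by (rule sym)
    qed
    also have "\<dots> \<in> fs.span (b ` {..<N})"
      by (intro fs.span_sum fs.span_scale fs.span_base) auto
    finally show "v i \<in> fs.span (b ` {..<N})" .
  qed (use indep in auto)
  also have "\<dots> \<le> N" using card_image_le[of "{..<N}" b] by simp
  finally show ?thesis .
qed

text \<open>For prime \<open>p\<close> a nontrivial \<open>p\<close>-th root of unity has order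
  exactly \<open>p\<close>, by a Bezout relation between \<open>p\<close> and a smaller
  exponent.\<close>

lemma root_of_unity_powers_inj:
  fixes z :: complex
  assumes "Factorial_Ring.prime p" "z ^ p = 1" "z \<noteq> 1"
  shows "inj_on (\<lambda>k. z ^ k) {..<p}"
proof -
  have z0: "z \<noteq> 0" using assms(2) prime_gt_0_nat[OF assms(1)] by (auto simp: power_0_left)
  have ne: "z ^ k \<noteq> 1" if k: "0 < k" "k < p" for k
  proof
    assume zk: "z ^ k = 1"
    have "\<not> p dvd k" using k by (auto dest: dvd_imp_le)
    then have "gcd k p = 1"
      using prime_imp_coprime[OF assms(1), of k] by (simp add: coprime_commute coprime_iff_gcd_eq_1)
    then obtain x y where xy: "k * x = p * y + 1" using bezout_nat[of k p] k by auto
    have "1 = z ^ (k * x)" using zk by (simp add: power_mult)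
    also have "\<dots> = z" using assms(2) by (simp add: xy power_add power_mult)
    finally show False using assms(3) by simp
  qed
  have *: "i = j" if "i \<le> j" "j < p" "z ^ i = z ^ j" for i j
  proof (rule ccontr)
    assume "i \<noteq> j"
    have "z ^ j = z ^ (j - i) * z ^ i" using that(1) by (simp add: power_add[symmetric])
    then have "z ^ (j - i) = 1" using that(3) z0 by simp
    moreover have "0 < j - i" "j - i < p" using that \<open>i \<noteq> j\<close> by linarith+
    ultimately show False using ne[of "j - i"] by blast
  qed
  show ?thesis
  proof (rule inj_onI)
    fix i j assume "i \<in> {..<p}" "j \<in> {..<p}" "z ^ i = z ^ j"
    then show "i = j" using *[of i j] *[of j i] by (cases "i \<le> j") auto
  qed
qed

section \<open>Separating characters of the additive group\<close>

context tvr
begin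

definition add_char :: "('a \<Rightarrow> complex) \<Rightarrow> bool" where
  "add_char \<chi> \<longleftrightarrow> (\<forall>a\<in>carrier R. \<forall>b\<in>carrier R. \<chi> (a \<oplus> b) = \<chi> a * \<chi> b) \<and> \<chi> \<zero> = 1"

lemma add_char_add: "add_char \<chi> \<Longrightarrow> a \<in> carrier R \<Longrightarrow> b \<in> carrier R \<Longrightarrow> \<chi> (a \<oplus> b) = \<chi> a * \<chi> b"
  and add_char_zero: "add_char \<chi> \<Longrightarrow> \<chi> \<zero> = 1"
  by (auto simp: add_char_def)

lemma add_char_nonzero: "add_char \<chi> \<Longrightarrow> a \<in> carrier R \<Longrightarrow> \<chi> a \<noteq> 0"
  using add_char_add[of \<chi> a "\<ominus> a"] add_char_zero[of \<chi>] by (auto simp: r_neg)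

lemma add_char_minus: "add_char \<chi> \<Longrightarrow> a \<in> carrier R \<Longrightarrow> b \<in> carrier R \<Longrightarrow> \<chi> (a \<ominus> b) = \<chi> a / \<chi> b"
proof -
  assume *: "add_char \<chi>" "a \<in> carrier R" "b \<in> carrier R"
  have "\<chi> a = \<chi> (a \<ominus> b) * \<chi> b"
    using add_char_add[OF *(1), of "a \<ominus> b" b] * by (simp add: minus_eq a_assoc l_neg)
  then show ?thesis using add_char_nonzero[OF *(1,3)] by simp
qed

lemma add_char_eq_iff:
  "add_char \<chi> \<Longrightarrow> a \<in> carrier R \<Longrightarrow> b \<in> carrier R \<Longrightarrow> \<chi> a = \<chi> b \<longleftrightarrow> \<chi> (a \<ominus> b) = 1"
  using add_char_nonzero[of \<chi> b] by (simp add: add_char_minus)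

lemma add_char_pow: "add_char \<chi> \<Longrightarrow> a \<in> carrier R \<Longrightarrow> \<chi> (add_pow R (k :: nat) a) = \<chi> a ^ k"
  by (induction k) (auto simp: add_char_add add_char_zero mult.commute add.nat_pow_Suc add.nat_pow_0)

text \<open>Translations act on the functions invariant under \<open>mi c\<close>, and the
  eigenvalues of a common eigenvector form a character that is trivial on \<open>mi c\<close>. As
  \<open>x\<close> moves the indicator function of \<open>mi c\<close>, some common eigenvector has
  a nontrivial eigenvalue at \<open>x\<close>.\<close>

lemma add_char_exists:
  assumes x: "x \<in> carrier R" "x \<notin> mi c"
  shows "\<exists>\<chi>. add_char \<chi> \<and> (\<forall>a\<in>mi c. \<chi> a = 1) \<and> \<chi> x \<noteq> 1"
proof -
  define T where "T z f = (\<lambda>r. if r \<in> carrier R then f (r \<oplus> z) else 0)" for z and f :: "'a \<Rightarrow> complex"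
  define P where "P = {f :: 'a \<Rightarrow> complex. (\<forall>r. r \<notin> carrier R \<longrightarrow> f r = 0) \<and>
    (\<forall>r\<in>carrier R. \<forall>a\<in>mi c. f (r \<oplus> a) = f r)}"
  define v where "v = (\<lambda>r. if r \<in> mi c then 1 else 0 :: complex)"
  have mc: "a \<in> carrier R" if "a \<in> mi c" for a using that by (rule mi_carrier)
  have pow: "(T z ^^ k) f = (\<lambda>r. if r \<in> carrier R then f (r \<oplus> [k] \<cdot> z) else 0)"
    if "z \<in> carrier R" "f \<in> P" for z f k
  proof (induction k)
    case 0
    then show ?case using that by (auto simp: P_def add_pow_def)
  next
    case (Suc k)
    have "[Suc k] \<cdot> z = z \<oplus> [k] \<cdot> z" by (rule add.nat_pow_Suc2) (rule that(1))
    then show ?case using Suc that by (auto simp: T_def a_assoc)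
  qed
  have "\<exists>u\<in>P. u \<noteq> 0 \<and> (\<exists>c. (\<forall>z\<in>carrier R. T z u = fscale (c z) u) \<and> c x \<noteq> 1)"
  proof (rule fs.common_eigenvector_nontrivial[where m = "p ^ (f * d)" and v = v])
    show "fs.lin (T z)" for z by (auto simp: fs.lin_def T_def fscale_def fun_eq_iff)
    show "fs.subspace P" by (auto simp: fs.subspace_def P_def fscale_def)
    show "T z f \<in> P" if "z \<in> carrier R" "f \<in> P" for z f
    proof -
      have "f (r \<oplus> a \<oplus> z) = f (r \<oplus> z)" if "r \<in> carrier R" "a \<in> mi c" for r a
      proof -
        have "r \<oplus> a \<oplus> z = (r \<oplus> z) \<oplus> a" using that \<open>z \<in> carrier R\<close> mc by (simp add: a_ac)
        then show ?thesis using that \<open>z \<in> carrier R\<close> \<open>f \<in> P\<close> by (simp add: P_def)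
      qed
      then show ?thesis using mc by (auto simp: P_def T_def)
    qed
    show "T z (T z' f) = T z' (T z f)" if "z \<in> carrier R" "z' \<in> carrier R" for z z' f
      using that by (auto simp: T_def a_ac)
    show "(T z ^^ (p ^ (f * d))) g = g" if "z \<in> carrier R" "g \<in> P" for z g
      using that pow[OF that] torsion[OF that(1)] by (auto simp: P_def)
    show "0 < p ^ (f * d)" using p_gt_1 by simp
    have "r \<oplus> a \<in> mi c \<longleftrightarrow> r \<in> mi c" if "r \<in> carrier R" "a \<in> mi c" for r a
    proof
      assume "r \<oplus> a \<in> mi c"
      then have "(r \<oplus> a) \<oplus> \<ominus> a \<in> mi c"
        using that additive_subgroup.a_closed[OF sub_mi] additive_subgroup.a_inv_closed[OF sub_mi] by blast
      then show "r \<in> mi c" using that mc by (simp add: a_assoc r_neg)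
    qed (use that additive_subgroup.a_closed[OF sub_mi] in blast)
    then show "v \<in> P" using mc by (auto simp: P_def v_def)
    have "T x v \<zero> \<noteq> v \<zero>"
      using x additive_subgroup.zero_closed[OF sub_mi[of c]] by (simp add: T_def v_def)
    then show "T x v \<noteq> v" by metis
  qed (use finite_carrier x in auto)
  then obtain u \<chi> where u: "u \<in> P" "u \<noteq> 0" "\<And>z. z \<in> carrier R \<Longrightarrow> T z u = fscale (\<chi> z) u" "\<chi> x \<noteq> 1"
    by blast
  obtain r where r: "u r \<noteq> 0" using u(2) by (auto simp: fun_eq_iff)
  then have rc: "r \<in> carrier R" using u(1) by (auto simp: P_def)
  have eig: "u (s \<oplus> z) = \<chi> z * u s" if "z \<in> carrier R" "s \<in> carrier R" for z s
    using fun_cong[OF u(3)[OF that(1)], of s] that by (simp add: T_def fscale_def)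
  have triv: "\<chi> a = 1" if "a \<in> mi c" for a
    using eig[OF mc[OF that] rc] u(1) r rc that by (auto simp: P_def)
  have "\<chi> (a \<oplus> b) = \<chi> a * \<chi> b" if "a \<in> carrier R" "b \<in> carrier R" for a b
    using eig[of "a \<oplus> b" r] eig[of b "r \<oplus> a"] eig[of a r] that rc r by (simp add: a_assoc)
  moreover have "\<chi> \<zero> = 1" by (rule triv) (rule additive_subgroup.zero_closed[OF sub_mi])
  ultimately show ?thesis using triv u(4) by (auto simp: add_char_def)
qed

lemma p_mult_mi: "x \<in> mi k \<Longrightarrow> [p] \<cdot> x \<in> mi (Suc k)"
proof -
  assume "x \<in> mi k"
  then obtain y where y: "y \<in> carrier R" "x = y \<otimes> unif [^] k" by (auto simp: mi_iff)
  have "[p] \<cdot> \<one> \<in> mi e" using p_mult by blast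
  then have "[p] \<cdot> \<one> \<in> mi 1" using mi_antimono[OF e_pos] by blast
  then obtain z where z: "z \<in> carrier R" "[p] \<cdot> \<one> = z \<otimes> unif [^] (1 :: nat)" by (auto simp: mi_iff)
  have "[p] \<cdot> x = x \<otimes> ([p] \<cdot> \<one>)" using y by (simp add: add_pow_rdistr)
  also have "\<dots> = (y \<otimes> z) \<otimes> unif [^] Suc k" using y z unif(1) by (simp add: m_ac)
  finally show ?thesis using miI[of "y \<otimes> z" "Suc k"] y z by simp
qed

text \<open>Greedy choice: while the common kernel inside \<open>mi l\<close> exceeds
  \<open>mi (Suc l)\<close>, some character is nontrivial on it and shrinks it by a factor of at
  least \<open>p\<close>. The quotient of the two ideals has order \<open>p ^ f\<close>, so
  \<open>f\<close> characters suffice.\<close>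

lemma add_char_separating:
  assumes l: "l < d"
  shows "\<exists>\<chi>. (\<forall>s. add_char (\<chi> s) \<and> (\<forall>a\<in>mi (Suc l). \<chi> s a = 1)) \<and>
    (\<forall>x\<in>mi l. x \<notin> mi (Suc l) \<longrightarrow> (\<exists>s<f. \<chi> s x \<noteq> 1))"
proof -
  let ?N = "mi (Suc l)"
  define Kr where "Kr \<chi> s = {x \<in> mi l. \<forall>t<s. \<chi> t x = 1}" for \<chi> :: "nat \<Rightarrow> 'a \<Rightarrow> complex" and s
  define ok where "ok \<chi> \<longleftrightarrow> (\<forall>s. add_char (\<chi> s) \<and> (\<forall>a\<in>?N. \<chi> s a = 1))" for \<chi> :: "nat \<Rightarrow> 'a \<Rightarrow> complex"
  have NK: "?N \<subseteq> Kr \<chi> s" if "ok \<chi>" for \<chi> s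
    using that mi_antimono[of l "Suc l"] by (auto simp: Kr_def ok_def)
  have cardN: "card (mi l) = p ^ f * card ?N" using card_mi_Suc[OF l] card_socle by simp
  have Npos: "card ?N > 0"
    using additive_subgroup.zero_closed[OF sub_mi[of "Suc l"]] by (auto simp: card_gt_0_iff)
  have "\<exists>\<chi>. ok \<chi> \<and> card (Kr \<chi> s) \<le> p ^ (f - s) * card ?N" for s
  proof (induction s)
    case 0
    have "ok (\<lambda>_ _. 1)" by (auto simp: ok_def add_char_def)
    moreover have "Kr (\<lambda>_ _. 1) 0 = mi l" by (auto simp: Kr_def)
    ultimately show ?case using cardN by (intro exI[of _ "\<lambda>_ _. 1"]) simp
  next
    case (Suc s)
    then obtain \<chi> where chi: "ok \<chi>" "card (Kr \<chi> s) \<le> p ^ (f - s) * card ?N" by blast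
    show ?case
    proof (cases "Kr \<chi> s \<subseteq> ?N")
      case True
      have "Kr \<chi> (Suc s) \<subseteq> ?N" using True by (auto simp: Kr_def)
      then have "card (Kr \<chi> (Suc s)) \<le> card ?N" by (intro card_mono) auto
      also have "\<dots> \<le> p ^ (f - Suc s) * card ?N" using p_gt_1 by simp
      finally show ?thesis using chi(1) by blast
    next
      case False
      then obtain x where x: "x \<in> Kr \<chi> s" "x \<notin> ?N" by blast
      have xm: "x \<in> mi l" using x by (simp add: Kr_def)
      obtain \<psi> where psi: "add_char \<psi>" "\<forall>a\<in>?N. \<psi> a = 1" "\<psi> x \<noteq> 1"
        using add_char_exists[of x "Suc l"] x(2) mi_carrier[OF xm] by blast
      let ?c = "\<chi>(s := \<psi>)"
      have ok: "ok ?c" using chi(1) psi by (auto simp: ok_def)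
      have H: "additive_subgroup (Kr \<chi> s) R"
      proof (rule additive_subgroup.intro, rule add.subgroupI)
        have ac: "add_char (\<chi> t)" for t using chi(1) by (auto simp: ok_def)
        show "Kr \<chi> s \<subseteq> carrier R" using mi_carrier by (auto simp: Kr_def)
        show "Kr \<chi> s \<noteq> {}" using x by blast
        fix a assume a: "a \<in> Kr \<chi> s"
        then have "a \<in> carrier R" using mi_carrier by (auto simp: Kr_def)
        then have "\<chi> t (\<ominus> a) = 1 / \<chi> t a" for t
          using add_char_minus[OF ac, of "\<zero>" a t] add_char_zero[OF ac] by (simp add: minus_eq)
        then show "\<ominus> a \<in> Kr \<chi> s"
          using a additive_subgroup.a_inv_closed[OF sub_mi] by (auto simp: Kr_def)
        fix b assume b: "b \<in> Kr \<chi> s"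
        then show "a \<oplus> b \<in> Kr \<chi> s"
          using a additive_subgroup.a_closed[OF sub_mi] mi_carrier add_char_add[OF ac]
          by (auto simp: Kr_def)
      qed
      have "card (Kr \<chi> s) = card (Kr ?c (Suc s)) * card (\<psi> ` Kr \<chi> s)"
      proof (rule card_fibres[OF H])
        show "finite (Kr \<chi> s)" by (simp add: Kr_def)
        show "Kr ?c (Suc s) \<subseteq> Kr \<chi> s" by (auto simp: Kr_def less_Suc_eq)
        fix a b assume ab: "a \<in> Kr \<chi> s" "b \<in> Kr \<chi> s"
        then have c: "a \<in> carrier R" "b \<in> carrier R" using mi_carrier by (auto simp: Kr_def)
        have "a \<ominus> b \<in> Kr \<chi> s"
          using ab additive_subgroup.a_closed[OF H] additive_subgroup.a_inv_closed[OF H] by (simp add: minus_eq)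
        then have "a \<ominus> b \<in> Kr ?c (Suc s) \<longleftrightarrow> \<psi> (a \<ominus> b) = 1"
          by (auto simp: Kr_def less_Suc_eq)
        then show "\<psi> a = \<psi> b \<longleftrightarrow> a \<ominus> b \<in> Kr ?c (Suc s)"
          using add_char_eq_iff[OF psi(1) c] by simp
      qed
      \<comment> \<open>\<open>p\<close> times \<open>x\<close> lies in \<open>?N\<close>, so
        \<open>\<psi> x\<close> is a nontrivial \<open>p\<close>-th root of unity, and the multiples
        of \<open>x\<close> already take \<open>p\<close> different values.\<close>
      moreover have "p \<le> card (\<psi> ` Kr \<chi> s)"
      proof -
        have "[p] \<cdot> x \<in> ?N" using xm by (rule p_mult_mi)
        then have "\<psi> x ^ p = 1" using psi add_char_pow[OF psi(1) mi_carrier[OF xm], of p] by simp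
        then have "inj_on (\<lambda>k. \<psi> x ^ k) {..<p}" using psi(3) prime_p by (intro root_of_unity_powers_inj)
        then have "p = card ((\<lambda>k. \<psi> x ^ k) ` {..<p})" by (simp add: card_image)
        also have "\<dots> \<le> card (\<psi> ` Kr \<chi> s)"
        proof (rule card_mono)
          show "finite (\<psi> ` Kr \<chi> s)" by (simp add: Kr_def)
          have "[k] \<cdot> x \<in> Kr \<chi> s" for k :: nat
            using additive_subgroup.a_closed[OF H] additive_subgroup.zero_closed[OF H] x(1)
            by (induction k) (auto simp: add_pow_def)
          then show "(\<lambda>k. \<psi> x ^ k) ` {..<p} \<subseteq> \<psi> ` Kr \<chi> s"
            using add_char_pow[OF psi(1) mi_carrier[OF xm]] by (metis (no_types, lifting) image_eqI image_subsetI)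
        qed
        finally show ?thesis .
      qed
      ultimately have "card (Kr ?c (Suc s)) * p \<le> p ^ (f - s) * card ?N"
        using chi(2) by (metis mult_le_mono2 order_trans)
      also have "\<dots> \<le> (p ^ (f - Suc s) * card ?N) * p"
      proof (cases "s < f")
        case True
        then have "p ^ (f - s) = p ^ (f - Suc s) * p" by (metis Suc_diff_Suc power_Suc2)
        then show ?thesis by simp
      qed (use p_gt_1 in simp)
      finally have "card (Kr ?c (Suc s)) \<le> p ^ (f - Suc s) * card ?N" using p_gt_1 by simp
      then show ?thesis using ok by blast
    qed
  qed
  then obtain \<chi> where chi: "ok \<chi>" "card (Kr \<chi> f) \<le> p ^ (f - f) * card ?N" by blast
  have "Kr \<chi> f = ?N"
    using chi NK[OF chi(1), of f] by (intro sym[OF card_seteq]) (auto simp: Kr_def)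
  then show ?thesis using chi(1) unfolding ok_def Kr_def by blast
qed

end

section \<open>A faithful monomial representation\<close>

text \<open>The nonzero entry of row \<open>b i\<close> stands in the column of
  \<open>sg g (b i)\<close>. With this convention matrix products correspond to a right action,
  which is why \<open>sg\<close> composes in reverse order and \<open>c\<close> satisfies the
  cocycle rule in this form.\<close>

lemma monomial_representation:
  fixes sg :: "'g \<Rightarrow> 'x \<Rightarrow> 'x" and c :: "'g \<Rightarrow> 'x \<Rightarrow> complex"
  assumes S: "finite S" "card S = N"
    and sg: "\<And>g x. g \<in> G \<Longrightarrow> x \<in> S \<Longrightarrow> sg g x \<in> S"
    and G: "\<And>g g'. g \<in> G \<Longrightarrow> g' \<in> G \<Longrightarrow> mul g g' \<in> G" "u \<in> G" "\<And>g. g \<in> G \<Longrightarrow> \<exists>g'\<in>G. mul g g' = u"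
    and sg_mul: "\<And>g g' x. g \<in> G \<Longrightarrow> g' \<in> G \<Longrightarrow> x \<in> S \<Longrightarrow> sg (mul g g') x = sg g' (sg g x)"
    and c_mul: "\<And>g g' x. g \<in> G \<Longrightarrow> g' \<in> G \<Longrightarrow> x \<in> S \<Longrightarrow> c (mul g g') x = c g x * c g' (sg g x)"
    and one: "\<And>x. x \<in> S \<Longrightarrow> sg u x = x \<and> c u x = 1"
    and faithful: "\<And>g g'. g \<in> G \<Longrightarrow> g' \<in> G \<Longrightarrow> (\<And>x. x \<in> S \<Longrightarrow> sg g x = sg g' x \<and> c g x = c g' x) \<Longrightarrow> g = g'"
  shows "\<exists>M. (\<forall>g\<in>G. M g \<in> carrier (GL_complex N)) \<and>
    (\<forall>g\<in>G. \<forall>g'\<in>G. M (mul g g') = M g * M g') \<and> inj_on M G"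
proof -
  obtain b where b: "bij_betw b {0..<N} S"
    using ex_bij_betw_nat_finite[OF S(1)] S(2) by auto
  have bS: "b i \<in> S" if "i < N" for i using b that by (auto simp: bij_betw_def)
  have binj: "b i = b j \<longleftrightarrow> i = j" if "i < N" "j < N" for i j
    using b that by (auto simp: bij_betw_def inj_on_def)
  have bsurj: "\<exists>i<N. b i = x" if "x \<in> S" for x using b that by (auto simp: bij_betw_def)
  define M where "M g = mat N N (\<lambda>(i, j). if b j = sg g (b i) then c g (b i) else 0)" for g
  have Mc: "M g \<in> carrier_mat N N" for g by (simp add: M_def)
  have mul: "M (mul g g') = M g * M g'" if g: "g \<in> G" "g' \<in> G" for g g'
  proof (rule eq_matI)
    fix i j assume "i < dim_row (M g * M g')" "j < dim_col (M g * M g')"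
    then have ij: "i < N" "j < N" by (simp_all add: M_def)
    obtain k where k: "k < N" "b k = sg g (b i)" using bsurj[OF sg[OF g(1) bS[OF ij(1)]]] by blast
    have "(M g * M g') $$ (i, j) = (\<Sum>l = 0..<N. M g $$ (i, l) * M g' $$ (l, j))"
      using ij by (simp add: M_def scalar_prod_def)
    also have "\<dots> = (\<Sum>l = 0..<N. if l = k then c g (b i) * M g' $$ (k, j) else 0)"
    proof (intro sum.cong refl)
      fix l assume "l \<in> {0..<N}"
      then have "b l = sg g (b i) \<longleftrightarrow> l = k" using binj[of l k] k by auto
      then show "M g $$ (i, l) * M g' $$ (l, j) = (if l = k then c g (b i) * M g' $$ (k, j) else 0)"
        using ij \<open>l \<in> {0..<N}\<close> by (simp add: M_def)
    qed
    also have "\<dots> = c g (b i) * M g' $$ (k, j)" using k by simp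
    also have "\<dots> = M (mul g g') $$ (i, j)"
      using ij k sg_mul[OF g bS[OF ij(1)]] c_mul[OF g bS[OF ij(1)]] by (simp add: M_def)
    finally show "M (mul g g') $$ (i, j) = (M g * M g') $$ (i, j)" by simp
  qed (simp_all add: M_def)
  have Mone: "M u = 1\<^sub>m N"
    by (rule eq_matI) (use one bS binj in \<open>auto simp: M_def\<close>)
  have GL: "M g \<in> carrier (GL_complex N)" if gG: "g \<in> G" for g
  proof -
    obtain g' where g': "g' \<in> G" "mul g g' = u" using G(3)[OF gG] by blast
    obtain g'' where g'': "g'' \<in> G" "mul g' g'' = u" using G(3)[OF g'(1)] by blast
    have 1: "M g * M g' = 1\<^sub>m N" "M g' * M g'' = 1\<^sub>m N"
      using mul[OF gG g'(1)] mul[OF g'(1) g''(1)] g' g'' Mone by simp_all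
    \<comment> \<open>Only right inverses are available. \<open>M g'\<close> has the left inverse
      \<open>M g\<close> and the right inverse \<open>M g''\<close>, so the two coincide and
      \<open>M g\<close> is invertible on both sides.\<close>
    have "M g = M g * (M g' * M g'')" using right_mult_one_mat[OF Mc] by (simp add: 1)
    also have "\<dots> = (M g * M g') * M g''" by (rule assoc_mult_mat[symmetric]) (rule Mc)+
    also have "\<dots> = M g''" using left_mult_one_mat[OF Mc] by (simp add: 1)
    finally have "M g' * M g = 1\<^sub>m N" using 1 by simp
    then show ?thesis using 1(1) Mc
      unfolding GL_complex_def units_of_def by (auto simp: Units_def ring_mat_def)
  qed
  have "inj_on M G"
  proof (rule inj_onI)
    fix g g' assume g: "g \<in> G" "g' \<in> G" "M g = M g'"
    have nz: "c h x \<noteq> 0" if h: "h \<in> G" "x \<in> S" for h x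
    proof -
      obtain h' where h': "h' \<in> G" "mul h h' = u" using G(3)[OF h(1)] by blast
      then show ?thesis using c_mul[OF h(1) h'(1) h(2)] one[OF h(2)] by auto
    qed
    have "sg g x = sg g' x \<and> c g x = c g' x" if x: "x \<in> S" for x
    proof -
      obtain i where i: "i < N" "b i = x" using bsurj[OF x] by blast
      obtain k where k: "k < N" "b k = sg g x" using bsurj[OF sg[OF g(1) x]] by blast
      have "M g $$ (i, k) = M g' $$ (i, k)" using g(3) by simp
      then have "c g x = (if sg g x = sg g' x then c g' x else 0)"
        using i k by (simp add: M_def)
      then show ?thesis using nz[OF g(1) x] by (auto split: if_splits)
    qed
    then show "g = g'" by (rule faithful[OF g(1,2)])
  qed
  then show ?thesis using mul GL by blast
qed

section \<open>Extreme pairs, residue classes and the characters of the layers\<close>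

locale pattern_tvr = tvr R d p e f + pattern_group R n prec "int p" "int p ^ (f * d)" "f * d"
  for R (structure) and d p e f n prec
begin

definition between :: "nat \<Rightarrow> nat \<Rightarrow> nat set" where
  "between i j = {k \<in> {1..n}. (i, k) \<in> prec \<and> (k, j) \<in> prec}"

lemma card_between: "card (between i j) = alpha n prec i j"
  by (simp add: between_def alpha_def)

lemma finite_between [simp]: "finite (between i j)"
  by (simp add: between_def)

abbreviation "Iex \<equiv> extreme_pairs n prec"

lemma finite_Iex [simp]: "finite Iex"
  by (rule finite_subset[OF _ finite_prec]) (auto simp: extreme_pairs_def)

lemma IexD:
  assumes "(i, j) \<in> Iex"
  shows "(i, j) \<in> prec" "(k, i) \<notin> prec" "(j, k) \<notin> prec"
proof -
  show "(i, j) \<in> prec" using assms unfolding extreme_pairs_def by blast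
  show "(k, i) \<notin> prec"
  proof
    assume k: "(k, i) \<in> prec"
    then have "k \<in> {1..n}" using prec_range by blast
    then show False using k assms unfolding extreme_pairs_def by blast
  qed
  show "(j, k) \<notin> prec"
  proof
    assume k: "(j, k) \<in> prec"
    then have "k \<in> {1..n}" using prec_range by blast
    then show False using k assms unfolding extreme_pairs_def by blast
  qed
qed

text \<open>Among the pairs with first point at or below \<open>a\<close> and second point at or
  above \<open>b\<close>, one with the largest \<open>alpha\<close> cannot be extended at either
  end, by \<open>alpha_mono\<close>.\<close>

lemma Iex_exists:
  assumes "(a, b) \<in> prec"
  shows "\<exists>i j. (i, j) \<in> Iex \<and> (i = a \<or> (i, a) \<in> prec) \<and> (j = b \<or> (b, j) \<in> prec)"
proof -
  let ?P = "\<lambda>x. x \<in> prec \<and> (fst x = a \<or> (fst x, a) \<in> prec) \<and> (snd x = b \<or> (b, snd x) \<in> prec)"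
  let ?al = "\<lambda>x. alpha n prec (fst x) (snd x)"
  have bound: "\<forall>x. ?P x \<longrightarrow> ?al x < Suc (max_alpha n prec)"
  proof (intro allI impI)
    fix x assume "?P x"
    then have "(fst x, snd x) \<in> prec" by simp
    from alpha_le_max[OF this] show "?al x < Suc (max_alpha n prec)" by (simp only: less_Suc_eq_le)
  qed
  have "?P (a, b)" using assms by simp
  then have "\<exists>x. ?P x \<and> (\<forall>y. ?P y \<longrightarrow> ?al y \<le> ?al x)"
    using bound by (rule ex_has_greatest_nat)
  then obtain x where x: "?P x" "\<And>y. ?P y \<Longrightarrow> ?al y \<le> ?al x" by blast
  obtain i j where ij: "x = (i, j)" by (cases x)
  have "(k, i) \<notin> prec" for k
  proof
    assume k: "(k, i) \<in> prec"
    then have "?P (k, j)" using x(1) ij prec_trans by auto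
    then show False using x(2)[of "(k, j)"] alpha_mono(1)[OF k, of j] x(1) ij by simp
  qed
  moreover have "(j, k) \<notin> prec" for k
  proof
    assume k: "(j, k) \<in> prec"
    then have "?P (i, k)" using x(1) ij prec_trans by auto
    then show False using x(2)[of "(i, k)"] alpha_mono(2)[OF _ k, of i] x(1) ij by simp
  qed
  ultimately show ?thesis using x(1) ij by (intro exI[of _ i] exI[of _ j]) (auto simp: extreme_pairs_def)
qed

lemma mi_minus_sym: "a \<in> carrier R \<Longrightarrow> b \<in> carrier R \<Longrightarrow> a \<ominus> b \<in> mi c \<Longrightarrow> b \<ominus> a \<in> mi c"
proof -
  assume *: "a \<in> carrier R" "b \<in> carrier R" "a \<ominus> b \<in> mi c"
  have "b \<ominus> a = \<ominus> (a \<ominus> b)" using * by (simp add: minus_eq minus_add a_comm)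
  then show ?thesis using additive_subgroup.a_inv_closed[OF sub_mi *(3)] by simp
qed

lemma mi_minus_trans:
  assumes "a \<in> carrier R" "b \<in> carrier R" "x \<in> carrier R" "a \<ominus> b \<in> mi c" "b \<ominus> x \<in> mi c"
  shows "a \<ominus> x \<in> mi c"
proof -
  have "a \<ominus> x = (a \<ominus> b) \<oplus> (b \<ominus> x)" using assms by (simp add: minus_eq a_assoc r_neg1)
  then show ?thesis using additive_subgroup.a_closed[OF sub_mi assms(4,5)] by simp
qed

lemma mi_zero: "\<zero> \<in> mi c"
  by (rule additive_subgroup.zero_closed[OF sub_mi])

text \<open>A representative of \<open>x + \<mm>\<^sup>c\<close> that depends only on the coset, as \<open>SOME\<close> is extensional.\<close>

definition coset_rep :: "nat \<Rightarrow> 'a \<Rightarrow> 'a" where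
  "coset_rep c x = (SOME y. y \<in> carrier R \<and> x \<ominus> y \<in> mi c)"

lemma coset_rep:
  assumes "x \<in> carrier R"
  shows "coset_rep c x \<in> carrier R" "x \<ominus> coset_rep c x \<in> mi c"
proof -
  have "\<exists>y. y \<in> carrier R \<and> x \<ominus> y \<in> mi c"
    using assms mi_zero by (intro exI[of _ x]) (simp add: minus_eq r_neg)
  from someI_ex[OF this] show "coset_rep c x \<in> carrier R" "x \<ominus> coset_rep c x \<in> mi c" by (auto simp: coset_rep_def)
qed

lemma coset_rep_eq_iff:
  assumes "x \<in> carrier R" "y \<in> carrier R"
  shows "coset_rep c x = coset_rep c y \<longleftrightarrow> x \<ominus> y \<in> mi c"
proof
  assume "coset_rep c x = coset_rep c y"
  then show "x \<ominus> y \<in> mi c"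
    using mi_minus_trans[OF assms(1) coset_rep(1)[OF assms(2), of c] assms(2)]
      mi_minus_sym[OF assms(2) coset_rep(1)[OF assms(2)] coset_rep(2)[OF assms(2), of c]] coset_rep(2)[OF assms(1), of c] by simp
next
  assume *: "x \<ominus> y \<in> mi c"
  have "x \<ominus> z \<in> mi c \<longleftrightarrow> y \<ominus> z \<in> mi c" if z: "z \<in> carrier R" for z
    using mi_minus_trans[OF assms(1,2) z *] mi_minus_trans[OF assms(2,1) z mi_minus_sym[OF assms *]] by blast
  then have "(\<lambda>z. z \<in> carrier R \<and> x \<ominus> z \<in> mi c) = (\<lambda>z. z \<in> carrier R \<and> y \<ominus> z \<in> mi c)" by blast
  then show "coset_rep c x = coset_rep c y" unfolding coset_rep_def by simp
qed

lemma coset_rep_idem: "x \<in> carrier R \<Longrightarrow> coset_rep c (coset_rep c x) = coset_rep c x"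
proof -
  assume x: "x \<in> carrier R"
  show ?thesis
    unfolding coset_rep_eq_iff[OF coset_rep(1)[OF x] x] by (rule mi_minus_sym[OF x coset_rep(1)[OF x] coset_rep(2)[OF x]])
qed

lemma card_coset_rep: "c \<le> d \<Longrightarrow> card (coset_rep c ` carrier R) = p ^ (f * c)"
proof -
  assume c: "c \<le> d"
  have "additive_subgroup (carrier R) R" using sub_mi[of 0] by (simp add: mi_0)
  then have "card (carrier R) = card (mi c) * card (coset_rep c ` carrier R)"
  proof (rule card_fibres)
    show "mi c \<subseteq> carrier R" using mi_carrier by blast
    show "a \<in> carrier R \<Longrightarrow> b \<in> carrier R \<Longrightarrow> coset_rep c a = coset_rep c b \<longleftrightarrow> a \<ominus> b \<in> mi c" for a b
      by (rule coset_rep_eq_iff)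
  qed (rule finite_carrier)
  moreover have "f * d = f * (d - c) + f * c" using c by (metis distrib_left le_add_diff_inverse2)
  ultimately show ?thesis using card_mi[OF c] card_carrier p_gt_1 by (simp add: power_add)
qed

text \<open>Levels are counted from the bottom: \<open>sep_char l\<close> is trivial on
  \<open>mi (d - l)\<close> and separates the layer directly above it, so that \<open>l = 0\<close>
  belongs to the socle.\<close>

definition sep_char :: "nat \<Rightarrow> nat \<Rightarrow> 'a \<Rightarrow> complex" where
  "sep_char l = (SOME \<chi>. (\<forall>s. add_char (\<chi> s) \<and> (\<forall>a\<in>mi (d - l). \<chi> s a = 1)) \<and>
    (\<forall>x\<in>mi (d - Suc l). x \<notin> mi (d - l) \<longrightarrow> (\<exists>s<f. \<chi> s x \<noteq> 1)))"

lemma sep_char: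
  assumes "l < d"
  shows "add_char (sep_char l s)" "a \<in> mi (d - l) \<Longrightarrow> sep_char l s a = 1"
    "x \<in> mi (d - Suc l) \<Longrightarrow> x \<notin> mi (d - l) \<Longrightarrow> \<exists>s<f. sep_char l s x \<noteq> 1"
proof -
  have s: "Suc (d - Suc l) = d - l" and l: "d - Suc l < d" using assms by auto
  have "\<exists>\<chi>. (\<forall>s. add_char (\<chi> s) \<and> (\<forall>a\<in>mi (d - l). \<chi> s a = 1)) \<and>
    (\<forall>x\<in>mi (d - Suc l). x \<notin> mi (d - l) \<longrightarrow> (\<exists>s<f. \<chi> s x \<noteq> 1))"
    using add_char_separating[OF l] unfolding s .
  from someI_ex[OF this, folded sep_char_def] show "add_char (sep_char l s)" "a \<in> mi (d - l) \<Longrightarrow> sep_char l s a = 1"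
    "x \<in> mi (d - Suc l) \<Longrightarrow> x \<notin> mi (d - l) \<Longrightarrow> \<exists>s<f. sep_char l s x \<noteq> 1" by blast+
qed

lemma socle_level:
  assumes "y \<in> mi k" "y \<noteq> \<zero>"
  shows "\<exists>j. k \<le> j \<and> j < d \<and> y \<in> mi j \<and> y \<notin> mi (Suc j)"
proof (rule ccontr)
  assume *: "\<not> ?thesis"
  have "k \<le> d" using assms mi_antimono[of d k] mi_d by (cases "k \<le> d") auto
  then have "y \<in> mi d"
  proof (induction rule: dec_induct)
    case (step j)
    then show ?case using * by blast
  qed (rule assms)
  then show False using mi_d assms by simp
qed

text \<open>A suitable \<open>p\<close>-power multiple \<open>y\<close> of a nonzero
  \<open>x\<close> is nonzero and killed by \<open>p\<close>, so it lies in
  \<open>mi (d - e)\<close> and thus in a layer with index \<open>l < e\<close>. A character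
  nontrivial at \<open>y\<close> is nontrivial at \<open>x\<close>, since its value at
  \<open>y\<close> is a power of that at \<open>x\<close>.\<close>

lemma sep_char_jointly_faithful:
  assumes x: "x \<in> carrier R" and triv: "\<And>l s. l < e \<Longrightarrow> s < f \<Longrightarrow> sep_char l s x = 1"
  shows "x = \<zero>"
proof (rule ccontr)
  assume ne: "x \<noteq> \<zero>"
  define t where "t = (LEAST t. add_pow R (p ^ t) x = \<zero>)"
  have t: "add_pow R (p ^ t) x = \<zero>" unfolding t_def using torsion[OF x] by (rule LeastI)
  have "t \<noteq> 0" using t ne x by (intro notI) simp
  then obtain t' where t': "t = Suc t'" by (cases t) auto
  define y where "y = add_pow R (p ^ t') x"
  have yc: "y \<in> carrier R" using x by (simp add: y_def)
  have "y \<noteq> \<zero>" unfolding y_def using not_less_Least[of t' "\<lambda>t. add_pow R (p ^ t) x = \<zero>"] t' t_def by auto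
  moreover have "[p] \<cdot> y = \<zero>" using t x by (simp add: y_def t' add.nat_pow_pow mult.commute)
  then have "y \<in> mi (d - e)" using p_torsion yc by blast
  ultimately obtain j where j: "d - e \<le> j" "j < d" "y \<in> mi j" "y \<notin> mi (Suc j)" using socle_level by blast
  define l where "l = d - Suc j"
  have l: "l < d" "l < e" "d - Suc l = j" "d - l = Suc j" using j d_pos by (auto simp: l_def)
  obtain s where s: "s < f" "sep_char l s y \<noteq> 1" using sep_char(3)[OF l(1), of y] j l by auto
  have "sep_char l s y = sep_char l s x ^ (p ^ t')" unfolding y_def by (rule add_char_pow[OF sep_char(1)[OF l(1)] x])
  then show False using s triv[OF l(2) s(1)] by simp
qed

section \<open>The action on rows over an interval, and its cocycle\<close>

definition rowmul :: "(nat \<Rightarrow> 'a) \<Rightarrow> (nat \<Rightarrow> nat \<Rightarrow> 'a) \<Rightarrow> nat \<Rightarrow> 'a" where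
  "rowmul u g k = (\<Oplus>l\<in>{1..n}. u l \<otimes> g l k)"

lemma rowmul_closed [simp]: "(\<And>l. u l \<in> carrier R) \<Longrightarrow> g \<in> carrier U \<Longrightarrow> rowmul u g k \<in> carrier R"
  by (auto simp: rowmul_def)

lemma rowmul_mult:
  assumes "\<And>l. u l \<in> carrier R" "g \<in> carrier U" "g' \<in> carrier U"
  shows "rowmul u (g \<otimes>\<^bsub>U\<^esub> g') k = rowmul (rowmul u g) g' k"
proof -
  have "rowmul u (g \<otimes>\<^bsub>U\<^esub> g') k = (\<Oplus>l\<in>{1..n}. \<Oplus>m\<in>{1..n}. u l \<otimes> g l m \<otimes> g' m k)"
    unfolding rowmul_def U_mult using assms
    by (intro finsum_cong' refl) (auto simp: finsum_rdistr m_assoc)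
  also have "\<dots> = (\<Oplus>m\<in>{1..n}. \<Oplus>l\<in>{1..n}. u l \<otimes> g l m \<otimes> g' m k)"
    using assms by (intro finsum_swap) auto
  also have "\<dots> = rowmul (rowmul u g) g' k"
    unfolding rowmul_def using assms by (intro finsum_cong' refl) (auto simp: finsum_ldistr)
  finally show ?thesis .
qed

lemma finsum_minus_mi:
  assumes "finite S" "\<And>x. x \<in> S \<Longrightarrow> a x \<in> carrier R" "\<And>x. x \<in> S \<Longrightarrow> b x \<in> carrier R"
    "\<And>x. x \<in> S \<Longrightarrow> a x \<ominus> b x \<in> mi c"
  shows "finsum R a S \<ominus> finsum R b S \<in> mi c"
  using assms
proof (induction S)
  case empty
  then show ?case using mi_zero by (simp add: minus_eq)
next
  case (insert x S)
  have cl: "a x \<in> carrier R" "b x \<in> carrier R" "finsum R a S \<in> carrier R" "finsum R b S \<in> carrier R"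
    using insert.prems by (auto intro!: finsum_closed)
  have "finsum R a (insert x S) \<ominus> finsum R b (insert x S) =
      (a x \<oplus> finsum R a S) \<ominus> (b x \<oplus> finsum R b S)"
    using insert by (subst (1 2) finsum_insert) auto
  also have "\<dots> = (a x \<ominus> b x) \<oplus> (finsum R a S \<ominus> finsum R b S)"
    using cl by (simp add: minus_eq minus_add a_ac)
  also have "\<dots> \<in> mi c"
    using insert by (intro additive_subgroup.a_closed[OF sub_mi]) auto
  finally show ?case .
qed

lemma rowmul_cong_mi:
  assumes "\<And>l. u l \<in> carrier R" "\<And>l. u' l \<in> carrier R" "g \<in> carrier U"
    "\<And>l. l \<in> {1..n} \<Longrightarrow> (u l \<ominus> u' l) \<otimes> g l k \<in> mi c"
  shows "rowmul u g k \<ominus> rowmul u' g k \<in> mi c"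
  unfolding rowmul_def
proof (rule finsum_minus_mi)
  fix l assume "l \<in> {1..n}"
  then show "u l \<otimes> g l k \<ominus> u' l \<otimes> g l k \<in> mi c"
    using assms(4)[of l] assms(1-3) by (simp add: minus_eq l_distr l_minus)
qed (use assms in auto)

text \<open>The coordinate \<open>j\<close> is zero because its value after the action is not stored
  in the permuted set; the character records it.\<close>

definition row_vec :: "nat \<Rightarrow> nat \<Rightarrow> (nat \<Rightarrow> 'a) \<Rightarrow> nat \<Rightarrow> 'a" where
  "row_vec i j v k = (if k = i then \<one> else if k \<in> between i j then v k else \<zero>)"

text \<open>\<open>coset_rep\<close> and \<open>restrict\<close> pick canonical functions, so that
  tuples of residue classes form an ordinary finite \<open>PiE\<close> set.\<close>

definition row_action :: "nat \<Rightarrow> nat \<Rightarrow> nat \<Rightarrow> (nat \<Rightarrow> nat \<Rightarrow> 'a) \<Rightarrow> (nat \<Rightarrow> 'a) \<Rightarrow> nat \<Rightarrow> 'a" where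
  "row_action c i j g v = restrict (\<lambda>k. coset_rep c (rowmul (row_vec i j v) g k)) (between i j)"

context
  fixes i j c :: nat
  assumes ij: "(i, j) \<in> Iex"
begin

lemma row_vec_closed: "(\<And>k. k \<in> between i j \<Longrightarrow> v k \<in> carrier R) \<Longrightarrow> row_vec i j v k \<in> carrier R"
  by (simp add: row_vec_def)

lemma ijn: "i \<in> {1..n}" "j \<in> {1..n}" "i \<noteq> j" "i \<notin> between i j" "j \<notin> between i j"
  using prec_range[OF IexD(1)[OF ij]] IexD(1)[OF ij] prec_irrefl by (auto simp: between_def)

lemma row_i:
  assumes "\<And>k. k \<in> between i j \<Longrightarrow> v k \<in> carrier R" "g \<in> unipotent"
  shows "rowmul (row_vec i j v) g i = \<one>"
proof -
  have "g l i = \<zero>" if "l \<noteq> i" for l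
    using that IexD(2)[OF ij, of l] by (intro U_zero_entry) (use assms in auto)
  then have "rowmul (row_vec i j v) g i = (if i \<in> {1..n} then row_vec i j v i \<otimes> g i i else \<zero>)"
    unfolding rowmul_def using assms row_vec_closed by (intro finsum_delta) auto
  then show ?thesis using ijn assms(2) by (simp add: row_vec_def unipotent_diag)
qed

lemma row_zero:
  assumes "\<And>k. k \<in> between i j \<Longrightarrow> v k \<in> carrier R" "g \<in> carrier U" "l \<noteq> i" "(i, l) \<notin> prec"
  shows "rowmul (row_vec i j v) g l = \<zero>"
proof -
  have "row_vec i j v m \<otimes> g m l = \<zero>" for m
  proof (cases "m = i \<or> m \<in> between i j")
    case True
    then have "(m, l) \<notin> preceq"
      using assms(3,4) prec_trans[of i m l] by (auto simp: between_def)
    then show ?thesis using U_zero_entry[OF assms(2)] row_vec_closed[OF assms(1)] by simp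
  qed (use assms(2) in \<open>simp add: row_vec_def\<close>)
  then show ?thesis by (simp add: rowmul_def)
qed

text \<open>Passing to representatives changes the inner coordinates only modulo
  \<open>mi c\<close>, and the dropped coordinate \<open>j\<close> re-enters additively because
  \<open>g'\<close> has diagonal entry 1 there. The second claim is the cocycle identity behind
  \<open>char_mult\<close>.\<close>

lemma row_action_step:
  assumes v: "\<And>k. k \<in> between i j \<Longrightarrow> v k \<in> carrier R" and g: "g \<in> unipotent" "g' \<in> unipotent"
  shows "k \<in> between i j \<Longrightarrow> rowmul (rowmul (row_vec i j v) g) g' k \<ominus> rowmul (row_vec i j (row_action c i j g v)) g' k \<in> mi c"
    and "rowmul (rowmul (row_vec i j v) g) g' j \<ominus>
      (rowmul (row_vec i j v) g j \<oplus> rowmul (row_vec i j (row_action c i j g v)) g' j) \<in> mi c"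
proof -
  let ?w = "rowmul (row_vec i j v) g" and ?u = "row_vec i j (row_action c i j g v)"
  have wc: "?w l \<in> carrier R" for l using g row_vec_closed[OF v] by simp
  have uc: "?u l \<in> carrier R" for l using wc coset_rep by (auto simp: row_vec_def row_action_def)
  have gc: "g' l k \<in> carrier R" for l k using g by simp
  \<comment> \<open>Coordinates \<open>l\<close> outside the interval do no harm: if
    \<open>l\<close> is above \<open>i\<close>, it is not at or below \<open>k\<close>, so
    \<open>g' l k\<close> is zero; otherwise the row itself is zero at \<open>l\<close>.\<close>
  have near: "(?w l \<ominus> ?u l) \<otimes> g' l k \<in> mi c"
    if "k \<in> between i j \<or> k = j" "l \<noteq> j" for k l
  proof (cases "l = i \<or> l \<in> between i j")
    case True
    have "?w l \<ominus> ?u l \<in> mi c"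
    proof (cases "l = i")
      case True
      then show ?thesis using row_i[OF v g(1)] mi_zero by (simp add: row_vec_def minus_eq r_neg)
    next
      case False
      then show ?thesis using True coset_rep(2)[OF wc] by (simp add: row_vec_def row_action_def)
    qed
    then show ?thesis using ideal.I_r_closed[OF ideal_mi _ gc] by blast
  next
    case False
    then have u0: "?u l = \<zero>" by (simp add: row_vec_def)
    have "?w l = \<zero> \<or> g' l k = \<zero>"
    proof (cases "(i, l) \<in> prec")
      case True
      have "(l, k) \<notin> preceq"
      proof
        assume "(l, k) \<in> preceq"
        then have "(l, j) \<in> prec" using that prec_trans[of l k j] by (auto simp: between_def)
        then show False using False True prec_range[OF True] by (auto simp: between_def)
      qed
      then show ?thesis using U_zero_entry[of g' l k] g by simp
    next
      case F2: False
      then show ?thesis using row_zero[OF v unipotent_U[OF g(1)] _ F2] False by auto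
    qed
    then have "(?w l \<ominus> ?u l) \<otimes> g' l k = \<zero>" using u0 wc gc by (auto simp: minus_eq)
    then show ?thesis using mi_zero by simp
  qed
  show "rowmul ?w g' k \<ominus> rowmul ?u g' k \<in> mi c" if k: "k \<in> between i j" for k
  proof (rule rowmul_cong_mi)
    fix l assume "l \<in> {1..n}"
    show "(?w l \<ominus> ?u l) \<otimes> g' l k \<in> mi c"
    proof (cases "l = j")
      case True
      have "(j, k) \<notin> preceq" using k IexD(3)[OF ij, of k] ijn by auto
      then have "g' l k = \<zero>" using U_zero_entry[of g' j k] g True by simp
      then show ?thesis using wc uc mi_zero by simp
    qed (use near k in blast)
  qed (use wc uc g in auto)
  \<comment> \<open>The new row with its coordinate \<open>j\<close> restored, so that it is close
    to \<open>?w\<close> in every coordinate that matters.\<close>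
  let ?u2 = "\<lambda>l. if l = j then ?w j else ?u l"
  have "rowmul ?u2 g' j = ?w j \<oplus> rowmul ?u g' j"
  proof -
    have "rowmul ?u2 g' j = (\<Oplus>l\<in>{1..n}. (if l = j then ?w j else \<zero>) \<oplus> ?u l \<otimes> g' l j)"
    proof -
      have "?u j = \<zero>" "g' j j = \<one>" using ijn unipotent_diag[OF g(2), of j] by (simp_all add: row_vec_def)
      then show ?thesis
        unfolding rowmul_def[of ?u2] using wc uc gc by (intro finsum_cong' refl) auto
    qed
    also have "\<dots> = (\<Oplus>l\<in>{1..n}. if l = j then ?w j else \<zero>) \<oplus> rowmul ?u g' j"
      unfolding rowmul_def[of ?u g' j] using wc uc gc by (intro finsum_addf) auto
    also have "(\<Oplus>l\<in>{1..n}. if l = j then ?w j else \<zero>) = ?w j"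
      using ijn wc by (subst finsum_delta[where k = j]) auto
    finally show ?thesis .
  qed
  moreover have "rowmul ?w g' j \<ominus> rowmul ?u2 g' j \<in> mi c"
  proof (rule rowmul_cong_mi)
    fix l assume "l \<in> {1..n}"
    show "(?w l \<ominus> ?u2 l) \<otimes> g' l j \<in> mi c"
      using near[of j l] wc gc mi_zero by (cases "l = j") (auto simp: minus_eq r_neg)
  qed (use wc uc g in auto)
  ultimately show "rowmul ?w g' j \<ominus> (?w j \<oplus> rowmul ?u g' j) \<in> mi c" by simp
qed

lemma row_action_closed:
  assumes "\<And>k. k \<in> between i j \<Longrightarrow> v k \<in> carrier R" "g \<in> carrier U"
  shows "row_action c i j g v \<in> between i j \<rightarrow>\<^sub>E coset_rep c ` carrier R"
  using assms row_vec_closed by (auto simp: row_action_def)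

lemma row_action_mult:
  assumes v: "\<And>k. k \<in> between i j \<Longrightarrow> v k \<in> carrier R" and g: "g \<in> unipotent" "g' \<in> unipotent"
  shows "row_action c i j (g \<otimes>\<^bsub>U\<^esub> g') v = row_action c i j g' (row_action c i j g v)"
proof -
  have "coset_rep c (rowmul (row_vec i j v) (g \<otimes>\<^bsub>U\<^esub> g') k) = coset_rep c (rowmul (row_vec i j (row_action c i j g v)) g' k)"
    if k: "k \<in> between i j" for k
  proof -
    have sc: "row_action c i j g v k \<in> carrier R" if "k \<in> between i j" for k
      using that coset_rep(1) g row_vec_closed[OF v] by (simp add: row_action_def)
    have "rowmul (row_vec i j v) (g \<otimes>\<^bsub>U\<^esub> g') k \<ominus> rowmul (row_vec i j (row_action c i j g v)) g' k \<in> mi c"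
      using row_action_step(1)[OF v g k] rowmul_mult[of "row_vec i j v" g g' k] row_vec_closed[OF v] g by simp
    then show ?thesis using coset_rep_eq_iff g row_vec_closed[OF v] row_vec_closed[OF sc] by simp
  qed
  then show ?thesis by (simp add: row_action_def[of c i j "g \<otimes>\<^bsub>U\<^esub> g'"] row_action_def[of c i j g'] cong: restrict_cong)
qed

lemma char_mult:
  assumes chi: "add_char \<chi>" "\<And>a. a \<in> mi c \<Longrightarrow> \<chi> a = 1"
    and v: "\<And>k. k \<in> between i j \<Longrightarrow> v k \<in> carrier R" and g: "g \<in> unipotent" "g' \<in> unipotent"
  shows "\<chi> (rowmul (row_vec i j v) (g \<otimes>\<^bsub>U\<^esub> g') j) =
    \<chi> (rowmul (row_vec i j v) g j) * \<chi> (rowmul (row_vec i j (row_action c i j g v)) g' j)"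
proof -
  have sc: "row_action c i j g v k \<in> carrier R" if "k \<in> between i j" for k
    using that coset_rep(1) g row_vec_closed[OF v] by (simp add: row_action_def)
  have cl: "rowmul (row_vec i j v) g j \<in> carrier R" "rowmul (row_vec i j (row_action c i j g v)) g' j \<in> carrier R"
    "rowmul (row_vec i j v) (g \<otimes>\<^bsub>U\<^esub> g') j \<in> carrier R"
    using g row_vec_closed[OF v] row_vec_closed[OF sc] by simp_all
  have "rowmul (row_vec i j v) (g \<otimes>\<^bsub>U\<^esub> g') j \<ominus>
      (rowmul (row_vec i j v) g j \<oplus> rowmul (row_vec i j (row_action c i j g v)) g' j) \<in> mi c"
    using row_action_step(2)[OF v g] rowmul_mult[of "row_vec i j v" g g' j] row_vec_closed[OF v] g by simp
  then have "\<chi> (rowmul (row_vec i j v) (g \<otimes>\<^bsub>U\<^esub> g') j) =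
      \<chi> (rowmul (row_vec i j v) g j \<oplus> rowmul (row_vec i j (row_action c i j g v)) g' j)"
    using cl by (subst add_char_eq_iff[OF chi(1)]) (auto intro: chi(2))
  then show ?thesis using cl by (simp add: add_char_add[OF chi(1)])
qed

lemma row_action_one:
  assumes "v \<in> between i j \<rightarrow>\<^sub>E coset_rep c ` carrier R"
  shows "row_action c i j \<one>\<^bsub>U\<^esub> v = v" "rowmul (row_vec i j v) \<one>\<^bsub>U\<^esub> j = \<zero>"
proof -
  have v: "v k \<in> carrier R" if "k \<in> between i j" for k
    using PiE_mem[OF assms that] coset_rep(1) by auto
  have row: "rowmul (row_vec i j v) \<one>\<^bsub>U\<^esub> k = row_vec i j v k" if "k \<in> {1..n}" for k
  proof -
    have "rowmul (row_vec i j v) \<one>\<^bsub>U\<^esub> k = (if k \<in> {1..n} then row_vec i j v k \<otimes> \<one>\<^bsub>U\<^esub> k k else \<zero>)"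
      unfolding rowmul_def using row_vec_closed[OF v] by (intro finsum_delta) (auto simp: U_one)
    then show ?thesis using that row_vec_closed[OF v] by (simp add: U_one)
  qed
  show "rowmul (row_vec i j v) \<one>\<^bsub>U\<^esub> j = \<zero>" using row ijn by (simp add: row_vec_def)
  show "row_action c i j \<one>\<^bsub>U\<^esub> v = v"
  proof (rule PiE_ext[OF _ assms])
    show "row_action c i j \<one>\<^bsub>U\<^esub> v \<in> between i j \<rightarrow>\<^sub>E coset_rep c ` carrier R" using v by (intro row_action_closed) auto
    fix k assume k: "k \<in> between i j"
    then have "k \<in> {1..n}" "k \<noteq> i" using ijn by (auto simp: between_def)
    then have "row_action c i j \<one>\<^bsub>U\<^esub> v k = coset_rep c (v k)" using k row by (simp add: row_action_def row_vec_def)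
    also have "\<dots> = v k" using assms k coset_rep_idem by (auto simp: PiE_iff)
    finally show "row_action c i j \<one>\<^bsub>U\<^esub> v k = v k" .
  qed
qed

lemma row_unit:
  assumes "g \<in> carrier U"
  shows "rowmul (row_vec i j (\<lambda>_. \<zero>)) g k = g i k"
proof -
  have "rowmul (row_vec i j (\<lambda>_. \<zero>)) g k = (if i \<in> {1..n} then row_vec i j (\<lambda>_. \<zero>) i \<otimes> g i k else \<zero>)"
    unfolding rowmul_def using assms by (intro finsum_delta) (auto simp: row_vec_def)
  then show ?thesis using ijn assms by (simp add: row_vec_def)
qed

lemma row_single:
  assumes g: "g \<in> carrier U" and a: "a \<in> between i j" and r: "r \<in> carrier R"
  shows "rowmul (row_vec i j (\<lambda>k. if k = a then r else \<zero>)) g k = g i k \<oplus> r \<otimes> g a k"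
proof -
  let ?u = "row_vec i j (\<lambda>_. \<zero>)"
  have ai: "a \<noteq> i" "a \<in> {1..n}" using a ijn by (auto simp: between_def)
  have uc: "?u l \<in> carrier R" for l by (rule row_vec_closed) simp
  have gc: "g l k \<in> carrier R" for l using g by simp
  have "rowmul (row_vec i j (\<lambda>k. if k = a then r else \<zero>)) g k =
      (\<Oplus>l\<in>{1..n}. ?u l \<otimes> g l k \<oplus> (if l = a then r \<otimes> g a k else \<zero>))"
    unfolding rowmul_def using uc gc r a ai
    by (intro finsum_cong' refl) (auto simp: row_vec_def)
  also have "\<dots> = rowmul ?u g k \<oplus> (\<Oplus>l\<in>{1..n}. if l = a then r \<otimes> g a k else \<zero>)"
    unfolding rowmul_def using uc gc r by (intro finsum_addf) auto
  also have "(\<Oplus>l\<in>{1..n}. if l = a then r \<otimes> g a k else \<zero>) = r \<otimes> g a k"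
    using ai gc r by (subst finsum_delta[where k = a]) auto
  finally show ?thesis by (simp add: row_unit[OF g])
qed

lemma row_vec_restrict: "row_vec i j (restrict v (between i j)) = row_vec i j v"
  by (auto simp: row_vec_def fun_eq_iff)

end

lemma coset_rep_d: "x \<in> carrier R \<Longrightarrow> coset_rep d x = x"
proof -
  assume x: "x \<in> carrier R"
  have "x \<ominus> coset_rep d x = \<zero>" using coset_rep(2)[OF x, of d] mi_d by simp
  then show ?thesis using x coset_rep(1)[OF x, of d] by simp
qed

text \<open>The ideal generated by a nonzero \<open>x\<close> contains the generator
  \<open>unif [^] (d - 1)\<close> of the socle, on which the characters of level 0 do not all vanish
  to 1.\<close>

lemma sep_char_ideal_faithful:
  assumes x: "x \<in> carrier R" and triv: "\<And>r s. r \<in> carrier R \<Longrightarrow> s < f \<Longrightarrow> sep_char 0 s (r \<otimes> x) = 1"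
  shows "x = \<zero>"
proof (rule ccontr)
  assume "x \<noteq> \<zero>"
  then obtain j u v where *: "j < d" "u \<in> carrier R" "v \<in> carrier R" "u \<otimes> v = \<one>" "x = u \<otimes> unif [^] j"
    using decompose[OF x] by blast
  let ?r = "v \<otimes> unif [^] (d - Suc j)"
  have "?r \<otimes> x = (u \<otimes> v) \<otimes> (unif [^] (d - Suc j) \<otimes> unif [^] j)"
    unfolding *(5) using *(2,3) by (simp add: m_ac)
  also have "\<dots> = unif [^] (d - Suc 0)"
    using *(1,4) nat_pow_mult[OF unif(1), of "d - Suc j" j] by simp
  finally have r: "?r \<otimes> x = unif [^] (d - Suc 0)" .
  have "unif [^] (d - Suc 0) \<in> mi (d - Suc 0)" using miI[of \<one> "d - Suc 0"] by simp
  moreover have "unif [^] (d - Suc 0) \<notin> mi (d - 0)"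
    using pow_nonzero[of "d - Suc 0"] d_pos mi_d by simp
  ultimately obtain s where "s < f" "sep_char 0 s (unif [^] (d - Suc 0)) \<noteq> 1"
    using sep_char(3)[of 0 "unif [^] (d - Suc 0)"] d_pos by auto
  then show False using triv[of ?r s] * r by simp
qed

section \<open>The sum of all blocks and its faithfulness\<close>

definition monomial_index :: "(((nat \<times> nat) \<times> nat \<times> nat) \<times> (nat \<Rightarrow> 'a)) set" where
  "monomial_index = (SIGMA x:Iex \<times> {0..<e} \<times> {0..<f}.
     between (fst (fst x)) (snd (fst x)) \<rightarrow>\<^sub>E coset_rep (d - fst (snd x)) ` carrier R)"

definition rep_dim :: nat where
  "rep_dim = (\<Sum>l = 0..e - 1. \<Sum>(i, j)\<in>Iex. f * p ^ (f * (d - l) * alpha n prec i j))"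

lemma rep_dim_alt:
  "rep_dim = (\<Sum>x\<in>Iex \<times> {0..<e} \<times> {0..<f}. p ^ (f * (d - fst (snd x)) * alpha n prec (fst (fst x)) (snd (fst x))))"
proof -
  have "(\<Sum>x\<in>Iex \<times> {0..<e} \<times> {0..<f}. p ^ (f * (d - fst (snd x)) * alpha n prec (fst (fst x)) (snd (fst x)))) =
    (\<Sum>ij\<in>Iex. \<Sum>l\<in>{0..<e}. \<Sum>s\<in>{0..<f}. p ^ (f * (d - l) * alpha n prec (fst ij) (snd ij)))"
    by (simp only: sum.cartesian_product' fst_conv snd_conv)
  also have "\<dots> = (\<Sum>l\<in>{0..<e}. \<Sum>ij\<in>Iex. f * p ^ (f * (d - l) * alpha n prec (fst ij) (snd ij)))"
    by (subst sum.swap) simp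
  also have "\<dots> = rep_dim"
  proof -
    have "{0..<e} = {0..e - 1}" using e_pos by auto
    then show ?thesis by (simp only: rep_dim_def case_prod_unfold)
  qed
  finally show ?thesis by (rule sym)
qed

lemma card_monomial_index: "finite monomial_index" "card monomial_index = rep_dim"
proof -
  have finR: "finite (coset_rep c ` carrier R)" for c using finite_carrier by simp
  show "finite monomial_index" unfolding monomial_index_def by (intro finite_SigmaI finite_PiE) (use finR in auto)
  show "card monomial_index = rep_dim"
    unfolding monomial_index_def rep_dim_alt
    by (subst card_SigmaI)
      (auto simp: finite_PiE finR card_PiE card_coset_rep card_between power_mult intro!: sum.cong)
qed

definition monomial_perm :: "(nat \<Rightarrow> nat \<Rightarrow> 'a) \<Rightarrow> ((nat \<times> nat) \<times> nat \<times> nat) \<times> (nat \<Rightarrow> 'a) \<Rightarrow> ((nat \<times> nat) \<times> nat \<times> nat) \<times> (nat \<Rightarrow> 'a)" where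
  "monomial_perm g = (\<lambda>(((i, j), l, s), v). (((i, j), l, s), row_action (d - l) i j g v))"

definition monomial_coeff :: "(nat \<Rightarrow> nat \<Rightarrow> 'a) \<Rightarrow> ((nat \<times> nat) \<times> nat \<times> nat) \<times> (nat \<Rightarrow> 'a) \<Rightarrow> complex" where
  "monomial_coeff g = (\<lambda>(((i, j), l, s), v). sep_char l s (rowmul (row_vec i j v) g j))"

lemma monomial_indexE:
  assumes "x \<in> monomial_index"
  obtains i j l s v where "x = (((i, j), l, s), v)" "(i, j) \<in> Iex" "l < e" "l < d" "s < f"
    "v \<in> between i j \<rightarrow>\<^sub>E coset_rep (d - l) ` carrier R" "\<And>k. k \<in> between i j \<Longrightarrow> v k \<in> carrier R"
proof -
  obtain i j l s v where x: "x = (((i, j), l, s), v)" by (metis prod.collapse)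
  have *: "(i, j) \<in> Iex" "l < e" "s < f" "v \<in> between i j \<rightarrow>\<^sub>E coset_rep (d - l) ` carrier R"
    using assms by (simp_all add: monomial_index_def x)
  have "v k \<in> carrier R" if "k \<in> between i j" for k using PiE_mem[OF *(4) that] coset_rep(1) by auto
  moreover have "l < d" using * e_le by simp
  ultimately show thesis using that[OF x] * by blast
qed

lemma monomial_indexI: "(i, j) \<in> Iex \<Longrightarrow> l < e \<Longrightarrow> s < f \<Longrightarrow> v \<in> between i j \<rightarrow>\<^sub>E coset_rep (d - l) ` carrier R \<Longrightarrow>
    (((i, j), l, s), v) \<in> monomial_index"
  by (simp add: monomial_index_def)

text \<open>Every position \<open>(a, b)\<close> is seen by an extreme pair \<open>(i, j)\<close>
  around it. The blocks of level 0 work modulo \<open>mi d\<close>, which is zero, and so determine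
  the entries in the inner columns, and also those in column \<open>j\<close> from inner rows. The
  entry \<open>(i, j)\<close> itself is visible only through characters, and there all levels are
  used.\<close>

lemma monomial_faithful:
  assumes g: "g \<in> unipotent" "g' \<in> unipotent"
    and eq: "\<And>x. x \<in> monomial_index \<Longrightarrow> monomial_perm g x = monomial_perm g' x \<and> monomial_coeff g x = monomial_coeff g' x"
  shows "g = g'"
proof (intro ext)
  fix a b
  have gU: "g \<in> carrier U" "g' \<in> carrier U" using g by auto
  have gc: "g k l \<in> carrier R" "g' k l \<in> carrier R" for k l using gU by simp_all
  show "g a b = g' a b"
  proof (cases "(a, b) \<in> prec")
    case False
    show ?thesis
    proof (cases "(a, b) \<in> preceq")
      case True
      then have "a = b" "a \<in> {1..n}" using False by auto
      then show ?thesis using unipotent_diag[OF g(1), of a] unipotent_diag[OF g(2), of a] by simp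
    next
      case False
      then show ?thesis using U_zero_entry gU by metis
    qed
  next
    case True
    obtain i j where ij: "(i, j) \<in> Iex" "i = a \<or> (i, a) \<in> prec" "j = b \<or> (b, j) \<in> prec"
      using Iex_exists[OF True] by blast
    have e0: "0 < e" and f0: "0 < f" using e_pos f_pos by auto
    have full: "restrict v (between i j) \<in> between i j \<rightarrow>\<^sub>E coset_rep (d - 0) ` carrier R" if "\<And>k. v k \<in> carrier R" for v
      using that coset_rep_d by (auto simp: image_iff)
    have row: "rowmul (row_vec i j v) g k = rowmul (row_vec i j v) g' k"
      if "\<And>k. v k \<in> carrier R" "k \<in> between i j" for v k
    proof -
      have c: "rowmul (row_vec i j v) g k \<in> carrier R" "rowmul (row_vec i j v) g' k \<in> carrier R"
        using gU row_vec_closed[OF ij(1)] that(1) by simp_all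
      have "monomial_perm g (((i, j), 0, 0), restrict v (between i j)) = monomial_perm g' (((i, j), 0, 0), restrict v (between i j))"
        using eq[OF monomial_indexI[OF ij(1) e0 f0 full[of v]]] that(1) by blast
      then have "row_action d i j g v k = row_action d i j g' v k"
        by (simp add: monomial_perm_def row_action_def row_vec_restrict[OF ij(1)] fun_eq_iff)
      then show ?thesis using that(2) c by (simp add: row_action_def coset_rep_d)
    qed
    have chr: "sep_char 0 s (rowmul (row_vec i j v) g j) = sep_char 0 s (rowmul (row_vec i j v) g' j)"
      if "\<And>k. v k \<in> carrier R" "s < f" for v s
    proof -
      have "monomial_coeff g (((i, j), 0, s), restrict v (between i j)) = monomial_coeff g' (((i, j), 0, s), restrict v (between i j))"
        using eq[OF monomial_indexI[OF ij(1) e0 that(2) full[of v]]] that(1) by blast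
      then show ?thesis by (simp add: monomial_coeff_def row_vec_restrict[OF ij(1)])
    qed
    have gij: "g i j = g' i j"
    proof -
      have "sep_char l s (g i j) = sep_char l s (g' i j)" if ls: "l < e" "s < f" for l s
      proof -
        define c where "c = d - l"
        have ld: "l < d" using ls e_le by simp
        \<comment> \<open>The index set contains only chosen representatives, so the zero row is
          represented by \<open>coset_rep c \<zero>\<close>, which may differ from zero by an
          element of \<open>mi c\<close>. The character does not notice the difference.\<close>
        let ?v = "restrict (\<lambda>_. coset_rep c \<zero>) (between i j)"
        have z: "coset_rep c \<zero> \<in> carrier R" "coset_rep c \<zero> \<ominus> \<zero> \<in> mi c"
          using coset_rep[of \<zero> c] mi_minus_sym[of \<zero> "coset_rep c \<zero>" c] by simp_all
        have near: "sep_char l s (rowmul (row_vec i j ?v) h j) = sep_char l s (h i j)" if h: "h \<in> carrier U" for h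
        proof -
          have "rowmul (row_vec i j ?v) h j \<ominus> rowmul (row_vec i j (\<lambda>_. \<zero>)) h j \<in> mi c"
          proof (rule rowmul_cong_mi)
            fix k
            have "row_vec i j ?v k \<ominus> row_vec i j (\<lambda>_. \<zero>) k \<in> mi c"
              using z mi_zero by (auto simp: row_vec_def minus_eq r_neg)
            then show "(row_vec i j ?v k \<ominus> row_vec i j (\<lambda>_. \<zero>) k) \<otimes> h k j \<in> mi c"
              using ideal.I_r_closed[OF ideal_mi] h by simp
          qed (use h z in \<open>auto simp: row_vec_def\<close>)
          then have "sep_char l s (rowmul (row_vec i j ?v) h j \<ominus> h i j) = 1"
            using sep_char(2)[OF ld] row_unit[OF ij(1) h] by (simp add: c_def)
          moreover have "rowmul (row_vec i j ?v) h j \<in> carrier R" using h z by (auto simp: row_vec_def)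
          ultimately show ?thesis using add_char_eq_iff[OF sep_char(1)[OF ld]] h by simp
        qed
        have "?v \<in> between i j \<rightarrow>\<^sub>E coset_rep (d - l) ` carrier R" by (auto simp: c_def)
        then have "monomial_coeff g (((i, j), l, s), ?v) = monomial_coeff g' (((i, j), l, s), ?v)"
          using eq[OF monomial_indexI[OF ij(1) ls]] by blast
        then show ?thesis using near[OF gU(1)] near[OF gU(2)] by (simp add: monomial_coeff_def)
      qed
      then have "sep_char l s (g i j \<ominus> g' i j) = 1" if "l < e" "s < f" for l s
        using that add_char_eq_iff[OF sep_char(1) gc(1) gc(2)] e_le by simp
      then have "g i j \<ominus> g' i j = \<zero>" using sep_char_jointly_faithful gc by simp
      then show ?thesis using gc by simp
    qed
    have gik: "g i k = g' i k" if "k \<in> between i j" for k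
      using row[of "\<lambda>_. \<zero>" k] that row_unit[OF ij(1)] gU by simp
    have gak: "g a' k = g' a' k" if "a' \<in> between i j" "k \<in> between i j" for a' k
      using row[of "\<lambda>k. if k = a' then \<one> else \<zero>" k] that row_single[OF ij(1) _ that(1), of _ \<one>] gU gc
        gik[OF that(2)] by simp
    \<comment> \<open>With \<open>r\<close> placed at \<open>a'\<close>, the coordinate
      \<open>j\<close> becomes \<open>g i j \<oplus> r \<otimes> g a' j\<close>. As \<open>r\<close>
      is arbitrary, the characters test the whole ideal generated by the difference of the two
      entries.\<close>
    have gaj: "g a' j = g' a' j" if a': "a' \<in> between i j" for a'
    proof -
      have "sep_char 0 s (r \<otimes> (g a' j \<ominus> g' a' j)) = 1" if "r \<in> carrier R" "s < f" for r s
      proof -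
        have d0: "0 < d" using d_pos by simp
        have "sep_char 0 s (g i j \<oplus> r \<otimes> g a' j) = sep_char 0 s (g i j \<oplus> r \<otimes> g' a' j)"
          using chr[of "\<lambda>k. if k = a' then r else \<zero>" s] that row_single[OF ij(1) _ a' that(1)] gU gij by simp
        then have "sep_char 0 s (r \<otimes> g a' j) = sep_char 0 s (r \<otimes> g' a' j)"
          using that gc add_char_add[OF sep_char(1)[OF d0]] add_char_nonzero[OF sep_char(1)[OF d0] gc(1)] add_char_nonzero[OF sep_char(1)[OF d0] gc(2)] by simp
        then have "sep_char 0 s (r \<otimes> g a' j \<ominus> r \<otimes> g' a' j) = 1"
          using add_char_eq_iff[OF sep_char(1)[OF d0]] that gc by simp
        then show ?thesis using that gc by (simp add: minus_eq r_distr r_minus)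
      qed
      then have "g a' j \<ominus> g' a' j = \<zero>" using gc by (intro sep_char_ideal_faithful) auto
      then show ?thesis using gc by simp
    qed
    have a: "a = i \<or> a \<in> between i j"
      using ij True prec_trans prec_range[OF True] by (auto simp: between_def)
    have b: "b = j \<or> b \<in> between i j"
      using ij True prec_trans prec_range[OF True] by (auto simp: between_def)
    show ?thesis using a b gij gik gak gaj by blast
  qed
qed

theorem exists_faithful_monomial:
  "\<exists>M. (\<forall>g\<in>unipotent. M g \<in> carrier (GL_complex rep_dim)) \<and>
    (\<forall>g\<in>unipotent. \<forall>g'\<in>unipotent. M (g \<otimes>\<^bsub>U\<^esub> g') = M g * M g') \<and> inj_on M unipotent"
proof (rule monomial_representation[OF card_monomial_index, where sg = monomial_perm and c = monomial_coeff and u = "\<one>\<^bsub>U\<^esub>"])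
  show "monomial_perm g x \<in> monomial_index" if "g \<in> unipotent" "x \<in> monomial_index" for g x
    using that(2)
  proof (rule monomial_indexE)
    fix i j l s v assume *: "x = (((i, j), l, s), v)" "(i, j) \<in> Iex" "l < e" "s < f"
      "\<And>k. k \<in> between i j \<Longrightarrow> v k \<in> carrier R"
    show ?thesis using monomial_indexI[OF *(2-4) row_action_closed[OF *(2,5)]] that(1) by (simp add: monomial_perm_def *(1))
  qed
  have "\<zero>\<^bsub>U\<^esub> \<in> pat" by (auto simp: U_zero intro!: patI)
  from unipotentI[OF this] show "\<one>\<^bsub>U\<^esub> \<in> unipotent" by simp
  show "monomial_perm (g \<otimes>\<^bsub>U\<^esub> g') x = monomial_perm g' (monomial_perm g x)" "monomial_coeff (g \<otimes>\<^bsub>U\<^esub> g') x = monomial_coeff g x * monomial_coeff g' (monomial_perm g x)"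
    if g: "g \<in> unipotent" "g' \<in> unipotent" and "x \<in> monomial_index" for g g' x
    using that(3)
  proof (atomize(full), rule monomial_indexE)
    fix i j l s v assume *: "x = (((i, j), l, s), v)" "(i, j) \<in> Iex" "l < d"
      "\<And>k. k \<in> between i j \<Longrightarrow> v k \<in> carrier R"
    show "monomial_perm (g \<otimes>\<^bsub>U\<^esub> g') x = monomial_perm g' (monomial_perm g x) \<and> monomial_coeff (g \<otimes>\<^bsub>U\<^esub> g') x = monomial_coeff g x * monomial_coeff g' (monomial_perm g x)"
      unfolding *(1) monomial_perm_def monomial_coeff_def
      using row_action_mult[OF *(2,4) g, where c = "d - l"] char_mult[OF *(2) sep_char(1)[OF *(3)] sep_char(2)[OF *(3)] *(4) g] by simp
  qed
  show "monomial_perm \<one>\<^bsub>U\<^esub> x = x \<and> monomial_coeff \<one>\<^bsub>U\<^esub> x = 1" if "x \<in> monomial_index" for x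
    using that
  proof (rule monomial_indexE)
    fix i j l s v assume *: "x = (((i, j), l, s), v)" "(i, j) \<in> Iex" "l < d"
      "v \<in> between i j \<rightarrow>\<^sub>E coset_rep (d - l) ` carrier R"
    show ?thesis
      using row_action_one[OF *(2,4)] add_char_zero[OF sep_char(1)[OF *(3)]] by (simp add: monomial_perm_def monomial_coeff_def *(1))
  qed
qed (use unipotent_mult unipotent_right_inverse monomial_faithful in blast)+

end

section \<open>Lower bound\<close>

text \<open>Layer-cake summation. It reduces the comparison of two sums of weights to a comparison
  of cardinalities for each threshold \<open>t\<close>.\<close>

lemma sum_eq_sum_card_ge:
  fixes w :: "'x \<Rightarrow> nat"
  assumes "finite S" "\<And>x. x \<in> S \<Longrightarrow> w x \<le> B"
  shows "(\<Sum>x\<in>S. w x) = (\<Sum>t = 1..B. card {x \<in> S. t \<le> w x})"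
proof -
  have "w x = (\<Sum>t = 1..B. if t \<le> w x then 1 else 0)" if "x \<in> S" for x
  proof -
    have "{1..B} \<inter> {t. t \<le> w x} = {1..w x}" using assms(2)[OF that] by auto
    then show ?thesis by (simp add: sum.If_cases)
  qed
  then have "(\<Sum>x\<in>S. w x) = (\<Sum>x\<in>S. \<Sum>t = 1..B. if t \<le> w x then 1 else 0)"
    by (intro sum.cong refl)
  also have "\<dots> = (\<Sum>t = 1..B. \<Sum>x\<in>S. if t \<le> w x then 1 else 0)" by (rule sum.swap)
  also have "\<dots> = (\<Sum>t = 1..B. card {x \<in> S. t \<le> w x})"
    using assms(1) by (intro sum.cong refl) (simp add: sum.If_cases Int_def)
  finally show ?thesis .
qed

section \<open>Characters of the central matrices and their conductors\<close>

context pattern_tvr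
begin

definition elem_mat :: "nat \<Rightarrow> nat \<Rightarrow> 'a \<Rightarrow> nat \<Rightarrow> nat \<Rightarrow> 'a" where
  "elem_mat i j r = (\<lambda>k l. if k = i \<and> l = j then r else \<zero>)"

lemma elem_mat_pat: "(i, j) \<in> prec \<Longrightarrow> r \<in> carrier R \<Longrightarrow> elem_mat i j r \<in> pat"
  by (rule patI) (auto simp: elem_mat_def)

definition center_mats :: "(nat \<Rightarrow> nat \<Rightarrow> 'a) set" where
  "center_mats = {M \<in> pat. \<forall>i j. (i, j) \<notin> Iex \<longrightarrow> M i j = \<zero>}"

lemma center_mats_pat: "M \<in> center_mats \<Longrightarrow> M \<in> pat" and center_mats_zero: "M \<in> center_mats \<Longrightarrow> (i, j) \<notin> Iex \<Longrightarrow> M i j = \<zero>"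
  by (simp_all add: center_mats_def)

lemma center_mats_U [simp]: "M \<in> center_mats \<Longrightarrow> M \<in> carrier U"
  using center_mats_pat pat_U by blast

lemma center_matsI:
  assumes "\<And>i j. M i j \<in> carrier R" "\<And>i j. (i, j) \<notin> Iex \<Longrightarrow> M i j = \<zero>"
  shows "M \<in> center_mats"
proof -
  have "M \<in> pat" using assms IexD(1) by (intro patI) blast+
  then show ?thesis using assms(2) by (simp add: center_mats_def)
qed

lemma elem_mat_center_mats: "(i, j) \<in> Iex \<Longrightarrow> r \<in> carrier R \<Longrightarrow> elem_mat i j r \<in> center_mats"
  by (rule center_matsI) (auto simp: elem_mat_def)

lemma center_mats_0: "\<zero>\<^bsub>U\<^esub> \<in> center_mats"
  by (rule center_matsI) (auto simp: U_zero)

lemma center_mats_add: "M \<in> center_mats \<Longrightarrow> M' \<in> center_mats \<Longrightarrow> M \<oplus>\<^bsub>U\<^esub> M' \<in> center_mats"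
  by (rule center_matsI) (simp_all add: U_add center_mats_zero)

lemma center_mats_minus: "M \<in> center_mats \<Longrightarrow> M' \<in> center_mats \<Longrightarrow> M \<ominus>\<^bsub>U\<^esub> M' \<in> center_mats"
  by (rule center_matsI) (simp_all add: U_minus center_mats_zero minus_eq)

lemma center_mats_annihilates:
  assumes "z \<in> center_mats" "x \<in> pat"
  shows "z \<otimes>\<^bsub>U\<^esub> x = \<zero>\<^bsub>U\<^esub>" "x \<otimes>\<^bsub>U\<^esub> z = \<zero>\<^bsub>U\<^esub>"
proof -
  have c: "z i j \<in> carrier R" "x i j \<in> carrier R" for i j using assms by simp_all
  have "z i k \<otimes> x k j = \<zero>" for i j k
  proof (cases "(i, k) \<in> Iex")
    case True
    then show ?thesis using pat_zero[OF assms(2), of k j] IexD(3)[OF True, of j] c by simp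
  qed (simp add: center_mats_zero[OF assms(1)] c)
  then show "z \<otimes>\<^bsub>U\<^esub> x = \<zero>\<^bsub>U\<^esub>" by (simp add: U_mult U_zero)
  have "x i k \<otimes> z k j = \<zero>" for i j k
  proof (cases "(k, j) \<in> Iex")
    case True
    then show ?thesis using pat_zero[OF assms(2), of i k] IexD(2)[OF True, of i] c by simp
  qed (simp add: center_mats_zero[OF assms(1)] c)
  then show "x \<otimes>\<^bsub>U\<^esub> z = \<zero>\<^bsub>U\<^esub>" by (simp add: U_mult U_zero)
qed

definition mat_on :: "(nat \<times> nat) set \<Rightarrow> (nat \<times> nat \<Rightarrow> 'a) \<Rightarrow> nat \<Rightarrow> nat \<Rightarrow> 'a" where
  "mat_on S m = (\<lambda>k l. if (k, l) \<in> S then m (k, l) else \<zero>)"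

lemma mat_on_center_mats: "S \<subseteq> Iex \<Longrightarrow> (\<And>x. x \<in> S \<Longrightarrow> m x \<in> carrier R) \<Longrightarrow> mat_on S m \<in> center_mats"
  by (rule center_matsI) (auto simp: mat_on_def)

lemma finite_center_mats: "finite center_mats"
proof (rule finite_subset)
  show "center_mats \<subseteq> mat_on Iex ` (Iex \<rightarrow>\<^sub>E carrier R)"
  proof
    fix M assume M: "M \<in> center_mats"
    have "M = mat_on Iex (restrict (\<lambda>x. M (fst x) (snd x)) Iex)"
      by (intro ext) (simp add: mat_on_def center_mats_zero[OF M])
    moreover have "restrict (\<lambda>x. M (fst x) (snd x)) Iex \<in> Iex \<rightarrow>\<^sub>E carrier R" using M by auto
    ultimately show "M \<in> mat_on Iex ` (Iex \<rightarrow>\<^sub>E carrier R)" by blast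
  qed
  show "finite (mat_on Iex ` (Iex \<rightarrow>\<^sub>E carrier R))" by (intro finite_imageI finite_PiE) (use finite_carrier in auto)
qed

definition zchar :: "((nat \<Rightarrow> nat \<Rightarrow> 'a) \<Rightarrow> complex) \<Rightarrow> bool" where
  "zchar \<chi> \<longleftrightarrow> \<chi> \<zero>\<^bsub>U\<^esub> = 1 \<and> (\<forall>z\<in>center_mats. \<forall>z'\<in>center_mats. \<chi> (z \<oplus>\<^bsub>U\<^esub> z') = \<chi> z * \<chi> z')"

lemma zchar_0: "zchar \<chi> \<Longrightarrow> \<chi> \<zero>\<^bsub>U\<^esub> = 1"
  and zchar_add: "zchar \<chi> \<Longrightarrow> z \<in> center_mats \<Longrightarrow> z' \<in> center_mats \<Longrightarrow> \<chi> (z \<oplus>\<^bsub>U\<^esub> z') = \<chi> z * \<chi> z'"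
  by (simp_all add: zchar_def)

lemma zchar_minus: "zchar \<chi> \<Longrightarrow> z \<in> center_mats \<Longrightarrow> z' \<in> center_mats \<Longrightarrow> \<chi> (z \<ominus>\<^bsub>U\<^esub> z') * \<chi> z' = \<chi> z"
  using zchar_add[of \<chi> "z \<ominus>\<^bsub>U\<^esub> z'" z'] center_mats_minus[of z z'] by (simp add: U.minus_eq U.a_assoc U.l_neg)

lemma zchar_nonzero: "zchar \<chi> \<Longrightarrow> z \<in> center_mats \<Longrightarrow> \<chi> z \<noteq> 0"
  using zchar_minus[of \<chi> "\<zero>\<^bsub>U\<^esub>" z] zchar_0[of \<chi>] center_mats_0 by auto

lemma zchar_elem_mat:
  assumes "zchar \<chi>" "(i, j) \<in> Iex"
  shows "add_char (\<lambda>r. \<chi> (elem_mat i j r))"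
proof -
  have "elem_mat i j (r \<oplus> s) = elem_mat i j r \<oplus>\<^bsub>U\<^esub> elem_mat i j s" for r s
    by (intro ext) (simp add: elem_mat_def U_add)
  moreover have "elem_mat i j \<zero> = \<zero>\<^bsub>U\<^esub>" by (intro ext) (simp add: elem_mat_def U_zero)
  ultimately show ?thesis
    using assms by (simp add: add_char_def zchar_0 zchar_add elem_mat_center_mats)
qed

lemma zchar_mat_on:
  assumes chi: "zchar \<chi>" and S: "S \<subseteq> Iex" and m: "\<And>x. x \<in> S \<Longrightarrow> m x \<in> carrier R"
  shows "\<chi> (mat_on S m) = (\<Prod>x\<in>S. \<chi> (elem_mat (fst x) (snd x) (m x)))"
proof -
  have "finite S" using S finite_Iex finite_subset by blast
  then show ?thesis using S m
  proof (induction S)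
    case empty
    have "mat_on {} m = \<zero>\<^bsub>U\<^esub>" by (simp add: mat_on_def U_zero)
    then show ?case using zchar_0[OF chi] by simp
  next
    case (insert x S)
    obtain i j where x: "x = (i, j)" by (cases x)
    have "mat_on (insert x S) m = elem_mat i j (m x) \<oplus>\<^bsub>U\<^esub> mat_on S m"
    proof (intro ext)
      fix k l
      show "mat_on (insert x S) m k l = (elem_mat i j (m x) \<oplus>\<^bsub>U\<^esub> mat_on S m) k l"
        using insert.hyps(2) insert.prems(2)[of "(k, l)"] x by (auto simp: mat_on_def elem_mat_def U_add)
    qed
    moreover have "elem_mat i j (m x) \<in> center_mats" using insert.prems x by (intro elem_mat_center_mats) auto
    moreover have "mat_on S m \<in> center_mats" using insert.prems by (intro mat_on_center_mats) auto
    ultimately show ?case using insert x by (simp add: zchar_add[OF chi])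
  qed
qed

text \<open>The largest ideal inside the kernel of the character. Since every ideal is a power of
  the maximal ideal, it has an exponent, which serves as conductor.\<close>

lemma ideal_add_char:
  assumes chi: "add_char \<chi>"
  shows "ideal {c \<in> carrier R. \<forall>r\<in>carrier R. \<chi> (r \<otimes> c) = 1} R" (is "ideal ?I R")
proof (rule idealI)
  have "\<chi> (r \<otimes> (\<ominus> c)) = 1" if "r \<in> carrier R" "c \<in> ?I" for r c
  proof -
    have "r \<otimes> (\<ominus> c) = (\<ominus> r) \<otimes> c" using that by (simp add: l_minus r_minus)
    then show ?thesis using that by simp
  qed
  then show "subgroup ?I (add_monoid R)"
    by (intro add.subgroupI) (auto simp: add_char_zero[OF chi] add_char_add[OF chi] r_distr a_inv_def[symmetric])
  show "x \<otimes> a \<in> ?I" if "a \<in> ?I" "x \<in> carrier R" for a x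
    using that by (auto simp: m_assoc[symmetric])
  then show "a \<otimes> x \<in> ?I" if "a \<in> ?I" "x \<in> carrier R" for a x
    using that m_comm[of a x] by simp
qed (rule ring_axioms)

text \<open>The exponent of the conductor of the restriction of \<open>\<chi>\<close> to the entry \<open>(i, j)\<close>.\<close>

definition char_level :: "((nat \<Rightarrow> nat \<Rightarrow> 'a) \<Rightarrow> complex) \<Rightarrow> nat \<Rightarrow> nat \<Rightarrow> nat" where
  "char_level \<chi> i j = (SOME k. k \<le> d \<and> {c \<in> carrier R. \<forall>r\<in>carrier R. \<chi> (elem_mat i j (r \<otimes> c)) = 1} = mi k)"

lemma char_level:
  assumes "zchar \<chi>" "(i, j) \<in> Iex"
  shows "char_level \<chi> i j \<le> d"
    and "c \<in> carrier R \<Longrightarrow> c \<in> mi (char_level \<chi> i j) \<longleftrightarrow> (\<forall>r\<in>carrier R. \<chi> (elem_mat i j (r \<otimes> c)) = 1)"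
proof -
  obtain k where "k \<le> d" "{c \<in> carrier R. \<forall>r\<in>carrier R. \<chi> (elem_mat i j (r \<otimes> c)) = 1} = mi k"
    using ideal_eq_mi[OF ideal_add_char[OF zchar_elem_mat[OF assms]]] by blast
  then have "\<exists>k. k \<le> d \<and> {c \<in> carrier R. \<forall>r\<in>carrier R. \<chi> (elem_mat i j (r \<otimes> c)) = 1} = mi k" by blast
  note s = someI_ex[OF this, folded char_level_def]
  show "char_level \<chi> i j \<le> d" using s by blast
  show "c \<in> carrier R \<Longrightarrow> c \<in> mi (char_level \<chi> i j) \<longleftrightarrow> (\<forall>r\<in>carrier R. \<chi> (elem_mat i j (r \<otimes> c)) = 1)"
    using conjunct2[OF s] by blast
qed

lemma char_level_trivial: "zchar \<chi> \<Longrightarrow> (i, j) \<in> Iex \<Longrightarrow> char_level \<chi> i j \<le> k \<Longrightarrow> c \<in> mi k \<Longrightarrow> \<chi> (elem_mat i j c) = 1"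
proof -
  assume *: "zchar \<chi>" "(i, j) \<in> Iex" "char_level \<chi> i j \<le> k" "c \<in> mi k"
  then have c: "c \<in> mi (char_level \<chi> i j)" "c \<in> carrier R" using mi_antimono mi_carrier by blast+
  have "\<chi> (elem_mat i j (\<one> \<otimes> c)) = 1" using char_level(2)[OF *(1,2) c(2)] c(1) by blast
  then show ?thesis using c by simp
qed

text \<open>
  The characters in \<open>Q\<close> embed the \<open>p\<close>-torsion central elements killed by all others into a power of the
  group of \<open>p\<close>-th roots of unity.
\<close>

lemma count_characters:
  assumes S: "finite S" "\<And>\<chi>. \<chi> \<in> S \<Longrightarrow> zchar \<chi>"
    and sep: "\<And>z. z \<in> center_mats \<Longrightarrow> (\<And>\<chi>. \<chi> \<in> S \<Longrightarrow> \<chi> z = 1) \<Longrightarrow> z = \<zero>\<^bsub>U\<^esub>"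
    and Q: "Q \<subseteq> S" and \<kappa>: "\<And>x. x \<in> Iex \<Longrightarrow> d - e \<le> \<kappa> x \<and> \<kappa> x \<le> d"
    and triv: "\<And>\<chi> x c. \<chi> \<in> S \<Longrightarrow> \<chi> \<notin> Q \<Longrightarrow> x \<in> Iex \<Longrightarrow> c \<in> mi (\<kappa> x) \<Longrightarrow> \<chi> (elem_mat (fst x) (snd x) c) = 1"
  shows "f * (\<Sum>x\<in>Iex. d - \<kappa> x) \<le> card Q"
proof -
  \<comment> \<open>\<open>?A\<close> parametrizes the central matrices with entries in
    \<open>mi (\<kappa> x)\<close>. They are killed by \<open>p\<close> because
    \<open>\<kappa> x\<close> is at least \<open>d - e\<close>, so the characters take
    \<open>p\<close>-th roots of unity as values on them.\<close>
  let ?A = "PiE Iex (\<lambda>x. mi (\<kappa> x))" and ?B = "PiE Q (\<lambda>_. {w :: complex. w ^ p = 1})"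
  let ?h = "\<lambda>m. restrict (\<lambda>\<chi>. \<chi> (mat_on Iex m)) Q"
  have finQ: "finite Q" using S(1) Q finite_subset by blast
  have roots: "finite {w :: complex. w ^ p = 1}" "card {w :: complex. w ^ p = 1} = p"
    using card_roots_unity_eq[of p] p_gt_1 finite_roots_unity[of p] by auto
  have mc: "m x \<in> carrier R" if "m \<in> ?A" "x \<in> Iex" for m x using PiE_mem[OF that] mi_carrier by blast
  have zc: "mat_on Iex m \<in> center_mats" if "m \<in> ?A" for m using mc[OF that] by (intro mat_on_center_mats) auto
  have unity: "\<chi> (mat_on Iex m) ^ p = 1" if m: "m \<in> ?A" and "\<chi> \<in> Q" for m \<chi>
  proof -
    have chi: "zchar \<chi>" using S(2) Q that(2) by blast
    have "\<chi> (elem_mat (fst x) (snd x) (m x)) ^ p = 1" if x: "x \<in> Iex" for x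
    proof -
      have x': "(fst x, snd x) \<in> Iex" using x by simp
      have "m x \<in> mi (d - e)" using PiE_mem[OF m x] \<kappa>[OF x] mi_antimono by blast
      then have "add_pow R p (m x) = \<zero>" using p_torsion by blast
      then have "\<chi> (elem_mat (fst x) (snd x) (add_pow R p (m x))) = 1"
        using add_char_zero[OF zchar_elem_mat[OF chi x']] by simp
      then show ?thesis using add_char_pow[OF zchar_elem_mat[OF chi x'] mc[OF m x], of p] by simp
    qed
    then show ?thesis using mc[OF m] by (simp add: zchar_mat_on[OF chi] prod_power_distrib)
  qed
  have "card ?A \<le> card ?B"
  proof (rule card_inj_on_le)
    show "?h ` ?A \<subseteq> ?B" using unity by auto
    show "finite ?B" using finQ roots by (intro finite_PiE) auto
    show "inj_on ?h ?A"
    proof (rule inj_onI)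
      fix m m' assume m: "m \<in> ?A" "m' \<in> ?A" "?h m = ?h m'"
      let ?z = "mat_on Iex m \<ominus>\<^bsub>U\<^esub> mat_on Iex m'"
      have "\<chi> ?z = 1" if chi: "\<chi> \<in> S" for \<chi>
      proof -
        note z = S(2)[OF chi]
        have "\<chi> (mat_on Iex m) = \<chi> (mat_on Iex m')"
        proof (cases "\<chi> \<in> Q")
          case True
          then show ?thesis using fun_cong[OF m(3), of \<chi>] by simp
        next
          case False
          have "\<chi> (mat_on Iex k) = 1" if k: "k \<in> ?A" for k
          proof -
            have "\<chi> (mat_on Iex k) = (\<Prod>x\<in>Iex. \<chi> (elem_mat (fst x) (snd x) (k x)))"
              using mc[OF k] by (intro zchar_mat_on[OF z]) auto
            also have "\<dots> = 1"
              by (rule prod.neutral) (use triv[OF chi False] PiE_mem[OF k] in blast)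
            finally show ?thesis .
          qed
          then show ?thesis using m by simp
        qed
        then show ?thesis using zchar_minus[OF z zc[OF m(1)] zc[OF m(2)]] zchar_nonzero[OF z zc[OF m(2)]] by simp
      qed
      then have "?z = \<zero>\<^bsub>U\<^esub>" using center_mats_minus[OF zc[OF m(1)] zc[OF m(2)]] by (intro sep)
      then have eq: "mat_on Iex m = mat_on Iex m'" using zc m by simp
      show "m = m'"
      proof (rule PiE_ext[OF m(1,2)])
        fix x assume "x \<in> Iex"
        then show "m x = m' x" using fun_cong[OF fun_cong[OF eq, of "fst x"], of "snd x"] by (simp add: mat_on_def)
      qed
    qed
  qed
  also have "card ?B = p ^ card Q" using finQ by (simp add: card_PiE roots)
  also have "card ?A = (\<Prod>x\<in>Iex. p ^ (f * (d - \<kappa> x)))"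
    using \<kappa> by (subst card_PiE) (auto intro!: prod.cong card_mi)
  also have "\<dots> = p ^ (f * (\<Sum>x\<in>Iex. d - \<kappa> x))" by (simp add: power_sum sum_distrib_left)
  finally show ?thesis using p_gt_1 by (simp add: power_increasing_iff)
qed

text \<open>Both sums are cut into layers. For a threshold \<open>t\<close> let
  \<open>\<kappa> x\<close> be the largest level at \<open>x\<close> whose bound is still below
  \<open>t\<close>, raised to \<open>d - e\<close> if necessary. Characters of weight below
  \<open>t\<close> are then trivial on \<open>mi (\<kappa> x)\<close>, so
  \<open>count_characters\<close> applies to the others, while the blocks of size at least
  \<open>t\<close> have \<open>l < d - \<kappa> x\<close>.\<close>

lemma rep_dim_le_weights:
  assumes S: "finite S" "\<And>\<chi>. \<chi> \<in> S \<Longrightarrow> zchar \<chi>"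
    and sep: "\<And>z. z \<in> center_mats \<Longrightarrow> (\<And>\<chi>. \<chi> \<in> S \<Longrightarrow> \<chi> z = 1) \<Longrightarrow> z = \<zero>\<^bsub>U\<^esub>"
    and w: "\<And>\<chi> i j. \<chi> \<in> S \<Longrightarrow> (i, j) \<in> Iex \<Longrightarrow> p ^ (f * char_level \<chi> i j * alpha n prec i j) \<le> w \<chi>"
  shows "rep_dim \<le> (\<Sum>\<chi>\<in>S. w \<chi>)"
proof -
  let ?I = "Iex \<times> {0..<e} \<times> {0..<f}"
  let ?al = "\<lambda>x. alpha n prec (fst x) (snd x)"
  let ?g = "\<lambda>x. p ^ (f * (d - fst (snd x)) * alpha n prec (fst (fst x)) (snd (fst x)))"
  have finI: "finite ?I" by simp
  \<comment> \<open>A common bound for both families of weights, so that both sums run over the same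
    thresholds.\<close>
  define B where "B = (\<Sum>\<chi>\<in>S. w \<chi>) + (\<Sum>x\<in>?I. ?g x)"
  have B1: "w \<chi> \<le> B" if "\<chi> \<in> S" for \<chi>
    using member_le_sum[of \<chi> S w] that S(1) by (simp add: B_def)
  have B2: "?g x \<le> B" if "x \<in> ?I" for x
    using member_le_sum[of x ?I ?g] that finI unfolding B_def by (meson le_add2 order_trans zero_le)
  have le: "card {x \<in> ?I. t \<le> ?g x} \<le> card {\<chi> \<in> S. t \<le> w \<chi>}" for t
  proof -
    define \<kappa>0 where "\<kappa>0 x = Max {k. k \<le> d \<and> (k = 0 \<or> p ^ (f * k * ?al x) < t)}" for x
    define \<kappa> where "\<kappa> x = max (d - e) (\<kappa>0 x)" for x
    have fin: "finite {k. k \<le> d \<and> (k = 0 \<or> p ^ (f * k * ?al x) < t)}" for x by simp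
    have ge: "k \<le> \<kappa>0 x" if "k \<le> d" "p ^ (f * k * ?al x) < t" for k x
      unfolding \<kappa>0_def using that by (intro Max_ge[OF fin]) simp
    have "\<kappa>0 x \<in> {k. k \<le> d \<and> (k = 0 \<or> p ^ (f * k * ?al x) < t)}" for x
      unfolding \<kappa>0_def by (rule Max_in[OF fin]) auto
    then have k0: "\<kappa>0 x \<le> d" "\<kappa>0 x = 0 \<or> p ^ (f * \<kappa>0 x * ?al x) < t" for x by blast+
    have "{x \<in> ?I. t \<le> ?g x} \<subseteq> (SIGMA x:Iex. {0..<d - \<kappa> x} \<times> {0..<f})"
    proof
      fix y assume y: "y \<in> {x \<in> ?I. t \<le> ?g x}"
      obtain x l s where yd: "y = (x, l, s)" by (cases y)
      have x: "x \<in> Iex" "l < e" "s < f" "t \<le> p ^ (f * (d - l) * ?al x)" using y yd by auto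
      have "\<kappa>0 x < d - l"
      proof (rule ccontr)
        assume *: "\<not> \<kappa>0 x < d - l"
        have "0 < d - l" using x(2) e_le by linarith
        then have "p ^ (f * \<kappa>0 x * ?al x) < t" using k0(2)[of x] * by linarith
        moreover have "p ^ (f * (d - l) * ?al x) \<le> p ^ (f * \<kappa>0 x * ?al x)"
          using * p_gt_1 by (intro power_increasing mult_le_mono) auto
        ultimately show False using x(4) by linarith
      qed
      then have "l < d - \<kappa> x" using x(2) e_le unfolding \<kappa>_def by linarith
      then show "y \<in> (SIGMA x:Iex. {0..<d - \<kappa> x} \<times> {0..<f})" using x yd by simp
    qed
    then have "card {x \<in> ?I. t \<le> ?g x} \<le> card (SIGMA x:Iex. {0..<d - \<kappa> x} \<times> {0..<f})"
      by (intro card_mono) auto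
    also have "\<dots> = f * (\<Sum>x\<in>Iex. d - \<kappa> x)"
      by (subst card_SigmaI) (auto simp: sum_distrib_left mult.commute)
    also have "\<dots> \<le> card {\<chi> \<in> S. t \<le> w \<chi>}"
    proof (rule count_characters[OF S sep])
      show "d - e \<le> \<kappa> x \<and> \<kappa> x \<le> d" for x using k0 by (simp add: \<kappa>_def)
      fix \<chi> x c assume *: "\<chi> \<in> S" "\<chi> \<notin> {\<chi> \<in> S. t \<le> w \<chi>}" "x \<in> Iex" "c \<in> mi (\<kappa> x)"
      have x: "(fst x, snd x) \<in> Iex" using * by simp
      have "p ^ (f * char_level \<chi> (fst x) (snd x) * ?al x) < t" using w[OF *(1) x] *(1,2) by simp
      then have "char_level \<chi> (fst x) (snd x) \<le> \<kappa>0 x" using char_level(1)[OF S(2)[OF *(1)] x] by (intro ge)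
      then show "\<chi> (elem_mat (fst x) (snd x) c) = 1"
        using *(4) by (intro char_level_trivial[OF S(2)[OF *(1)] x, of "\<kappa> x"]) (auto simp: \<kappa>_def)
    qed auto
    finally show ?thesis .
  qed
  have "rep_dim = (\<Sum>t = 1..B. card {x \<in> ?I. t \<le> ?g x})"
    unfolding rep_dim_alt using B2 by (intro sum_eq_sum_card_ge finI)
  also have "\<dots> \<le> (\<Sum>t = 1..B. card {\<chi> \<in> S. t \<le> w \<chi>})" by (intro sum_mono le)
  also have "\<dots> = (\<Sum>\<chi>\<in>S. w \<chi>)" by (rule sum_eq_sum_card_ge[symmetric, OF S(1) B1])
  finally show ?thesis .
qed

end

section \<open>Faithful actions and their weight spaces\<close>

definition coord_space :: "nat \<Rightarrow> (nat \<Rightarrow> complex) set" where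
  "coord_space N = {v. \<forall>k\<ge>N. v k = 0}"

lemma subspace_coord_space: "fs.subspace (coord_space N)"
  unfolding fs.subspace_def by (auto simp: coord_space_def fscale_def)

text \<open>\<open>G\<close> stands for the image of the exponential. It is accessed through the
  elements \<open>1 + M\<close> with \<open>M\<close> of square zero, on which the exponential is
  explicit, and through its products; rows, columns and central matrices are of this kind.\<close>

locale faithful_action = pattern_tvr R d p e f n prec for R (structure) and d p e f n prec +
  fixes N :: nat and G :: "(nat \<Rightarrow> nat \<Rightarrow> 'a) set"
    and Op :: "(nat \<Rightarrow> nat \<Rightarrow> 'a) \<Rightarrow> (nat \<Rightarrow> complex) \<Rightarrow> nat \<Rightarrow> complex"
  assumes G_square_zero: "M \<in> pat \<Longrightarrow> M \<otimes>\<^bsub>U\<^esub> M = \<zero>\<^bsub>U\<^esub> \<Longrightarrow> \<one>\<^bsub>U\<^esub> \<oplus>\<^bsub>U\<^esub> M \<in> G"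
    and G_mult: "g \<in> G \<Longrightarrow> g' \<in> G \<Longrightarrow> g \<otimes>\<^bsub>U\<^esub> g' \<in> G"
    and Op_lin: "g \<in> G \<Longrightarrow> fs.lin (Op g)"
    and Op_closed: "g \<in> G \<Longrightarrow> v \<in> coord_space N \<Longrightarrow> Op g v \<in> coord_space N"
    and Op_mult: "g \<in> G \<Longrightarrow> g' \<in> G \<Longrightarrow> v \<in> coord_space N \<Longrightarrow> Op (g \<otimes>\<^bsub>U\<^esub> g') v = Op g (Op g' v)"
    and Op_one: "v \<in> coord_space N \<Longrightarrow> Op \<one>\<^bsub>U\<^esub> v = v"
    and Op_inj: "g \<in> G \<Longrightarrow> g' \<in> G \<Longrightarrow> (\<And>v. v \<in> coord_space N \<Longrightarrow> Op g v = Op g' v) \<Longrightarrow> g = g'"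
begin

definition square_zero :: "(nat \<Rightarrow> nat \<Rightarrow> 'a) set" where
  "square_zero = {M \<in> pat. M \<otimes>\<^bsub>U\<^esub> M = \<zero>\<^bsub>U\<^esub>}"

lemma square_zero_U [simp]: "M \<in> square_zero \<Longrightarrow> M \<in> carrier U"
  by (simp add: square_zero_def)

lemma center_mats_square_zero: "z \<in> center_mats \<Longrightarrow> z \<in> square_zero"
  using center_mats_annihilates(1)[OF _ center_mats_pat] center_mats_pat by (simp add: square_zero_def)

abbreviation one_plus_op :: "(nat \<Rightarrow> nat \<Rightarrow> 'a) \<Rightarrow> (nat \<Rightarrow> complex) \<Rightarrow> nat \<Rightarrow> complex" where
  "one_plus_op M \<equiv> Op (\<one>\<^bsub>U\<^esub> \<oplus>\<^bsub>U\<^esub> M)"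

lemma square_zero_G: "M \<in> square_zero \<Longrightarrow> \<one>\<^bsub>U\<^esub> \<oplus>\<^bsub>U\<^esub> M \<in> G"
  by (simp add: square_zero_def G_square_zero)

lemma one_plus_op_lin: "M \<in> square_zero \<Longrightarrow> fs.lin (one_plus_op M)"
  by (intro Op_lin square_zero_G)

lemma one_plus_op_closed: "M \<in> square_zero \<Longrightarrow> v \<in> coord_space N \<Longrightarrow> one_plus_op M v \<in> coord_space N"
  by (intro Op_closed square_zero_G)

lemma one_plus_op_zero: "v \<in> coord_space N \<Longrightarrow> one_plus_op \<zero>\<^bsub>U\<^esub> v = v"
  by (simp add: Op_one)

lemma one_plus_mult:
  "M \<in> carrier U \<Longrightarrow> M' \<in> carrier U \<Longrightarrow> (\<one>\<^bsub>U\<^esub> \<oplus>\<^bsub>U\<^esub> M) \<otimes>\<^bsub>U\<^esub> (\<one>\<^bsub>U\<^esub> \<oplus>\<^bsub>U\<^esub> M') =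
    \<one>\<^bsub>U\<^esub> \<oplus>\<^bsub>U\<^esub> (M \<oplus>\<^bsub>U\<^esub> M' \<oplus>\<^bsub>U\<^esub> M \<otimes>\<^bsub>U\<^esub> M')"
  by (simp add: U.l_distr U.r_distr U.a_ac)

lemma one_plus_op_mult:
  "M \<in> square_zero \<Longrightarrow> M' \<in> square_zero \<Longrightarrow> v \<in> coord_space N \<Longrightarrow>
    one_plus_op M (one_plus_op M' v) = Op (\<one>\<^bsub>U\<^esub> \<oplus>\<^bsub>U\<^esub> (M \<oplus>\<^bsub>U\<^esub> M' \<oplus>\<^bsub>U\<^esub> M \<otimes>\<^bsub>U\<^esub> M')) v"
  using Op_mult[OF square_zero_G square_zero_G, of M M' v] by (simp add: one_plus_mult)

lemma one_plus_op_comm: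
  assumes "M \<in> square_zero" "M' \<in> square_zero" "M \<otimes>\<^bsub>U\<^esub> M' = M' \<otimes>\<^bsub>U\<^esub> M" "v \<in> coord_space N"
  shows "one_plus_op M (one_plus_op M' v) = one_plus_op M' (one_plus_op M v)"
  unfolding one_plus_op_mult[OF assms(1,2,4)] one_plus_op_mult[OF assms(2,1,4)] assms(3)
  using U.a_comm[of M M'] assms by simp

lemma one_plus_op_add:
  assumes "M \<in> square_zero" "M' \<in> square_zero" "M \<otimes>\<^bsub>U\<^esub> M' = \<zero>\<^bsub>U\<^esub>" "v \<in> coord_space N"
  shows "one_plus_op (M \<oplus>\<^bsub>U\<^esub> M') v = one_plus_op M (one_plus_op M' v)"
  using assms by (simp add: one_plus_op_mult)

text \<open>If \<open>M\<close> has square zero, then \<open>(1 + M)^k = 1 + k M\<close>, and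
  \<open>p ^ (f * d)\<close> is the order of \<open>R\<close> and kills all entries.\<close>

lemma one_plus_op_order:
  assumes M: "M \<in> square_zero" and v: "v \<in> coord_space N"
  shows "(one_plus_op M ^^ (p ^ (f * d))) v = v"
proof -
  have MM: "M \<otimes>\<^bsub>U\<^esub> M = \<zero>\<^bsub>U\<^esub>" "M \<in> pat" "M \<in> carrier U" using M by (simp_all add: square_zero_def)
  have *: "add_pow U k M \<in> square_zero \<and> M \<otimes>\<^bsub>U\<^esub> add_pow U k M = \<zero>\<^bsub>U\<^esub> \<and> (one_plus_op M ^^ k) v = one_plus_op (add_pow U k M) v" for k :: nat
  proof (induction k)
    case 0
    have "\<zero>\<^bsub>U\<^esub> \<in> pat" using center_mats_0 center_mats_pat by blast
    then show ?case using MM v by (simp add: square_zero_def Op_one)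
  next
    case (Suc k)
    have k: "add_pow U k M \<in> pat" "add_pow U k M \<in> carrier U" using Suc by (simp_all add: square_zero_def)
    have S: "add_pow U (Suc k) M = M \<oplus>\<^bsub>U\<^esub> add_pow U k M"
      using MM(3) k by (simp add: U.add.nat_pow_Suc U.a_comm)
    have "add_pow U k M \<otimes>\<^bsub>U\<^esub> M = \<zero>\<^bsub>U\<^esub>"
      using MM by (simp add: U.add_pow_ldistr)
    moreover have "add_pow U k M \<otimes>\<^bsub>U\<^esub> add_pow U k M = \<zero>\<^bsub>U\<^esub>" using Suc by (simp add: square_zero_def)
    ultimately have "add_pow U (Suc k) M \<in> square_zero"
      unfolding S using Suc MM k pat_add by (simp add: square_zero_def U.l_distr U.r_distr)
    moreover have "(one_plus_op M ^^ Suc k) v = one_plus_op (add_pow U (Suc k) M) v"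
      unfolding S using Suc M v by (simp add: one_plus_op_add)
    moreover have "M \<otimes>\<^bsub>U\<^esub> add_pow U (Suc k) M = \<zero>\<^bsub>U\<^esub>" unfolding S using Suc MM k by (simp add: U.r_distr)
    ultimately show ?case by blast
  qed
  have "add_pow U (p ^ (f * d)) M = add_pow U (int p ^ (f * d)) M"
    unfolding add_pow_def by (metis int_pow_int of_nat_power)
  also have "\<dots> = \<zero>\<^bsub>U\<^esub>" using T.torsion[OF MM(3)] .
  finally show ?thesis using *[of "p ^ (f * d)"] v by (simp add: Op_one)
qed

lemma one_plus_op_nonzero:
  assumes "M \<in> square_zero" "v \<in> coord_space N" "v \<noteq> 0"
  shows "one_plus_op M v \<noteq> 0"
proof
  assume z: "one_plus_op M v = 0"
  have "(one_plus_op M ^^ k) v = 0" if "0 < k" for k using that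
    by (induction k rule: nat_induct_non_zero)
      (simp_all only: One_nat_def funpow.simps comp_apply id_apply z fs.lin_0[OF one_plus_op_lin[OF assms(1)]])
  then show False using one_plus_op_order[OF assms(1,2)] assms(3) p_gt_1 by simp
qed

definition weight_space :: "((nat \<Rightarrow> nat \<Rightarrow> 'a) \<Rightarrow> complex) \<Rightarrow> (nat \<Rightarrow> complex) set" where
  "weight_space \<chi> = {v \<in> coord_space N. \<forall>z\<in>center_mats. one_plus_op z v = fscale (\<chi> z) v}"

lemma weight_spaceD: "v \<in> weight_space \<chi> \<Longrightarrow> v \<in> coord_space N" "v \<in> weight_space \<chi> \<Longrightarrow> z \<in> center_mats \<Longrightarrow> one_plus_op z v = fscale (\<chi> z) v"
  by (simp_all add: weight_space_def)

lemma subspace_weight_space: "fs.subspace (weight_space \<chi>)"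
proof -
  have "one_plus_op z 0 = 0" "one_plus_op z (u + v) = one_plus_op z u + one_plus_op z v" "one_plus_op z (fscale c v) = fscale c (one_plus_op z v)"
    if "z \<in> center_mats" for z u v c
    using fs.lin_0 fs.lin_add fs.lin_scale one_plus_op_lin[OF center_mats_square_zero[OF that]] by blast+
  then show ?thesis
    using subspace_coord_space[of N] unfolding fs.subspace_def weight_space_def
    by (auto simp: fs.scale_right_distrib mult.commute)
qed

lemma weight_space_stable:
  assumes "M \<in> square_zero" "v \<in> weight_space \<chi>"
  shows "one_plus_op M v \<in> weight_space \<chi>"
proof -
  have M: "M \<in> pat" using assms(1) by (simp add: square_zero_def)
  have "one_plus_op z (one_plus_op M v) = fscale (\<chi> z) (one_plus_op M v)" if z: "z \<in> center_mats" for z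
  proof -
    have "one_plus_op z (one_plus_op M v) = one_plus_op M (one_plus_op z v)"
      using center_mats_annihilates[OF z M] by (intro one_plus_op_comm center_mats_square_zero z assms weight_spaceD(1)[OF assms(2)]) simp
    then show ?thesis using weight_spaceD(2)[OF assms(2) z] fs.lin_scale[OF one_plus_op_lin[OF assms(1)]] by simp
  qed
  then show ?thesis using one_plus_op_closed[OF assms(1) weight_spaceD(1)[OF assms(2)]] by (simp add: weight_space_def)
qed

lemma weight_space_zchar:
  assumes u: "u \<in> weight_space \<chi>" "u \<noteq> 0"
  shows "zchar \<chi>"
proof -
  have "fscale (\<chi> \<zero>\<^bsub>U\<^esub>) u = fscale 1 u"
    using weight_spaceD(2)[OF u(1) center_mats_0] one_plus_op_zero[OF weight_spaceD(1)[OF u(1)]] by simp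
  then have "\<chi> \<zero>\<^bsub>U\<^esub> = 1" using u(2) fs.scale_cancel_right by blast
  moreover have "\<chi> (z \<oplus>\<^bsub>U\<^esub> z') = \<chi> z * \<chi> z'" if z: "z \<in> center_mats" "z' \<in> center_mats" for z z'
  proof -
    have "fscale (\<chi> (z \<oplus>\<^bsub>U\<^esub> z')) u = one_plus_op (z \<oplus>\<^bsub>U\<^esub> z') u" using weight_spaceD(2)[OF u(1) center_mats_add[OF z]] by simp
    also have "\<dots> = one_plus_op z (one_plus_op z' u)"
      by (intro one_plus_op_add center_mats_square_zero z weight_spaceD(1)[OF u(1)] center_mats_annihilates center_mats_pat)
    also have "\<dots> = fscale (\<chi> z * \<chi> z') u"
      using weight_spaceD(2)[OF u(1)] z fs.lin_scale[OF one_plus_op_lin[OF center_mats_square_zero[OF z(1)]]] by (simp add: mult.commute)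
    finally show ?thesis using u(2) fs.scale_cancel_right by blast
  qed
  ultimately show ?thesis by (simp add: zchar_def)
qed

text \<open>Faithfulness provides a vector that \<open>z\<close> moves, and the central operators
  commute. Setting the weight to 0 off the central matrices normalizes it, so that two different
  weights differ at some central matrix.\<close>

lemma weight_exists:
  assumes z: "z \<in> center_mats" "z \<noteq> \<zero>\<^bsub>U\<^esub>"
  shows "\<exists>\<chi>. (\<exists>u\<in>weight_space \<chi>. u \<noteq> 0) \<and> \<chi> z \<noteq> 1 \<and> (\<forall>M. M \<notin> center_mats \<longrightarrow> \<chi> M = 0)"
proof -
  have "\<exists>v\<in>coord_space N. one_plus_op z v \<noteq> v"
  proof (rule ccontr)
    assume "\<not> ?thesis"
    then have "Op (\<one>\<^bsub>U\<^esub> \<oplus>\<^bsub>U\<^esub> z) v = Op (\<one>\<^bsub>U\<^esub> \<oplus>\<^bsub>U\<^esub> \<zero>\<^bsub>U\<^esub>) v" if "v \<in> coord_space N" for v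
      using that one_plus_op_zero by simp
    then have "\<one>\<^bsub>U\<^esub> \<oplus>\<^bsub>U\<^esub> z = \<one>\<^bsub>U\<^esub> \<oplus>\<^bsub>U\<^esub> \<zero>\<^bsub>U\<^esub>"
      by (intro Op_inj square_zero_G center_mats_square_zero z center_mats_0)
    then show False using z by simp
  qed
  then obtain v where v: "v \<in> coord_space N" "one_plus_op z v \<noteq> v" by blast
  have "\<exists>u\<in>coord_space N. u \<noteq> 0 \<and> (\<exists>c. (\<forall>z\<in>center_mats. one_plus_op z u = fscale (c z) u) \<and> c z \<noteq> 1)"
  proof (rule fs.common_eigenvector_nontrivial
      [where T = one_plus_op and Y = center_mats and P = "coord_space N" and x = z and v = v and m = "p ^ (f * d)", OF finite_center_mats _ subspace_coord_space])
    show "one_plus_op y (one_plus_op y' u) = one_plus_op y' (one_plus_op y u)" if "y \<in> center_mats" "y' \<in> center_mats" "u \<in> coord_space N" for y y' u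
      using that center_mats_annihilates[OF that(1) center_mats_pat[OF that(2)]] by (intro one_plus_op_comm center_mats_square_zero) auto
  qed (use one_plus_op_lin one_plus_op_closed one_plus_op_order center_mats_square_zero p_gt_1 z v in auto)
  then obtain u c where u: "u \<in> coord_space N" "u \<noteq> 0" "\<forall>z\<in>center_mats. one_plus_op z u = fscale (c z) u" "c z \<noteq> 1" by blast
  let ?\<chi> = "\<lambda>M. if M \<in> center_mats then c M else 0"
  have "u \<in> weight_space ?\<chi>" using u by (simp add: weight_space_def)
  then show ?thesis using u z by (intro exI[of _ ?\<chi>]) auto
qed

definition column_mat :: "nat \<Rightarrow> nat \<Rightarrow> (nat \<Rightarrow> 'a) \<Rightarrow> nat \<Rightarrow> nat \<Rightarrow> 'a" where
  "column_mat i j c = (\<lambda>k l. if l = j \<and> k \<in> between i j then c k else \<zero>)"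

text \<open>The row matrices \<open>A y\<close> commute and have a common eigenvector
  \<open>u'\<close> in the weight space. Moving \<open>u'\<close> by the column matrix of
  \<open>c\<close> twists its eigenvalue at \<open>A y\<close> by the value of \<open>\<chi>\<close>
  at the product of row and column. Columns that differ modulo the conductor give different twists,
  hence independent vectors.\<close>

lemma weight_family:
  assumes u: "u \<in> weight_space \<chi>" "u \<noteq> 0" and ij: "(i, j) \<in> Iex"
  defines "C \<equiv> between i j \<rightarrow>\<^sub>E coset_rep (char_level \<chi> i j) ` carrier R"
  shows "\<exists>v. (\<forall>c\<in>C. v c \<in> weight_space \<chi>) \<and> (\<forall>a. (\<Sum>c\<in>C. fscale (a c) (v c)) = 0 \<longrightarrow> (\<forall>c\<in>C. a c = 0))"
proof -
  have chi: "zchar \<chi>" by (rule weight_space_zchar[OF u])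
  note ijn = ijn[OF ij]
  have Zk: "(i, k) \<in> prec" "(k, j) \<in> prec" "k \<noteq> i" "k \<noteq> j" "k \<in> {1..n}" if "k \<in> between i j" for k
    using that ijn by (auto simp: between_def)
  define Y where "Y = between i j \<times> carrier R"
  define A where "A y = elem_mat i (fst y) (snd y)" for y
  have A_square_zero: "A y \<in> square_zero" if "y \<in> Y" for y
  proof -
    have y: "fst y \<in> between i j" "snd y \<in> carrier R" using that by (auto simp: Y_def)
    have "elem_mat i (fst y) (snd y) k l \<otimes> elem_mat i (fst y) (snd y) l k' = \<zero>" for k l k'
      using Zk[OF y(1)] y(2) by (auto simp: elem_mat_def)
    then have "A y \<otimes>\<^bsub>U\<^esub> A y = \<zero>\<^bsub>U\<^esub>" by (simp add: A_def U_mult U_zero)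
    then show ?thesis using elem_mat_pat[OF Zk(1)[OF y(1)] y(2)] by (simp add: square_zero_def A_def)
  qed
  have A_ann: "A y \<otimes>\<^bsub>U\<^esub> A y' = \<zero>\<^bsub>U\<^esub>" if "y \<in> Y" "y' \<in> Y" for y y'
  proof -
    have y: "fst y \<in> between i j" "snd y \<in> carrier R" "snd y' \<in> carrier R" using that by (auto simp: Y_def)
    have "elem_mat i (fst y) (snd y) k l \<otimes> elem_mat i (fst y') (snd y') l k' = \<zero>" for k l k'
      using Zk[OF y(1)] y(2,3) by (auto simp: elem_mat_def)
    then show ?thesis by (simp add: A_def U_mult U_zero)
  qed
  have cR: "c k \<in> carrier R" if "c \<in> C" "k \<in> between i j" for c k
    using PiE_mem[OF that[unfolded C_def]] coset_rep(1) by auto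
  have column_mat_square_zero: "column_mat i j c \<in> square_zero" if c: "c \<in> C" for c
  proof -
    have "column_mat i j c \<in> pat" using cR[OF c] Zk(2) by (intro patI) (auto simp: column_mat_def)
    moreover have "column_mat i j c k l \<otimes> column_mat i j c l k' = \<zero>" for k l k'
      using cR[OF c] ijn by (auto simp: column_mat_def)
    then have "column_mat i j c \<otimes>\<^bsub>U\<^esub> column_mat i j c = \<zero>\<^bsub>U\<^esub>" by (simp add: U_mult U_zero)
    ultimately show ?thesis by (simp add: square_zero_def)
  qed
  have "\<exists>u'\<in>weight_space \<chi>. u' \<noteq> 0 \<and> (\<exists>m. \<forall>y\<in>Y. one_plus_op (A y) u' = fscale (m y) u')"
  proof (rule fs.common_eigenvector
      [where T = "\<lambda>y. one_plus_op (A y)" and Y = Y and P = "weight_space \<chi>" and w = u and m = "p ^ (f * d)", OF _ _ subspace_weight_space])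
    show "finite Y" using finite_carrier by (simp add: Y_def)
    show "one_plus_op (A y) (one_plus_op (A y') v) = one_plus_op (A y') (one_plus_op (A y) v)" if "y \<in> Y" "y' \<in> Y" "v \<in> weight_space \<chi>" for y y' v
      using that by (intro one_plus_op_comm A_square_zero weight_spaceD(1)) (simp_all add: A_ann)
  qed (use A_square_zero one_plus_op_lin weight_space_stable one_plus_op_order weight_spaceD(1) p_gt_1 u in auto)
  then obtain u' \<mu> where u': "u' \<in> weight_space \<chi>" "u' \<noteq> 0" "\<And>y. y \<in> Y \<Longrightarrow> one_plus_op (A y) u' = fscale (\<mu> y) u'" by blast
  have uV: "u' \<in> coord_space N" using u'(1) by (rule weight_spaceD)
  define v where "v c = one_plus_op (column_mat i j c) u'" for c
  have vW: "v c \<in> weight_space \<chi>" if "c \<in> C" for c unfolding v_def by (intro weight_space_stable column_mat_square_zero that u')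
  have v0: "v c \<noteq> 0" if "c \<in> C" for c unfolding v_def by (intro one_plus_op_nonzero column_mat_square_zero that u' uV)
  \<comment> \<open>The eigenvalue of \<open>u'\<close> times the central character at the single
    entry of the product of row \<open>y\<close> and column \<open>c\<close>.\<close>
  define wt where "wt c y = \<chi> (elem_mat i j (snd y \<otimes> c (fst y))) * \<mu> y" for c y
  have eig: "one_plus_op (A y) (v c) = fscale (wt c y) (v c)" if y: "y \<in> Y" and c: "c \<in> C" for y c
  proof -
    have y': "fst y \<in> between i j" "snd y \<in> carrier R" using y by (auto simp: Y_def)
    let ?B = "column_mat i j c" and ?D = "elem_mat i j (snd y \<otimes> c (fst y))"
    have DZ: "?D \<in> center_mats" using y' cR[OF c] by (intro elem_mat_center_mats ij) auto
    have DU: "?D \<in> carrier U" "A y \<in> carrier U" "?B \<in> carrier U"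
      using DZ A_square_zero[OF y] column_mat_square_zero[OF c] by simp_all
    have AB: "A y \<otimes>\<^bsub>U\<^esub> ?B = ?D"
    proof (intro ext)
      fix k l
      have e: "A y k m \<in> carrier R" "?B m l \<in> carrier R" for m using DU by simp_all
      have "A y k m = \<zero>" if "m \<noteq> fst y" for m using that by (simp add: A_def elem_mat_def)
      then have "(A y \<otimes>\<^bsub>U\<^esub> ?B) k l = (if fst y \<in> {1..n} then A y k (fst y) \<otimes> ?B (fst y) l else \<zero>)"
        unfolding U_mult using e by (intro finsum_delta) simp_all
      then show "(A y \<otimes>\<^bsub>U\<^esub> ?B) k l = ?D k l"
        using Zk(5)[OF y'(1)] y' cR[OF c] by (auto simp: A_def elem_mat_def column_mat_def)
    qed
    have "?B k l \<otimes> A y l k' = \<zero>" for k l k'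
      using cR[OF c] y' ijn by (auto simp: column_mat_def A_def elem_mat_def)
    then have BA: "?B \<otimes>\<^bsub>U\<^esub> A y = \<zero>\<^bsub>U\<^esub>" by (simp add: U_mult U_zero)
    \<comment> \<open>Heisenberg relation: with \<open>A B = D\<close> central and
      \<open>B A = 0\<close>, one has
      \<open>(1 + A) (1 + B) = (1 + D) (1 + B) (1 + A)\<close>.\<close>
    have "one_plus_op (A y) (v c) = Op (\<one>\<^bsub>U\<^esub> \<oplus>\<^bsub>U\<^esub> (?D \<oplus>\<^bsub>U\<^esub> (?B \<oplus>\<^bsub>U\<^esub> A y))) u'"
      unfolding v_def one_plus_op_mult[OF A_square_zero[OF y] column_mat_square_zero[OF c] uV] AB using DU by (simp add: U.a_ac)
    also have "\<dots> = Op ((\<one>\<^bsub>U\<^esub> \<oplus>\<^bsub>U\<^esub> ?D) \<otimes>\<^bsub>U\<^esub> ((\<one>\<^bsub>U\<^esub> \<oplus>\<^bsub>U\<^esub> ?B) \<otimes>\<^bsub>U\<^esub> (\<one>\<^bsub>U\<^esub> \<oplus>\<^bsub>U\<^esub> A y))) u'"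
    proof -
      have "?D \<otimes>\<^bsub>U\<^esub> ?B = \<zero>\<^bsub>U\<^esub>" "?D \<otimes>\<^bsub>U\<^esub> A y = \<zero>\<^bsub>U\<^esub>"
        using center_mats_annihilates(1)[OF DZ] column_mat_square_zero[OF c] A_square_zero[OF y] by (simp_all add: square_zero_def)
      then have "?D \<otimes>\<^bsub>U\<^esub> (?B \<oplus>\<^bsub>U\<^esub> A y) = \<zero>\<^bsub>U\<^esub>" using DU by (simp add: U.r_distr)
      then show ?thesis using DU BA by (simp add: one_plus_mult)
    qed
    also have "\<dots> = one_plus_op ?D (one_plus_op ?B (one_plus_op (A y) u'))"
      using uV DZ center_mats_square_zero A_square_zero[OF y] column_mat_square_zero[OF c] by (simp add: Op_mult G_mult square_zero_G one_plus_op_closed)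
    also have "\<dots> = fscale (wt c y) (v c)"
      using weight_spaceD(2)[OF vW[OF c] DZ] u'(3)[OF y] fs.lin_scale[OF one_plus_op_lin[OF column_mat_square_zero[OF c]]] fs.lin_scale[OF one_plus_op_lin[OF center_mats_square_zero[OF DZ]]]
      by (simp add: wt_def v_def mult.commute)
    finally show ?thesis .
  qed
  have \<mu>0: "\<mu> y \<noteq> 0" if y: "y \<in> Y" for y
    using one_plus_op_nonzero[OF A_square_zero[OF y] uV u'(2)] u'(3)[OF y] by auto
  have dist: "\<exists>y\<in>Y. wt c y \<noteq> wt c' y" if c: "c \<in> C" "c' \<in> C" "c \<noteq> c'" for c c'
  proof -
    obtain k where k: "k \<in> between i j" "c k \<noteq> c' k"
      using PiE_ext[OF c(1,2)[unfolded C_def]] c(3) by blast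
    have ck: "c k \<in> carrier R" "c' k \<in> carrier R" using cR k c by blast+
    obtain x x' where x: "x \<in> carrier R" "x' \<in> carrier R" "c k = coset_rep (char_level \<chi> i j) x" "c' k = coset_rep (char_level \<chi> i j) x'"
      using PiE_mem[OF c(1)[unfolded C_def] k(1)] PiE_mem[OF c(2)[unfolded C_def] k(1)] by blast
    \<comment> \<open>Both entries are canonical representatives, so being different they lie in
      different classes, and their difference is outside the conductor. This produces a multiplier
      \<open>r\<close> at which \<open>\<chi>\<close> distinguishes them.\<close>
    have "coset_rep (char_level \<chi> i j) (c k) \<noteq> coset_rep (char_level \<chi> i j) (c' k)" using k(2) x coset_rep_idem by simp
    then have "c k \<ominus> c' k \<notin> mi (char_level \<chi> i j)" using coset_rep_eq_iff[OF ck] by simp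
    then obtain r where r: "r \<in> carrier R" "\<chi> (elem_mat i j (r \<otimes> (c k \<ominus> c' k))) \<noteq> 1"
      using char_level(2)[OF chi ij, of "c k \<ominus> c' k"] ck by auto
    have "r \<otimes> (c k \<ominus> c' k) = r \<otimes> c k \<ominus> r \<otimes> c' k" using r ck by (simp add: minus_eq r_distr r_minus)
    then have "\<chi> (elem_mat i j (r \<otimes> c k)) \<noteq> \<chi> (elem_mat i j (r \<otimes> c' k))"
      using r ck add_char_eq_iff[OF zchar_elem_mat[OF chi ij], of "r \<otimes> c k" "r \<otimes> c' k"] by simp
    then have "wt c (k, r) \<noteq> wt c' (k, r)" using \<mu>0[of "(k, r)"] k r by (simp add: wt_def Y_def)
    then show ?thesis using k r by (auto simp: Y_def)
  qed
  have finC: "finite C" unfolding C_def using finite_carrier by (intro finite_PiE) auto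
  have "a c = 0" if a: "(\<Sum>c\<in>C. fscale (a c) (v c)) = 0" and c: "c \<in> C" for a c
  proof -
    have "fscale (a c) (v c) = 0"
    proof (rule fs.weight_vectors_independent[where T = "\<lambda>y. one_plus_op (A y)" and Y = Y and wt = wt, OF finC _ _ dist a c])
      show "one_plus_op (A y) (fscale (a c) (v c)) = fscale (wt c y) (fscale (a c) (v c))" if "c \<in> C" "y \<in> Y" for c y
        using that by (simp add: fs.lin_scale[OF one_plus_op_lin[OF A_square_zero]] eig mult.commute)
    qed (auto intro: one_plus_op_lin A_square_zero)
    then show ?thesis using v0[OF c] by simp
  qed
  then show ?thesis using vW by blast
qed

text \<open>Each weight \<open>\<chi>\<close> is given the extreme pair \<open>b \<chi>\<close> at
  which its bound is largest. The families of \<open>weight_family\<close> for these pairs are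
  jointly independent, since vectors from different weight spaces are, and their sizes are the
  weights that \<open>rep_dim_le_weights\<close> requires.\<close>

theorem rep_dim_le_degree: "rep_dim \<le> N"
\<comment> \<open>Without extreme pairs the dimension is 0, and there would be no pair at which the
  maximum below is attained.\<close>
proof (cases "Iex = {}")
  case True
  then show ?thesis by (simp add: rep_dim_def)
next
  case False
  \<comment> \<open>One weight for each nonzero central matrix: a finite set of weights that
    separates the centre from zero.\<close>
  obtain ws where ws: "\<And>z. z \<in> center_mats \<Longrightarrow> z \<noteq> \<zero>\<^bsub>U\<^esub> \<Longrightarrow>
      (\<exists>u\<in>weight_space (ws z). u \<noteq> 0) \<and> ws z z \<noteq> 1 \<and> (\<forall>M. M \<notin> center_mats \<longrightarrow> ws z M = 0)"
    using weight_exists by metis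
  define S where "S = ws ` (center_mats - {\<zero>\<^bsub>U\<^esub>})"
  have finS: "finite S" unfolding S_def using finite_center_mats by simp
  have S: "\<exists>u\<in>weight_space \<chi>. u \<noteq> 0" "\<forall>M. M \<notin> center_mats \<longrightarrow> \<chi> M = 0" if "\<chi> \<in> S" for \<chi>
    using that ws unfolding S_def by blast+
  have sep: "z = \<zero>\<^bsub>U\<^esub>" if "z \<in> center_mats" "\<And>\<chi>. \<chi> \<in> S \<Longrightarrow> \<chi> z = 1" for z
  proof (rule ccontr)
    assume z: "z \<noteq> \<zero>\<^bsub>U\<^esub>"
    then have "ws z \<in> S" using that(1) by (simp add: S_def)
    then show False using ws[OF that(1) z] that(2) by blast
  qed
  let ?g = "\<lambda>\<chi> x. p ^ (f * char_level \<chi> (fst x) (snd x) * alpha n prec (fst x) (snd x))"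
  have "\<exists>x\<in>Iex. \<forall>y\<in>Iex. ?g \<chi> y \<le> ?g \<chi> x" for \<chi>
  proof -
    have "Max (?g \<chi> ` Iex) \<in> ?g \<chi> ` Iex" using False by (intro Max_in) auto
    then obtain x where x: "x \<in> Iex" "Max (?g \<chi> ` Iex) = ?g \<chi> x" by blast
    have "?g \<chi> y \<le> ?g \<chi> x" if "y \<in> Iex" for y
      unfolding x(2)[symmetric] by (rule Max_ge) (simp_all add: that)
    then show ?thesis using x(1) by blast
  qed
  then obtain b where b: "\<And>\<chi>. b \<chi> \<in> Iex" "\<And>\<chi> y. y \<in> Iex \<Longrightarrow> ?g \<chi> y \<le> ?g \<chi> (b \<chi>)" by metis
  define C where "C \<chi> = between (fst (b \<chi>)) (snd (b \<chi>)) \<rightarrow>\<^sub>E coset_rep (char_level \<chi> (fst (b \<chi>)) (snd (b \<chi>))) ` carrier R" for \<chi>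
  have zch: "zchar \<chi>" if "\<chi> \<in> S" for \<chi> using S(1)[OF that] weight_space_zchar by blast
  have bI: "(fst (b \<chi>), snd (b \<chi>)) \<in> Iex" for \<chi> using b(1) by simp
  have finC: "finite (C \<chi>)" for \<chi> unfolding C_def using finite_carrier by (intro finite_PiE) auto
  have cardC: "card (C \<chi>) = ?g \<chi> (b \<chi>)" if "\<chi> \<in> S" for \<chi>
    unfolding C_def using char_level(1)[OF zch[OF that] bI] by (simp add: card_PiE card_coset_rep card_between power_mult)
  let ?P = "\<lambda>\<chi> v. (\<forall>c\<in>C \<chi>. v c \<in> weight_space \<chi>) \<and> (\<forall>a. (\<Sum>c\<in>C \<chi>. fscale (a c) (v c)) = 0 \<longrightarrow> (\<forall>c\<in>C \<chi>. a c = 0))"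
  have "\<forall>\<chi>\<in>S. \<exists>v. ?P \<chi> v"
    using S(1) weight_family[OF _ _ bI] unfolding C_def by blast
  from bchoice[OF this] obtain v where vP: "\<forall>\<chi>\<in>S. ?P \<chi> (v \<chi>)" by (rule exE)
  have v: "v \<chi> c \<in> weight_space \<chi>" if "\<chi> \<in> S" "c \<in> C \<chi>" for \<chi> c
    using bspec[OF vP that(1)] that(2) by blast
  have indep: "a c = 0" if "\<chi> \<in> S" "(\<Sum>c\<in>C \<chi>. fscale (a c) (v \<chi> c)) = 0" "c \<in> C \<chi>" for \<chi> a c
    using conjunct2[OF bspec[OF vP that(1)], rule_format, OF that(2,3)] .
  have "card (SIGMA \<chi>:S. C \<chi>) \<le> N"
  proof (rule card_independent_functions[where v = "\<lambda>x. v (fst x) (snd x)"])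
    show "finite (SIGMA \<chi>:S. C \<chi>)" using finS finC by blast
    show "v (fst x) (snd x) k = 0" if "x \<in> (SIGMA \<chi>:S. C \<chi>)" "N \<le> k" for x k
      using weight_spaceD(1)[OF v[of "fst x" "snd x"]] that by (auto simp: coord_space_def)
    fix a x assume a: "(\<Sum>x\<in>(SIGMA \<chi>:S. C \<chi>). fscale (a x) (v (fst x) (snd x))) = 0" and x: "x \<in> (SIGMA \<chi>:S. C \<chi>)"
    let ?u = "\<lambda>\<chi>. \<Sum>c\<in>C \<chi>. fscale (a (\<chi>, c)) (v \<chi> c)"
    have "(\<Sum>x\<in>(SIGMA \<chi>:S. C \<chi>). fscale (a x) (v (fst x) (snd x))) = (\<Sum>\<chi>\<in>S. ?u \<chi>)"
      using finS finC by (subst sum.Sigma) (auto intro!: sum.cong)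
    then have s0: "(\<Sum>\<chi>\<in>S. ?u \<chi>) = 0" using a by simp
    have uW: "?u \<chi> \<in> weight_space \<chi>" if "\<chi> \<in> S" for \<chi>
      by (intro fs.subspace_sum fs.subspace_scale subspace_weight_space v that)
    have x1: "fst x \<in> S" "snd x \<in> C (fst x)" using x by auto
    have "?u (fst x) = 0"
    proof (rule fs.weight_vectors_independent[where T = one_plus_op and Y = center_mats and wt = "\<lambda>\<chi>. \<chi>" and u = ?u, OF finS _ _ _ s0 x1(1)])
      show "\<exists>z\<in>center_mats. \<chi> z \<noteq> \<chi>' z" if "\<chi> \<in> S" "\<chi>' \<in> S" "\<chi> \<noteq> \<chi>'" for \<chi> \<chi>'
      proof (rule ccontr)
        assume "\<not> ?thesis"
        then have "\<chi> z = \<chi>' z" for z using S(2)[OF that(1)] S(2)[OF that(2)] by (cases "z \<in> center_mats") auto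
        then show False using that(3) by blast
      qed
      show "one_plus_op z (?u \<chi>) = fscale (\<chi> z) (?u \<chi>)" if "\<chi> \<in> S" "z \<in> center_mats" for \<chi> z
        by (rule weight_spaceD(2)[OF uW[OF that(1)] that(2)])
    qed (auto intro: one_plus_op_lin center_mats_square_zero)
    then show "a x = 0" using indep[OF x1(1) _ x1(2), of "\<lambda>c. a (fst x, c)"] by simp
  qed
  moreover have "card (SIGMA \<chi>:S. C \<chi>) = (\<Sum>\<chi>\<in>S. card (C \<chi>))"
    using finS finC by (intro card_SigmaI) auto
  moreover have "rep_dim \<le> (\<Sum>\<chi>\<in>S. card (C \<chi>))"
  proof (rule rep_dim_le_weights[OF finS zch sep])
    fix \<chi> i j assume "\<chi> \<in> S" "(i, j) \<in> Iex"
    then show "p ^ (f * char_level \<chi> i j * alpha n prec i j) \<le> card (C \<chi>)"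
      using b(2)[of "(i, j)" \<chi>] cardC by simp
  qed
  ultimately show ?thesis by linarith
qed

end

section \<open>From matrix representations to actions, and the conclusion\<close>

definition mat_act :: "nat \<Rightarrow> complex mat \<Rightarrow> (nat \<Rightarrow> complex) \<Rightarrow> nat \<Rightarrow> complex" where
  "mat_act N A v = (\<lambda>i. if i < N then \<Sum>j<N. A $$ (i, j) * v j else 0)"

lemma mat_act_mult:
  assumes "A \<in> carrier_mat N N" "B \<in> carrier_mat N N"
  shows "mat_act N (A * B) v = mat_act N A (mat_act N B v)"
proof
  fix i
  have "(\<Sum>j<N. (A * B) $$ (i, j) * v j) = (\<Sum>k<N. A $$ (i, k) * (\<Sum>j<N. B $$ (k, j) * v j))" if "i < N"
  proof -
    have "(\<Sum>j<N. (A * B) $$ (i, j) * v j) = (\<Sum>j<N. \<Sum>k<N. A $$ (i, k) * B $$ (k, j) * v j)"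
      using assms that by (intro sum.cong refl) (auto simp: scalar_prod_def sum_distrib_right atLeast0LessThan)
    also have "\<dots> = (\<Sum>k<N. \<Sum>j<N. A $$ (i, k) * B $$ (k, j) * v j)" by (rule sum.swap)
    finally show ?thesis by (simp add: sum_distrib_left mult.assoc)
  qed
  then show "mat_act N (A * B) v i = mat_act N A (mat_act N B v) i" by (simp add: mat_act_def)
qed

lemma mat_act_one: "v \<in> coord_space N \<Longrightarrow> mat_act N (1\<^sub>m N) v = v"
proof
  fix i assume v: "v \<in> coord_space N"
  have "(\<Sum>j<N. 1\<^sub>m N $$ (i, j) * v j) = (\<Sum>j<N. if j = i then v i else 0)" if "i < N"
    using that by (intro sum.cong refl) auto
  then show "mat_act N (1\<^sub>m N) v i = v i" using v by (simp add: mat_act_def coord_space_def)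
qed

lemma mat_act_inj:
  assumes AB: "A \<in> carrier_mat N N" "B \<in> carrier_mat N N"
    and eq: "\<And>v. v \<in> coord_space N \<Longrightarrow> mat_act N A v = mat_act N B v"
  shows "A = B"
proof (rule eq_matI)
  fix i j assume "i < dim_row B" "j < dim_col B"
  then have ij: "i < N" "j < N" using AB by auto
  let ?b = "\<lambda>k. if k = j then 1 else (0 :: complex)"
  have ent: "mat_act N M ?b i = M $$ (i, j)" for M
  proof -
    have "(\<Sum>k<N. M $$ (i, k) * ?b k) = (\<Sum>k<N. if k = j then M $$ (i, j) else 0)"
      by (intro sum.cong refl) auto
    then show ?thesis using ij by (simp add: mat_act_def)
  qed
  have "?b \<in> coord_space N" using ij by (simp add: coord_space_def)
  from eq[OF this] show "A $$ (i, j) = B $$ (i, j)" using ent[of A] ent[of B] by simp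
qed (use AB in auto)

lemma GL_complex_simps:
  "A \<otimes>\<^bsub>GL_complex N\<^esub> B = A * B" "\<one>\<^bsub>GL_complex N\<^esub> = 1\<^sub>m N"
  "A \<in> carrier (GL_complex N) \<Longrightarrow> A \<in> carrier_mat N N"
  "A \<in> carrier (GL_complex N) \<Longrightarrow> \<exists>B\<in>carrier_mat N N. B * A = 1\<^sub>m N"
  by (auto simp: GL_complex_def units_of_def ring_mat_def Units_def)

context pattern_tvr
begin

lemma lie_exp_simps:
  "carrier (lie_exp L) = carrier L" "x \<otimes>\<^bsub>lie_exp L\<^esub> y = bch L x y"
  by (simp_all add: lie_exp_def)

lemma bch_closed: "x \<in> carrier L \<Longrightarrow> y \<in> carrier L \<Longrightarrow> bch L x y \<in> carrier L"
  by (rule tensor_mat_bch(1))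

lemma mon_rep_dim: "mon (lie_exp L) (GL_complex rep_dim) \<noteq> {}"
proof -
  obtain M where M: "\<And>g. g \<in> unipotent \<Longrightarrow> M g \<in> carrier (GL_complex rep_dim)"
    "\<And>g g'. g \<in> unipotent \<Longrightarrow> g' \<in> unipotent \<Longrightarrow> M (g \<otimes>\<^bsub>U\<^esub> g') = M g * M g'" "inj_on M unipotent"
    using exists_faithful_monomial by blast
  have "x = y" if "x \<in> carrier L" "y \<in> carrier L" "M (group_elem x) = M (group_elem y)" for x y
    using that inj_onD[OF M(3)] group_elem_unipotent group_elem_inj by blast
  then have "inj_on (\<lambda>x. M (group_elem x)) (carrier L)" by (intro inj_onI)
  then have "(\<lambda>x. M (group_elem x)) \<in> mon (lie_exp L) (GL_complex rep_dim)"
    using M(1,2) group_elem_unipotent group_elem_bch by (simp add: mon_def hom_def lie_exp_simps GL_complex_simps)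
  then show ?thesis by blast
qed

text \<open>The embedding is transported along \<open>group_elem\<close> to a set of unipotent
  matrices, where the product is the matrix product and the bound for faithful actions
  applies.\<close>

lemma rep_dim_le_mon:
  assumes rho: "rho \<in> mon (lie_exp L) (GL_complex N)"
  shows "rep_dim \<le> N"
proof -
  have GL: "rho x \<in> carrier (GL_complex N)" if "x \<in> carrier L" for x
    using rho that by (auto simp: mon_def hom_def lie_exp_simps)
  note cm = GL_complex_simps(3)[OF GL]
  have mult: "rho (bch L x y) = rho x * rho y" if "x \<in> carrier L" "y \<in> carrier L" for x y
    using rho that by (auto simp: mon_def hom_def lie_exp_simps GL_complex_simps)
  have inj: "x = y" if "x \<in> carrier L" "y \<in> carrier L" "rho x = rho y" for x y
    using rho that by (auto simp: mon_def lie_exp_simps dest: inj_onD)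
  define group_log where "group_log = inv_into (carrier L) group_elem"
  have group_log: "group_log (group_elem x) = x" if "x \<in> carrier L" for x
    unfolding group_log_def using that by (intro inv_into_f_f inj_onI) (auto dest: group_elem_inj)
  \<comment> \<open>A member of \<open>mon\<close> is only known to respect products. The element
    over the identity matrix is idempotent, and its image is both idempotent and invertible, hence
    the identity.\<close>
  obtain o1 where o1: "o1 \<in> carrier L" "group_elem o1 = \<one>\<^bsub>U\<^esub>"
    using group_elem_square_zero[of "\<zero>\<^bsub>U\<^esub>"] center_mats_pat[OF center_mats_0] by auto
  have "bch L o1 o1 = o1" using o1 by (intro group_elem_inj bch_closed) (simp_all add: group_elem_bch)
  then have idem: "rho o1 * rho o1 = rho o1" using mult[OF o1(1) o1(1)] by simp
  obtain B where B: "B \<in> carrier_mat N N" "B * rho o1 = 1\<^sub>m N" using GL_complex_simps(4)[OF GL[OF o1(1)]] by blast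
  have "rho o1 = (B * rho o1) * rho o1" using B cm[OF o1(1)] by simp
  also have "\<dots> = B * (rho o1 * rho o1)" by (rule assoc_mult_mat[OF B(1) cm cm]) (rule o1)+
  also have "\<dots> = 1\<^sub>m N" by (simp add: idem B(2))
  finally have one: "rho o1 = 1\<^sub>m N" .
  have "faithful_action R d p e f n prec N (group_elem ` carrier L) (\<lambda>g. mat_act N (rho (group_log g)))"
  proof (intro faithful_action.intro faithful_action_axioms.intro)
    show "pattern_tvr R d p e f n prec" by (rule pattern_tvr_axioms)
    show "\<one>\<^bsub>U\<^esub> \<oplus>\<^bsub>U\<^esub> M \<in> group_elem ` carrier L" if M: "M \<in> pat" "M \<otimes>\<^bsub>U\<^esub> M = \<zero>\<^bsub>U\<^esub>" for M
    proof -
      obtain x where "x \<in> carrier L" "group_elem x = \<one>\<^bsub>U\<^esub> \<oplus>\<^bsub>U\<^esub> M" using group_elem_square_zero[OF M] by blast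
      then show ?thesis by (metis image_eqI)
    qed
    show "g \<otimes>\<^bsub>U\<^esub> g' \<in> group_elem ` carrier L" if g: "g \<in> group_elem ` carrier L" "g' \<in> group_elem ` carrier L" for g g'
    proof -
      obtain x y where xy: "x \<in> carrier L" "g = group_elem x" "y \<in> carrier L" "g' = group_elem y"
        using g by blast
      then have "g \<otimes>\<^bsub>U\<^esub> g' = group_elem (bch L x y)" by (simp add: group_elem_bch)
      then show ?thesis using bch_closed[OF xy(1,3)] by blast
    qed
    show "fs.lin (mat_act N (rho (group_log g)))" for g
      by (auto simp: fs.lin_def mat_act_def fscale_def fun_eq_iff distrib_left distrib_right sum.distrib sum_distrib_left ac_simps)
    show "mat_act N (rho (group_log g)) v \<in> coord_space N" for g v by (simp add: mat_act_def coord_space_def)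
    show "mat_act N (rho (group_log (g \<otimes>\<^bsub>U\<^esub> g'))) v = mat_act N (rho (group_log g)) (mat_act N (rho (group_log g')) v)"
      if g: "g \<in> group_elem ` carrier L" "g' \<in> group_elem ` carrier L" for g g' v
    proof -
      obtain x y where xy: "x \<in> carrier L" "g = group_elem x" "y \<in> carrier L" "g' = group_elem y"
        using g by blast
      then have "g \<otimes>\<^bsub>U\<^esub> g' = group_elem (bch L x y)" by (simp add: group_elem_bch)
      then show ?thesis
        using mat_act_mult[OF cm[OF xy(1)] cm[OF xy(3)]] by (simp add: xy group_log bch_closed mult)
    qed
    show "mat_act N (rho (group_log \<one>\<^bsub>U\<^esub>)) v = v" if "v \<in> coord_space N" for v
      using mat_act_one[OF that] group_log[OF o1(1)] by (simp add: o1(2) one)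
    show "g = g'" if g: "g \<in> group_elem ` carrier L" "g' \<in> group_elem ` carrier L"
      and eq: "\<And>v. v \<in> coord_space N \<Longrightarrow> mat_act N (rho (group_log g)) v = mat_act N (rho (group_log g')) v" for g g'
    proof -
      obtain x y where xy: "x \<in> carrier L" "g = group_elem x" "y \<in> carrier L" "g' = group_elem y"
        using g by blast
      have "rho x = rho y"
      proof (rule mat_act_inj[OF cm[OF xy(1)] cm[OF xy(3)]])
        show "mat_act N (rho x) v = mat_act N (rho y) v" if "v \<in> coord_space N" for v
          using eq[OF that] xy by (simp add: group_log)
      qed
      then show ?thesis using inj xy by blast
    qed
  qed
  then interpret faithful_action R d p e f n prec N "group_elem ` carrier L" "\<lambda>g. mat_act N (rho (group_log g))" .
  show ?thesis by (rule rep_dim_le_degree)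
qed

theorem m_faithful_eq: "m_faithful (lie_exp L) = rep_dim"
  unfolding m_faithful_def
proof (rule Least_equality)
  show "mon (lie_exp L) (GL_complex rep_dim) \<noteq> {}" by (rule mon_rep_dim)
  show "rep_dim \<le> N" if "mon (lie_exp L) (GL_complex N) \<noteq> {}" for N
    using that rep_dim_le_mon by blast
qed

end

theorem theorem1p5:
  fixes n :: nat and prec :: "nat rel" and R :: "('r, 'k) ring_scheme" and d p e f :: nat
  assumes "strict_order_on_upto n prec"
    and "finite_truncated_valuation_ring R"
    and "tvr_parameters R d p e f"
    and "p > max_alpha n prec + 1"
  shows "m_faithful (lie_exp (lie_tensor (pattern_lie n prec) R)) =
    (\<Sum>l = 0..e - 1. \<Sum>(i, j)\<in>extreme_pairs n prec. f * p ^ (f * (d - l) * alpha n prec i j))"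
proof -
  have tvr: "tvr R d p e f"
    using assms(2-4) by (intro tvr.intro tvr_axioms.intro) auto
  then interpret tvr R d p e f .
  have "pattern_tvr R d p e f n prec"
  proof (intro pattern_tvr.intro tvr pattern_group.intro pattern_group_axioms.intro incidence.intro
      incidence_axioms.intro prime_power_modulus.intro)
    show "cring R" by (rule is_cring)
    show "Factorial_Ring.prime (int p)" using prime_p by simp
    show "add_pow R (int p ^ (f * d)) r = \<zero>\<^bsub>R\<^esub>" if "r \<in> carrier R" for r
    proof -
      have "add_pow R (int p ^ (f * d)) r = add_pow R (p ^ (f * d)) r"
        unfolding add_pow_def by (metis int_pow_int of_nat_power)
      then show ?thesis using torsion[OF that] by simp
    qed
    show "int (Suc (max_alpha n prec)) < int p" using assms(4) by simp
  qed (rule assms(1) refl)+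
  then interpret pattern_tvr R d p e f n prec .
  show ?thesis using m_faithful_eq unfolding rep_dim_def .
qed

end
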